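(* Let $P$ be a finite TAOS and let $Q$ be its Hasse quiver. Suppose that every algebraically connected component of $Q$ is the Hasse quiver of some array TAOS. Suppose moreover that for any two distinct algebraically connected components $Q^i$ and $Q^j$ of $Q$ there do not exist paths $p_i$ in $Q^i$ and $p_j$ in $Q^j$, both of length at least two, such that $s(p_i)=s(p_j)$ and $t(p_i)=t(p_j)$. Then the simply-connected Lie group with Lie algebra $R(P)$ admits a left-invariant Ricci soliton, i.e. a left-invariant Riemannian metric that is a Ricci soliton.
   Context: A Riemannian metric $g$ on a manifold $M$ is a Ricci soliton if its Ricci tensor satisfies $\mathrm{ric}_g = c\, g + \mathcal{L}_X g$ for some constant $c\in\mathbb{R}$ and some vector field $X$ on $M$. A transitively and antisymmetrically ordered set (TAOS) is a set $P$ with a binary relation $\prec$ that is transitive and antisymmetric ($s\prec t$, $t\prec s$ imply $s=t$); it need be neither reflexive nor irreflexive. Lie algebra of a finite TAOS: $R(P)$ is the real vector space with basis $B(P)=\{(s,t)\mid s,t\in P,\ s\prec t\}\setminus\{(u,u)\mid u\in P,\ u\prec u\}$, with bilinear product determined by $(s,t)\cdot(u,v)=(s,v)$ if $t=u$ and $0$ if $t\ne u$, and Lie bracket $[x,y]=x\cdot y-y\cdot x$. Hasse quiver of a TAOS $P$: the quiver with vertex set $P$ and with exactly one arrow from $a$ to $b$ whenever $a\prec b$, $a\neq b$, and there is no $t\in P\setminus\{a,b\}$ with $a\prec t\prec b$ (no other arrows). For a path $p$, $s(p)$ and $t(p)$ are its starting and terminal vertices; its length is its number of arrows. Path algebra: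 for a finite acyclic quiver $Q$, $\mathfrak{n}_Q$ is the real associative algebra with basis all paths of length $\ge 1$ in $Q$, with product given by concatenation of paths ($xy$ if $xy$ is a path, and $0$ otherwise). Algebraic connectivity: a finite quiver $Q$ is algebraically connected if $\mathfrak{n}_Q$ is not isomorphic, as an associative algebra, to a direct sum of more than one (nonzero) path algebra of a quiver. In general $\mathfrak{n}_Q=\bigoplus_{i=1}^n \mathfrak{n}_{E_i}$ where the $E_i$ are algebraically connected subquivers of $Q$ (each having at least one arrow and no isolated vertices; the direct sum is internal, so the arrow sets of the $E_i$ partition the arrow set of $Q$, while different $E_i$ may share vertices). The $E_i$ are the algebraically connected components of $Q$. Array TAOS: given integers $k\ge 2$, $n_1,\dots,n_k\ge 1$, and $m_1,\dots,m_k$ with $1\le m_i\le n_i$, $m_1=n_1$, $m_k=n_k$, let $P$ be a set with $\sum_{i=1}^k n_i$ elements partitioned into $k$ columns, the $i$-th column having $n_i$ elements. For each $i=1,\dots,k-1$ choose $m_{i+1}$ elements of the $(i+1)$-th column and declare $\eta_i\prec\eta_{i+1}$ for each element $\eta_i$ of the $i$-th column and each of the $m_{i+1}$ chosen elements $\eta_{i+1}$ of the $(i+1)$-th column. The relation $\prec$ on $P$ is the transitive closure of these relations. *)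

theory Defs
  imports
    "HOL-Analysis.Analysis"
    "HOL-Algebra.Group"
    "Graph_Theory.Digraph_Component"
begin

section \<open>Real algebras\<close>

text \<open>
  A real vector space on a carrier set with a bilinear product. The record serves both for
  associative algebras and for Lie algebras (the product then being the bracket).
\<close>

record 'a real_alg =
  acarrier :: "'a set"
  aadd :: "'a \<Rightarrow> 'a \<Rightarrow> 'a"
  ascale :: "real \<Rightarrow> 'a \<Rightarrow> 'a"
  amult :: "'a \<Rightarrow> 'a \<Rightarrow> 'a"

definition real_alg_isomorphic :: "'a real_alg \<Rightarrow> 'b real_alg \<Rightarrow> bool" where
  "real_alg_isomorphic A B \<longleftrightarrow>
    (\<exists>f. bij_betw f (acarrier A) (acarrier B) \<and>
         (\<forall>x\<in>acarrier A. \<forall>y\<in>acarrier A. f (aadd A x y) = aadd B (f x) (f y)) \<and>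
         (\<forall>a. \<forall>x\<in>acarrier A. f (ascale A a x) = ascale B a (f x)) \<and>
         (\<forall>x\<in>acarrier A. \<forall>y\<in>acarrier A. f (amult A x y) = amult B (f x) (f y)))"

text \<open>
  The algebra with basis \<open>B\<close> in which a product of two basis elements is again a basis element
  (\<open>Some b\<close>) or zero (\<open>None\<close>). An element is given by its coefficient function. The operation
  \<open>m\<close> is expected to map \<open>B \<times> B\<close> into \<open>B\<close> (where defined).
\<close>

definition basis_algebra :: "'b set \<Rightarrow> ('b \<Rightarrow> 'b \<Rightarrow> 'b option) \<Rightarrow> ('b \<Rightarrow> real) real_alg" where
  "basis_algebra B m =
    \<lparr> acarrier = {x. finite {b. x b \<noteq> 0} \<and> {b. x b \<noteq> 0} \<subseteq> B},
      aadd = (\<lambda>x y b. x b + y b),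
      ascale = (\<lambda>a x b. a * x b),
      amult = (\<lambda>x y b. \<Sum>(p, q) \<in> {(p, q) \<in> B \<times> B. m p q = Some b}. x p * y q) \<rparr>"

definition commutator_algebra :: "'a real_alg \<Rightarrow> 'a real_alg" where
  "commutator_algebra A =
    A \<lparr> amult := (\<lambda>x y. aadd A (amult A x y) (ascale A (-1) (amult A y x))) \<rparr>"

definition direct_sum_algebra :: "nat \<Rightarrow> (nat \<Rightarrow> 'a real_alg) \<Rightarrow> (nat \<Rightarrow> 'a) real_alg" where
  "direct_sum_algebra n A =
    \<lparr> acarrier = (\<Pi>\<^sub>E i\<in>{..<n}. acarrier (A i)),
      aadd = (\<lambda>x y. \<lambda>i\<in>{..<n}. aadd (A i) (x i) (y i)),
      ascale = (\<lambda>a x. \<lambda>i\<in>{..<n}. ascale (A i) a (x i)),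
      amult = (\<lambda>x y. \<lambda>i\<in>{..<n}. amult (A i) (x i) (y i)) \<rparr>"


section \<open>TAOSes, their algebras and Hasse quivers\<close>

text \<open>Only the restriction of \<open>r\<close> to \<open>P\<close> matters; \<open>r s t\<close> means that \<open>s\<close> precedes \<open>t\<close>.\<close>

definition taos :: "'p set \<Rightarrow> ('p \<Rightarrow> 'p \<Rightarrow> bool) \<Rightarrow> bool" where
  "taos P r \<longleftrightarrow> transp_on P r \<and> antisymp_on P r"

definition taos_basis :: "'p set \<Rightarrow> ('p \<Rightarrow> 'p \<Rightarrow> bool) \<Rightarrow> ('p \<times> 'p) set" where
  "taos_basis P r = {(s, t). s \<in> P \<and> t \<in> P \<and> r s t} - {(u, u) | u. u \<in> P \<and> r u u}"

definition taos_algebra :: "'p set \<Rightarrow> ('p \<Rightarrow> 'p \<Rightarrow> bool) \<Rightarrow> ('p \<times> 'p \<Rightarrow> real) real_alg" where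
  "taos_algebra P r =
    basis_algebra (taos_basis P r) (\<lambda>(s, t) (u, v). if t = u then Some (s, v) else None)"

definition taos_lie_algebra :: "'p set \<Rightarrow> ('p \<Rightarrow> 'p \<Rightarrow> bool) \<Rightarrow> ('p \<times> 'p \<Rightarrow> real) real_alg" where
  "taos_lie_algebra P r = commutator_algebra (taos_algebra P r)"

definition hasse_quiver :: "'p set \<Rightarrow> ('p \<Rightarrow> 'p \<Rightarrow> bool) \<Rightarrow> ('p, 'p \<times> 'p) pre_digraph" where
  "hasse_quiver P r =
    \<lparr> verts = P,
      arcs = {(a, b). a \<in> P \<and> b \<in> P \<and> r a b \<and> a \<noteq> b \<and> \<not> (\<exists>t \<in> P - {a, b}. r a t \<and> r t b)},
      tail = fst,
      head = snd \<rparr>"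

text \<open>
  \<open>col i\<close> is the \<open>i\<close>-th column and \<open>ch i\<close> its subset of chosen elements (only used for \<open>i \<ge> 2\<close>).
\<close>

definition array_taos :: "'p set \<Rightarrow> ('p \<Rightarrow> 'p \<Rightarrow> bool) \<Rightarrow> bool" where
  "array_taos P r \<longleftrightarrow>
    (\<exists>(k::nat) (n::nat \<Rightarrow> nat) (m::nat \<Rightarrow> nat) (col::nat \<Rightarrow> 'p set) (ch::nat \<Rightarrow> 'p set).
      k \<ge> 2 \<and>
      (\<forall>i\<in>{1..k}. 1 \<le> m i \<and> m i \<le> n i) \<and> m 1 = n 1 \<and> m k = n k \<and>
      P = (\<Union>i\<in>{1..k}. col i) \<and>
      disjoint_family_on col {1..k} \<and>
      (\<forall>i\<in>{1..k}. finite (col i) \<and> card (col i) = n i) \<and>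
      (\<forall>i\<in>{2..k}. ch i \<subseteq> col i \<and> card (ch i) = m i) \<and>
      r = (\<lambda>a b. \<exists>i\<in>{1..k - 1}. a \<in> col i \<and> b \<in> ch (i + 1))\<^sup>+\<^sup>+)"


section \<open>Quivers and path algebras\<close>

text \<open>A path is the list of its arcs, read in the order in which they are traversed.\<close>

definition acyclic_quiver :: "('v, 'e) pre_digraph \<Rightarrow> bool" where
  "acyclic_quiver Q \<longleftrightarrow> fin_digraph Q \<and> \<not> (\<exists>p. pre_digraph.cycle Q p)"

definition quiver_paths :: "('v, 'e) pre_digraph \<Rightarrow> 'e list set" where
  "quiver_paths Q = {p. p \<noteq> [] \<and> (\<exists>u v. pre_digraph.awalk Q u p v)}"

definition path_algebra :: "('v, 'e) pre_digraph \<Rightarrow> ('e list \<Rightarrow> real) real_alg" where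
  "path_algebra Q =
    basis_algebra (quiver_paths Q)
      (\<lambda>p q. if p @ q \<in> quiver_paths Q then Some (p @ q) else None)"

text \<open>
  Every finite quiver is isomorphic to one whose vertices and arcs are natural numbers, so the
  quantification below does cover all finite acyclic quivers. The path algebra of a quiver is
  nonzero iff the quiver has an arc.
\<close>

definition algebraically_connected :: "('v, 'e) pre_digraph \<Rightarrow> bool" where
  "algebraically_connected Q \<longleftrightarrow>
    \<not> (\<exists>(n::nat) (R::nat \<Rightarrow> (nat, nat) pre_digraph).
        n \<ge> 2 \<and>
        (\<forall>i<n. acyclic_quiver (R i) \<and> arcs (R i) \<noteq> {}) \<and>
        real_alg_isomorphic (path_algebra Q) (direct_sum_algebra n (\<lambda>i. path_algebra (R i))))"

text \<open>
  The set \<open>C\<close> of algebraically connected components of \<open>Q\<close>. The last two conjuncts say that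
  the path algebra of \<open>Q\<close> is the internal direct sum (as an algebra) of those of the
  members of \<open>C\<close>; all of these consist of functions on the same type of arc lists.
\<close>

definition algebraically_connected_components ::
    "('v, 'e) pre_digraph \<Rightarrow> ('v, 'e) pre_digraph set \<Rightarrow> bool" where
  "algebraically_connected_components Q C \<longleftrightarrow>
    finite C \<and>
    (\<forall>E\<in>C. subgraph E Q \<and> arcs E \<noteq> {} \<and>
            verts E = tail E ` arcs E \<union> head E ` arcs E \<and>
            algebraically_connected E) \<and>
    (\<forall>x\<in>acarrier (path_algebra Q).
       \<exists>!y. y \<in> (\<Pi>\<^sub>E E\<in>C. acarrier (path_algebra E)) \<and> x = (\<lambda>p. \<Sum>E\<in>C. y E p)) \<and>
    (\<forall>E\<in>C. \<forall>F\<in>C. E \<noteq> F \<longrightarrow>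
       (\<forall>x\<in>acarrier (path_algebra E). \<forall>y\<in>acarrier (path_algebra F).
          amult (path_algebra Q) x y = (\<lambda>_. 0)))"


section \<open>Smooth functions and smooth manifolds\<close>

text \<open>
  Manifolds are modelled on the spaces \<^term>\<open>Euclidean_space d\<close> of sequences vanishing from
  index \<open>d\<close> on, so that the dimension is a natural number, possibly zero.
\<close>

definition partial_deriv :: "nat \<Rightarrow> ((nat \<Rightarrow> real) \<Rightarrow> real) \<Rightarrow> (nat \<Rightarrow> real) \<Rightarrow> real" where
  "partial_deriv i f x = deriv (\<lambda>t. f (x(i := t))) (x i)"

text \<open>Meant for open subsets \<open>W\<close> of \<^term>\<open>Euclidean_space d\<close> only.\<close>

primrec Ck_on :: "nat \<Rightarrow> nat \<Rightarrow> (nat \<Rightarrow> real) set \<Rightarrow> ((nat \<Rightarrow> real) \<Rightarrow> real) \<Rightarrow> bool" where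
  "Ck_on 0 d W f \<longleftrightarrow> continuous_on W f"
| "Ck_on (Suc k) d W f \<longleftrightarrow> continuous_on W f \<and>
     (\<forall>i<d. (\<forall>x\<in>W. (\<lambda>t. f (x(i := t))) differentiable (at (x i))) \<and>
            Ck_on k d W (partial_deriv i f))"

definition smooth_fun_on :: "nat \<Rightarrow> (nat \<Rightarrow> real) set \<Rightarrow> ((nat \<Rightarrow> real) \<Rightarrow> real) \<Rightarrow> bool" where
  "smooth_fun_on d W f \<longleftrightarrow> (\<forall>k. Ck_on k d W f)"

text \<open>A chart is a pair of its domain and its coordinate map.\<close>

type_synonym 'm chart = "'m set \<times> ('m \<Rightarrow> nat \<Rightarrow> real)"

definition chart_inv :: "'m chart \<Rightarrow> (nat \<Rightarrow> real) \<Rightarrow> 'm" where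
  "chart_inv c = inv_into (fst c) (snd c)"

record 'm mfd =
  mdim :: nat
  mtop :: "'m topology"
  matlas :: "'m chart set"

definition smooth_manifold :: "'m mfd \<Rightarrow> bool" where
  "smooth_manifold M \<longleftrightarrow>
    Hausdorff_space (mtop M) \<and> second_countable (mtop M) \<and>
    (\<forall>(U, \<phi>)\<in>matlas M.
       openin (mtop M) U \<and> openin (Euclidean_space (mdim M)) (\<phi> ` U) \<and>
       homeomorphic_map (subtopology (mtop M) U)
         (subtopology (Euclidean_space (mdim M)) (\<phi> ` U)) \<phi>) \<and>
    (\<Union>c\<in>matlas M. fst c) = topspace (mtop M) \<and>
    (\<forall>c\<in>matlas M. \<forall>c'\<in>matlas M. \<forall>j<mdim M.
       smooth_fun_on (mdim M) (snd c ` (fst c \<inter> fst c')) (\<lambda>x. snd c' (chart_inv c x) j))"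

definition smooth_map :: "'m mfd \<Rightarrow> 'n mfd \<Rightarrow> ('m \<Rightarrow> 'n) \<Rightarrow> bool" where
  "smooth_map M N F \<longleftrightarrow>
    continuous_map (mtop M) (mtop N) F \<and>
    (\<forall>c\<in>matlas M. \<forall>c'\<in>matlas N. \<forall>j<mdim N.
       smooth_fun_on (mdim M) (snd c ` {p \<in> fst c. F p \<in> fst c'})
         (\<lambda>x. snd c' (F (chart_inv c x)) j))"

definition product_chart :: "nat \<Rightarrow> 'm chart \<Rightarrow> 'n chart \<Rightarrow> ('m \<times> 'n) chart" where
  "product_chart d c c' =
    (fst c \<times> fst c', \<lambda>(p, q) i. if i < d then snd c p i else snd c' q (i - d))"

definition product_mfd :: "'m mfd \<Rightarrow> 'n mfd \<Rightarrow> ('m \<times> 'n) mfd" where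
  "product_mfd M N =
    \<lparr> mdim = mdim M + mdim N,
      mtop = prod_topology (mtop M) (mtop N),
      matlas = {product_chart (mdim M) c c' | c c'. c \<in> matlas M \<and> c' \<in> matlas N} \<rparr>"

definition simply_connected_space :: "'m topology \<Rightarrow> bool" where
  "simply_connected_space X \<longleftrightarrow>
    path_connected_space X \<and>
    (\<forall>p. pathin X p \<and> p 0 = p 1 \<longrightarrow>
       homotopic_with (\<lambda>q. q 0 = p 0 \<and> q 1 = p 0) (top_of_set {0..1}) X p (\<lambda>_. p 0))"


section \<open>Tensor fields and Riemannian geometry\<close>

text \<open>
  Tensor fields are given by their components in every chart of the atlas: \<open>X c p i\<close> is the
  coefficient of the \<open>i\<close>-th coordinate vector of the chart \<open>c\<close> at \<open>p\<close>, and \<open>g c p i j\<close> is the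
  value of \<open>g\<close> on the \<open>i\<close>-th and \<open>j\<close>-th coordinate vectors.
\<close>

type_synonym 'm vfield = "'m chart \<Rightarrow> 'm \<Rightarrow> nat \<Rightarrow> real"
type_synonym 'm tensor2 = "'m chart \<Rightarrow> 'm \<Rightarrow> nat \<Rightarrow> nat \<Rightarrow> real"

text \<open>The partial derivative, at a point of the manifold, in the \<open>i\<close>-th coordinate of \<open>c\<close>.\<close>

definition chart_deriv :: "'m chart \<Rightarrow> nat \<Rightarrow> ('m \<Rightarrow> real) \<Rightarrow> 'm \<Rightarrow> real" where
  "chart_deriv c i f p = partial_deriv i (\<lambda>x. f (chart_inv c x)) (snd c p)"

text \<open>The Jacobian entry \<open>\<partial>y\<^sup>j/\<partial>x\<^sup>i\<close> of \<open>F\<close> at \<open>p\<close> with respect to charts \<open>c\<close> and \<open>c'\<close>.\<close>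

definition jacobian ::
    "('m \<Rightarrow> 'n) \<Rightarrow> 'm chart \<Rightarrow> 'n chart \<Rightarrow> 'm \<Rightarrow> nat \<Rightarrow> nat \<Rightarrow> real" where
  "jacobian F c c' p i j = chart_deriv c i (\<lambda>q. snd c' (F q) j) p"

text \<open>
  The condition that components vanish outside their range of definition makes the
  representation of a vector field unique.
\<close>

definition vector_field :: "'m mfd \<Rightarrow> 'm vfield \<Rightarrow> bool" where
  "vector_field M X \<longleftrightarrow>
    (\<forall>c p i. \<not> (c \<in> matlas M \<and> p \<in> fst c \<and> i < mdim M) \<longrightarrow> X c p i = 0) \<and>
    (\<forall>c\<in>matlas M. \<forall>i<mdim M.
       smooth_fun_on (mdim M) (snd c ` fst c) (\<lambda>x. X c (chart_inv c x) i)) \<and>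
    (\<forall>c\<in>matlas M. \<forall>c'\<in>matlas M. \<forall>p\<in>fst c \<inter> fst c'. \<forall>j<mdim M.
       X c' p j = (\<Sum>i<mdim M. jacobian (\<lambda>q. q) c c' p i j * X c p i))"

definition lie_bracket :: "'m mfd \<Rightarrow> 'm vfield \<Rightarrow> 'm vfield \<Rightarrow> 'm vfield" where
  "lie_bracket M X Y = (\<lambda>c p j.
    if c \<in> matlas M \<and> p \<in> fst c \<and> j < mdim M
    then \<Sum>i<mdim M. X c p i * chart_deriv c i (\<lambda>q. Y c q j) p
                     - Y c p i * chart_deriv c i (\<lambda>q. X c q j) p
    else 0)"

definition riemannian_metric :: "'m mfd \<Rightarrow> 'm tensor2 \<Rightarrow> bool" where
  "riemannian_metric M g \<longleftrightarrow>
    (\<forall>c\<in>matlas M. \<forall>i<mdim M. \<forall>j<mdim M.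
       smooth_fun_on (mdim M) (snd c ` fst c) (\<lambda>x. g c (chart_inv c x) i j)) \<and>
    (\<forall>c\<in>matlas M. \<forall>c'\<in>matlas M. \<forall>p\<in>fst c \<inter> fst c'. \<forall>i<mdim M. \<forall>j<mdim M.
       g c p i j = (\<Sum>k<mdim M. \<Sum>l<mdim M.
         jacobian (\<lambda>q. q) c c' p i k * jacobian (\<lambda>q. q) c c' p j l * g c' p k l)) \<and>
    (\<forall>c\<in>matlas M. \<forall>p\<in>fst c.
       (\<forall>i<mdim M. \<forall>j<mdim M. g c p i j = g c p j i) \<and>
       (\<forall>v. (\<exists>i<mdim M. v i \<noteq> 0) \<longrightarrow>
          (\<Sum>i<mdim M. \<Sum>j<mdim M. g c p i j * v i * v j) > 0))"

definition metric_inverse :: "'m mfd \<Rightarrow> 'm tensor2 \<Rightarrow> 'm tensor2" where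
  "metric_inverse M g c p = (THE h.
    (\<forall>i k. i < mdim M \<and> k < mdim M \<longrightarrow>
       (\<Sum>j<mdim M. g c p i j * h j k) = (if i = k then 1 else 0)) \<and>
    (\<forall>i k. \<not> (i < mdim M \<and> k < mdim M) \<longrightarrow> h i k = 0))"

text \<open>The Christoffel symbol of the Levi-Civita connection with upper index \<open>k\<close>.\<close>

definition christoffel ::
    "'m mfd \<Rightarrow> 'm tensor2 \<Rightarrow> 'm chart \<Rightarrow> nat \<Rightarrow> nat \<Rightarrow> nat \<Rightarrow> 'm \<Rightarrow> real" where
  "christoffel M g c k i j p = (\<Sum>l<mdim M. metric_inverse M g c p k l / 2 *
     (chart_deriv c i (\<lambda>q. g c q j l) p + chart_deriv c j (\<lambda>q. g c q i l) p
        - chart_deriv c l (\<lambda>q. g c q i j) p))"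

text \<open>
  With \<open>R(X, Y) = [\<nabla>\<^sub>X, \<nabla>\<^sub>Y] - \<nabla>\<^bsub>[X, Y]\<^esub>\<close>, the number \<open>curvature M g c l k i j p\<close> is the
  \<open>l\<close>-th component of \<open>R(\<partial>\<^sub>i, \<partial>\<^sub>j)\<partial>\<^sub>k\<close>, and the Ricci tensor is \<open>ric(Y, Z) = tr(X \<mapsto> R(X, Y)Z)\<close>.
\<close>

definition curvature ::
    "'m mfd \<Rightarrow> 'm tensor2 \<Rightarrow> 'm chart \<Rightarrow> nat \<Rightarrow> nat \<Rightarrow> nat \<Rightarrow> nat \<Rightarrow> 'm \<Rightarrow> real" where
  "curvature M g c l k i j p =
     chart_deriv c i (christoffel M g c l j k) p - chart_deriv c j (christoffel M g c l i k) p
     + (\<Sum>m<mdim M. christoffel M g c m j k p * christoffel M g c l i m p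
                   - christoffel M g c m i k p * christoffel M g c l j m p)"

definition ricci :: "'m mfd \<Rightarrow> 'm tensor2 \<Rightarrow> 'm tensor2" where
  "ricci M g c p j k = (\<Sum>i<mdim M. curvature M g c i k i j p)"

definition lie_derivative :: "'m mfd \<Rightarrow> 'm vfield \<Rightarrow> 'm tensor2 \<Rightarrow> 'm tensor2" where
  "lie_derivative M X g c p i j = (\<Sum>k<mdim M.
     X c p k * chart_deriv c k (\<lambda>q. g c q i j) p
     + g c p k j * chart_deriv c i (\<lambda>q. X c q k) p
     + g c p i k * chart_deriv c j (\<lambda>q. X c q k) p)"

definition ricci_soliton :: "'m mfd \<Rightarrow> 'm tensor2 \<Rightarrow> bool" where
  "ricci_soliton M g \<longleftrightarrow>
    riemannian_metric M g \<and>
    (\<exists>(a::real) X. vector_field M X \<and>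
       (\<forall>c\<in>matlas M. \<forall>p\<in>fst c. \<forall>i<mdim M. \<forall>j<mdim M.
          ricci M g c p i j = a * g c p i j + lie_derivative M X g c p i j))"


section \<open>Lie groups\<close>

definition lie_group :: "'m mfd \<Rightarrow> 'm monoid \<Rightarrow> bool" where
  "lie_group M G \<longleftrightarrow>
    smooth_manifold M \<and> group G \<and> carrier G = topspace (mtop M) \<and>
    smooth_map (product_mfd M M) M (\<lambda>(x, y). x \<otimes>\<^bsub>G\<^esub> y) \<and>
    smooth_map M M (\<lambda>x. inv\<^bsub>G\<^esub> x)"

definition left_invariant_field :: "'m mfd \<Rightarrow> 'm monoid \<Rightarrow> 'm vfield \<Rightarrow> bool" where
  "left_invariant_field M G X \<longleftrightarrow>
    (\<forall>a\<in>carrier G. \<forall>c\<in>matlas M. \<forall>c'\<in>matlas M. \<forall>p\<in>fst c. a \<otimes>\<^bsub>G\<^esub> p \<in> fst c' \<longrightarrow>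
      (\<forall>j<mdim M. X c' (a \<otimes>\<^bsub>G\<^esub> p) j =
        (\<Sum>i<mdim M. jacobian (\<lambda>q. a \<otimes>\<^bsub>G\<^esub> q) c c' p i j * X c p i)))"

definition left_invariant_metric :: "'m mfd \<Rightarrow> 'm monoid \<Rightarrow> 'm tensor2 \<Rightarrow> bool" where
  "left_invariant_metric M G g \<longleftrightarrow>
    riemannian_metric M g \<and>
    (\<forall>a\<in>carrier G. \<forall>c\<in>matlas M. \<forall>c'\<in>matlas M. \<forall>p\<in>fst c. a \<otimes>\<^bsub>G\<^esub> p \<in> fst c' \<longrightarrow>
      (\<forall>i<mdim M. \<forall>j<mdim M. g c p i j = (\<Sum>k<mdim M. \<Sum>l<mdim M.
         jacobian (\<lambda>q. a \<otimes>\<^bsub>G\<^esub> q) c c' p i k * jacobian (\<lambda>q. a \<otimes>\<^bsub>G\<^esub> q) c c' p j l *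
         g c' (a \<otimes>\<^bsub>G\<^esub> p) k l)))"

text \<open>The Lie algebra of left-invariant vector fields.\<close>

definition lie_algebra_of :: "'m mfd \<Rightarrow> 'm monoid \<Rightarrow> 'm vfield real_alg" where
  "lie_algebra_of M G =
    \<lparr> acarrier = {X. vector_field M X \<and> left_invariant_field M G X},
      aadd = (\<lambda>X Y c p i. X c p i + Y c p i),
      ascale = (\<lambda>a X c p i. a * X c p i),
      amult = lie_bracket M \<rparr>"

end

(* Each component of the Hasse quiver contributes an ideal of R(P), and the brackets of different
   components vanish, so R(P) has the basis e(a,b), a < b, with [e(a,b), e(b,c)] = e(a,c) as only
   brackets. Give e(a,b) the squared length k(b), where k(b) = 1 unless b has predecessors and
   successors, in which case k(b) is their number plus the number of chosen elements in the column
   of b. The orthonormal basis f(a,b) then satisfies [f(a,b), f(b,c)] = f(a,c) / sqrt (k b), the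
   Ricci operator is diagonal, and the choice of k makes Ric + 1/2 a derivation D (this is the
   identity x_sum, with x = 1/k). The associated vector field X on the group satisfies [Y, X] = (D/2) Y for
   left-invariant Y. Its components in the left-invariant frame solve a triangular system of equations
   d f = (closed one-form), where the closedness is the Jacobi identity together with the derivation
   property; since the group is simply connected, closed one-forms are exact. *)

theory Submission
  imports Defs "Jordan_Normal_Form.Determinant"
begin

section \<open>Calculus on open subsets of coordinate spaces\<close>

text \<open>The weights solve a counting problem. On f(a,b) the Ricci eigenvalue is half of the
  following: the sum of 1/k(l) over all l strictly between a and b, minus out(b)/k(b), minus
  in(a)/k(a), where in and out count predecessors and successors. Additivity of Ric + 1/2 along a <
  b < c means that the elements between a and c that are neither between a and b nor between b and c
  contribute 1 - (in(b) + out(b))/k(b). In an array these are the chosen elements of the column of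
  b, including b itself; they share one value of k, which forces the stated k. The hypothesis on
  parallel long paths keeps elements of other components out of this count. The group is known only
  through its Lie algebra, so there are no preferred global coordinates. Usually the soliton field
  is the generator of the automorphisms obtained by integrating the derivation; here it is found on
  the group itself, through primitives of one-forms. This requires calculus with partial derivatives
  in charts, a Poincare lemma and continuation along homotopies, while the tensor computations
  remain algebra in a single chart.\<close>

definition coord_space :: "nat \<Rightarrow> (nat \<Rightarrow> real) set" where
  "coord_space d = {x. \<forall>i\<ge>d. x i = 0}"

text \<open>A ball for the maximum norm of the first \<open>d\<close> coordinates. Boxes suit
  partial derivatives: moving single coordinates towards the centre does not leave them.\<close>

definition ebox :: "nat \<Rightarrow> (nat \<Rightarrow> real) \<Rightarrow> real \<Rightarrow> (nat \<Rightarrow> real) set" where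
  "ebox d x e = {y \<in> coord_space d. \<forall>i<d. \<bar>y i - x i\<bar> < e}"

definition eopen :: "nat \<Rightarrow> (nat \<Rightarrow> real) set \<Rightarrow> bool" where
  "eopen d W \<longleftrightarrow> W \<subseteq> coord_space d \<and> (\<forall>x\<in>W. \<exists>e>0. ebox d x e \<subseteq> W)"

lemma Euclidean_space_eq: "Euclidean_space d = top_of_set (coord_space d)"
  by (simp add: Euclidean_space_def coord_space_def euclidean_product_topology)

lemma open_box: "open {y::nat \<Rightarrow> real. \<forall>i<d. \<bar>y i - x i\<bar> < e}"
proof -
  have "open (\<Inter>i\<in>{..<d}. {y::nat \<Rightarrow> real. \<bar>y i - x i\<bar> < e})"
    by (intro open_INT finite_lessThan ballI open_Collect_less) (auto intro!: continuous_intros)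
  moreover have "(\<Inter>i\<in>{..<d}. {y::nat \<Rightarrow> real. \<bar>y i - x i\<bar> < e}) = {y. \<forall>i<d. \<bar>y i - x i\<bar> < e}"
    by auto
  ultimately show ?thesis by simp
qed

lemma openin_ebox: "openin (top_of_set (coord_space d)) (ebox d x e)"
proof -
  have "ebox d x e = coord_space d \<inter> {y::nat \<Rightarrow> real. \<forall>i<d. \<bar>y i - x i\<bar> < e}"
    by (auto simp: ebox_def)
  then show ?thesis by (simp add: openin_open_Int open_box)
qed

text \<open>A basic open set of the product topology constrains each coordinate separately.
  Coordinates from \<open>d\<close> on agree with those of \<open>x\<close>, so only
  \<open>d\<close> radii have to be minimised.\<close>

lemma ebox_subset_openI:
  fixes T :: "(nat \<Rightarrow> real) set"
  assumes "open T" "x \<in> T" "x \<in> coord_space d"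
  shows "\<exists>e>0. ebox d x e \<subseteq> T"
proof -
  have "openin (product_topology (\<lambda>i. euclidean::real topology) (UNIV::nat set)) T"
    using assms(1) by (simp add: euclidean_product_topology)
  from product_topology_open_contains_basis[OF this assms(2)]
  obtain X where X: "x \<in> (\<Pi>\<^sub>E i\<in>UNIV. X i)" "\<forall>i. openin euclidean (X i)"
    "(\<Pi>\<^sub>E i\<in>UNIV. X i) \<subseteq> T" by blast
  have xX: "x i \<in> X i" for i using X(1) by (simp add: PiE_UNIV_domain Pi_iff)
  have "open (X i)" for i using X(2) by simp
  then have "\<exists>e>0. ball (x i) e \<subseteq> X i" for i
    using xX open_contains_ball by blast
  then obtain ee where ee: "\<And>i. ee i > 0" "\<And>i. ball (x i) (ee i) \<subseteq> X i" by metis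
  \<comment> \<open>The extra 1 keeps the minimum defined for \<open>d = 0\<close>.\<close>
  define e where "e = Min (insert 1 (ee ` {..<d}))"
  have "e > 0" unfolding e_def by (subst Min_gr_iff) (use ee(1) in auto)
  moreover have "ebox d x e \<subseteq> T"
  proof
    fix y assume y: "y \<in> ebox d x e"
    have "y i \<in> X i" for i
    proof (cases "i < d")
      case True
      then have "e \<le> ee i" unfolding e_def by (intro Min_le) auto
      then have "\<bar>y i - x i\<bar> < ee i" using y True by (fastforce simp: ebox_def)
      then have "y i \<in> ball (x i) (ee i)" by (simp add: dist_real_def abs_minus_commute)
      then show ?thesis using ee(2)[of i] by blast
    next
      case False
      then have "y i = x i" using y assms(3) by (simp add: ebox_def coord_space_def)
      then show ?thesis using xX by simp
    qed
    then have "y \<in> (\<Pi>\<^sub>E i\<in>UNIV. X i)" by (simp add: PiE_UNIV_domain)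
    then show "y \<in> T" using X(3) by blast
  qed
  ultimately show ?thesis by blast
qed

text \<open>Lets chart images, whose openness is stated in \<open>Euclidean_space\<close>, be
  handled through boxes.\<close>

lemma openin_Euclidean_space_iff: "openin (Euclidean_space d) W \<longleftrightarrow> eopen d W"
proof
  assume "openin (Euclidean_space d) W"
  then have "openin (top_of_set (coord_space d)) W" by (simp only: Euclidean_space_eq)
  then obtain T where T: "open T" "W = coord_space d \<inter> T"
    by (auto simp: openin_open)
  show "eopen d W"
    unfolding eopen_def
  proof (intro conjI ballI)
    fix x assume "x \<in> W"
    then obtain e where "e > 0" "ebox d x e \<subseteq> T" using ebox_subset_openI[OF T(1)] T(2) by blast
    then show "\<exists>e>0. ebox d x e \<subseteq> W" using T(2) by (auto simp: ebox_def)
  qed (use T in auto)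
next
  assume W: "eopen d W"
  have "\<exists>T. openin (top_of_set (coord_space d)) T \<and> x \<in> T \<and> T \<subseteq> W" if x: "x \<in> W" for x
  proof -
    obtain e where e: "e > 0" "ebox d x e \<subseteq> W" using W x by (auto simp: eopen_def)
    have "x \<in> ebox d x e" using x W e by (auto simp: ebox_def eopen_def)
    then show ?thesis using e(2) openin_ebox by blast
  qed
  then have "openin (top_of_set (coord_space d)) W" using openin_subopen by blast
  then show "openin (Euclidean_space d) W" by (simp only: Euclidean_space_eq)
qed

lemma eopenD: "eopen d W \<Longrightarrow> x \<in> W \<Longrightarrow> \<exists>e>0. ebox d x e \<subseteq> W"
  by (simp add: eopen_def)

lemma eopen_sub: "eopen d W \<Longrightarrow> W \<subseteq> coord_space d"
  by (simp add: eopen_def)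

lemma eopen_ebox: "eopen d (ebox d x e)"
  using openin_ebox Euclidean_space_eq openin_Euclidean_space_iff by metis

lemma ebox_center: "x \<in> coord_space d \<Longrightarrow> e > 0 \<Longrightarrow> x \<in> ebox d x e"
  by (simp add: ebox_def)

text \<open>On \<open>coord_space d\<close> the product topology is that of the maximum norm of
  \<open>d\<close> coordinates. The estimates on partial derivatives use continuity in this
  epsilon-delta form.\<close>

lemma continuous_on_ebox_iff:
  assumes W: "eopen d W"
  shows "continuous_on W (f :: (nat \<Rightarrow> real) \<Rightarrow> real) \<longleftrightarrow>
    (\<forall>x\<in>W. \<forall>\<epsilon>>0. \<exists>e>0. \<forall>y\<in>W. (\<forall>i<d. \<bar>y i - x i\<bar> < e) \<longrightarrow> \<bar>f y - f x\<bar> < \<epsilon>)" (is "?L \<longleftrightarrow> ?R")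
proof
  assume f: ?L
  show ?R
  proof (intro ballI allI impI)
    fix x and \<epsilon> :: real assume x: "x \<in> W" "\<epsilon> > 0"
    have "openin (top_of_set W) (W \<inter> f -` ball (f x) \<epsilon>)"
      by (rule continuous_openin_preimage_gen[OF f open_ball])
    moreover have "openin (top_of_set (coord_space d)) W"
      using W openin_Euclidean_space_iff Euclidean_space_eq by metis
    ultimately have "openin (top_of_set (coord_space d)) (W \<inter> f -` ball (f x) \<epsilon>)"
      by (rule openin_trans)
    then have "eopen d (W \<inter> f -` ball (f x) \<epsilon>)"
      using openin_Euclidean_space_iff Euclidean_space_eq by metis
    then obtain e where e: "e > 0" "ebox d x e \<subseteq> W \<inter> f -` ball (f x) \<epsilon>"
      using eopenD x by (metis IntI centre_in_ball vimageI)
    have "\<bar>f y - f x\<bar> < \<epsilon>" if "y \<in> W" "\<forall>i<d. \<bar>y i - x i\<bar> < e" for y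
    proof -
      have "y \<in> ebox d x e" using that W by (auto simp: ebox_def eopen_def)
      then have "y \<in> f -` ball (f x) \<epsilon>" using e by blast
      then show ?thesis by (simp add: dist_real_def abs_minus_commute)
    qed
    then show "\<exists>e>0. \<forall>y\<in>W. (\<forall>i<d. \<bar>y i - x i\<bar> < e) \<longrightarrow> \<bar>f y - f x\<bar> < \<epsilon>"
      using e(1) by blast
  qed
next
  assume R: ?R
  show ?L
    unfolding continuous_on_topological
  proof (intro ballI allI impI)
    fix x B assume x: "x \<in> W" "open B" "f x \<in> B"
    then obtain \<epsilon> where "\<epsilon> > 0" "ball (f x) \<epsilon> \<subseteq> B" by (meson open_contains_ball)
    with R x obtain e where e: "e > 0"
      "\<And>y. y \<in> W \<Longrightarrow> (\<forall>i<d. \<bar>y i - x i\<bar> < e) \<Longrightarrow> \<bar>f y - f x\<bar> < \<epsilon>" by meson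
    show "\<exists>A. open A \<and> x \<in> A \<and> (\<forall>y\<in>W. y \<in> A \<longrightarrow> f y \<in> B)"
    proof (intro exI[of _ "{y. \<forall>i<d. \<bar>y i - x i\<bar> < e}"] conjI ballI impI)
      fix y assume "y \<in> W" "y \<in> {y. \<forall>i<d. \<bar>y i - x i\<bar> < e}"
      then have "f y \<in> ball (f x) \<epsilon>" using e(2)[of y] by (auto simp: dist_real_def abs_minus_commute)
      then show "f y \<in> B" using \<open>ball (f x) \<epsilon> \<subseteq> B\<close> by blast
    qed (use e open_box in auto)
  qed
qed

lemma continuous_on_eboxD:
  fixes f :: "(nat \<Rightarrow> real) \<Rightarrow> real"
  assumes "eopen d W" "continuous_on W f" "x \<in> W" "\<epsilon> > 0"
  shows "\<exists>e>0. \<forall>y\<in>W. (\<forall>i<d. \<bar>y i - x i\<bar> < e) \<longrightarrow> \<bar>f y - f x\<bar> < \<epsilon>"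
  using assms(2)[unfolded continuous_on_ebox_iff[OF assms(1)]] assms(3,4) by blast

lemma upd_in_ebox:
  assumes "x \<in> coord_space d" "i < d" "\<bar>t - x i\<bar> < e"
  shows "x(i := t) \<in> ebox d x e"
  using assms by (auto simp: ebox_def coord_space_def)

text \<open>This is why values outside an open set never influence a derivative taken inside it,
  although all functions here are total.\<close>

lemma eventually_upd:
  assumes "eopen d W" "x \<in> W" "i < d"
  shows "eventually (\<lambda>t. x(i := t) \<in> W) (nhds (x i))"
proof -
  obtain e where "e > 0" "ebox d x e \<subseteq> W" using eopenD[OF assms(1,2)] by blast
  then have "\<forall>t. dist t (x i) < e \<longrightarrow> x(i := t) \<in> W"
    using upd_in_ebox[of x d i] assms by (auto simp: dist_real_def eopen_def)
  then show ?thesis using \<open>e > 0\<close> eventually_nhds_metric by blast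
qed

text \<open>Carries a named gradient \<open>h\<close>, so that derivative formulas can be supplied
  rather than extracted from \<open>deriv\<close>. Read for a one-form \<open>h\<close>, it says
  that \<open>f\<close> is a primitive.\<close>

definition partials_on :: "nat \<Rightarrow> (nat \<Rightarrow> real) set \<Rightarrow> ((nat \<Rightarrow> real) \<Rightarrow> real) \<Rightarrow>
    (nat \<Rightarrow> (nat \<Rightarrow> real) \<Rightarrow> real) \<Rightarrow> bool" where
  "partials_on d W f h \<longleftrightarrow>
    (\<forall>i<d. \<forall>x\<in>W. ((\<lambda>t. f (x(i := t))) has_real_derivative h i x) (at (x i)))"

lemma partials_onD:
  "partials_on d W f h \<Longrightarrow> i < d \<Longrightarrow> x \<in> W \<Longrightarrow>
    ((\<lambda>t. f (x(i := t))) has_real_derivative h i x) (at (x i))"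
  by (simp add: partials_on_def)

lemma partials_on_partial_deriv:
  "partials_on d W f h \<Longrightarrow> i < d \<Longrightarrow> x \<in> W \<Longrightarrow> partial_deriv i f x = h i x"
  unfolding partial_deriv_def by (rule DERIV_imp_deriv) (rule partials_onD)

lemma partials_on_cong:
  assumes W: "eopen d W" and f: "partials_on d W f h"
    and fg: "\<And>x. x \<in> W \<Longrightarrow> f x = g x"
    and hk: "\<And>i x. i < d \<Longrightarrow> x \<in> W \<Longrightarrow> h i x = k i x"
  shows "partials_on d W g k"
  unfolding partials_on_def
proof (intro allI impI ballI)
  fix i x assume i: "i < d" and x: "x \<in> W"
  have "eventually (\<lambda>t. f (x(i := t)) = g (x(i := t))) (nhds (x i))"
    using eventually_upd[OF W x i] by eventually_elim (rule fg)
  then show "((\<lambda>t. g (x(i := t))) has_real_derivative k i x) (at (x i))"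
    using partials_onD[OF f i x] hk[OF i x] by (simp add: DERIV_cong_ev[OF refl _ refl])
qed

lemma partials_on_subset: "partials_on d W f h \<Longrightarrow> V \<subseteq> W \<Longrightarrow> partials_on d V f h"
  by (auto simp: partials_on_def)

lemma mvt_segment:
  fixes u :: "real \<Rightarrow> real"
  assumes "\<And>t. min a b \<le> t \<Longrightarrow> t \<le> max a b \<Longrightarrow> (u has_real_derivative u' t) (at t)"
  shows "\<exists>z. min a b \<le> z \<and> z \<le> max a b \<and> u b - u a = (b - a) * u' z"
proof (cases a b rule: linorder_cases)
  case less
  then obtain z where "a < z" "z < b" "u b - u a = (b - a) * u' z"
    using MVT2[of a b u u'] assms by (auto simp: min_def max_def)
  then show ?thesis using less by (intro exI[of _ z]) auto
next
  case greater
  then obtain z where "b < z" "z < a" "u a - u b = (a - b) * u' z"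
    using MVT2[of b a u u'] assms by (auto simp: min_def max_def)
  then show ?thesis using greater by (intro exI[of _ z]) (auto simp: algebra_simps)
qed auto

text \<open>The increment is telescoped along the coordinate directions.\<close>

lemma partials_on_mvt:
  assumes f: "partials_on d (ebox d x e) f h" and x: "x \<in> coord_space d" and y: "y \<in> ebox d x e"
  shows "\<exists>\<xi>. (\<forall>k<d. \<xi> k \<in> ebox d x e \<and> (\<forall>j. \<bar>\<xi> k j - x j\<bar> \<le> \<bar>y j - x j\<bar>)) \<and>
    f y - f x = (\<Sum>k<d. h k (\<xi> k) * (y k - x k))"
proof -
  define z where "z k = (\<lambda>j. if j < k then y j else x j)" for k :: nat
  have step: "\<exists>\<xi>. \<xi> \<in> ebox d x e \<and> (\<forall>j. \<bar>\<xi> j - x j\<bar> \<le> \<bar>y j - x j\<bar>) \<and>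
      f (z (Suc k)) - f (z k) = h k \<xi> * (y k - x k)" if k: "k < d" for k
  proof -
    have mem: "(z k)(k := t) \<in> ebox d x e \<and> (\<forall>j. \<bar>((z k)(k := t)) j - x j\<bar> \<le> \<bar>y j - x j\<bar>)"
      if t: "min (x k) (y k) \<le> t" "t \<le> max (x k) (y k)" for t
    proof -
      have tk: "\<bar>t - x k\<bar> \<le> \<bar>y k - x k\<bar>" using t by (auto simp: min_def max_def split: if_splits)
      have "\<bar>((z k)(k := t)) j - x j\<bar> \<le> \<bar>y j - x j\<bar>" for j using tk by (auto simp: z_def)
      moreover have "(z k)(k := t) \<in> ebox d x e"
        unfolding ebox_def
      proof (intro CollectI conjI allI impI)
        show "(z k)(k := t) \<in> coord_space d" using x y k by (auto simp: coord_space_def z_def ebox_def)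
        fix i assume i: "i < d"
        have "\<bar>((z k)(k := t)) i - x i\<bar> \<le> \<bar>y i - x i\<bar>" using tk by (auto simp: z_def)
        also have "\<dots> < e" using y i by (auto simp: ebox_def)
        finally show "\<bar>((z k)(k := t)) i - x i\<bar> < e" .
      qed
      ultimately show ?thesis by blast
    qed
    have "((\<lambda>t. f ((z k)(k := t))) has_real_derivative h k ((z k)(k := t))) (at t)"
      if "min (x k) (y k) \<le> t" "t \<le> max (x k) (y k)" for t
      using partials_onD[OF f k, of "(z k)(k := t)"] mem[OF that] by simp
    then obtain t where t: "min (x k) (y k) \<le> t" "t \<le> max (x k) (y k)"
      "f ((z k)(k := y k)) - f ((z k)(k := x k)) = (y k - x k) * h k ((z k)(k := t))"
      using mvt_segment[of "x k" "y k" "\<lambda>t. f ((z k)(k := t))" "\<lambda>t. h k ((z k)(k := t))"] by blast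
    have "(z k)(k := y k) = z (Suc k)" "(z k)(k := x k) = z k" by (auto simp: z_def)
    then show ?thesis using t mem[OF t(1,2)]
      by (intro exI[of _ "(z k)(k := t)"]) auto
  qed
  then obtain \<xi> where \<xi>: "\<And>k. k < d \<Longrightarrow> \<xi> k \<in> ebox d x e"
    "\<And>k j. k < d \<Longrightarrow> \<bar>\<xi> k j - x j\<bar> \<le> \<bar>y j - x j\<bar>"
    "\<And>k. k < d \<Longrightarrow> f (z (Suc k)) - f (z k) = h k (\<xi> k) * (y k - x k)" by metis
  have "f (z d) - f (z 0) = (\<Sum>k<d. f (z (Suc k)) - f (z k))"
    by (simp only: sum_lessThan_telescope[of "\<lambda>k. f (z k)" d])
  also have "\<dots> = (\<Sum>k<d. h k (\<xi> k) * (y k - x k))" by (intro sum.cong) (auto simp: \<xi>(3))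
  finally have "f (z d) - f (z 0) = (\<Sum>k<d. h k (\<xi> k) * (y k - x k))" .
  moreover have "z d = y" "z 0 = x" using x y by (auto simp: z_def coord_space_def ebox_def)
  ultimately show ?thesis using \<xi>(1,2) by (intro exI[of _ \<xi>]) auto
qed

text \<open>The chain rule from continuous partial derivatives alone. The telescoped mean value
  theorem writes the difference quotient as a sum of \<open>h k (\<xi> t k)\<close> times coordinate
  quotients, and continuity of \<open>h\<close> lets the intermediate points move into
  \<open>\<phi> s\<close>.\<close>

lemma partials_on_curve:
  assumes V: "eopen e V" and f: "partials_on e V f h"
    and h: "\<And>j. j < e \<Longrightarrow> continuous_on V (h j)"
    and \<phi>: "\<And>j. j < e \<Longrightarrow> ((\<lambda>t. \<phi> t j) has_real_derivative v j) (at s)"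
    and mem: "eventually (\<lambda>t. \<phi> t \<in> V) (nhds s)"
  shows "((\<lambda>t. f (\<phi> t)) has_real_derivative (\<Sum>j<e. h j (\<phi> s) * v j)) (at s)"
proof -
  have s: "\<phi> s \<in> V" using eventually_nhds_x_imp_x[OF mem] .
  then have sc: "\<phi> s \<in> coord_space e" using V by (auto simp: eopen_def)
  obtain r where r: "r > 0" "ebox e (\<phi> s) r \<subseteq> V" using eopenD[OF V s] by blast
  have lim: "((\<lambda>t. \<phi> t j) \<longlongrightarrow> \<phi> s j) (at s)" if "j < e" for j
    using DERIV_isCont[OF \<phi>[OF that]] by (simp add: isCont_def)
  have close: "eventually (\<lambda>t. \<forall>j<e. \<bar>\<phi> t j - \<phi> s j\<bar> < r') (at s)" if "r' > 0" for r'
  proof -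
    have "eventually (\<lambda>t. \<forall>j\<in>{..<e}. \<bar>\<phi> t j - \<phi> s j\<bar> < r') (at s)"
      using tendstoD[OF lim that] by (intro eventually_ball_finite) (auto simp: dist_real_def)
    then show ?thesis by (rule eventually_mono) auto
  qed
  have memat: "eventually (\<lambda>t. \<phi> t \<in> V) (at s)"
    using mem by (auto simp: eventually_at_filter elim: eventually_mono)
  have box: "eventually (\<lambda>t. \<phi> t \<in> ebox e (\<phi> s) r) (at s)"
    using close[OF r(1)] memat
  proof eventually_elim
    case (elim t)
    then show ?case using eopen_sub[OF V] by (auto simp: ebox_def)
  qed
  have fb: "partials_on e (ebox e (\<phi> s) r) f h" using f r(2) by (rule partials_on_subset)
  \<comment> \<open>Intermediate points exist only while the curve stays in the box, hence the
    implication under the choice.\<close>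
  have "\<forall>t. \<exists>\<xi>. \<phi> t \<in> ebox e (\<phi> s) r \<longrightarrow> (\<forall>k<e. \<xi> k \<in> ebox e (\<phi> s) r \<and>
        (\<forall>j. \<bar>\<xi> k j - \<phi> s j\<bar> \<le> \<bar>\<phi> t j - \<phi> s j\<bar>)) \<and>
        f (\<phi> t) - f (\<phi> s) = (\<Sum>k<e. h k (\<xi> k) * (\<phi> t k - \<phi> s k))"
    using partials_on_mvt[OF fb sc] by blast
  from choice[OF this] obtain \<xi> where \<xi>: "\<And>t. \<phi> t \<in> ebox e (\<phi> s) r \<Longrightarrow> (\<forall>k<e. \<xi> t k \<in> ebox e (\<phi> s) r \<and>
        (\<forall>j. \<bar>\<xi> t k j - \<phi> s j\<bar> \<le> \<bar>\<phi> t j - \<phi> s j\<bar>)) \<and>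
        f (\<phi> t) - f (\<phi> s) = (\<Sum>k<e. h k (\<xi> t k) * (\<phi> t k - \<phi> s k))" by blast
  have hlim: "((\<lambda>t. h k (\<xi> t k)) \<longlongrightarrow> h k (\<phi> s)) (at s)" if k: "k < e" for k
  proof (rule tendstoI)
    fix \<epsilon> :: real assume \<epsilon>: "\<epsilon> > 0"
    obtain q where q: "q > 0"
      "\<And>y. y \<in> V \<Longrightarrow> (\<forall>i<e. \<bar>y i - \<phi> s i\<bar> < q) \<Longrightarrow> \<bar>h k y - h k (\<phi> s)\<bar> < \<epsilon>"
      using continuous_on_eboxD[OF V h[OF k] s \<epsilon>] by blast
    show "eventually (\<lambda>t. dist (h k (\<xi> t k)) (h k (\<phi> s)) < \<epsilon>) (at s)"
      using close[OF q(1)] box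
    proof eventually_elim
      case (elim t)
      have "\<xi> t k \<in> V" using \<xi>[OF elim(2)] k r(2) by blast
      moreover have "\<forall>i<e. \<bar>\<xi> t k i - \<phi> s i\<bar> < q"
      proof (intro allI impI)
        fix i assume i: "i < e"
        have "\<bar>\<xi> t k i - \<phi> s i\<bar> \<le> \<bar>\<phi> t i - \<phi> s i\<bar>" using \<xi>[OF elim(2)] k by blast
        also have "\<dots> < q" using elim(1) i by blast
        finally show "\<bar>\<xi> t k i - \<phi> s i\<bar> < q" .
      qed
      ultimately show ?case using q(2) by (simp add: dist_real_def)
    qed
  qed
  have "((\<lambda>t. h k (\<xi> t k) * ((\<phi> t k - \<phi> s k) / (t - s))) \<longlongrightarrow> h k (\<phi> s) * v k) (at s)"
    if "k < e" for k
    by (rule tendsto_mult[OF hlim[OF that] \<phi>[OF that, unfolded has_field_derivative_iff]])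
  then have L: "((\<lambda>t. \<Sum>k<e. h k (\<xi> t k) * ((\<phi> t k - \<phi> s k) / (t - s))) \<longlongrightarrow> (\<Sum>j<e. h j (\<phi> s) * v j)) (at s)"
    by (intro tendsto_sum) simp
  have "eventually (\<lambda>t. (\<Sum>k<e. h k (\<xi> t k) * ((\<phi> t k - \<phi> s k) / (t - s))) =
      (f (\<phi> t) - f (\<phi> s)) / (t - s)) (at s)"
    using box
  proof eventually_elim
    case (elim t)
    then show ?case using \<xi>[OF elim] by (simp add: sum_divide_distrib)
  qed
  from Lim_transform_eventually[OF L this] show ?thesis
    by (simp only: has_field_derivative_iff)
qed

text \<open>Continuous partial derivatives are bounded near a point, and bounded ones make
  \<open>f\<close> Lipschitz there.\<close>

lemma partials_on_continuous:
  assumes W: "eopen d W" and f: "partials_on d W f h"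
    and h: "\<And>j. j < d \<Longrightarrow> continuous_on W (h j)"
  shows "continuous_on W f"
  unfolding continuous_on_ebox_iff[OF W]
proof (intro ballI allI impI)
  fix x and \<epsilon> :: real assume x: "x \<in> W" and \<epsilon>: "\<epsilon> > 0"
  then have xc: "x \<in> coord_space d" using W by (auto simp: eopen_def)
  have "\<forall>k. \<exists>q. k < d \<longrightarrow> q > 0 \<and> (\<forall>y\<in>W. (\<forall>i<d. \<bar>y i - x i\<bar> < q) \<longrightarrow> \<bar>h k y - h k x\<bar> < 1)"
  proof
    fix k
    show "\<exists>q. k < d \<longrightarrow> q > 0 \<and> (\<forall>y\<in>W. (\<forall>i<d. \<bar>y i - x i\<bar> < q) \<longrightarrow> \<bar>h k y - h k x\<bar> < 1)"
      using continuous_on_eboxD[OF W h[of k] x, of 1] by auto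
  qed
  from choice[OF this] obtain q where q: "\<And>k. k < d \<Longrightarrow> q k > 0"
    "\<And>k y. k < d \<Longrightarrow> y \<in> W \<Longrightarrow> (\<forall>i<d. \<bar>y i - x i\<bar> < q k) \<Longrightarrow> \<bar>h k y - h k x\<bar> < 1" by blast
  obtain r where r: "r > 0" "ebox d x r \<subseteq> W" using eopenD[OF W x] by blast
  \<comment> \<open>\<open>Q\<close> bounds the sum of the absolute partial derivatives near
    \<open>x\<close>. Dividing by \<open>Q + 1\<close> instead of \<open>Q\<close> covers
    \<open>d = 0\<close> and leaves the final estimate strict.\<close>
  define Q where "Q = (\<Sum>k<d. \<bar>h k x\<bar> + 1)"
  have Q0: "Q \<ge> 0" unfolding Q_def by (intro sum_nonneg) auto
  define e where "e = Min ({r, \<epsilon> / (Q + 1)} \<union> q ` {..<d})"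
  have "e > 0" unfolding e_def by (subst Min_gr_iff) (use r q \<epsilon> Q0 in auto)
  moreover have "e \<le> r" "e \<le> \<epsilon> / (Q + 1)" unfolding e_def by (rule Min_le; simp)+
  moreover have "e \<le> q k" if "k < d" for k unfolding e_def by (rule Min_le) (use that in auto)
  ultimately have e: "e > 0" "e \<le> r" "e \<le> \<epsilon> / (Q + 1)" "\<And>k. k < d \<Longrightarrow> e \<le> q k" by blast+
  show "\<exists>e>0. \<forall>y\<in>W. (\<forall>i<d. \<bar>y i - x i\<bar> < e) \<longrightarrow> \<bar>f y - f x\<bar> < \<epsilon>"
  proof (intro exI[of _ e] conjI ballI impI)
    fix y assume y: "y \<in> W" "\<forall>i<d. \<bar>y i - x i\<bar> < e"
    have yb: "y \<in> ebox d x e" using y W by (auto simp: ebox_def eopen_def)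
    have eW: "ebox d x e \<subseteq> W" using r(2) e(2) unfolding ebox_def by (auto dest: less_le_trans)
    obtain \<xi> where \<xi>: "\<And>k. k < d \<Longrightarrow> \<xi> k \<in> ebox d x e"
      "f y - f x = (\<Sum>k<d. h k (\<xi> k) * (y k - x k))"
      using partials_on_mvt[OF partials_on_subset[OF f eW] xc yb] by blast
    have "\<bar>f y - f x\<bar> \<le> (\<Sum>k<d. \<bar>h k (\<xi> k)\<bar> * \<bar>y k - x k\<bar>)"
      unfolding \<xi>(2) by (rule order_trans[OF sum_abs]) (simp add: abs_mult)
    also have "\<dots> \<le> (\<Sum>k<d. (\<bar>h k x\<bar> + 1) * e)"
    proof (intro sum_mono mult_mono)
      fix k assume "k \<in> {..<d}"
      then have k: "k < d" by simp
      have "\<forall>i<d. \<bar>\<xi> k i - x i\<bar> < q k"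
        using \<xi>(1)[OF k] e(4)[OF k] unfolding ebox_def by (auto dest: less_le_trans)
      moreover have "\<xi> k \<in> W" using \<xi>(1)[OF k] eW by blast
      ultimately have "\<bar>h k (\<xi> k) - h k x\<bar> < 1" using q(2)[OF k] by blast
      then show "\<bar>h k (\<xi> k)\<bar> \<le> \<bar>h k x\<bar> + 1" by linarith
      show "\<bar>y k - x k\<bar> \<le> e" using y(2) k by auto
    qed auto
    also have "\<dots> = Q * e" by (simp add: Q_def sum_distrib_right)
    also have "\<dots> \<le> Q * (\<epsilon> / (Q + 1))" using e(3) Q0 by (rule mult_left_mono)
    also have "\<dots> < \<epsilon>" using Q0 \<epsilon> by (simp add: field_simps)
    finally show "\<bar>f y - f x\<bar> < \<epsilon>" .
  qed (rule e)
qed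

subsection \<open>Functions of class \<open>C\<^sup>k\<close>\<close>

lemma Ck_on_continuous: "Ck_on k d W f \<Longrightarrow> continuous_on W f"
  by (cases k) auto

lemma Ck_on_SucD:
  assumes "Ck_on (Suc k) d W f"
  shows "partials_on d W f (\<lambda>i. partial_deriv i f)" "\<And>i. i < d \<Longrightarrow> Ck_on k d W (partial_deriv i f)"
proof -
  show "partials_on d W f (\<lambda>i. partial_deriv i f)"
    unfolding partials_on_def
  proof (intro allI impI ballI)
    fix i x assume "i < d" "x \<in> W"
    then have "(\<lambda>t. f (x(i := t))) differentiable (at (x i))" using assms by simp
    then obtain D where "((\<lambda>t. f (x(i := t))) has_real_derivative D) (at (x i))"
      by (auto simp: real_differentiable_def)
    then show "((\<lambda>t. f (x(i := t))) has_real_derivative partial_deriv i f x) (at (x i))"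
      unfolding partial_deriv_def using DERIV_imp_deriv[of _ D] by simp
  qed
qed (use assms in simp)

text \<open>\<open>Ck_on\<close> refers to \<open>partial_deriv\<close> of total functions, so
  independence of the values outside \<open>W\<close> has to be carried through the recursion.
  Openness of \<open>W\<close> provides it at every level.\<close>

lemma Ck_on_cong_imp:
  assumes W: "eopen d W"
  shows "Ck_on k d W f \<Longrightarrow> (\<And>x. x \<in> W \<Longrightarrow> f x = g x) \<Longrightarrow> Ck_on k d W g"
proof (induction k arbitrary: f g)
  case 0
  then show ?case using continuous_on_cong[OF refl, of W f g] by simp
next
  case (Suc k)
  have p: "partials_on d W g (\<lambda>i. partial_deriv i f)"
    by (rule partials_on_cong[OF W Ck_on_SucD(1)[OF Suc.prems(1)] Suc.prems(2) refl])
  have "continuous_on W g"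
    using Ck_on_continuous[OF Suc.prems(1)] continuous_on_cong[OF refl, of W f g] Suc.prems(2) by simp
  moreover have "(\<lambda>t. g (x(i := t))) differentiable (at (x i))" if "i < d" "x \<in> W" for i x
    using partials_onD[OF p that] real_differentiable_def by blast
  moreover have "Ck_on k d W (partial_deriv i g)" if "i < d" for i
    by (rule Suc.IH[OF Ck_on_SucD(2)[OF Suc.prems(1) that]]) (simp add: partials_on_partial_deriv[OF p that])
  ultimately show ?case by simp
qed

lemma Ck_on_cong:
  assumes "eopen d W" "\<And>x. x \<in> W \<Longrightarrow> f x = g x"
  shows "Ck_on k d W f \<longleftrightarrow> Ck_on k d W g"
  using Ck_on_cong_imp[OF assms(1), of k f g] Ck_on_cong_imp[OF assms(1), of k g f] assms(2) by auto

text \<open>The working introduction rule: any gradient formula valid on \<open>W\<close> may be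
  used, and continuity of \<open>f\<close> itself comes from that of the gradient.\<close>

lemma Ck_on_SucI:
  assumes W: "eopen d W" and f: "partials_on d W f h" and h: "\<And>i. i < d \<Longrightarrow> Ck_on k d W (h i)"
  shows "Ck_on (Suc k) d W f"
proof -
  have "continuous_on W f"
    by (rule partials_on_continuous[OF W f Ck_on_continuous[OF h]])
  moreover have "(\<lambda>t. f (x(i := t))) differentiable (at (x i))" if "i < d" "x \<in> W" for i x
    using partials_onD[OF f that] real_differentiable_def by blast
  moreover have "Ck_on k d W (partial_deriv i f)" if "i < d" for i
    by (rule Ck_on_cong_imp[OF W h[OF that]]) (simp add: partials_on_partial_deriv[OF f that])
  ultimately show ?thesis by simp
qed

lemma Ck_on_Suc_imp: "Ck_on (Suc k) d W f \<Longrightarrow> Ck_on k d W f"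
  by (induction k arbitrary: f) auto

lemma Ck_on_subset: "Ck_on k d W f \<Longrightarrow> V \<subseteq> W \<Longrightarrow> Ck_on k d V f"
  by (induction k arbitrary: f) (auto intro: continuous_on_subset)

lemma Ck_on_const: 
  assumes "eopen d W" shows "Ck_on k d W (\<lambda>_. a)"
proof (induction k arbitrary: a)
  case (Suc k)
  show ?case by (rule Ck_on_SucI[OF assms, where h="\<lambda>_ _. 0"]) (auto simp: partials_on_def Suc)
qed auto

lemma Ck_on_coord: 
  assumes "eopen d W" shows "Ck_on k d W (\<lambda>x. x i)"
proof (cases k)
  case (Suc k)
  show ?thesis unfolding Suc
  proof (rule Ck_on_SucI[OF assms, where h="\<lambda>j _. if i = j then 1 else 0"])
    show "partials_on d W (\<lambda>x. x i) (\<lambda>j _. if i = j then 1 else 0)"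
      unfolding partials_on_def by (auto intro!: derivative_eq_intros)
  qed (auto intro: Ck_on_const assms)
qed (auto intro: continuous_on_subset[OF continuous_on_product_coordinates])

lemma Ck_on_add:
  assumes "eopen d W"
  shows "Ck_on k d W f \<Longrightarrow> Ck_on k d W g \<Longrightarrow> Ck_on k d W (\<lambda>x. f x + g x)"
proof (induction k arbitrary: f g)
  case (Suc k)
  note f = Ck_on_SucD[OF Suc.prems(1)] and g = Ck_on_SucD[OF Suc.prems(2)]
  show ?case
  proof (rule Ck_on_SucI[OF assms, where h="\<lambda>i x. partial_deriv i f x + partial_deriv i g x"])
    show "partials_on d W (\<lambda>x. f x + g x) (\<lambda>i x. partial_deriv i f x + partial_deriv i g x)"
      unfolding partials_on_def by (auto intro!: DERIV_add partials_onD[OF f(1)] partials_onD[OF g(1)])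
  qed (intro Suc.IH f(2) g(2))
qed (auto intro: continuous_intros)

lemma partials_on_mult:
  assumes "partials_on d W f h" "partials_on d W g k"
  shows "partials_on d W (\<lambda>x. f x * g x) (\<lambda>i x. h i x * g x + k i x * f x)"
  unfolding partials_on_def
proof (intro allI impI ballI)
  fix i x assume i: "i < d" "x \<in> W"
  show "((\<lambda>t. f (x(i := t)) * g (x(i := t))) has_real_derivative h i x * g x + k i x * f x) (at (x i))"
    using DERIV_mult[OF partials_onD[OF assms(1) i] partials_onD[OF assms(2) i]] by simp
qed

lemma Ck_on_mult:
  assumes "eopen d W"
  shows "Ck_on k d W f \<Longrightarrow> Ck_on k d W g \<Longrightarrow> Ck_on k d W (\<lambda>x. f x * g x)"
proof (induction k arbitrary: f g)
  case (Suc k)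
  note f = Ck_on_SucD[OF Suc.prems(1)] and g = Ck_on_SucD[OF Suc.prems(2)]
  note l = Ck_on_Suc_imp[OF Suc.prems(1)] Ck_on_Suc_imp[OF Suc.prems(2)]
  show ?case
    by (rule Ck_on_SucI[OF assms partials_on_mult[OF f(1) g(1)]])
      (intro Ck_on_add[OF assms] Suc.IH f(2) g(2) l)
qed (auto intro: continuous_intros)

lemma Ck_on_inverse:
  assumes "eopen d W" "\<And>x. x \<in> W \<Longrightarrow> f x \<noteq> 0"
  shows "Ck_on k d W f \<Longrightarrow> Ck_on k d W (\<lambda>x. inverse (f x))"
proof (induction k)
  case (Suc k)
  note f = Ck_on_SucD[OF Suc.prems(1)]
  have IH: "Ck_on k d W (\<lambda>x. inverse (f x))" by (rule Suc.IH[OF Ck_on_Suc_imp[OF Suc.prems(1)]])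
  show ?case
  proof (rule Ck_on_SucI[OF assms(1),
        where h="\<lambda>i x. (-1) * (partial_deriv i f x * (inverse (f x) * inverse (f x)))"])
    show "partials_on d W (\<lambda>x. inverse (f x))
        (\<lambda>i x. (-1) * (partial_deriv i f x * (inverse (f x) * inverse (f x))))"
      unfolding partials_on_def
    proof (intro allI impI ballI)
      fix i x assume i: "i < d" "x \<in> W"
      show "((\<lambda>t. inverse (f (x(i := t)))) has_real_derivative
          (-1) * (partial_deriv i f x * (inverse (f x) * inverse (f x)))) (at (x i))"
        using DERIV_inverse'[OF partials_onD[OF f(1) i]] assms(2)[OF i(2)]
        by (simp add: mult.commute mult.left_commute fun_upd_def)
    qed
  qed (intro Ck_on_mult[OF assms(1)] Ck_on_const[OF assms(1)] IH f(2))
qed (use assms in \<open>auto intro: continuous_intros\<close>)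

lemma Ck_on_sum:
  assumes "eopen d W"
  shows "(\<And>a. a \<in> A \<Longrightarrow> Ck_on k d W (f a)) \<Longrightarrow> Ck_on k d W (\<lambda>x. \<Sum>a\<in>A. f a x)"
proof (induction A rule: infinite_finite_induct)
  case (insert a A)
  then show ?case using Ck_on_add[OF assms, of k "f a" "\<lambda>x. \<Sum>a\<in>A. f a x"] by simp
qed (auto intro: Ck_on_const assms)

lemma Ck_on_prod:
  assumes "eopen d W"
  shows "(\<And>a. a \<in> A \<Longrightarrow> Ck_on k d W (f a)) \<Longrightarrow> Ck_on k d W (\<lambda>x. \<Prod>a\<in>A. f a x)"
proof (induction A rule: infinite_finite_induct)
  case (insert a A)
  then show ?case using Ck_on_mult[OF assms, of k "f a" "\<lambda>x. \<Prod>a\<in>A. f a x"] by simp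
qed (auto intro: Ck_on_const assms)

lemma partials_on_compose:
  assumes V: "eopen e V" and W: "eopen d W" and f: "partials_on e V f h"
    and h: "\<And>j. j < e \<Longrightarrow> continuous_on V (h j)"
    and \<phi>: "\<And>j. j < e \<Longrightarrow> partials_on d W (\<lambda>x. \<phi> x j) (k j)"
    and mem: "\<And>x. x \<in> W \<Longrightarrow> \<phi> x \<in> V"
  shows "partials_on d W (\<lambda>x. f (\<phi> x)) (\<lambda>i x. \<Sum>j<e. h j (\<phi> x) * k j i x)"
  unfolding partials_on_def
proof (intro allI impI ballI)
  fix i x assume i: "i < d" "x \<in> W"
  have "((\<lambda>t. f (\<phi> (x(i := t)))) has_real_derivative (\<Sum>j<e. h j (\<phi> (x(i := x i))) * k j i x)) (at (x i))"
  proof (rule partials_on_curve[OF V f h])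
    show "eventually (\<lambda>t. \<phi> (x(i := t)) \<in> V) (nhds (x i))"
      using eventually_upd[OF W i(2,1)] by eventually_elim (rule mem)
  qed (auto intro: partials_onD[OF \<phi>] i)
  then show "((\<lambda>t. f (\<phi> (x(i := t)))) has_real_derivative (\<Sum>j<e. h j (\<phi> x) * k j i x)) (at (x i))"
    by simp
qed

text \<open>Starts at class one because the chain rule needs continuous partial derivatives of
  \<open>f\<close>. In the induction step the factors \<open>partial_deriv j f (\<phi> x)\<close>
  are again compositions, one class lower.\<close>

lemma Ck_on_compose:
  assumes V: "eopen e V" and W: "eopen d W" and mem: "\<And>x. x \<in> W \<Longrightarrow> \<phi> x \<in> V"
  shows "Ck_on (Suc k) e V f \<Longrightarrow> (\<And>j. j < e \<Longrightarrow> Ck_on (Suc k) d W (\<lambda>x. \<phi> x j)) \<Longrightarrow>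
    Ck_on (Suc k) d W (\<lambda>x. f (\<phi> x))"
proof (induction k arbitrary: f)
  case 0
  note f = Ck_on_SucD[OF 0(1)] and \<phi> = Ck_on_SucD[OF 0(2)]
  have p: "partials_on d W (\<lambda>x. f (\<phi> x)) 
      (\<lambda>i x. \<Sum>j<e. partial_deriv j f (\<phi> x) * partial_deriv i (\<lambda>x. \<phi> x j) x)"
    by (rule partials_on_compose[OF V W f(1) Ck_on_continuous[OF f(2)] \<phi>(1) mem])
  have c: "continuous_on W (\<lambda>x. g (\<phi> x))" if g: "continuous_on V g" for g :: "(nat \<Rightarrow> real) \<Rightarrow> real"
  proof (rule continuous_on_compose2[OF g])
    have "continuous_on W (\<lambda>x. \<phi> x j)" for j
    proof (cases "j < e")
      case True then show ?thesis using 0(2) Ck_on_continuous by blast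
    next
      \<comment> \<open>Coordinates from \<open>e\<close> on vanish on \<open>coord_space e\<close>;
        they still have to be treated, since continuity into the product topology concerns all
        coordinates.\<close>
      case False
      then have "\<phi> x j = 0" if "x \<in> W" for x using mem[OF that] eopen_sub[OF V] by (auto simp: coord_space_def)
      then show ?thesis using continuous_on_cong[OF refl, of W "\<lambda>x. \<phi> x j" "\<lambda>_. 0"] by simp
    qed
    then show "continuous_on W \<phi>" by (rule continuous_on_coordinatewise_then_product)
  qed (use mem in auto)
  show ?case
  proof (rule Ck_on_SucI[OF W p])
    fix i assume i: "i < d"
    show "Ck_on 0 d W (\<lambda>x. \<Sum>j<e. partial_deriv j f (\<phi> x) * partial_deriv i (\<lambda>x. \<phi> x j) x)"
    proof (rule Ck_on_sum[OF W], rule Ck_on_mult[OF W])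
      fix j assume "j \<in> {..<e}"
      then have j: "j < e" by simp
      show "Ck_on 0 d W (\<lambda>x. partial_deriv j f (\<phi> x))"
        using c[OF Ck_on_continuous[OF f(2)[OF j]]] by simp
      show "Ck_on 0 d W (partial_deriv i (\<lambda>x. \<phi> x j))"
        by (rule \<phi>(2)[OF j i])
    qed
  qed
next
  case (Suc k)
  note f = Ck_on_SucD[OF Suc.prems(1)] and \<phi> = Ck_on_SucD[OF Suc.prems(2)]
  have p: "partials_on d W (\<lambda>x. f (\<phi> x)) 
      (\<lambda>i x. \<Sum>j<e. partial_deriv j f (\<phi> x) * partial_deriv i (\<lambda>x. \<phi> x j) x)"
    by (rule partials_on_compose[OF V W f(1) Ck_on_continuous[OF f(2)] \<phi>(1) mem])
  show ?case
  proof (rule Ck_on_SucI[OF W p])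
    fix i assume i: "i < d"
    show "Ck_on (Suc k) d W (\<lambda>x. \<Sum>j<e. partial_deriv j f (\<phi> x) * partial_deriv i (\<lambda>x. \<phi> x j) x)"
    proof (rule Ck_on_sum[OF W], rule Ck_on_mult[OF W])
      fix j assume "j \<in> {..<e}"
      then have j: "j < e" by simp
      show "Ck_on (Suc k) d W (\<lambda>x. partial_deriv j f (\<phi> x))"
        by (rule Suc.IH[OF f(2)[OF j] Ck_on_Suc_imp[OF Suc.prems(2)]])
      show "Ck_on (Suc k) d W (partial_deriv i (\<lambda>x. \<phi> x j))"
        by (rule \<phi>(2)[OF j i])
    qed
  qed
qed

text \<open>The mean value theorem in direction \<open>i\<close>, followed by one in direction
  \<open>j\<close> for the difference of first derivatives.\<close>

lemma second_difference:
  assumes W: "ebox d x r \<subseteq> W" "eopen d W" "x \<in> W" and f: "partials_on d W f h"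
    and k: "partials_on d W (h i) k"
    and ij: "i < d" "j < d" "i \<noteq> j" and e: "0 < e" "e < r"
  shows "\<exists>p\<in>W. (\<forall>l<d. \<bar>p l - x l\<bar> \<le> e) \<and>
    f (x(i := x i + e, j := x j + e)) - f (x(i := x i + e, j := x j)) -
      (f (x(i := x i, j := x j + e)) - f (x(i := x i, j := x j))) = e * (e * k j p)"
proof -
  have xc: "x \<in> coord_space d" using W by (auto simp: eopen_def)
  have mem: "x(i := s, j := t) \<in> W" if "x i \<le> s" "s \<le> x i + e" "x j \<le> t" "t \<le> x j + e" for s t
    using W(1) that ij e xc by (force simp: ebox_def coord_space_def)
  have d1: "((\<lambda>s. f (x(i := s, j := t))) has_real_derivative h i (x(i := s, j := t))) (at s)"
    if "x i \<le> s" "s \<le> x i + e" "x j \<le> t" "t \<le> x j + e" for s t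
    using partials_onD[OF f ij(1) mem[OF that]] ij(3) by (simp add: fun_upd_twist)
  have "\<exists>z. x i < z \<and> z < x i + e \<and>
     (f (x(i := x i + e, j := x j + e)) - f (x(i := x i + e, j := x j))) -
      (f (x(i := x i, j := x j + e)) - f (x(i := x i, j := x j))) =
     (x i + e - x i) * (h i (x(i := z, j := x j + e)) - h i (x(i := z, j := x j)))"
    using e by (intro MVT2[of _ _ "\<lambda>s. f (x(i := s, j := x j + e)) - f (x(i := s, j := x j))"])
       (auto intro!: DERIV_diff d1)
  then obtain z where z: "x i < z" "z < x i + e"
     "(f (x(i := x i + e, j := x j + e)) - f (x(i := x i + e, j := x j))) -
      (f (x(i := x i, j := x j + e)) - f (x(i := x i, j := x j))) =
     e * (h i (x(i := z, j := x j + e)) - h i (x(i := z, j := x j)))" by auto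
  have d2: "((\<lambda>t. h i (x(i := z, j := t))) has_real_derivative k j (x(i := z, j := t))) (at t)"
    if "x j \<le> t" "t \<le> x j + e" for t
    using partials_onD[OF k ij(2) mem[of z t]] z that by simp
  have "\<exists>y. x j < y \<and> y < x j + e \<and> h i (x(i := z, j := x j + e)) - h i (x(i := z, j := x j)) =
     (x j + e - x j) * k j (x(i := z, j := y))"
    using e by (intro MVT2[of _ _ "\<lambda>t. h i (x(i := z, j := t))"]) (auto intro!: d2)
  then obtain y where y: "x j < y" "y < x j + e" 
    "h i (x(i := z, j := x j + e)) - h i (x(i := z, j := x j)) = e * k j (x(i := z, j := y))" by auto
  show ?thesis
    using z y mem[of z y] e by (intro bexI[of _ "x(i := z, j := y)"]) auto
qed

text \<open>The double difference does not depend on the order of the two directions. Evaluated both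
  ways it equates the two mixed derivatives at two points close to \<open>x\<close>, and continuity
  moves both points to \<open>x\<close>.\<close>

lemma partial_deriv_commute:
  assumes W: "eopen d W" "x \<in> W" and f: "Ck_on 2 d W f" and ij: "i < d" "j < d"
  shows "partial_deriv i (partial_deriv j f) x = partial_deriv j (partial_deriv i f) x"
proof (cases "i = j")
  case False
  have f': "Ck_on (Suc (Suc 0)) d W f" using f by (simp add: numeral_2_eq_2)
  note p = Ck_on_SucD[OF f'] note q = Ck_on_SucD[OF p(2)]
  let ?a = "partial_deriv i (partial_deriv j f)" and ?b = "partial_deriv j (partial_deriv i f)"
  have ca: "continuous_on W ?a" "continuous_on W ?b" using q(2) ij by auto
  obtain r where r: "r > 0" "ebox d x r \<subseteq> W" using eopenD[OF W] by blast
  have small: "\<bar>?a x - ?b x\<bar> < 2 * \<epsilon>" if \<epsilon>: "\<epsilon> > 0" for \<epsilon>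
  proof -
    obtain e1 where e1: "e1 > 0" "\<And>y. y \<in> W \<Longrightarrow> (\<forall>i<d. \<bar>y i - x i\<bar> < e1) \<Longrightarrow> \<bar>?a y - ?a x\<bar> < \<epsilon>"
      using continuous_on_eboxD[OF W(1) ca(1) W(2) \<epsilon>] by blast
    obtain e2 where e2: "e2 > 0" "\<And>y. y \<in> W \<Longrightarrow> (\<forall>i<d. \<bar>y i - x i\<bar> < e2) \<Longrightarrow> \<bar>?b y - ?b x\<bar> < \<epsilon>"
      using continuous_on_eboxD[OF W(1) ca(2) W(2) \<epsilon>] by blast
    define e where "e = min r (min e1 e2) / 2"
    have e: "0 < e" "e < r" "e < e1" "e < e2" using r e1 e2 by (auto simp: e_def)
    obtain y where y: "y \<in> W" "\<forall>l<d. \<bar>y l - x l\<bar> \<le> e"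
      "f (x(j := x j + e, i := x i + e)) - f (x(j := x j + e, i := x i)) -
      (f (x(j := x j, i := x i + e)) - f (x(j := x j, i := x i))) = e * (e * ?a y)"
      using second_difference[OF r(2) W p(1) q(1)[OF ij(2)] ij(2,1) _ e(1,2)] False by metis
    obtain z where z: "z \<in> W" "\<forall>l<d. \<bar>z l - x l\<bar> \<le> e"
      "f (x(i := x i + e, j := x j + e)) - f (x(i := x i + e, j := x j)) -
      (f (x(i := x i, j := x j + e)) - f (x(i := x i, j := x j))) = e * (e * ?b z)"
      using second_difference[OF r(2) W p(1) q(1)[OF ij(1)] ij _ e(1,2)] False by metis
    have tw: "x(j := t, i := s) = x(i := s, j := t)" for s t using False by (simp add: fun_upd_twist)
    have "e * (e * ?a y) = e * (e * ?b z)" using y(3) z(3) unfolding tw by linarith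
    then have "?a y = ?b z" using e(1) by simp
    moreover have "\<bar>?a y - ?a x\<bar> < \<epsilon>" using e1(2)[OF y(1)] y(2) e(3) by (meson le_less_trans)
    moreover have "\<bar>?b z - ?b x\<bar> < \<epsilon>" using e2(2)[OF z(1)] z(2) e(4) by (meson le_less_trans)
    ultimately show ?thesis by linarith
  qed
  show ?thesis
  proof (rule ccontr)
    assume "?a x \<noteq> ?b x"
    then show False using small[of "\<bar>?a x - ?b x\<bar> / 2"] by simp
  qed
qed simp

subsection \<open>Smooth functions\<close>

lemma smooth_fun_on_cong:
  assumes "eopen d W" "\<And>x. x \<in> W \<Longrightarrow> f x = g x"
  shows "smooth_fun_on d W f \<longleftrightarrow> smooth_fun_on d W g"
  using Ck_on_cong[OF assms] by (simp add: smooth_fun_on_def)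

lemma smooth_fun_on_subset: "smooth_fun_on d W f \<Longrightarrow> V \<subseteq> W \<Longrightarrow> smooth_fun_on d V f"
  by (auto simp: smooth_fun_on_def intro: Ck_on_subset)

lemma smooth_fun_on_partials:
  "smooth_fun_on d W f \<Longrightarrow> partials_on d W f (\<lambda>i. partial_deriv i f)"
  using Ck_on_SucD(1) smooth_fun_on_def by blast

lemma smooth_fun_on_partial_deriv:
  "smooth_fun_on d W f \<Longrightarrow> i < d \<Longrightarrow> smooth_fun_on d W (partial_deriv i f)"
  using Ck_on_SucD(2) smooth_fun_on_def by blast

lemma smooth_fun_on_continuous: "smooth_fun_on d W f \<Longrightarrow> continuous_on W f"
  using Ck_on_continuous smooth_fun_on_def by blast

lemma smooth_fun_onI_partials:
  assumes "eopen d W" "partials_on d W f h" "\<And>i. i < d \<Longrightarrow> smooth_fun_on d W (h i)"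
  shows "smooth_fun_on d W f"
  unfolding smooth_fun_on_def
proof
  fix k show "Ck_on k d W f"
    by (rule Ck_on_Suc_imp, rule Ck_on_SucI[OF assms(1,2)]) 
      (use assms(3) in \<open>auto simp: smooth_fun_on_def\<close>)
qed

lemma smooth_fun_on_compose:
  assumes V: "eopen e V" and W: "eopen d W" and mem: "\<And>x. x \<in> W \<Longrightarrow> \<phi> x \<in> V"
    and f: "smooth_fun_on e V f" and \<phi>: "\<And>j. j < e \<Longrightarrow> smooth_fun_on d W (\<lambda>x. \<phi> x j)"
  shows "smooth_fun_on d W (\<lambda>x. f (\<phi> x))"
  unfolding smooth_fun_on_def
proof
  fix k show "Ck_on k d W (\<lambda>x. f (\<phi> x))"
    by (rule Ck_on_Suc_imp, rule Ck_on_compose[OF V W mem])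
      (use f \<phi> in \<open>auto simp: smooth_fun_on_def simp del: Ck_on.simps\<close>)
qed

lemma partial_deriv_compose:
  assumes V: "eopen e V" and W: "eopen d W" and mem: "\<And>x. x \<in> W \<Longrightarrow> \<phi> x \<in> V"
    and f: "smooth_fun_on e V f" and \<phi>: "\<And>j. j < e \<Longrightarrow> smooth_fun_on d W (\<lambda>x. \<phi> x j)"
    and x: "i < d" "x \<in> W"
  shows "partial_deriv i (\<lambda>x. f (\<phi> x)) x =
    (\<Sum>j<e. partial_deriv j f (\<phi> x) * partial_deriv i (\<lambda>x. \<phi> x j) x)"
  by (rule partials_on_partial_deriv[OF partials_on_compose[OF V W smooth_fun_on_partials[OF f]
    smooth_fun_on_continuous[OF smooth_fun_on_partial_deriv[OF f]] smooth_fun_on_partials[OF \<phi>] mem] x])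

lemma smooth_fun_on_intros:
  assumes "eopen d W"
  shows "smooth_fun_on d W (\<lambda>_. a)" "smooth_fun_on d W (\<lambda>x. x i)"
    "smooth_fun_on d W f \<Longrightarrow> smooth_fun_on d W g \<Longrightarrow> smooth_fun_on d W (\<lambda>x. f x + g x)"
    "smooth_fun_on d W f \<Longrightarrow> smooth_fun_on d W g \<Longrightarrow> smooth_fun_on d W (\<lambda>x. f x * g x)"
    "smooth_fun_on d W f \<Longrightarrow> (\<And>x. x \<in> W \<Longrightarrow> f x \<noteq> 0) \<Longrightarrow> smooth_fun_on d W (\<lambda>x. inverse (f x))"
    "(\<And>a. a \<in> A \<Longrightarrow> smooth_fun_on d W (F a)) \<Longrightarrow> smooth_fun_on d W (\<lambda>x. \<Sum>a\<in>A. F a x)"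
    "(\<And>a. a \<in> A \<Longrightarrow> smooth_fun_on d W (F a)) \<Longrightarrow> smooth_fun_on d W (\<lambda>x. \<Prod>a\<in>A. F a x)"
  unfolding smooth_fun_on_def
  by (simp_all add: Ck_on_const[OF assms] Ck_on_coord[OF assms] Ck_on_add[OF assms]
    Ck_on_mult[OF assms] Ck_on_inverse[OF assms] Ck_on_sum[OF assms] Ck_on_prod[OF assms])

section \<open>Inverse matrices depending smoothly on parameters\<close>

text \<open>More than \<open>m\<close> vectors with \<open>m\<close> entries are dependent: padding
  with zero rows gives a singular square matrix, and a kernel vector is the dependency.\<close>

lemma dependent_vectors:
  fixes V :: "nat \<Rightarrow> nat \<Rightarrow> real"
  assumes "m < n"
  shows "\<exists>v. (\<exists>a<n. v a \<noteq> 0) \<and> (\<forall>j<m. (\<Sum>a<n. v a * V a j) = 0)"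
proof -
  let ?A = "mat n n (\<lambda>(j, a). if j < m then V a j else 0)"
  have A: "?A \<in> carrier_mat n n" by simp
  have "Determinant.det ?A = 0"
  proof (rule ccontr)
    assume "Determinant.det ?A \<noteq> 0"
    then have "Determinant.det (transpose_mat ?A) \<noteq> 0" using Determinant.det_transpose[OF A] by simp
    \<comment> \<open>Row \<open>m\<close> of the padded matrix is zero, so the transpose has a zero
      column and kills the corresponding unit vector.\<close>
    moreover have "transpose_mat ?A *\<^sub>v unit_vec n m = 0\<^sub>v n"
    proof (rule eq_vecI)
      fix i assume "i < dim_vec (0\<^sub>v n :: real Matrix.vec)"
      then have i: "i < n" by simp
      have "vec_index (transpose_mat ?A *\<^sub>v unit_vec n m) i = transpose_mat ?A $$ (i, m)"
        using i assms by (simp add: scalar_prod_right_unit)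
      also have "\<dots> = 0" using i assms by simp
      finally show "vec_index (transpose_mat ?A *\<^sub>v unit_vec n m) i = vec_index (0\<^sub>v n) i" using i by simp
    qed simp
    moreover have "unit_vec n m \<noteq> (0\<^sub>v n :: real Matrix.vec)"
    proof
      assume "unit_vec n m = (0\<^sub>v n :: real Matrix.vec)"
      then have "vec_index (unit_vec n m) m = vec_index (0\<^sub>v n :: real Matrix.vec) m" by (rule arg_cong)
      then show False using assms by simp
    qed
    moreover have "transpose_mat ?A \<in> carrier_mat n n" using A by simp
    ultimately show False
      using det_0_iff_vec_prod_zero[of "transpose_mat ?A" n] unit_vec_carrier[of n m] by blast
  qed
  then obtain v where v: "v \<in> carrier_vec n" "v \<noteq> 0\<^sub>v n" "?A *\<^sub>v v = 0\<^sub>v n"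
    using det_0_iff_vec_prod_zero[OF A] by blast
  show ?thesis
  proof (intro exI[of _ "\<lambda>a. vec_index v a"] conjI allI impI)
    show "\<exists>a<n. vec_index v a \<noteq> 0"
    proof (rule ccontr)
      assume "\<not> (\<exists>a<n. vec_index v a \<noteq> 0)"
      then have "v = 0\<^sub>v n" using v(1) by (intro eq_vecI) auto
      then show False using v(2) by simp
    qed
    fix j assume j: "j < m"
    have "vec_index (?A *\<^sub>v v) j = 0" using v(3) j assms by simp
    moreover have "vec_index (?A *\<^sub>v v) j = (\<Sum>a<n. V a j * vec_index v a)"
      using j assms v(1) by (simp add: scalar_prod_def atLeast0LessThan)
    ultimately show "(\<Sum>a<n. vec_index v a * V a j) = 0" by (simp add: mult.commute)
  qed
qed

definition mdet :: "nat \<Rightarrow> (nat \<Rightarrow> nat \<Rightarrow> real) \<Rightarrow> real" where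
  "mdet d A = Determinant.det (mat d d (\<lambda>(i, j). A i j))"

text \<open>Cramer's rule, chosen because it is polynomial in the entries apart from division by the
  determinant; smooth dependence on parameters can then be read off.\<close>

definition minv :: "nat \<Rightarrow> (nat \<Rightarrow> nat \<Rightarrow> real) \<Rightarrow> nat \<Rightarrow> nat \<Rightarrow> real" where
  "minv d A i j = inverse (mdet d A) * adj_mat (mat d d (\<lambda>(i, j). A i j)) $$ (i, j)"

lemma mdet_nonzero:
  assumes "\<And>v. (\<And>i. i < d \<Longrightarrow> (\<Sum>j<d. A i j * v j) = 0) \<Longrightarrow> \<forall>j<d. v j = 0"
  shows "mdet d A \<noteq> 0"
proof
  let ?A = "mat d d (\<lambda>(i, j). A i j)"
  assume "mdet d A = 0"
  then obtain v where v: "v \<in> carrier_vec d" "v \<noteq> 0\<^sub>v d" "?A *\<^sub>v v = 0\<^sub>v d"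
    using det_0_iff_vec_prod_zero[of ?A d] by (auto simp: mdet_def)
  have "(\<Sum>j<d. A i j * vec_index v j) = 0" if i: "i < d" for i
  proof -
    have "vec_index (?A *\<^sub>v v) i = (\<Sum>j<d. A i j * vec_index v j)"
      using i v(1) by (simp add: scalar_prod_def atLeast0LessThan)
    then show ?thesis using v(3) i by simp
  qed
  from assms[OF this] have "v = 0\<^sub>v d" using v(1) by (intro eq_vecI) auto
  then show False using v(2) by simp
qed

lemma minv_right:
  assumes "mdet d A \<noteq> 0" "i < d" "j < d"
  shows "(\<Sum>k<d. A i k * minv d A k j) = (if i = j then 1 else 0)"
proof -
  let ?A = "mat d d (\<lambda>(i, j). A i j)"
  have A: "?A \<in> carrier_mat d d" by simp
  have "(?A * adj_mat ?A) $$ (i, j) = (mdet d A \<cdot>\<^sub>m 1\<^sub>m d) $$ (i, j)"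
    using adj_mat(2)[OF A] by (simp add: mdet_def)
  moreover have "(?A * adj_mat ?A) $$ (i, j) = (\<Sum>k<d. A i k * adj_mat ?A $$ (k, j))"
    using assms(2,3) adj_mat(1)[OF A] by (simp add: scalar_prod_def atLeast0LessThan)
  ultimately have "(\<Sum>k<d. A i k * adj_mat ?A $$ (k, j)) = (if i = j then mdet d A else 0)"
    using assms(2,3) by simp
  then have "inverse (mdet d A) * (\<Sum>k<d. A i k * adj_mat ?A $$ (k, j)) = (if i = j then 1 else 0)"
    using assms(1) by simp
  then show ?thesis by (simp add: minv_def sum_distrib_left mult_ac)
qed

lemma minv_left:
  assumes "mdet d A \<noteq> 0" "i < d" "j < d"
  shows "(\<Sum>k<d. minv d A i k * A k j) = (if i = j then 1 else 0)"
proof -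
  let ?A = "mat d d (\<lambda>(i, j). A i j)"
  have A: "?A \<in> carrier_mat d d" by simp
  have "(adj_mat ?A * ?A) $$ (i, j) = (mdet d A \<cdot>\<^sub>m 1\<^sub>m d) $$ (i, j)"
    using adj_mat(3)[OF A] by (simp add: mdet_def)
  moreover have "(adj_mat ?A * ?A) $$ (i, j) = (\<Sum>k<d. adj_mat ?A $$ (i, k) * A k j)"
    using assms(2,3) adj_mat(1)[OF A] by (simp add: scalar_prod_def atLeast0LessThan)
  ultimately have "(\<Sum>k<d. adj_mat ?A $$ (i, k) * A k j) = (if i = j then mdet d A else 0)"
    using assms(2,3) by simp
  then have "inverse (mdet d A) * (\<Sum>k<d. adj_mat ?A $$ (i, k) * A k j) = (if i = j then 1 else 0)"
    using assms(1) by simp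
  then show ?thesis by (simp add: minv_def sum_distrib_left mult_ac)
qed

text \<open>By the Leibniz formula. The size is a free \<open>n\<close> so that minors, of size
  \<open>d - 1\<close>, are covered too.\<close>

lemma smooth_det:
  assumes W: "eopen e W" and B: "\<And>i j. i < n \<Longrightarrow> j < n \<Longrightarrow> smooth_fun_on e W (\<lambda>x. B x i j)"
  shows "smooth_fun_on e W (\<lambda>x. Determinant.det (mat n n (\<lambda>(i, j). B x i j)))"
proof -
  have "smooth_fun_on e W (\<lambda>x. \<Sum>p\<in>{p. p permutes {0..<n}}. signof p * (\<Prod>i\<in>{0..<n}. B x i (p i)))"
  proof (rule smooth_fun_on_intros(6)[OF W], rule smooth_fun_on_intros(4)[OF W],
      rule smooth_fun_on_intros(1)[OF W], rule smooth_fun_on_intros(7)[OF W])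
    fix p i assume "p \<in> {p. p permutes {0..<n}}" "i \<in> {0..<n}"
    then have "i < n" "p i < n" using permutes_in_image[of p "{0..<n}" i] by auto
    then show "smooth_fun_on e W (\<lambda>x. B x i (p i))" by (rule B)
  qed
  moreover have "Determinant.det (mat n n (\<lambda>(i, j). B x i j)) =
      (\<Sum>p\<in>{p. p permutes {0..<n}}. signof p * (\<Prod>i\<in>{0..<n}. B x i (p i)))" for x
  proof -
    have "(\<Prod>i = 0..<n. mat n n (\<lambda>(i, j). B x i j) $$ (i, p i)) = (\<Prod>i\<in>{0..<n}. B x i (p i))"
      if "p permutes {0..<n}" for p
      using permutes_in_image[OF that] by (intro prod.cong refl) auto
    then show ?thesis by (simp add: Determinant.det_def)
  qed
  ultimately show ?thesis by simp
qed

lemma smooth_minv: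
  assumes W: "eopen e W" and A: "\<And>i j. i < d \<Longrightarrow> j < d \<Longrightarrow> smooth_fun_on e W (\<lambda>x. A x i j)"
    and nz: "\<And>x. x \<in> W \<Longrightarrow> mdet d (A x) \<noteq> 0" and ij: "i < d" "j < d"
  shows "smooth_fun_on e W (\<lambda>x. minv d (A x) i j)"
  unfolding minv_def
proof (rule smooth_fun_on_intros(4)[OF W], rule smooth_fun_on_intros(5)[OF W _ nz])
  show "smooth_fun_on e W (\<lambda>x. mdet d (A x))"
    unfolding mdet_def by (rule smooth_det[OF W A])
  \<comment> \<open>The index shift that skips a deleted row or column.\<close>
  let ?s = "\<lambda>k l. if k < l then k else Suc k"
  have "adj_mat (mat d d (\<lambda>(i, j). A x i j)) $$ (i, j) = (-1) ^ (j + i) *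
      Determinant.det (mat (d - 1) (d - 1) (\<lambda>(k, l). A x (?s k j) (?s l i)))" for x
  proof -
    have "mat_delete (mat d d (\<lambda>(i, j). A x i j)) j i = mat (d - 1) (d - 1) (\<lambda>(k, l). A x (?s k j) (?s l i))"
      using ij by (intro eq_matI) (auto simp: mat_delete_def)
    then show ?thesis using ij by (simp add: adj_mat_def cofactor_def)
  qed
  moreover have "smooth_fun_on e W (\<lambda>x. (-1) ^ (j + i) *
      Determinant.det (mat (d - 1) (d - 1) (\<lambda>(k, l). A x (?s k j) (?s l i))))"
    by (rule smooth_fun_on_intros(4)[OF W], rule smooth_fun_on_intros(1)[OF W], rule smooth_det[OF W], rule A)
      (use ij in auto)
  ultimately show "smooth_fun_on e W (\<lambda>x. adj_mat (mat d d (\<lambda>(i, j). A x i j)) $$ (i, j))"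
    by simp
qed

section \<open>Curvature of a coframe with constant structure functions\<close>

lemma sum3_swap: "(\<Sum>a\<in>I. \<Sum>b\<in>I. \<Sum>c\<in>I. F a b c) = (\<Sum>a\<in>I. \<Sum>b\<in>I. \<Sum>c\<in>I. (F a c b :: real))"
  by (intro sum.cong refl sum.swap)

lemma sum3_rot: "(\<Sum>a\<in>I. \<Sum>b\<in>I. \<Sum>c\<in>I. F a b c) = (\<Sum>a\<in>I. \<Sum>b\<in>I. \<Sum>c\<in>I. (F b c a :: real))"
proof -
  have "(\<Sum>a\<in>I. \<Sum>b\<in>I. \<Sum>c\<in>I. F b c a) = (\<Sum>b\<in>I. \<Sum>a\<in>I. \<Sum>c\<in>I. F b c a)" by (rule sum.swap)
  also have "\<dots> = (\<Sum>b\<in>I. \<Sum>c\<in>I. \<Sum>a\<in>I. F b c a)" by (intro sum.cong refl sum.swap)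
  finally show ?thesis by simp
qed

text \<open>Meant for the Ricci formula, where the two summands agree only after exchanging the
  indices.\<close>

lemma sum_symmetrize:
  fixes F G :: "'i \<Rightarrow> 'i \<Rightarrow> real"
  assumes "\<And>a b. a \<in> I \<Longrightarrow> b \<in> I \<Longrightarrow> F a b + F b a = G a b + G b a"
  shows "(\<Sum>a\<in>I. \<Sum>b\<in>I. F a b) = (\<Sum>a\<in>I. \<Sum>b\<in>I. G a b)"
proof -
  have s: "2 * (\<Sum>a\<in>I. \<Sum>b\<in>I. H a b) = (\<Sum>a\<in>I. \<Sum>b\<in>I. H a b + H b a)" for H :: "'i \<Rightarrow> 'i \<Rightarrow> real"
    using sum.swap[of H I I] by (simp add: sum.distrib)
  have "(\<Sum>a\<in>I. \<Sum>b\<in>I. F a b + F b a) = (\<Sum>a\<in>I. \<Sum>b\<in>I. G a b + G b a)"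
    by (intro sum.cong refl assms)
  with s[of F] s[of G] show ?thesis by linarith
qed

text \<open>To be instantiated by the functions smooth in a chart and the coordinate derivatives.
  The tensor calculus uses no analysis beyond these laws; \<open>U\<close> is where equality of
  functions is tested.\<close>

locale derivation_algebra =
  fixes d :: nat and U :: "'m set" and S :: "('m \<Rightarrow> real) set"
    and D :: "nat \<Rightarrow> ('m \<Rightarrow> real) \<Rightarrow> 'm \<Rightarrow> real"
  assumes S_const: "(\<lambda>_. k) \<in> S"
    and S_add: "f \<in> S \<Longrightarrow> g \<in> S \<Longrightarrow> (\<lambda>p. f p + g p) \<in> S"
    and S_mult: "f \<in> S \<Longrightarrow> g \<in> S \<Longrightarrow> (\<lambda>p. f p * g p) \<in> S"
    and S_D: "i < d \<Longrightarrow> f \<in> S \<Longrightarrow> D i f \<in> S"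
    and D_const: "i < d \<Longrightarrow> p \<in> U \<Longrightarrow> D i (\<lambda>_. k) p = 0"
    and D_add: "i < d \<Longrightarrow> f \<in> S \<Longrightarrow> g \<in> S \<Longrightarrow> p \<in> U \<Longrightarrow> D i (\<lambda>q. f q + g q) p = D i f p + D i g p"
    and D_mult: "i < d \<Longrightarrow> f \<in> S \<Longrightarrow> g \<in> S \<Longrightarrow> p \<in> U \<Longrightarrow>
      D i (\<lambda>q. f q * g q) p = D i f p * g p + f p * D i g p"
    and D_comm: "i < d \<Longrightarrow> j < d \<Longrightarrow> f \<in> S \<Longrightarrow> p \<in> U \<Longrightarrow> D i (D j f) p = D j (D i f) p"
    and D_cong: "i < d \<Longrightarrow> (\<And>q. q \<in> U \<Longrightarrow> f q = g q) \<Longrightarrow> p \<in> U \<Longrightarrow> D i f p = D i g p"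
begin

lemma S_cmult: "f \<in> S \<Longrightarrow> (\<lambda>p. k * f p) \<in> S"
  using S_mult[OF S_const] by simp

lemma S_sum: "(\<And>a. a \<in> A \<Longrightarrow> F a \<in> S) \<Longrightarrow> (\<lambda>p. \<Sum>a\<in>A. F a p) \<in> S"
proof (induction A rule: infinite_finite_induct)
  case (insert a A)
  then show ?case using S_add[of "F a" "\<lambda>p. \<Sum>a\<in>A. F a p"] by simp
qed (auto intro: S_const)

lemma D_sum: "i < d \<Longrightarrow> p \<in> U \<Longrightarrow> (\<And>a. a \<in> A \<Longrightarrow> F a \<in> S) \<Longrightarrow>
  D i (\<lambda>p. \<Sum>a\<in>A. F a p) p = (\<Sum>a\<in>A. D i (F a) p)"
proof (induction A rule: infinite_finite_induct)
  case (insert a A)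
  then show ?case using D_add[of i "F a" "\<lambda>p. \<Sum>a\<in>A. F a p" p] S_sum[of A F] by simp
qed (auto simp: D_const)

lemma D_cmult: "i < d \<Longrightarrow> f \<in> S \<Longrightarrow> p \<in> U \<Longrightarrow> D i (\<lambda>q. k * f q) p = k * D i f p"
  using D_mult[OF _ S_const] D_const by simp

lemma D_sum_mult:
  assumes "i < d" "p \<in> U" "\<And>a. a \<in> A \<Longrightarrow> F a \<in> S" "\<And>a. a \<in> A \<Longrightarrow> G a \<in> S"
  shows "D i (\<lambda>p. \<Sum>a\<in>A. F a p * G a p) p = (\<Sum>a\<in>A. D i (F a) p * G a p + F a p * D i (G a) p)"
proof -
  have "D i (\<lambda>p. \<Sum>a\<in>A. F a p * G a p) p = (\<Sum>a\<in>A. D i (\<lambda>p. F a p * G a p) p)"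
    by (rule D_sum[OF assms(1,2)]) (rule S_mult[OF assms(3,4)])
  also have "\<dots> = (\<Sum>a\<in>A. D i (F a) p * G a p + F a p * D i (G a) p)"
    by (intro sum.cong refl D_mult assms)
  finally show ?thesis .
qed

end

text \<open>\<open>E\<close> is a frame of vector fields and \<open>th\<close> its dual coframe,
  both in coordinates. Requiring both duality relations keeps the index set \<open>I\<close>
  independent of the coordinate indices. That \<open>C\<close> does not depend on the point is what
  left invariance will supply.\<close>

locale frame = derivation_algebra d U S D for d :: nat and U :: "'m set" and S D +
  fixes I :: "'i set" and th E :: "'i \<Rightarrow> nat \<Rightarrow> 'm \<Rightarrow> real" and C :: "'i \<Rightarrow> 'i \<Rightarrow> 'i \<Rightarrow> real"
  assumes finI: "finite I"
    and th_S: "a \<in> I \<Longrightarrow> i < d \<Longrightarrow> th a i \<in> S"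
    and E_S: "a \<in> I \<Longrightarrow> i < d \<Longrightarrow> E a i \<in> S"
    and dual1: "p \<in> U \<Longrightarrow> a \<in> I \<Longrightarrow> b \<in> I \<Longrightarrow> (\<Sum>i<d. E a i p * th b i p) = (if a = b then 1 else 0)"
    and dual2: "p \<in> U \<Longrightarrow> i < d \<Longrightarrow> j < d \<Longrightarrow> (\<Sum>a\<in>I. E a i p * th a j p) = (if i = j then 1 else 0)"
    and C_skew: "a \<in> I \<Longrightarrow> b \<in> I \<Longrightarrow> c \<in> I \<Longrightarrow> C b a c = - C a b c"
    and bracket: "p \<in> U \<Longrightarrow> a \<in> I \<Longrightarrow> b \<in> I \<Longrightarrow> j < d \<Longrightarrow>
      (\<Sum>i<d. E a i p * D i (E b j) p - E b i p * D i (E a j) p) = (\<Sum>c\<in>I. C a b c * E c j p)"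
begin

section \<open>Expansion in a frame and the structure equation\<close>

lemma con_E_th:
  assumes "p \<in> U" "b \<in> I"
  shows "(\<Sum>i<d. E b i p * (\<Sum>a\<in>I. w a * th a i p)) = w b"
proof -
  have "(\<Sum>i<d. E b i p * (\<Sum>a\<in>I. w a * th a i p)) = (\<Sum>i<d. \<Sum>a\<in>I. w a * (E b i p * th a i p))"
    by (simp add: sum_distrib_left mult_ac)
  also have "\<dots> = (\<Sum>a\<in>I. \<Sum>i<d. w a * (E b i p * th a i p))" by (rule sum.swap)
  also have "\<dots> = (\<Sum>a\<in>I. w a * (if b = a then 1 else 0))"
    by (simp add: sum_distrib_left[symmetric] dual1 assms)
  also have "\<dots> = w b" using assms finI by (simp add: if_distrib cong: if_cong)
  finally show ?thesis .
qed

lemma con_th_E: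
  assumes "p \<in> U" "b \<in> I"
  shows "(\<Sum>i<d. th b i p * (\<Sum>a\<in>I. w a * E a i p)) = w b"
proof -
  have "(\<Sum>i<d. th b i p * (\<Sum>a\<in>I. w a * E a i p)) = (\<Sum>i<d. \<Sum>a\<in>I. w a * (E a i p * th b i p))"
    by (simp add: sum_distrib_left mult_ac)
  also have "\<dots> = (\<Sum>a\<in>I. \<Sum>i<d. w a * (E a i p * th b i p))" by (rule sum.swap)
  also have "\<dots> = (\<Sum>a\<in>I. w a * (if a = b then 1 else 0))"
    by (simp add: sum_distrib_left[symmetric] dual1 assms)
  also have "\<dots> = w b" using assms finI by (simp add: if_distrib cong: if_cong)
  finally show ?thesis .
qed

lemma expand_th:
  assumes "p \<in> U" "j < d"
  shows "(\<Sum>a\<in>I. th a j p * (\<Sum>i<d. E a i p * v i)) = v j"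
proof -
  have "(\<Sum>a\<in>I. th a j p * (\<Sum>i<d. E a i p * v i)) = (\<Sum>a\<in>I. \<Sum>i<d. v i * (E a i p * th a j p))"
    by (simp add: sum_distrib_left mult_ac)
  also have "\<dots> = (\<Sum>i<d. \<Sum>a\<in>I. v i * (E a i p * th a j p))" by (rule sum.swap)
  also have "\<dots> = (\<Sum>i<d. v i * (if i = j then 1 else 0))"
    by (simp add: sum_distrib_left[symmetric] dual2 assms)
  also have "\<dots> = v j" using assms by (simp add: if_distrib cong: if_cong)
  finally show ?thesis .
qed

lemma expand_E:
  assumes "p \<in> U" "j < d"
  shows "(\<Sum>a\<in>I. E a j p * (\<Sum>i<d. th a i p * v i)) = v j"
proof -
  have "(\<Sum>a\<in>I. E a j p * (\<Sum>i<d. th a i p * v i)) = (\<Sum>a\<in>I. \<Sum>i<d. v i * (E a j p * th a i p))"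
    by (simp add: sum_distrib_left mult_ac)
  also have "\<dots> = (\<Sum>i<d. \<Sum>a\<in>I. v i * (E a j p * th a i p))" by (rule sum.swap)
  also have "\<dots> = (\<Sum>i<d. v i * (if j = i then 1 else 0))"
    by (simp add: sum_distrib_left[symmetric] dual2 assms)
  also have "\<dots> = v j" using assms by (simp add: if_distrib cong: if_cong)
  finally show ?thesis .
qed

text \<open>A quantity with two coordinate indices is determined by its values on pairs of frame
  vectors. This reduces the structure equation to a check on frame vectors.\<close>

lemma expand_th2:
  assumes p: "p \<in> U" and ij: "i < d" "j < d"
  shows "v i j = (\<Sum>a\<in>I. \<Sum>b\<in>I. th a i p * th b j p * (\<Sum>k<d. E a k p * (\<Sum>l<d. E b l p * v k l)))"
proof -
  have "(\<Sum>b\<in>I. th a i p * th b j p * (\<Sum>k<d. E a k p * (\<Sum>l<d. E b l p * v k l))) =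
      th a i p * (\<Sum>k<d. E a k p * v k j)" if "a \<in> I" for a
  proof -
    have "(\<Sum>b\<in>I. th a i p * th b j p * (\<Sum>k<d. E a k p * (\<Sum>l<d. E b l p * v k l))) =
        th a i p * (\<Sum>b\<in>I. \<Sum>k<d. E a k p * (th b j p * (\<Sum>l<d. E b l p * v k l)))"
      by (simp add: sum_distrib_left mult_ac)
    also have "\<dots> = th a i p * (\<Sum>k<d. E a k p * (\<Sum>b\<in>I. th b j p * (\<Sum>l<d. E b l p * v k l)))"
      by (subst sum.swap) (simp add: sum_distrib_left)
    also have "\<dots> = th a i p * (\<Sum>k<d. E a k p * v k j)"
      by (simp add: expand_th[OF p ij(2)])
    finally show ?thesis .
  qed
  then show ?thesis by (simp add: expand_th[OF p ij(1), of "\<lambda>k. v k j"])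
qed

text \<open>The dual form of the bracket relation: since the pairing of frame and coframe is
  constant, the exterior derivative of \<open>th c\<close> on \<open>E a\<close> and
  \<open>E b\<close> is minus the \<open>c\<close>-component of their bracket.\<close>

lemma maurer_cartan:
  assumes p: "p \<in> U" and c: "c \<in> I" and ij: "i < d" "j < d"
  shows "D i (th c j) p - D j (th c i) p = - (\<Sum>a\<in>I. \<Sum>b\<in>I. C a b c * th a i p * th b j p)"
proof -
  let ?W = "\<lambda>i j. D i (th c j) p - D j (th c i) p"
  \<comment> \<open>Differentiating the constant pairing moves the derivative from the coframe to
    the frame.\<close>
  have leib: "(\<Sum>l<d. E b l p * D k (th c l) p) = - (\<Sum>l<d. th c l p * D k (E b l) p)"
    if k: "k < d" and b: "b \<in> I" for k b
  proof -
    have "(\<Sum>l<d. D k (E b l) p * th c l p + E b l p * D k (th c l) p) = D k (\<lambda>p. \<Sum>l<d. E b l p * th c l p) p"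
      by (subst D_sum_mult) (auto simp: k p E_S th_S b c)
    also have "\<dots> = D k (\<lambda>_. if b = c then 1 else 0) p"
      by (rule D_cong[OF k _ p]) (simp add: dual1 b c)
    also have "\<dots> = 0" by (simp add: D_const k p)
    finally show ?thesis by (simp add: sum.distrib mult.commute)
  qed
  have "(\<Sum>k<d. E a k p * (\<Sum>l<d. E b l p * ?W k l)) = - C a b c" if a: "a \<in> I" and b: "b \<in> I" for a b
  proof -
    have "(\<Sum>k<d. E a k p * (\<Sum>l<d. E b l p * ?W k l)) =
       (\<Sum>k<d. E a k p * (\<Sum>l<d. E b l p * D k (th c l) p)) -
       (\<Sum>k<d. \<Sum>l<d. E a k p * (E b l p * D l (th c k) p))"
      by (simp add: right_diff_distrib sum_subtractf sum_distrib_left)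
    also have "(\<Sum>k<d. \<Sum>l<d. E a k p * (E b l p * D l (th c k) p)) =
       (\<Sum>l<d. E b l p * (\<Sum>k<d. E a k p * D l (th c k) p))"
      by (subst sum.swap) (simp add: sum_distrib_left mult_ac)
    also have "(\<Sum>k<d. E a k p * (\<Sum>l<d. E b l p * D k (th c l) p)) =
      - (\<Sum>k<d. \<Sum>l<d. th c l p * (E a k p * D k (E b l) p))"
      by (simp add: leib b sum_distrib_left sum_negf mult_ac)
    also have "(\<Sum>l<d. E b l p * (\<Sum>k<d. E a k p * D l (th c k) p)) =
      - (\<Sum>k<d. \<Sum>l<d. th c l p * (E b k p * D k (E a l) p))"
      by (simp add: leib a sum_distrib_left sum_negf mult_ac)
    also have "- (\<Sum>k<d. \<Sum>l<d. th c l p * (E a k p * D k (E b l) p)) -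
        - (\<Sum>k<d. \<Sum>l<d. th c l p * (E b k p * D k (E a l) p)) =
        - (\<Sum>k<d. \<Sum>l<d. th c l p * (E a k p * D k (E b l) p - E b k p * D k (E a l) p))"
      by (simp add: right_diff_distrib sum_subtractf)
    also have "(\<Sum>k<d. \<Sum>l<d. th c l p * (E a k p * D k (E b l) p - E b k p * D k (E a l) p)) =
        (\<Sum>l<d. th c l p * (\<Sum>k<d. E a k p * D k (E b l) p - E b k p * D k (E a l) p))"
      by (subst sum.swap) (simp add: sum_distrib_left)
    also have "\<dots> = (\<Sum>l<d. th c l p * (\<Sum>e\<in>I. C a b e * E e l p))"
      by (intro sum.cong refl) (simp add: bracket[OF p a b])
    also have "\<dots> = C a b c" by (rule con_th_E[OF p c])
    finally show ?thesis .
  qed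
  then have "?W i j = (\<Sum>a\<in>I. \<Sum>b\<in>I. th a i p * th b j p * - C a b c)"
    by (subst expand_th2[OF p ij, of ?W]) (simp cong: sum.cong)
  then show ?thesis by (simp add: sum_negf mult_ac)
qed

text \<open>Here \<open>w a b\<close> is the component of d(h b) along \<open>th a\<close>. In the
  exterior derivative of the form with components \<open>h\<close>, the skew part of
  \<open>w\<close> meets the Maurer-Cartan term, and \<open>eq\<close> says that they
  cancel.\<close>

lemma closed_form:
  assumes h: "\<And>a. a \<in> I \<Longrightarrow> h a \<in> S" and ij: "i < d" "j < d" and p: "p \<in> U"
    and w: "\<And>b i. b \<in> I \<Longrightarrow> i < d \<Longrightarrow> D i (h b) p = (\<Sum>a\<in>I. w a b * th a i p)"
    and eq: "\<And>a b. a \<in> I \<Longrightarrow> b \<in> I \<Longrightarrow> w a b - w b a = (\<Sum>c\<in>I. C a b c * h c p)"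
  shows "D i (\<lambda>p. \<Sum>b\<in>I. h b p * th b j p) p = D j (\<lambda>p. \<Sum>b\<in>I. h b p * th b i p) p"
proof -
  have 1: "D i (\<lambda>p. \<Sum>b\<in>I. h b p * th b j p) p =
      (\<Sum>b\<in>I. \<Sum>a\<in>I. w a b * th a i p * th b j p) + (\<Sum>b\<in>I. h b p * D i (th b j) p)"
    if "i < d" "j < d" for i j
    using that by (subst D_sum_mult) (auto simp: p h th_S w sum.distrib sum_distrib_right)
  have 2: "(\<Sum>b\<in>I. \<Sum>a\<in>I. w a b * th a j p * th b i p) = (\<Sum>b\<in>I. \<Sum>a\<in>I. w b a * th a i p * th b j p)"
    by (subst sum.swap) (simp add: mult_ac)
  have "(\<Sum>b\<in>I. \<Sum>a\<in>I. w a b * th a i p * th b j p) - (\<Sum>b\<in>I. \<Sum>a\<in>I. w b a * th a i p * th b j p) =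
      (\<Sum>b\<in>I. \<Sum>a\<in>I. (w a b - w b a) * th a i p * th b j p)"
    by (simp add: left_diff_distrib sum_subtractf)
  also have "\<dots> = (\<Sum>b\<in>I. \<Sum>a\<in>I. \<Sum>c\<in>I. h c p * (C a b c * th a i p * th b j p))"
    by (intro sum.cong refl) (simp add: eq sum_distrib_right sum_distrib_left mult_ac)
  also have "\<dots> = (\<Sum>c\<in>I. \<Sum>a\<in>I. \<Sum>b\<in>I. h c p * (C a b c * th a i p * th b j p))"
    by (subst (1) sum3_rot, subst (1) sum3_swap) simp
  also have "\<dots> = (\<Sum>c\<in>I. h c p * (\<Sum>a\<in>I. \<Sum>b\<in>I. C a b c * th a i p * th b j p))"
    by (simp add: sum_distrib_left)
  also have "\<dots> = (\<Sum>c\<in>I. h c p * - (D i (th c j) p - D j (th c i) p))"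
    by (intro sum.cong refl) (simp add: maurer_cartan[OF p _ ij])
  finally have "(\<Sum>b\<in>I. \<Sum>a\<in>I. w a b * th a i p * th b j p) - (\<Sum>b\<in>I. \<Sum>a\<in>I. w b a * th a i p * th b j p) =
     (\<Sum>c\<in>I. h c p * D j (th c i) p) - (\<Sum>c\<in>I. h c p * D i (th c j) p)"
    by (simp add: right_diff_distrib sum_subtractf)
  then show ?thesis unfolding 1[OF ij] 1[OF ij(2,1)] 2 by linarith
qed

text \<open>In matrix notation, with the coframe \<open>th\<close>, the Levi-Civita connection is
  \<open>Gam\<^sub>i = th\<^sup>-\<^sup>1 (D\<^sub>i th + conn\<^sub>i th)\<close>, a gauge transform of \<open>conn\<close>, so that its curvature is the
  conjugate by \<open>th\<close> of the curvature of \<open>conn\<close>. Here \<open>low\<close> stands for \<open>th Gam\<close>.\<close>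

definition gg :: "nat \<Rightarrow> nat \<Rightarrow> 'm \<Rightarrow> real" where
  "gg i j p = (\<Sum>a\<in>I. th a i p * th a j p)"

definition hh :: "nat \<Rightarrow> nat \<Rightarrow> 'm \<Rightarrow> real" where
  "hh i j p = (\<Sum>a\<in>I. E a i p * E a j p)"

text \<open>Koszul's formula for an orthonormal frame: \<open>om a b c\<close> is the inner product
  of the covariant derivative of \<open>E b\<close> along \<open>E a\<close> with
  \<open>E c\<close>. The derivative terms are absent because inner products of frame vectors are
  constant.\<close>

definition om :: "'i \<Rightarrow> 'i \<Rightarrow> 'i \<Rightarrow> real" where
  "om a b c = (C a b c - C b c a + C c a b) / 2"

definition conn :: "nat \<Rightarrow> 'i \<Rightarrow> 'i \<Rightarrow> 'm \<Rightarrow> real" where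
  "conn i c b p = (\<Sum>a\<in>I. om a b c * th a i p)"

definition low :: "'i \<Rightarrow> nat \<Rightarrow> nat \<Rightarrow> 'm \<Rightarrow> real" where
  "low c i j p = D i (th c j) p + (\<Sum>b\<in>I. conn i c b p * th b j p)"

definition Gam :: "nat \<Rightarrow> nat \<Rightarrow> nat \<Rightarrow> 'm \<Rightarrow> real" where
  "Gam k i j p = (\<Sum>c\<in>I. E c k p * low c i j p)"

lemma hh_sym: "hh i j p = hh j i p" by (simp add: hh_def mult.commute)

lemma th_hh:
  assumes "p \<in> U" "a \<in> I"
  shows "(\<Sum>l<d. th a l p * hh k l p) = E a k p"
  unfolding hh_def by (rule con_th_E[OF assms])

lemma gg_hh:
  assumes p: "p \<in> U" and ik: "i < d" "k < d"
  shows "(\<Sum>j<d. gg i j p * hh j k p) = (if i = k then 1 else 0)"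
proof -
  have "(\<Sum>j<d. gg i j p * hh j k p) = (\<Sum>j<d. \<Sum>a\<in>I. th a i p * (th a j p * hh k j p))"
    by (simp add: gg_def hh_sym[of _ k] sum_distrib_right mult.assoc)
  also have "\<dots> = (\<Sum>a\<in>I. th a i p * (\<Sum>j<d. th a j p * hh k j p))"
    by (subst sum.swap) (simp add: sum_distrib_left)
  also have "\<dots> = (\<Sum>a\<in>I. E a k p * th a i p)" by (simp add: th_hh p mult.commute)
  also have "\<dots> = (if i = k then 1 else 0)" using dual2[OF p ik(2,1)] by auto
  finally show ?thesis .
qed

lemma gg_sym: "gg i j p = gg j i p" by (simp add: gg_def mult.commute)

lemma D_gg:
  assumes "p \<in> U" "i < d" "j < d" "k < d"
  shows "D k (gg i j) p = (\<Sum>a\<in>I. D k (th a i) p * th a j p + th a i p * D k (th a j) p)"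
proof -
  have "gg i j = (\<lambda>p. \<Sum>a\<in>I. th a i p * th a j p)" by (simp add: gg_def fun_eq_iff)
  then show ?thesis using assms by (simp add: D_sum_mult th_S)
qed

text \<open>Maurer-Cartan exchanges the two lower indices of each derivative of \<open>th\<close> at
  the price of a structure constant. What remains is twice a derivative of \<open>th\<close> and
  three structure terms, which add up to twice \<open>om\<close>.\<close>

lemma koszul:
  assumes p: "p \<in> U" and ijl: "i < d" "j < d" "l < d"
  shows "D i (gg j l) p + D j (gg i l) p - D l (gg i j) p = 2 * (\<Sum>c\<in>I. th c l p * low c i j p)"
proof -
  \<comment> \<open>Minus the exterior derivative of \<open>th c\<close>.\<close>
  define T where "T c i j = (\<Sum>a\<in>I. \<Sum>b\<in>I. C a b c * th a i p * th b j p)" for c i j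
  have MC: "D j (th c i) p = D i (th c j) p + T c i j" if "c \<in> I" "i < d" "j < d" for c i j
    using maurer_cartan[OF p that] by (simp add: T_def)
  have a: "(\<Sum>c\<in>I. th c l p * T c i j) = (\<Sum>a\<in>I. \<Sum>b\<in>I. \<Sum>c\<in>I. C a b c * (th a i p * th b j p * th c l p))"
    unfolding T_def by (subst sum3_rot) (simp add: sum_distrib_left mult_ac)
  have b: "(\<Sum>c\<in>I. th c j p * T c i l) = - (\<Sum>a\<in>I. \<Sum>b\<in>I. \<Sum>c\<in>I. C c a b * (th a i p * th b j p * th c l p))"
  proof -
    have "(\<Sum>c\<in>I. th c j p * T c i l) = (\<Sum>a\<in>I. \<Sum>c\<in>I. \<Sum>b\<in>I. C a c b * (th a i p * th b j p * th c l p))"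
      unfolding T_def by (subst sum3_rot) (simp add: sum_distrib_left mult_ac)
    also have "\<dots> = (\<Sum>a\<in>I. \<Sum>b\<in>I. \<Sum>c\<in>I. C a c b * (th a i p * th b j p * th c l p))"
      by (rule sum3_swap)
    also have "\<dots> = (\<Sum>a\<in>I. \<Sum>b\<in>I. \<Sum>c\<in>I. - (C c a b * (th a i p * th b j p * th c l p)))"
    proof (intro sum.cong refl)
      fix a b c assume "a \<in> I" "b \<in> I" "c \<in> I"
      then have "C a c b = - C c a b" using C_skew by blast
      then show "C a c b * (th a i p * th b j p * th c l p) = - (C c a b * (th a i p * th b j p * th c l p))"
        by simp
    qed
    finally show ?thesis by (simp add: sum_negf)
  qed
  have c: "(\<Sum>c\<in>I. th c i p * T c j l) = (\<Sum>a\<in>I. \<Sum>b\<in>I. \<Sum>c\<in>I. C b c a * (th a i p * th b j p * th c l p))"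
    unfolding T_def by (simp add: sum_distrib_left mult_ac)
  have r: "2 * (\<Sum>c\<in>I. th c l p * (\<Sum>b\<in>I. conn i c b p * th b j p)) =
     (\<Sum>a\<in>I. \<Sum>b\<in>I. \<Sum>c\<in>I. (C a b c - C b c a + C c a b) * (th a i p * th b j p * th c l p))"
  proof -
    have "2 * (\<Sum>c\<in>I. th c l p * (\<Sum>b\<in>I. conn i c b p * th b j p)) =
      (\<Sum>c\<in>I. \<Sum>b\<in>I. \<Sum>a\<in>I. (C a b c - C b c a + C c a b) * (th a i p * th b j p * th c l p))"
      unfolding conn_def om_def by (simp add: sum_distrib_left sum_distrib_right mult_ac)
    also have "\<dots> = (\<Sum>c\<in>I. \<Sum>a\<in>I. \<Sum>b\<in>I. (C a b c - C b c a + C c a b) * (th a i p * th b j p * th c l p))"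
      by (rule sum3_swap)
    also have "\<dots> = (\<Sum>a\<in>I. \<Sum>b\<in>I. \<Sum>c\<in>I. (C a b c - C b c a + C c a b) * (th a i p * th b j p * th c l p))"
      by (rule sum3_rot[symmetric])
    finally show ?thesis .
  qed
  have "D i (gg j l) p + D j (gg i l) p - D l (gg i j) p =
     (\<Sum>c\<in>I. 2 * (th c l p * D i (th c j) p) + th c l p * T c i j - th c j p * T c i l - th c i p * T c j l)"
    unfolding D_gg[OF p ijl(2,3,1)] D_gg[OF p ijl(1,3,2)] D_gg[OF p ijl(1,2,3)]
      sum.distrib[symmetric] sum_subtractf[symmetric]
  proof (intro sum.cong refl)
    fix c assume c: "c \<in> I"
    show "D i (th c j) p * th c l p + th c j p * D i (th c l) p +
         (D j (th c i) p * th c l p + th c i p * D j (th c l) p) -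
         (D l (th c i) p * th c j p + th c i p * D l (th c j) p) =
         2 * (th c l p * D i (th c j) p) + th c l p * T c i j - th c j p * T c i l - th c i p * T c j l"
      using MC[OF c ijl(1,2)] MC[OF c ijl(1,3)] MC[OF c ijl(2,3)] by (simp add: algebra_simps)
  qed
  also have "\<dots> = 2 * (\<Sum>c\<in>I. th c l p * D i (th c j) p) +
     ((\<Sum>c\<in>I. th c l p * T c i j) - (\<Sum>c\<in>I. th c j p * T c i l) - (\<Sum>c\<in>I. th c i p * T c j l))"
    by (simp add: sum.distrib sum_subtractf sum_distrib_left)
  also have "(\<Sum>c\<in>I. th c l p * T c i j) - (\<Sum>c\<in>I. th c j p * T c i l) - (\<Sum>c\<in>I. th c i p * T c j l) =
     2 * (\<Sum>c\<in>I. th c l p * (\<Sum>b\<in>I. conn i c b p * th b j p))"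
    unfolding a b c r by (simp add: left_diff_distrib distrib_right sum.distrib sum_subtractf)
  finally show ?thesis by (simp add: low_def distrib_left sum.distrib)
qed

text \<open>Raising the index with \<open>hh\<close> turns the coframe in the Koszul identity into
  the frame.\<close>

lemma christoffel_eq:
  assumes p: "p \<in> U" and kij: "k < d" "i < d" "j < d"
  shows "(\<Sum>l<d. hh k l p / 2 * (D i (gg j l) p + D j (gg i l) p - D l (gg i j) p)) = Gam k i j p"
proof -
  have "(\<Sum>l<d. hh k l p / 2 * (D i (gg j l) p + D j (gg i l) p - D l (gg i j) p)) =
     (\<Sum>l<d. \<Sum>c\<in>I. low c i j p * (th c l p * hh k l p))"
  proof (intro sum.cong refl)
    fix l assume "l \<in> {..<d}"
    then have l: "l < d" by simp
    show "hh k l p / 2 * (D i (gg j l) p + D j (gg i l) p - D l (gg i j) p) =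
       (\<Sum>c\<in>I. low c i j p * (th c l p * hh k l p))"
      unfolding koszul[OF p kij(2,3) l] by (simp add: sum_distrib_left mult_ac)
  qed
  also have "\<dots> = (\<Sum>c\<in>I. low c i j p * (\<Sum>l<d. th c l p * hh k l p))"
    by (subst sum.swap) (simp add: sum_distrib_left)
  also have "\<dots> = Gam k i j p" by (simp add: th_hh p Gam_def mult.commute)
  finally show ?thesis .
qed

lemma conn_S: "i < d \<Longrightarrow> conn i c b \<in> S"
  unfolding conn_def[abs_def] by (intro S_sum S_cmult th_S)

lemma low_S: "c \<in> I \<Longrightarrow> i < d \<Longrightarrow> j < d \<Longrightarrow> low c i j \<in> S"
  unfolding low_def[abs_def] by (intro S_add S_D th_S S_sum S_mult conn_S)

lemma Gam_S: "k < d \<Longrightarrow> i < d \<Longrightarrow> j < d \<Longrightarrow> Gam k i j \<in> S"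
  unfolding Gam_def[abs_def] by (intro S_sum S_mult E_S low_S)

lemma th_Gam:
  assumes "p \<in> U" "c \<in> I"
  shows "(\<Sum>l<d. th c l p * Gam l i j p) = low c i j p"
  using con_th_E[OF assms, of "\<lambda>c. low c i j p"] by (simp add: Gam_def mult.commute)

section \<open>Curvature and Ricci tensor in the frame\<close>

definition Rm :: "nat \<Rightarrow> nat \<Rightarrow> nat \<Rightarrow> nat \<Rightarrow> 'm \<Rightarrow> real" where
  "Rm l k i j p = D i (Gam l j k) p - D j (Gam l i k) p +
    (\<Sum>m<d. Gam m j k p * Gam l i m p - Gam m i k p * Gam l j m p)"

text \<open>Cartan's curvature form: exterior derivative of the connection form plus its wedge
  square.\<close>

definition cform :: "'i \<Rightarrow> 'i \<Rightarrow> nat \<Rightarrow> nat \<Rightarrow> 'm \<Rightarrow> real" where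
  "cform c m i j p = D i (conn j c m) p - D j (conn i c m) p +
    (\<Sum>n\<in>I. conn i c n p * conn j n m p - conn j c n p * conn i n m p)"

text \<open>Differentiating th Gam = low expresses th times the derivative of Gam. The terms
  containing a derivative of \<open>th\<close> then cancel against those of the quadratic part, and
  the second derivatives of \<open>th\<close> cancel by \<open>D_comm\<close>.\<close>

lemma th_Rm:
  assumes p: "p \<in> U" and c: "c \<in> I" and kij: "k < d" "i < d" "j < d"
  shows "(\<Sum>l<d. th c l p * Rm l k i j p) = (\<Sum>m\<in>I. cform c m i j p * th m k p)"
proof -
  have d1: "(\<Sum>l<d. th c l p * D i (Gam l j k) p) =
      D i (D j (th c k)) p + (\<Sum>b\<in>I. D i (conn j c b) p * th b k p + conn j c b p * D i (th b k) p)
      - (\<Sum>l<d. D i (th c l) p * Gam l j k p)" if "i < d" "j < d" for i j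
  proof -
    have "(\<Sum>l<d. D i (th c l) p * Gam l j k p + th c l p * D i (Gam l j k) p) =
        D i (\<lambda>p. \<Sum>l<d. th c l p * Gam l j k p) p"
      using that kij by (subst D_sum_mult) (auto simp: p c th_S Gam_S)
    also have "\<dots> = D i (\<lambda>p. D j (th c k) p + (\<Sum>b\<in>I. conn j c b p * th b k p)) p"
      by (rule D_cong[OF that(1) _ p]) (simp add: th_Gam c low_def)
    also have "\<dots> = D i (D j (th c k)) p + D i (\<lambda>p. \<Sum>b\<in>I. conn j c b p * th b k p) p"
      using that kij by (intro D_add p S_D th_S c S_sum S_mult conn_S) 
    also have "D i (\<lambda>p. \<Sum>b\<in>I. conn j c b p * th b k p) p =
        (\<Sum>b\<in>I. D i (conn j c b) p * th b k p + conn j c b p * D i (th b k) p)"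
      using that kij by (subst D_sum_mult) (auto simp: p th_S conn_S)
    finally show ?thesis by (simp add: sum.distrib)
  qed
  \<comment> \<open>Applying th Gam = low twice makes the quadratic part visible as a product of
    connection forms plus derivative terms.\<close>
  have q1: "(\<Sum>l<d. th c l p * (\<Sum>m<d. Gam m j k p * Gam l i m p)) =
      (\<Sum>m<d. D i (th c m) p * Gam m j k p) + (\<Sum>b\<in>I. conn i c b p * D j (th b k) p)
      + (\<Sum>n\<in>I. \<Sum>b\<in>I. conn i c b p * conn j b n p * th n k p)" if "i < d" "j < d" for i j
  proof -
    have "(\<Sum>l<d. th c l p * (\<Sum>m<d. Gam m j k p * Gam l i m p)) =
        (\<Sum>l<d. \<Sum>m<d. Gam m j k p * (th c l p * Gam l i m p))"
      by (simp add: sum_distrib_left mult_ac)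
    also have "\<dots> = (\<Sum>m<d. Gam m j k p * (\<Sum>l<d. th c l p * Gam l i m p))"
      by (subst sum.swap) (simp add: sum_distrib_left)
    also have "\<dots> = (\<Sum>m<d. D i (th c m) p * Gam m j k p + (\<Sum>b\<in>I. conn i c b p * (th b m p * Gam m j k p)))"
      by (simp add: th_Gam p c low_def distrib_left sum_distrib_left mult_ac)
    also have "\<dots> = (\<Sum>m<d. D i (th c m) p * Gam m j k p) + (\<Sum>m<d. \<Sum>b\<in>I. conn i c b p * (th b m p * Gam m j k p))"
      by (rule sum.distrib)
    also have "(\<Sum>m<d. \<Sum>b\<in>I. conn i c b p * (th b m p * Gam m j k p)) =
       (\<Sum>b\<in>I. conn i c b p * (\<Sum>m<d. th b m p * Gam m j k p))"
      by (subst sum.swap) (simp add: sum_distrib_left)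
    also have "\<dots> = (\<Sum>b\<in>I. conn i c b p * D j (th b k) p + (\<Sum>n\<in>I. conn i c b p * conn j b n p * th n k p))"
      by (intro sum.cong refl) (simp add: th_Gam p low_def distrib_left sum_distrib_left mult_ac)
    also have "\<dots> = (\<Sum>b\<in>I. conn i c b p * D j (th b k) p) + (\<Sum>b\<in>I. \<Sum>n\<in>I. conn i c b p * conn j b n p * th n k p)"
      by (rule sum.distrib)
    also have "(\<Sum>b\<in>I. \<Sum>n\<in>I. conn i c b p * conn j b n p * th n k p) =
        (\<Sum>n\<in>I. \<Sum>b\<in>I. conn i c b p * conn j b n p * th n k p)" by (rule sum.swap)
    finally show ?thesis by simp
  qed
  have "(\<Sum>l<d. th c l p * Rm l k i j p) =
     (\<Sum>l<d. th c l p * D i (Gam l j k) p) - (\<Sum>l<d. th c l p * D j (Gam l i k) p) +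
     ((\<Sum>l<d. th c l p * (\<Sum>m<d. Gam m j k p * Gam l i m p)) -
      (\<Sum>l<d. th c l p * (\<Sum>m<d. Gam m i k p * Gam l j m p)))"
    by (simp add: Rm_def distrib_left right_diff_distrib sum.distrib sum_subtractf)
  also have "\<dots> = (\<Sum>b\<in>I. D i (conn j c b) p * th b k p) - (\<Sum>b\<in>I. D j (conn i c b) p * th b k p)
     + (\<Sum>n\<in>I. \<Sum>b\<in>I. conn i c b p * conn j b n p * th n k p)
     - (\<Sum>n\<in>I. \<Sum>b\<in>I. conn j c b p * conn i b n p * th n k p)"
    unfolding d1[OF kij(2,3)] d1[OF kij(3,2)] q1[OF kij(2,3)] q1[OF kij(3,2)]
    using D_comm[OF kij(2,3) th_S[OF c kij(1)] p] by (simp add: sum.distrib)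
  also have "\<dots> = (\<Sum>m\<in>I. cform c m i j p * th m k p)"
    by (simp add: cform_def distrib_right left_diff_distrib sum.distrib sum_subtractf sum_distrib_right)
  finally show ?thesis .
qed

text \<open>The \<open>c\<close>-component of R(E a, E b) applied to \<open>E m\<close>. The
  connection coefficients \<open>om\<close> are constant, so only products of them and the bracket
  term are left.\<close>

definition cten :: "'i \<Rightarrow> 'i \<Rightarrow> 'i \<Rightarrow> 'i \<Rightarrow> real" where
  "cten c m a b = (\<Sum>n\<in>I. om a n c * om b m n - om b n c * om a m n - C a b n * om n m c)"

lemma cform_eq:
  assumes p: "p \<in> U" and ij: "i < d" "j < d"
  shows "cform c m i j p = (\<Sum>a\<in>I. (\<Sum>b\<in>I. cten c m a b * th b j p) * th a i p)"
proof -
  have D_conn: "D i (conn j c m) p = (\<Sum>n\<in>I. om n m c * D i (th n j) p)" if "i < d" "j < d" for i j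
    unfolding conn_def[abs_def] using that by (subst D_sum) (auto simp: p S_cmult th_S D_cmult)
  have "D i (conn j c m) p - D j (conn i c m) p = (\<Sum>n\<in>I. om n m c * (D i (th n j) p - D j (th n i) p))"
    unfolding D_conn[OF ij] D_conn[OF ij(2,1)] by (simp add: right_diff_distrib sum_subtractf)
  also have "\<dots> = (\<Sum>n\<in>I. om n m c * - (\<Sum>a\<in>I. \<Sum>b\<in>I. C a b n * th a i p * th b j p))"
    by (intro sum.cong refl) (simp add: maurer_cartan[OF p _ ij])
  also have "\<dots> = (\<Sum>n\<in>I. \<Sum>a\<in>I. \<Sum>b\<in>I. - (C a b n * om n m c * th b j p * th a i p))"
    by (simp add: sum_distrib_left sum_negf mult_ac)
  also have "\<dots> = (\<Sum>a\<in>I. \<Sum>b\<in>I. \<Sum>n\<in>I. - (C a b n * om n m c * th b j p * th a i p))"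
    by (rule sum3_rot[symmetric])
  finally have 1: "D i (conn j c m) p - D j (conn i c m) p =
    (\<Sum>a\<in>I. \<Sum>b\<in>I. \<Sum>n\<in>I. - (C a b n * om n m c * th b j p * th a i p))" .
  have 2: "(\<Sum>n\<in>I. conn i c n p * conn j n m p) =
     (\<Sum>a\<in>I. \<Sum>b\<in>I. \<Sum>n\<in>I. om a n c * om b m n * th b j p * th a i p)"
  proof -
    have "(\<Sum>n\<in>I. conn i c n p * conn j n m p) =
      (\<Sum>n\<in>I. \<Sum>a\<in>I. \<Sum>b\<in>I. om a n c * om b m n * th b j p * th a i p)"
      by (simp add: conn_def sum_product mult_ac)
    also have "\<dots> = (\<Sum>a\<in>I. \<Sum>b\<in>I. \<Sum>n\<in>I. om a n c * om b m n * th b j p * th a i p)"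
      by (rule sum3_rot[symmetric])
    finally show ?thesis .
  qed
  have 3: "(\<Sum>n\<in>I. conn j c n p * conn i n m p) =
     (\<Sum>a\<in>I. \<Sum>b\<in>I. \<Sum>n\<in>I. om b n c * om a m n * th b j p * th a i p)"
  proof -
    have "(\<Sum>n\<in>I. conn j c n p * conn i n m p) =
      (\<Sum>n\<in>I. \<Sum>b\<in>I. \<Sum>a\<in>I. om b n c * om a m n * th b j p * th a i p)"
      by (simp only: conn_def sum_product) (simp add: mult_ac)
    also have "\<dots> = (\<Sum>n\<in>I. \<Sum>a\<in>I. \<Sum>b\<in>I. om b n c * om a m n * th b j p * th a i p)"
      by (rule sum3_swap)
    also have "\<dots> = (\<Sum>a\<in>I. \<Sum>b\<in>I. \<Sum>n\<in>I. om b n c * om a m n * th b j p * th a i p)"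
      by (rule sum3_rot[symmetric])
    finally show ?thesis .
  qed
  show ?thesis
    unfolding cform_def cten_def sum_subtractf 1 2 3
    by (simp add: sum.distrib sum_subtractf sum_negf left_diff_distrib sum_distrib_right)
qed

text \<open>The Ricci tensor on the pair \<open>E b\<close>, \<open>E m\<close>: the trace over the
  first curvature argument, in the convention of \<open>ricci\<close>.\<close>

definition ricc :: "'i \<Rightarrow> 'i \<Rightarrow> real" where
  "ricc b m = (\<Sum>c\<in>I. cten c m c b)"

text \<open>The trace over coordinates becomes a trace over the frame, because the frame and coframe
  resolve the identity (\<open>expand_E\<close>).\<close>

lemma ricci_frame:
  assumes p: "p \<in> U" and jk: "j < d" "k < d"
  shows "(\<Sum>i<d. Rm i k i j p) = (\<Sum>b\<in>I. \<Sum>m\<in>I. ricc b m * th b j p * th m k p)"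
proof -
  have "(\<Sum>i<d. Rm i k i j p) = (\<Sum>i<d. \<Sum>c\<in>I. E c i p * (\<Sum>l<d. th c l p * Rm l k i j p))"
    by (intro sum.cong refl) (simp add: expand_E p)
  also have "\<dots> = (\<Sum>i<d. \<Sum>c\<in>I. \<Sum>m\<in>I. th m k p * (E c i p * cform c m i j p))"
    using jk by (intro sum.cong refl) (simp add: th_Rm p sum_distrib_left mult_ac)
  also have "\<dots> = (\<Sum>c\<in>I. \<Sum>i<d. \<Sum>m\<in>I. th m k p * (E c i p * cform c m i j p))"
    by (rule sum.swap)
  also have "\<dots> = (\<Sum>c\<in>I. \<Sum>m\<in>I. \<Sum>i<d. th m k p * (E c i p * cform c m i j p))"
    by (intro sum.cong refl sum.swap)
  also have "\<dots> = (\<Sum>c\<in>I. \<Sum>m\<in>I. th m k p * (\<Sum>i<d. E c i p * (\<Sum>a\<in>I. (\<Sum>b\<in>I. cten c m a b * th b j p) * th a i p)))"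
    using jk by (intro sum.cong refl) (simp add: cform_eq p sum_distrib_left)
  also have "\<dots> = (\<Sum>c\<in>I. \<Sum>m\<in>I. th m k p * (\<Sum>b\<in>I. cten c m c b * th b j p))"
  proof (intro sum.cong refl)
    fix c m assume "c \<in> I"
    then show "th m k p * (\<Sum>i<d. E c i p * (\<Sum>a\<in>I. (\<Sum>b\<in>I. cten c m a b * th b j p) * th a i p)) =
        th m k p * (\<Sum>b\<in>I. cten c m c b * th b j p)"
      using con_E_th[OF p, of c "\<lambda>a. \<Sum>b\<in>I. cten c m a b * th b j p"] by simp
  qed
  also have "\<dots> = (\<Sum>c\<in>I. \<Sum>m\<in>I. \<Sum>b\<in>I. cten c m c b * th b j p * th m k p)"
    by (simp add: sum_distrib_left mult_ac)
  also have "\<dots> = (\<Sum>c\<in>I. \<Sum>b\<in>I. \<Sum>m\<in>I. cten c m c b * th b j p * th m k p)"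
    by (rule sum3_swap)
  also have "\<dots> = (\<Sum>b\<in>I. \<Sum>m\<in>I. \<Sum>c\<in>I. cten c m c b * th b j p * th m k p)"
    by (rule sum3_rot[symmetric])
  also have "\<dots> = (\<Sum>b\<in>I. \<Sum>m\<in>I. ricc b m * th b j p * th m k p)"
    by (simp add: ricc_def sum_distrib_right)
  finally show ?thesis .
qed

text \<open>Unimodularity removes the mean curvature terms; the last term is the Killing form.\<close>

lemma ricc_eq:
  assumes bm: "b \<in> I" "m \<in> I" and uni: "\<And>n. n \<in> I \<Longrightarrow> (\<Sum>a\<in>I. C a n a) = 0"
  shows "ricc b m = (\<Sum>a\<in>I. \<Sum>n\<in>I. C a n b * C a n m / 4 - C b a n * C m a n / 2 - C b a n * C m n a / 2)"
proof -
  \<comment> \<open>Skewness kills one of the three terms of \<open>om\<close> and merges the other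
    two, so this trace is the one that unimodularity makes zero.\<close>
  have "om c n c = C c n c" if "c \<in> I" "n \<in> I" for c n
    using C_skew[of c c n] C_skew[of c n c] that by (simp add: om_def)
  then have 0: "(\<Sum>c\<in>I. \<Sum>n\<in>I. om c n c * om b m n) = (\<Sum>c\<in>I. \<Sum>n\<in>I. C c n c * om b m n)"
    by (intro sum.cong refl) simp
  also have "\<dots> = (\<Sum>n\<in>I. \<Sum>c\<in>I. C c n c * om b m n)" by (rule sum.swap)
  also have "\<dots> = 0" by (simp add: sum_distrib_right[symmetric] uni)
  finally have "ricc b m = (\<Sum>c\<in>I. \<Sum>n\<in>I. - om b n c * om c m n - C c b n * om n m c)"
    by (simp add: ricc_def cten_def sum_subtractf sum_negf)
  also have "\<dots> = (\<Sum>a\<in>I. \<Sum>n\<in>I. C a n b * C a n m / 4 - C b a n * C m a n / 2 - C b a n * C m n a / 2)"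
  \<comment> \<open>The summands differ individually; their sums over the exchange of
    \<open>a\<close> and \<open>n\<close> agree.\<close>
  proof (rule sum_symmetrize)
    fix a n assume an: "a \<in> I" "n \<in> I"
    have s: "C n a b = - C a n b" "C n a m = - C a n m" "C a b n = - C b a n" "C a m n = - C m a n"
      "C n b a = - C b n a" "C n m a = - C m n a"
      by (intro C_skew an bm)+
    show "- om b n a * om a m n - C a b n * om n m a + (- om b a n * om n m a - C n b a * om a m n) =
       C a n b * C a n m / 4 - C b a n * C m a n / 2 - C b a n * C m n a / 2 +
       (C n a b * C n a m / 4 - C b n a * C m n a / 2 - C b n a * C m a n / 2)"
      unfolding om_def s by (simp add: field_simps)
  qed
  finally show ?thesis .
qed

text \<open>The hypothesis on \<open>f\<close> says that [E b, X] = dd b E b. Dually the Lie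
  derivative along X multiplies \<open>th a\<close> by \<open>dd a\<close>, and the metric, being
  the sum of the squares of the \<open>th a\<close>, picks up each factor twice.\<close>

lemma lie_derivative_frame:
  assumes f: "\<And>a. a \<in> I \<Longrightarrow> f a \<in> S" and p: "p \<in> U" and ij: "i < d" "j < d"
    and X: "\<And>k. k < d \<Longrightarrow> X k = (\<lambda>p. \<Sum>a\<in>I. f a p * E a k p)"
    and Df: "\<And>a i. a \<in> I \<Longrightarrow> i < d \<Longrightarrow>
      D i (f a) p = dd a * th a i p - (\<Sum>b\<in>I. \<Sum>c\<in>I. C b c a * th b i p * f c p)"
  shows "(\<Sum>k<d. X k p * D k (gg i j) p + gg k j p * D i (X k) p + gg i k p * D j (X k) p) =
    (\<Sum>a\<in>I. 2 * dd a * th a i p * th a j p)"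
proof -
  have XS: "X k \<in> S" if "k < d" for k
    unfolding X[OF that] using that by (intro S_sum S_mult f E_S)
  have thX: "(\<Sum>k<d. th a k q * X k q) = f a q" if "a \<in> I" "q \<in> U" for a q
    using con_th_E[OF that(2,1), of "\<lambda>a. f a q"] by (simp add: X)
  \<comment> \<open>The left-hand side is the Lie derivative of the one-form
    \<open>th a\<close>.\<close>
  have Z: "(\<Sum>k<d. X k p * D k (th a i) p) + (\<Sum>k<d. th a k p * D i (X k) p) = dd a * th a i p"
    if a: "a \<in> I" and i: "i < d" for a i
  proof -
    have "(\<Sum>k<d. D i (th a k) p * X k p + th a k p * D i (X k) p) = D i (\<lambda>p. \<Sum>k<d. th a k p * X k p) p"
      using i by (subst D_sum_mult) (auto simp: p th_S a XS)
    also have "\<dots> = D i (f a) p" by (rule D_cong[OF i _ p]) (simp add: thX a)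
    finally have 1: "(\<Sum>k<d. th a k p * D i (X k) p) = D i (f a) p - (\<Sum>k<d. D i (th a k) p * X k p)"
      by (simp add: sum.distrib)
    have "(\<Sum>k<d. X k p * D k (th a i) p) - (\<Sum>k<d. D i (th a k) p * X k p) =
        (\<Sum>k<d. X k p * (D k (th a i) p - D i (th a k) p))"
      by (simp add: right_diff_distrib sum_subtractf mult.commute)
    also have "\<dots> = (\<Sum>k<d. X k p * - (\<Sum>b\<in>I. \<Sum>c\<in>I. C b c a * th b k p * th c i p))"
      using a i by (intro sum.cong refl) (simp add: maurer_cartan[OF p a])
    also have "\<dots> = - (\<Sum>k<d. \<Sum>b\<in>I. (\<Sum>c\<in>I. C b c a * th c i p) * (th b k p * X k p))"
      by (simp add: sum_distrib_left sum_distrib_right sum_negf mult_ac)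
    also have "(\<Sum>k<d. \<Sum>b\<in>I. (\<Sum>c\<in>I. C b c a * th c i p) * (th b k p * X k p)) =
        (\<Sum>b\<in>I. (\<Sum>c\<in>I. C b c a * th c i p) * (\<Sum>k<d. th b k p * X k p))"
      by (subst sum.swap) (simp add: sum_distrib_left)
    also have "\<dots> = (\<Sum>b\<in>I. \<Sum>c\<in>I. C b c a * th c i p * f b p)"
      by (simp add: thX p sum_distrib_right)
    also have "\<dots> = (\<Sum>c\<in>I. \<Sum>b\<in>I. C b c a * th c i p * f b p)" by (rule sum.swap)
    also have "\<dots> = - (\<Sum>c\<in>I. \<Sum>b\<in>I. C c b a * th c i p * f b p)"
    proof -
      have "(\<Sum>c\<in>I. \<Sum>b\<in>I. C b c a * th c i p * f b p) = (\<Sum>c\<in>I. \<Sum>b\<in>I. - (C c b a * th c i p * f b p))"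
      proof (intro sum.cong refl)
        fix c b assume "c \<in> I" "b \<in> I"
        then show "C b c a * th c i p * f b p = - (C c b a * th c i p * f b p)"
          using C_skew[of c b a] a by (simp only: mult_minus_left)
      qed
      then show ?thesis by (simp add: sum_negf)
    qed
    finally show ?thesis unfolding 1 Df[OF a i] by simp
  qed
  have g1: "(\<Sum>k<d. X k p * D k (gg i j) p) =
     (\<Sum>a\<in>I. th a j p * (\<Sum>k<d. X k p * D k (th a i) p) + th a i p * (\<Sum>k<d. X k p * D k (th a j) p))"
  proof -
    have "(\<Sum>k<d. X k p * D k (gg i j) p) =
      (\<Sum>k<d. \<Sum>a\<in>I. th a j p * (X k p * D k (th a i) p) + th a i p * (X k p * D k (th a j) p))"
      by (intro sum.cong refl) (simp add: D_gg p ij sum_distrib_left algebra_simps)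
    also have "\<dots> = (\<Sum>a\<in>I. \<Sum>k<d. th a j p * (X k p * D k (th a i) p) + th a i p * (X k p * D k (th a j) p))"
      by (rule sum.swap)
    finally show ?thesis by (simp add: sum.distrib sum_distrib_left)
  qed
  have g2: "(\<Sum>k<d. gg k j p * D i (X k) p) = (\<Sum>a\<in>I. th a j p * (\<Sum>k<d. th a k p * D i (X k) p))" for i j
  proof -
    have "(\<Sum>k<d. gg k j p * D i (X k) p) = (\<Sum>k<d. \<Sum>a\<in>I. th a j p * (th a k p * D i (X k) p))"
      by (simp add: gg_def sum_distrib_right sum_distrib_left mult_ac)
    also have "\<dots> = (\<Sum>a\<in>I. \<Sum>k<d. th a j p * (th a k p * D i (X k) p))" by (rule sum.swap)
    finally show ?thesis by (simp add: sum_distrib_left)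
  qed
  have "(\<Sum>k<d. X k p * D k (gg i j) p + gg k j p * D i (X k) p + gg i k p * D j (X k) p) =
    (\<Sum>k<d. X k p * D k (gg i j) p) + (\<Sum>k<d. gg k j p * D i (X k) p) + (\<Sum>k<d. gg k i p * D j (X k) p)"
    by (simp add: sum.distrib gg_sym)
  also have "\<dots> = (\<Sum>a\<in>I. th a j p * ((\<Sum>k<d. X k p * D k (th a i) p) + (\<Sum>k<d. th a k p * D i (X k) p))
     + th a i p * ((\<Sum>k<d. X k p * D k (th a j) p) + (\<Sum>k<d. th a k p * D j (X k) p)))"
    unfolding g1 g2 by (simp add: sum.distrib distrib_left)
  also have "\<dots> = (\<Sum>a\<in>I. 2 * dd a * th a i p * th a j p)"
    by (intro sum.cong refl) (simp add: Z ij)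
  finally show ?thesis .
qed

end

section \<open>Paths in Hasse quivers\<close>

definition joined :: "('v, 'e) pre_digraph \<Rightarrow> 'v \<Rightarrow> 'v \<Rightarrow> bool" where
  "joined Q a b \<longleftrightarrow> (\<exists>p. p \<noteq> [] \<and> pre_digraph.awalk Q a p b)"

lemma taos_basis_iff: "(a, b) \<in> taos_basis P r \<longleftrightarrow> a \<in> P \<and> b \<in> P \<and> r a b \<and> a \<noteq> b"
  by (auto simp: taos_basis_def)

lemma taos_basis_trans:
  assumes "taos P r" "(a, b) \<in> taos_basis P r" "(b, c) \<in> taos_basis P r"
  shows "(a, c) \<in> taos_basis P r"
proof -
  have *: "a \<in> P" "b \<in> P" "c \<in> P" "r a b" "a \<noteq> b" "r b c" using assms by (auto simp: taos_basis_iff)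
  have "r a c" using assms(1) * unfolding taos_def transp_on_def by blast
  moreover have "a \<noteq> c" using assms(1) * unfolding taos_def antisymp_on_def by blast
  ultimately show ?thesis using * by (simp add: taos_basis_iff)
qed

lemma finite_taos_basis: "finite P \<Longrightarrow> finite (taos_basis P r)"
  by (rule finite_subset[of _ "P \<times> P"]) (auto simp: taos_basis_iff)

lemma awalk_append:
  assumes "pre_digraph.awalk Q a p b" "pre_digraph.awalk Q b q c"
  shows "pre_digraph.awalk Q a (p @ q) c"
proof -
  have "pre_digraph.cas Q a (p @ q) c" if "pre_digraph.cas Q a p b" "pre_digraph.cas Q b q c"
    using that by (induction p arbitrary: a) (auto simp: pre_digraph.cas.simps)
  then show ?thesis using assms by (auto simp: pre_digraph.awalk_def)
qed

text \<open>Members of \<open>quiver_paths\<close> are bare arc lists, so their end points have to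
  be recovered from the list; an empty list would not determine them.\<close>

lemma awalk_ends_unique:
  assumes "pre_digraph.awalk Q a p b" "pre_digraph.awalk Q a' p b'" "p \<noteq> []"
  shows "a = a' \<and> b = b'"
proof -
  have "a = a'" using assms by (cases p) (auto simp: pre_digraph.awalk_def pre_digraph.cas.simps)
  have "pre_digraph.cas Q u p b \<Longrightarrow> pre_digraph.cas Q u p b' \<Longrightarrow> b = b'" for u
    by (induction p arbitrary: u) (auto simp: pre_digraph.cas.simps)
  from this[of a] show ?thesis using assms \<open>a = a'\<close> by (simp add: pre_digraph.awalk_def)
qed

lemma joined_trans:
  assumes "joined Q a b" "joined Q b c"
  shows "joined Q a c"
proof -
  obtain p q where pq: "p \<noteq> []" "pre_digraph.awalk Q a p b" "pre_digraph.awalk Q b q c"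
    using assms by (auto simp: joined_def)
  show ?thesis unfolding joined_def
    by (rule exI[of _ "p @ q"]) (use pq(1) awalk_append[OF pq(2,3)] in simp)
qed

text \<open>Provides the paths of length at least two on which the separation hypothesis
  acts.\<close>

lemma joined_long:
  assumes "joined Q a b" "joined Q b c"
  shows "\<exists>p. pre_digraph.awalk Q a p c \<and> length p \<ge> 2"
proof -
  obtain p q where pq: "p \<noteq> []" "q \<noteq> []" "pre_digraph.awalk Q a p b" "pre_digraph.awalk Q b q c"
    using assms by (auto simp: joined_def)
  then have "length (p @ q) \<ge> 2" by (cases p; cases q) auto
  with awalk_append[OF pq(3,4)] show ?thesis by blast
qed

lemma subgraph_awalk:
  assumes "subgraph E Q" "pre_digraph.awalk E a p b"
  shows "pre_digraph.awalk Q a p b"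
  using assms compatible_cas[of Q E] by (auto simp: subgraph_def pre_digraph.awalk_def)

text \<open>By induction on the number of elements strictly between: with none the relation is an
  arrow, otherwise a split at an intermediate element lowers the number on both sides. Conversely
  transitivity composes the arrows of a path.\<close>

lemma joined_hasse_quiver:
  assumes P: "finite P" "taos P r"
  shows "joined (hasse_quiver P r) a b \<longleftrightarrow> (a, b) \<in> taos_basis P r"
proof
  assume "(a, b) \<in> taos_basis P r"
  then show "joined (hasse_quiver P r) a b"
  proof (induction "card {l. (a, l) \<in> taos_basis P r \<and> (l, b) \<in> taos_basis P r}" arbitrary: a b
      rule: less_induct)
    case less
    have fin: "finite {l. (a, l) \<in> taos_basis P r \<and> (l, b) \<in> taos_basis P r}" for a b
      by (rule finite_subset[OF _ P(1)]) (auto simp: taos_basis_iff)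
    show ?case
    proof (cases "\<exists>t. (a, t) \<in> taos_basis P r \<and> (t, b) \<in> taos_basis P r")
      case True
      then obtain t where t: "(a, t) \<in> taos_basis P r" "(t, b) \<in> taos_basis P r" by blast
      have irr: "(t, t) \<notin> taos_basis P r" by (simp add: taos_basis_iff)
      have "{l. (a, l) \<in> taos_basis P r \<and> (l, t) \<in> taos_basis P r} \<subset>
          {l. (a, l) \<in> taos_basis P r \<and> (l, b) \<in> taos_basis P r}"
        using t irr taos_basis_trans[OF P(2) _ t(2)] by blast
      from psubset_card_mono[OF fin this] have 1: "joined (hasse_quiver P r) a t" using less(1) t(1) by blast
      have "{l. (t, l) \<in> taos_basis P r \<and> (l, b) \<in> taos_basis P r} \<subset>
          {l. (a, l) \<in> taos_basis P r \<and> (l, b) \<in> taos_basis P r}"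
        using t irr taos_basis_trans[OF P(2) t(1)] by blast
      from psubset_card_mono[OF fin this] have "joined (hasse_quiver P r) t b" using less(1) t(2) by blast
      with 1 show ?thesis by (rule joined_trans)
    next
      case False
      then have "(a, b) \<in> arcs (hasse_quiver P r)" "a \<in> P" "b \<in> P"
        using less(2) by (auto simp: hasse_quiver_def taos_basis_iff)
      then have "pre_digraph.awalk (hasse_quiver P r) a [(a, b)] b"
        by (auto simp: hasse_quiver_def pre_digraph.awalk_def pre_digraph.cas.simps)
      then show ?thesis by (auto simp: joined_def)
    qed
  qed
next
  have "pre_digraph.cas (hasse_quiver P r) a p b \<Longrightarrow> set p \<subseteq> arcs (hasse_quiver P r) \<Longrightarrow> p \<noteq> [] \<Longrightarrow>
      (a, b) \<in> taos_basis P r" for p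
  proof (induction p arbitrary: a)
    case (Cons e p)
    have e: "(a, snd e) \<in> taos_basis P r"
      using Cons.prems by (auto simp: hasse_quiver_def taos_basis_iff pre_digraph.cas.simps)
    show ?case
    proof (cases "p = []")
      case True
      then show ?thesis using e Cons.prems by (auto simp: hasse_quiver_def pre_digraph.cas.simps)
    next
      case False
      then have "(snd e, b) \<in> taos_basis P r"
        using Cons by (auto simp: hasse_quiver_def pre_digraph.cas.simps)
      with e show ?thesis by (rule taos_basis_trans[OF P(2)])
    qed
  qed simp
  then show "joined (hasse_quiver P r) a b \<Longrightarrow> (a, b) \<in> taos_basis P r"
    by (auto simp: joined_def pre_digraph.awalk_def)
qed

section \<open>Algebraically connected components\<close>

lemma indicator_in_path_algebra:
  "p \<in> quiver_paths Q \<Longrightarrow> (\<lambda>q. if q = p then 1 else 0) \<in> acarrier (path_algebra Q)"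
  by (simp add: path_algebra_def basis_algebra_def)

text \<open>Decompose the basis element of \<open>p\<close>. Some summand has a nonzero coefficient
  at \<open>p\<close>, and each summand is supported on paths of its own component.\<close>

lemma component_of_path:
  assumes C: "algebraically_connected_components Q C" and p: "p \<in> quiver_paths Q"
  shows "\<exists>E\<in>C. p \<in> quiver_paths E"
proof -
  let ?x = "\<lambda>q. if q = p then 1 else (0::real)"
  have "\<forall>x\<in>acarrier (path_algebra Q).
      \<exists>!y. y \<in> (\<Pi>\<^sub>E E\<in>C. acarrier (path_algebra E)) \<and> x = (\<lambda>p. \<Sum>E\<in>C. y E p)"
    using C unfolding algebraically_connected_components_def by (elim conjE) assumption
  from ex1_implies_ex[OF bspec[OF this indicator_in_path_algebra[OF p]]] obtain y where y: "y \<in> (\<Pi>\<^sub>E E\<in>C. acarrier (path_algebra E))" "?x = (\<lambda>p. \<Sum>E\<in>C. y E p)"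
    by blast
  have "(\<Sum>E\<in>C. y E p) = 1" using fun_cong[OF y(2), of p] by simp
  then have "\<exists>E\<in>C. y E p \<noteq> 0" by (intro ccontr[of "\<exists>E\<in>C. y E p \<noteq> 0"]) simp
  then obtain E where "E \<in> C" "y E p \<noteq> 0" by blast
  moreover from this have "{q. y E q \<noteq> 0} \<subseteq> quiver_paths E"
    using y(1) by (auto simp: path_algebra_def basis_algebra_def PiE_iff)
  ultimately show ?thesis by blast
qed

text \<open>Basis elements of different components would have product zero, whereas the coefficient
  of this product at \<open>p @ q\<close> is 1.\<close>

lemma component_of_product:
  assumes C: "algebraically_connected_components Q C" and EF: "E \<in> C" "F \<in> C"
    and p: "p \<in> quiver_paths E" and q: "q \<in> quiver_paths F" and pq: "p @ q \<in> quiver_paths Q"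
  shows "E = F"
proof (rule ccontr)
  assume ne: "E \<noteq> F"
  let ?x = "\<lambda>w. if w = p then 1 else (0::real)" and ?y = "\<lambda>w. if w = q then 1 else (0::real)"
  have sub: "quiver_paths E \<subseteq> quiver_paths Q" if "E \<in> C" for E
  proof -
    have "subgraph E Q" using C that by (auto simp: algebraically_connected_components_def)
    from subgraph_awalk[OF this] show ?thesis unfolding quiver_paths_def by blast
  qed
  have "\<forall>E\<in>C. \<forall>F\<in>C. E \<noteq> F \<longrightarrow>
       (\<forall>x\<in>acarrier (path_algebra E). \<forall>y\<in>acarrier (path_algebra F).
          amult (path_algebra Q) x y = (\<lambda>_. 0))"
    using C unfolding algebraically_connected_components_def by (elim conjE) assumption
  from this[rule_format, OF EF ne indicator_in_path_algebra[OF p] indicator_in_path_algebra[OF q]]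
  have "amult (path_algebra Q) ?x ?y = (\<lambda>_. 0)" .
  from fun_cong[OF this, of "p @ q"]
  have 0: "(\<Sum>(u, v)\<in>{(u, v) \<in> quiver_paths Q \<times> quiver_paths Q.
        (if u @ v \<in> quiver_paths Q then Some (u @ v) else None) = Some (p @ q)}. ?x u * ?y v) = 0"
    by (simp add: path_algebra_def basis_algebra_def)
  let ?S = "{(u, v) \<in> quiver_paths Q \<times> quiver_paths Q.
        (if u @ v \<in> quiver_paths Q then Some (u @ v) else None) = Some (p @ q)}"
  \<comment> \<open>A factorisation of \<open>p @ q\<close> is determined by the length of its first
    factor. Finiteness is needed for the sum to be the intended one, since
    \<open>quiver_paths\<close> is not known to be finite here.\<close>
  have "finite ?S"
  proof (rule finite_subset)
    show "?S \<subseteq> (\<lambda>n. (take n (p @ q), drop n (p @ q))) ` {..length (p @ q)}"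
    proof clarify
      fix u v assume "(if u @ v \<in> quiver_paths Q then Some (u @ v) else None) = Some (p @ q)"
      then have uv: "u @ v = p @ q" by (simp split: if_splits)
      show "(u, v) \<in> (\<lambda>n. (take n (p @ q), drop n (p @ q))) ` {..length (p @ q)}"
        unfolding uv[symmetric] by (rule image_eqI[of _ _ "length u"]) auto
    qed
  qed simp
  moreover have "(p, q) \<in> ?S" using p q pq sub EF by auto
  ultimately have "(\<Sum>(u, v)\<in>?S. ?x u * ?y v) = (\<Sum>(u, v)\<in>{(p, q)}. ?x u * ?y v)"
    by (intro sum.mono_neutral_right) (auto split: if_splits)
  then show False using 0 by simp
qed

section \<open>Array TAOSes\<close>

text \<open>Chosen sets are nonempty because 1 \<le> m i, so the transitive closure reaches every
  chosen element of every later column. Disjointness of the columns excludes cycles.\<close>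

lemma array_taos_columns:
  assumes "array_taos A s"
  shows "\<exists>(k :: nat) (col :: nat \<Rightarrow> 'p set) ch. finite (A :: 'p set) \<and> taos A s \<and>
    (\<forall>i\<in>{1..k}. \<forall>j\<in>{1..k}. i \<noteq> j \<longrightarrow> col i \<inter> col j = {}) \<and>
    (\<forall>j\<in>{2..k}. finite (ch j) \<and> ch j \<subseteq> col j) \<and>
    (\<forall>a b. (a, b) \<in> taos_basis A s \<longleftrightarrow> (\<exists>i j. 1 \<le> i \<and> i < j \<and> j \<le> k \<and> a \<in> col i \<and> b \<in> ch j))"
proof -
  obtain k :: nat and n m :: "nat \<Rightarrow> nat" and col ch where k: "k \<ge> 2"
    and nm: "\<And>i. i \<in> {1..k} \<Longrightarrow> 1 \<le> m i \<and> m i \<le> n i"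
    and A: "A = (\<Union>i\<in>{1..k}. col i)" and dis: "disjoint_family_on col {1..k}"
    and col: "\<And>i. i \<in> {1..k} \<Longrightarrow> finite (col i) \<and> card (col i) = n i"
    and ch: "\<And>i. i \<in> {2..k} \<Longrightarrow> ch i \<subseteq> col i \<and> card (ch i) = m i"
    and s: "s = (\<lambda>a b. \<exists>i\<in>{1..k - 1}. a \<in> col i \<and> b \<in> ch (i + 1))\<^sup>+\<^sup>+"
    using assms unfolding array_taos_def by blast
  let ?R = "\<lambda>a b. \<exists>i\<in>{1..k - 1}. a \<in> col i \<and> b \<in> ch (i + 1)"
  let ?T = "\<lambda>a b. \<exists>i j. 1 \<le> i \<and> i < j \<and> j \<le> k \<and> a \<in> col i \<and> b \<in> ch j"
  have d: "i = j" if "x \<in> col i" "x \<in> col j" "i \<in> {1..k}" "j \<in> {1..k}" for i j x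
    using dis that unfolding disjoint_family_on_def by blast
  have chcol: "b \<in> col j" if "b \<in> ch j" "1 < j" "j \<le> k" for b j
    using ch[of j] that by auto
  have T_trans: "?T a c" if T: "?T a b" "?T b c" for a b c
  proof -
    obtain i j i' j' where *: "1 \<le> i" "i < j" "j \<le> k" "a \<in> col i" "b \<in> ch j"
      "1 \<le> i'" "i' < j'" "j' \<le> k" "b \<in> col i'" "c \<in> ch j'" using T by blast
    have "b \<in> col j" using chcol * by auto
    then have "i' = j" using d * by auto
    then show ?thesis using * by (intro exI[of _ i] exI[of _ j']) auto
  qed
  have sT: "?T a b" if "s a b" for a b
    using that unfolding s
  proof (induction rule: tranclp_induct)
    case (base y)
    then obtain i where "i \<in> {1..k - 1}" "a \<in> col i" "y \<in> ch (i + 1)" by blast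
    then show ?case by (intro exI[of _ i] exI[of _ "i + 1"]) auto
  next
    case (step y z)
    then obtain i where "i \<in> {1..k - 1}" "y \<in> col i" "z \<in> ch (i + 1)" by blast
    then have "?T y z" by (intro exI[of _ i] exI[of _ "i + 1"]) auto
    with step show ?case using T_trans by blast
  qed
  have ne: "\<exists>x. x \<in> ch j" if "j \<in> {2..k}" for j
  proof -
    have "card (ch j) \<noteq> 0" using ch[OF that] nm[of j] that by auto
    then show ?thesis by (metis card.empty ex_in_conv)
  qed
  have Ts: "s a b" if "1 \<le> i" "i < j" "j \<le> k" "a \<in> col i" "b \<in> ch j" for a b i j
    using that(2,3,5)
  proof (induction j arbitrary: b rule: less_induct)
    case (less j)
    show ?case
    proof (cases "j = Suc i")
      case True
      then have "?R a b" using less.prems that(1,4) by (intro bexI[of _ i]) auto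
      then show ?thesis unfolding s by (rule tranclp.r_into_trancl)
    next
      case False
      then have j: "i < j - 1" "j - 1 < j" "j - 1 \<le> k" "j - 1 \<in> {2..k}" using less.prems that by auto
      \<comment> \<open>Any chosen element of the preceding column serves as the last intermediate
        stop.\<close>
      obtain x where x: "x \<in> ch (j - 1)" using ne[OF j(4)] by blast
      have "s a x" using less.IH[OF j(2,1,3) x] .
      moreover have "x \<in> col (j - 1)" using chcol[OF x] j by auto
      then have "?R x b" using less.prems j by (intro bexI[of _ "j - 1"]) auto
      ultimately show ?thesis unfolding s by (rule tranclp.trancl_into_trancl)
    qed
  qed
  have irr: "\<not> ?T a a" for a
  proof
    assume "?T a a"
    then obtain i j where *: "1 \<le> i" "i < j" "j \<le> k" "a \<in> col i" "a \<in> ch j" by blast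
    then have "i = j" using chcol[of a j] by (intro d[of a]) auto
    then show False using * by simp
  qed
  have s_iff: "s a b \<longleftrightarrow> ?T a b" for a b using sT Ts by blast
  have inA: "a \<in> A" "b \<in> A" if ab: "?T a b" for a b
  proof -
    obtain i j where *: "1 \<le> i" "i < j" "j \<le> k" "a \<in> col i" "b \<in> ch j" using ab by blast
    then show "a \<in> A" unfolding A by auto
    have "b \<in> col j" using chcol * by auto
    then show "b \<in> A" unfolding A using * by auto
  qed
  show ?thesis
  proof (rule exI[of _ k], rule exI[of _ col], rule exI[of _ ch], intro conjI ballI impI allI)
    show "finite A" unfolding A using col by auto
    have "transp_on A s" unfolding transp_on_def s_iff using T_trans by blast
    moreover have "antisymp_on A s" unfolding antisymp_on_def s_iff using T_trans irr by blast
    ultimately show "taos A s" by (simp add: taos_def)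
    show "col i \<inter> col j = {}" if "i \<in> {1..k}" "j \<in> {1..k}" "i \<noteq> j" for i j
      using d that by blast
    show "finite (ch j)" if "j \<in> {2..k}" for j
      using ch[OF that] col[of j] that by (auto intro: finite_subset)
    show "ch j \<subseteq> col j" if "j \<in> {2..k}" for j
      using ch[OF that] by blast
    show "(a, b) \<in> taos_basis A s \<longleftrightarrow> ?T a b" for a b
      unfolding taos_basis_iff s_iff using inA irr by blast
  qed
qed

section \<open>The weights\<close>

text \<open>In the application \<open>L\<close> consists of the chosen elements of the column of \<open>b\<close>.\<close>

lemma taos_level:
  fixes P :: "'p set" and C :: "('p, 'p \<times> 'p) pre_digraph set"
  assumes P: "finite P" "taos P r"
    and C: "algebraically_connected_components (hasse_quiver P r) C"
    and arr: "\<forall>E\<in>C. \<exists>A s. array_taos A s \<and> E = hasse_quiver A s"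
    and sep: "\<forall>E\<in>C. \<forall>F\<in>C. E \<noteq> F \<longrightarrow>
      \<not> (\<exists>u v p q. pre_digraph.awalk E u p v \<and> pre_digraph.awalk F u q v \<and>
            length p \<ge> 2 \<and> length q \<ge> 2)"
    and b0: "(a0, b) \<in> taos_basis P r" "(b, c0) \<in> taos_basis P r"
  shows "\<exists>L. finite L \<and>
    (\<forall>a c. (a, b) \<in> taos_basis P r \<longrightarrow> (b, c) \<in> taos_basis P r \<longrightarrow>
      {l. (a, l) \<in> taos_basis P r \<and> (l, c) \<in> taos_basis P r} =
      {l. (a, l) \<in> taos_basis P r \<and> (l, b) \<in> taos_basis P r} \<union>
      {l. (b, l) \<in> taos_basis P r \<and> (l, c) \<in> taos_basis P r} \<union> L) \<and>
    (\<forall>l\<in>L. (l, b) \<notin> taos_basis P r \<and> (b, l) \<notin> taos_basis P r \<and>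
      (\<forall>d. (d, l) \<in> taos_basis P r \<longleftrightarrow> (d, b) \<in> taos_basis P r) \<and>
      (\<forall>d. (l, d) \<in> taos_basis P r \<longleftrightarrow> (b, d) \<in> taos_basis P r))"
proof -
  let ?Q = "hasse_quiver P r" and ?B = "taos_basis P r"
  have sub: "subgraph E ?Q" if "E \<in> C" for E
    using C that by (auto simp: algebraically_connected_components_def)
  have lt: "(a, b) \<in> ?B" if "joined E a b" "E \<in> C" for E a b
    using that subgraph_awalk[OF sub[OF that(2)]] joined_hasse_quiver[OF P] unfolding joined_def by blast
  have ex: "\<exists>E\<in>C. joined E a b" if ab: "(a, b) \<in> ?B" for a b
  proof -
    obtain p where p: "p \<noteq> []" "pre_digraph.awalk ?Q a p b"
      using ab joined_hasse_quiver[OF P] unfolding joined_def by blast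
    then have "p \<in> quiver_paths ?Q" by (auto simp: quiver_paths_def)
    from component_of_path[OF C this] obtain E u v where E: "E \<in> C" "pre_digraph.awalk E u p v"
      unfolding quiver_paths_def by blast
    then have "u = a \<and> v = b"
      using awalk_ends_unique[OF subgraph_awalk[OF sub] p(2,1)] by blast
    then show ?thesis using E p(1) by (auto simp: joined_def)
  qed
  \<comment> \<open>Consecutive relations belong to one component, since the concatenation of their
    paths is a nonzero product in the path algebra.\<close>
  have comp: "E = F" if EF: "E \<in> C" "F \<in> C" "joined E a b" "joined F b c" for E F a b c
  proof -
    obtain p q where pq: "p \<noteq> []" "q \<noteq> []" "pre_digraph.awalk E a p b" "pre_digraph.awalk F b q c"
      using EF by (auto simp: joined_def)
    have "pre_digraph.awalk ?Q a (p @ q) c"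
      by (rule awalk_append[OF subgraph_awalk[OF sub[OF EF(1)] pq(3)] subgraph_awalk[OF sub[OF EF(2)] pq(4)]])
    then have "p @ q \<in> quiver_paths ?Q" using pq(1) by (auto simp: quiver_paths_def)
    moreover have "p \<in> quiver_paths E" "q \<in> quiver_paths F" using pq by (auto simp: quiver_paths_def)
    ultimately show ?thesis using component_of_product[OF C EF(1,2)] by blast
  qed
  \<comment> \<open>Here the separation hypothesis enters: chains through \<open>b\<close> and
    through \<open>l\<close> with the same ends are parallel paths of length at least two.\<close>
  have same: "E = F" if "E \<in> C" "F \<in> C" "joined E a b" "joined E b c" "joined F a l" "joined F l c"
    for E F a b c l
    using bspec[OF bspec[OF sep that(1)] that(2)] joined_long[OF that(3,4)] joined_long[OF that(5,6)] by blast
  obtain E where E: "E \<in> C" "joined E a0 b" using ex[OF b0(1)] by blast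
  obtain E' where "E' \<in> C" "joined E' b c0" using ex[OF b0(2)] by blast
  then have Ec0: "joined E b c0" using comp[OF E(1) _ E(2)] by blast
  obtain A s where As: "array_taos A s" "E = hasse_quiver A s" using bspec[OF arr E(1)] by blast
  from array_taos_columns[OF As(1)]
  obtain k :: nat and col ch :: "nat \<Rightarrow> 'p set" where A: "finite A" "taos A s"
    and dis: "\<forall>i\<in>{1..k}. \<forall>j\<in>{1..k}. i \<noteq> j \<longrightarrow> col i \<inter> col j = {}"
    and ch': "\<forall>j\<in>{2..k}. finite (ch j) \<and> ch j \<subseteq> col j"
    and bas: "\<forall>a b. (a, b) \<in> taos_basis A s \<longleftrightarrow> (\<exists>i j. 1 \<le> i \<and> i < j \<and> j \<le> k \<and> a \<in> col i \<and> b \<in> ch j)"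
    by (elim exE conjE) (rule that)
  note ch = bspec[OF ch']
  have jE: "joined E a b \<longleftrightarrow> (\<exists>i j. 1 \<le> i \<and> i < j \<and> j \<le> k \<and> a \<in> col i \<and> b \<in> ch j)" for a b
    unfolding As(2) joined_hasse_quiver[OF A] using bas by blast
  obtain i0 j where j: "1 \<le> i0" "i0 < j" "j \<le> k" "a0 \<in> col i0" "b \<in> ch j" using E(2) jE by blast
  have j2: "j \<in> {2..k}" using j by auto
  have uniq: "i = j" if "x \<in> col i" "x \<in> col j" "1 \<le> i" "i \<le> k" "1 \<le> j" "j \<le> k" for i j x
    using bspec[OF bspec[OF dis, of i], of j] that by auto
  obtain m0 where m0: "j < m0" "m0 \<le> k" "c0 \<in> ch m0"
  proof -
    obtain i m where "1 \<le> i" "i < m" "m \<le> k" "b \<in> col i" "c0 \<in> ch m" using Ec0 jE by blast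
    moreover from this have "i = j" using ch[OF j2] j by (intro uniq[of b]) auto
    ultimately show ?thesis using that by blast
  qed
  \<comment> \<open>\<open>x\<close> has the successor \<open>c0\<close> within \<open>E\<close>, so
    by \<open>comp\<close> all its predecessors are joined to it within \<open>E\<close>, and the
    columns decide.\<close>
  have pred: "(d, x) \<in> ?B \<longleftrightarrow> (\<exists>i. 1 \<le> i \<and> i < j \<and> d \<in> col i)" if x: "x \<in> ch j" for d x
  proof
    assume "(d, x) \<in> ?B"
    then obtain F where F: "F \<in> C" "joined F d x" using ex by blast
    have "joined E x c0"
      unfolding jE using m0 j x ch[OF j2] by (intro exI[of _ j] exI[of _ m0]) auto
    then have "F = E" using comp[OF F(1) E(1) F(2)] by blast
    then obtain i j' where *: "1 \<le> i" "i < j'" "j' \<le> k" "d \<in> col i" "x \<in> ch j'"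
      using F(2) jE by blast
    then have "j' = j" using ch[OF j2] ch[of j'] x j by (intro uniq[of x]) auto
    then show "\<exists>i. 1 \<le> i \<and> i < j \<and> d \<in> col i" using * by blast
  next
    assume "\<exists>i. 1 \<le> i \<and> i < j \<and> d \<in> col i"
    then have "joined E d x" unfolding jE using x j by blast
    then show "(d, x) \<in> ?B" using lt E(1) by blast
  qed
  have succ: "(x, d) \<in> ?B \<longleftrightarrow> (\<exists>m. j < m \<and> m \<le> k \<and> d \<in> ch m)" if x: "x \<in> ch j" for d x
  proof
    assume "(x, d) \<in> ?B"
    then obtain F where F: "F \<in> C" "joined F x d" using ex by blast
    have "joined E a0 x" unfolding jE using j x by blast
    then have "E = F" using comp[OF E(1) F(1) _ F(2)] by blast
    then obtain i m where *: "1 \<le> i" "i < m" "m \<le> k" "x \<in> col i" "d \<in> ch m"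
      using F(2) jE by blast
    then have "i = j" using ch[OF j2] x j by (intro uniq[of x]) auto
    then show "\<exists>m. j < m \<and> m \<le> k \<and> d \<in> ch m" using * by blast
  next
    assume "\<exists>m. j < m \<and> m \<le> k \<and> d \<in> ch m"
    moreover have "x \<in> col j" "1 \<le> j" using x ch[OF j2] j by auto
    ultimately have "joined E x d" unfolding jE by blast
    then show "(x, d) \<in> ?B" using lt E(1) by blast
  qed
  have incomp: "(l, b) \<notin> ?B" "(b, l) \<notin> ?B" if l: "l \<in> ch j" for l
  proof -
    have lb: "l \<in> col j" "b \<in> col j" using ch[OF j2] l j by auto
    show "(l, b) \<notin> ?B"
    proof
      assume "(l, b) \<in> ?B"
      then obtain i where "1 \<le> i" "i < j" "l \<in> col i" using pred[OF j(5)] by blast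
      then show False using uniq[of l i j] lb j by auto
    qed
    show "(b, l) \<notin> ?B"
    proof
      assume "(b, l) \<in> ?B"
      then obtain i where "1 \<le> i" "i < j" "b \<in> col i" using pred[OF l] by blast
      then show False using uniq[of b i j] lb j by auto
    qed
  qed
  \<comment> \<open>Any \<open>l\<close> between \<open>a\<close> and \<open>c\<close> lies in
    \<open>E\<close> by \<open>same\<close>. Comparing its column with that of \<open>b\<close>
    yields the three parts.\<close>
  have btw: "{l. (a, l) \<in> ?B \<and> (l, c) \<in> ?B} =
      {l. (a, l) \<in> ?B \<and> (l, b) \<in> ?B} \<union> {l. (b, l) \<in> ?B \<and> (l, c) \<in> ?B} \<union> ch j" (is "?l = ?r")
    if ab: "(a, b) \<in> ?B" and bc: "(b, c) \<in> ?B" for a c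
  proof
    show "?l \<subseteq> ?r"
    proof
      fix l assume "l \<in> ?l"
      then have al: "(a, l) \<in> ?B" and lc: "(l, c) \<in> ?B" by auto
      obtain F where F: "F \<in> C" "joined F a l" using ex[OF al] by blast
      obtain F' where F': "F' \<in> C" "joined F' l c" using ex[OF lc] by blast
      have Flc: "joined F l c" using comp[OF F(1) F'(1) F(2) F'(2)] F' by simp
      obtain i1 where i1: "1 \<le> i1" "i1 < j" "a \<in> col i1" using ab pred[OF j(5)] by blast
      obtain m1 where m1: "j < m1" "m1 \<le> k" "c \<in> ch m1" using bc succ[OF j(5)] by blast
      have Eab: "joined E a b" unfolding jE using i1 j by blast
      have "b \<in> col j" "1 \<le> j" using ch[OF j2] j by auto
      then have Ebc: "joined E b c" unfolding jE using m1 by blast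
      have "E = F" by (rule same[OF E(1) F(1) Eab Ebc F(2) Flc])
      then obtain i j' where j': "1 \<le> i" "i < j'" "j' \<le> k" "a \<in> col i" "l \<in> ch j'"
        using F(2) jE by blast
      consider "j' < j" | "j' = j" | "j < j'" by linarith
      then show "l \<in> ?r"
      proof cases
        case 1
        moreover have "l \<in> col j'" using ch[of j'] j' by auto
        ultimately have "(l, b) \<in> ?B" using pred[OF j(5)] j' by (meson le_less_trans less_imp_le le_trans)
        then show ?thesis using al by blast
      next
        case 2
        then show ?thesis using j' by blast
      next
        case 3
        then have "(b, l) \<in> ?B" using succ[OF j(5)] j' by blast
        then show ?thesis using lc by blast
      qed
    qed
    show "?r \<subseteq> ?l"
      using taos_basis_trans[OF P(2)] ab bc pred[OF j(5)] succ[OF j(5)] pred succ by blast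
  qed
  show ?thesis
    using ch[OF j2] incomp btw pred succ j(5) by (intro exI[of _ "ch j"]) auto
qed

text \<open>With \<open>x = 1 / \<kappa>\<close>, the elements at the level of \<open>b\<close> must
  contribute 1 minus (predecessors plus successors) times \<open>x b\<close>. They all carry the
  weight of \<open>b\<close>, so this is the equation that defines
  \<open>\<kappa> b\<close>.\<close>

lemma taos_weights:
  fixes P :: "'p set" and C :: "('p, 'p \<times> 'p) pre_digraph set"
  assumes P: "finite P" "taos P r"
    and C: "algebraically_connected_components (hasse_quiver P r) C"
    and arr: "\<forall>E\<in>C. \<exists>A s. array_taos A s \<and> E = hasse_quiver A s"
    and sep: "\<forall>E\<in>C. \<forall>F\<in>C. E \<noteq> F \<longrightarrow>
      \<not> (\<exists>u v p q. pre_digraph.awalk E u p v \<and> pre_digraph.awalk F u q v \<and>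
            length p \<ge> 2 \<and> length q \<ge> 2)"
  obtains x :: "'p \<Rightarrow> real" where "\<And>b. x b > 0"
    "\<And>a b c. (a, b) \<in> taos_basis P r \<Longrightarrow> (b, c) \<in> taos_basis P r \<Longrightarrow>
      (\<Sum>l | (a, l) \<in> taos_basis P r \<and> (l, c) \<in> taos_basis P r. x l) =
      (\<Sum>l | (a, l) \<in> taos_basis P r \<and> (l, b) \<in> taos_basis P r. x l) +
      (\<Sum>l | (b, l) \<in> taos_basis P r \<and> (l, c) \<in> taos_basis P r. x l) +
      (1 - (real (card {d. (d, b) \<in> taos_basis P r}) + real (card {d. (b, d) \<in> taos_basis P r})) * x b)"
proof -
  let ?B = "taos_basis P r"
  \<comment> \<open>The level of \<open>b\<close>, described through the order alone. The columns
    found by \<open>taos_level\<close> depend on choices made for each \<open>b\<close>, while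
    \<open>\<kappa>\<close> has to be one function on all of the set.\<close>
  define L where "L b = {l. \<exists>a c. (a, b) \<in> ?B \<and> (b, c) \<in> ?B \<and> (a, l) \<in> ?B \<and> (l, c) \<in> ?B \<and>
    (l, b) \<notin> ?B \<and> (b, l) \<notin> ?B}" for b
  \<comment> \<open>Elements without predecessor or without successor never lie strictly between two
    others, so the value 1 there is a free choice.\<close>
  define \<kappa> where "\<kappa> b = (if \<exists>a c. (a, b) \<in> ?B \<and> (b, c) \<in> ?B
    then real (card {d. (d, b) \<in> ?B}) + real (card {d. (b, d) \<in> ?B}) + real (card (L b)) else 1)" for b
  have fin: "finite {d. (d, b) \<in> ?B}" "finite {d. (b, d) \<in> ?B}" for b
    by (rule finite_subset[OF _ P(1)]; auto simp: taos_basis_iff)+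
  have pos: "\<kappa> b > 0" for b
  proof (cases "\<exists>a c. (a, b) \<in> ?B \<and> (b, c) \<in> ?B")
    case True
    then have "card {d. (d, b) \<in> ?B} > 0" using fin by (auto simp: card_gt_0_iff)
    then show ?thesis using True by (simp add: \<kappa>_def)
  next
    case False
    then show ?thesis unfolding \<kappa>_def if_not_P[OF False] by simp
  qed
  show ?thesis
  proof (rule that[of "\<lambda>b. 1 / \<kappa> b"])
    show "1 / \<kappa> b > 0" for b using pos by simp
    fix a b c assume ab: "(a, b) \<in> ?B" and bc: "(b, c) \<in> ?B"
    from taos_level[OF P C arr sep ab bc] obtain M where M1: "finite M"
      and M2: "\<forall>a c. (a, b) \<in> ?B \<longrightarrow> (b, c) \<in> ?B \<longrightarrow> {l. (a, l) \<in> ?B \<and> (l, c) \<in> ?B} =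
        {l. (a, l) \<in> ?B \<and> (l, b) \<in> ?B} \<union> {l. (b, l) \<in> ?B \<and> (l, c) \<in> ?B} \<union> M"
      and M3: "\<forall>l\<in>M. (l, b) \<notin> ?B \<and> (b, l) \<notin> ?B \<and> (\<forall>d. (d, l) \<in> ?B \<longleftrightarrow> (d, b) \<in> ?B) \<and>
        (\<forall>d. (l, d) \<in> ?B \<longleftrightarrow> (b, d) \<in> ?B)"
      by (elim exE conjE) (rule that)
    have M: "finite M"
      "(a, b) \<in> ?B \<Longrightarrow> (b, c) \<in> ?B \<Longrightarrow> {l. (a, l) \<in> ?B \<and> (l, c) \<in> ?B} =
        {l. (a, l) \<in> ?B \<and> (l, b) \<in> ?B} \<union> {l. (b, l) \<in> ?B \<and> (l, c) \<in> ?B} \<union> M"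
      "l \<in> M \<Longrightarrow> (l, b) \<notin> ?B \<and> (b, l) \<notin> ?B"
      "l \<in> M \<Longrightarrow> (d, l) \<in> ?B \<longleftrightarrow> (d, b) \<in> ?B"
      "l \<in> M \<Longrightarrow> (l, d) \<in> ?B \<longleftrightarrow> (b, d) \<in> ?B" for a c l d
      using M1 M2 M3 by blast+
    have LM: "L b = M"
    proof
      show "L b \<subseteq> M"
      proof
        fix l assume "l \<in> L b"
        then obtain a c where *: "(a, b) \<in> ?B" "(b, c) \<in> ?B" "(a, l) \<in> ?B" "(l, c) \<in> ?B"
          "(l, b) \<notin> ?B" "(b, l) \<notin> ?B" by (auto simp: L_def)
        then show "l \<in> M" using M(2)[OF *(1,2)] by blast
      qed
      show "M \<subseteq> L b" using M(3-5) ab bc unfolding L_def by blast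
    qed
    \<comment> \<open>Elements of one level have the same predecessors and successors, hence also
      the same \<open>L\<close>.\<close>
    have "\<kappa> l = \<kappa> b" if l: "l \<in> M" for l
    proof -
      have "L l = L b" unfolding L_def by (simp add: M(4,5)[OF l])
      then show ?thesis unfolding \<kappa>_def by (simp add: M(4,5)[OF l])
    qed
    then have "(\<Sum>l\<in>M. 1 / \<kappa> l) = real (card M) / \<kappa> b" by simp
    also have "\<dots> = 1 - (real (card {d. (d, b) \<in> ?B}) + real (card {d. (b, d) \<in> ?B})) * (1 / \<kappa> b)"
    proof -
      have "\<kappa> b = real (card {d. (d, b) \<in> ?B}) + real (card {d. (b, d) \<in> ?B}) + real (card M)"
        using ab bc LM by (auto simp: \<kappa>_def)
      then show ?thesis using pos[of b] by (simp add: field_simps)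
    qed
    finally have s: "(\<Sum>l\<in>M. 1 / \<kappa> l) =
      1 - (real (card {d. (d, b) \<in> ?B}) + real (card {d. (b, d) \<in> ?B})) * (1 / \<kappa> b)" .
    have f1: "finite {l. (a, l) \<in> ?B \<and> (l, b) \<in> ?B}" "finite {l. (b, l) \<in> ?B \<and> (l, c) \<in> ?B}"
      by (rule finite_subset[OF _ P(1)]; auto simp: taos_basis_iff)+
    have d1: "{l. (a, l) \<in> ?B \<and> (l, b) \<in> ?B} \<inter> {l. (b, l) \<in> ?B \<and> (l, c) \<in> ?B} = {}"
    proof -
      have "(b, b) \<notin> ?B" by (simp add: taos_basis_iff)
      then show ?thesis using taos_basis_trans[OF P(2), of b _ b] by blast
    qed
    have d2: "({l. (a, l) \<in> ?B \<and> (l, b) \<in> ?B} \<union> {l. (b, l) \<in> ?B \<and> (l, c) \<in> ?B}) \<inter> M = {}"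
      using M(3) by blast
    show "(\<Sum>l | (a, l) \<in> ?B \<and> (l, c) \<in> ?B. 1 / \<kappa> l) =
      (\<Sum>l | (a, l) \<in> ?B \<and> (l, b) \<in> ?B. 1 / \<kappa> l) + (\<Sum>l | (b, l) \<in> ?B \<and> (l, c) \<in> ?B. 1 / \<kappa> l) +
      (1 - (real (card {d. (d, b) \<in> ?B}) + real (card {d. (b, d) \<in> ?B})) * (1 / \<kappa> b))"
      by (simp only: M(2)[OF ab bc] sum.union_disjoint[OF finite_UnI[OF f1] M(1) d2]
        sum.union_disjoint[OF f1 d1] s)
  qed
qed

section \<open>Locally constant ambiguity on simply connected spaces\<close>

text \<open>A family of local functions that differ by locally constant functions, such as the local
  primitives of a closed one-form. \<open>prim H A K\<close> says that \<open>K\<close> continues these functions along \<open>H\<close>.\<close>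

locale local_primitives =
  fixes X :: "'m topology" and pot :: "'m set \<Rightarrow> ('m \<Rightarrow> real) \<Rightarrow> bool"
  assumes pot_open: "pot U f \<Longrightarrow> openin X U"
    and pot_diff: "pot U f \<Longrightarrow> pot V g \<Longrightarrow> p \<in> U \<Longrightarrow> p \<in> V \<Longrightarrow>
      \<exists>W. openin X W \<and> p \<in> W \<and> (\<exists>k. \<forall>q\<in>W. f q = g q + (k::real))"
    and pot_add: "pot U f \<Longrightarrow> pot U (\<lambda>q. f q + k)"
    and pot_ex: "p \<in> topspace X \<Longrightarrow> \<exists>U f. pot U f \<and> p \<in> U \<and> path_connectedin X U"
begin

definition prim :: "('z::topological_space \<Rightarrow> 'm) \<Rightarrow> 'z set \<Rightarrow> ('z \<Rightarrow> real) \<Rightarrow> bool" where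
  "prim H A K \<longleftrightarrow> (\<forall>z\<in>A. \<exists>V U f. open V \<and> z \<in> V \<and> pot U f \<and> H ` (V \<inter> A) \<subseteq> U \<and>
    (\<forall>z'\<in>V \<inter> A. K z' = f (H z')))"

lemma primE:
  assumes "prim H A K" "z \<in> A"
  obtains V U f where "open V" "z \<in> V" "pot U f" "H ` (V \<inter> A) \<subseteq> U" "\<And>z'. z' \<in> V \<inter> A \<Longrightarrow> K z' = f (H z')"
  using bspec[OF assms(1)[unfolded prim_def] assms(2)] by (elim exE conjE) (rule that, auto)

lemma primI:
  assumes "\<And>z. z \<in> A \<Longrightarrow> \<exists>V U f. open V \<and> z \<in> V \<and> pot U f \<and> H ` (V \<inter> A) \<subseteq> U \<and>
    (\<forall>z'\<in>V \<inter> A. K z' = f (H z'))"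
  shows "prim H A K"
  unfolding prim_def using assms by (rule ballI)

lemma prim_compose:
  fixes H :: "'z::topological_space \<Rightarrow> 'm" and h :: "'y::topological_space \<Rightarrow> 'z"
  assumes K: "prim H A K" and h: "continuous_on B h" "\<And>y. y \<in> B \<Longrightarrow> h y \<in> A"
    and H': "\<And>y. y \<in> B \<Longrightarrow> H' y = H (h y)"
  shows "prim H' B (\<lambda>y. K (h y))"
proof (rule primI)
  fix y assume y: "y \<in> B"
  obtain V U f where V: "open V" "h y \<in> V" "pot U f" "H ` (V \<inter> A) \<subseteq> U"
    "\<And>z'. z' \<in> V \<inter> A \<Longrightarrow> K z' = f (H z')" using primE[OF K h(2)[OF y]] by blast
  obtain V' where V': "open V'" "y \<in> V'" "\<And>y'. y' \<in> B \<Longrightarrow> y' \<in> V' \<Longrightarrow> h y' \<in> V"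
    using h(1)[unfolded continuous_on_topological, rule_format, OF y V(1,2)] by blast
  show "\<exists>V U f. open V \<and> y \<in> V \<and> pot U f \<and> H' ` (V \<inter> B) \<subseteq> U \<and> (\<forall>z'\<in>V \<inter> B. K (h z') = f (H' z'))"
    by (rule exI[of _ V'], rule exI[of _ U], rule exI[of _ f])
      (use V V' h(2) H' in \<open>auto simp: image_subset_iff\<close>)
qed

lemma prim_subset:
  assumes "prim H A K" "B \<subseteq> A"
  shows "prim H B K"
  using prim_compose[OF assms(1) continuous_on_id, of B H] assms(2) by auto

lemma prim_add:
  assumes "prim H A K"
  shows "prim H A (\<lambda>z. K z + k)"
proof (rule primI)
  fix z assume "z \<in> A"
  obtain V U f where V: "open V" "z \<in> V" "pot U f" "H ` (V \<inter> A) \<subseteq> U"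
    "\<And>z'. z' \<in> V \<inter> A \<Longrightarrow> K z' = f (H z')" using primE[OF assms \<open>z \<in> A\<close>] by blast
  show "\<exists>V U f. open V \<and> z \<in> V \<and> pot U f \<and> H ` (V \<inter> A) \<subseteq> U \<and> (\<forall>z'\<in>V \<inter> A. K z' + k = f (H z'))"
    by (rule exI[of _ V], rule exI[of _ U], rule exI[of _ "\<lambda>q. f q + k"]) (use V pot_add in auto)
qed

text \<open>By \<open>pot_diff\<close> the difference of two continuations is locally constant, and
  \<open>A\<close> is connected.\<close>

lemma prim_unique:
  fixes H :: "'z::topological_space \<Rightarrow> 'm"
  assumes A: "topological_space_class.connected A" and H: "continuous_map (top_of_set A) X H"
    and K: "prim H A K" and L: "prim H A L" and zw: "z \<in> A" "w \<in> A"
  shows "K z - L z = K w - L w"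
proof (rule connected_local_const[OF A zw])
  show "\<forall>z\<in>A. eventually (\<lambda>w. K z - L z = K w - L w) (at z within A)"
  proof
    fix z assume z: "z \<in> A"
    obtain V U f where V: "open V" "z \<in> V" "pot U f" "H ` (V \<inter> A) \<subseteq> U"
      "\<And>z'. z' \<in> V \<inter> A \<Longrightarrow> K z' = f (H z')" using primE[OF K z] by blast
    obtain V' U' f' where V': "open V'" "z \<in> V'" "pot U' f'" "H ` (V' \<inter> A) \<subseteq> U'"
      "\<And>z'. z' \<in> V' \<inter> A \<Longrightarrow> L z' = f' (H z')" using primE[OF L z] by blast
    have "H z \<in> U" "H z \<in> U'" using V V' z by auto
    from pot_diff[OF V(3) V'(3) this] obtain W k where W: "openin X W" "H z \<in> W"
      "\<forall>q\<in>W. f q = f' q + k" by blast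
    have "openin (top_of_set A) {x \<in> A. H x \<in> W}"
      using openin_continuous_map_preimage[OF H W(1)] by simp
    then obtain T where T: "open T" "{x \<in> A. H x \<in> W} = A \<inter> T" by (auto simp: openin_open)
    have "K z - L z = K w - L w" if "w \<in> A" "w \<in> V \<inter> V' \<inter> T" for w
    proof -
      have "H z \<in> W" "H w \<in> W" using T(2) W that z by auto
      then show ?thesis using V(5)[of z] V(5)[of w] V'(5)[of z] V'(5)[of w] W(3) z that V(2) V'(2) by auto
    qed
    moreover have "open (V \<inter> V' \<inter> T)" using V V' T by auto
    moreover have "z \<in> V \<inter> V' \<inter> T" using V V' T(2) W(2) z by auto
    ultimately show "eventually (\<lambda>w. K z - L z = K w - L w) (at z within A)"
      unfolding eventually_at_topological by blast
  qed
qed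

text \<open>On the connected overlap the two continuations differ by one constant, which is added to
  \<open>L\<close>; openness keeps the local condition intact on the union.\<close>

lemma prim_glue:
  fixes H :: "'z::topological_space \<Rightarrow> 'm"
  assumes H: "continuous_map euclidean X H" and AB: "open A" "open B" "topological_space_class.connected (A \<inter> B)"
    and K: "prim H A K" and L: "prim H B L"
  shows "\<exists>N. prim H (A \<union> B) N"
proof -
  have Hs: "continuous_map (top_of_set S) X H" for S using H by (rule continuous_map_from_subtopology)
  have "\<exists>k. \<forall>z\<in>A \<inter> B. K z = L z + k"
  proof (cases "A \<inter> B = {}")
    case False
    then obtain w where w: "w \<in> A \<inter> B" by blast
    have "K z = L z + (K w - L w)" if "z \<in> A \<inter> B" for z
      using prim_unique[OF AB(3) Hs prim_subset[OF K] prim_subset[OF L] that w] by simp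
    then show ?thesis by blast
  qed auto
  then obtain k where k: "\<And>z. z \<in> A \<Longrightarrow> z \<in> B \<Longrightarrow> K z = L z + k" by blast
  define N where "N z = (if z \<in> A then K z else L z + k)" for z
  have NA: "N z = K z" if "z \<in> A" for z using that by (simp add: N_def)
  have NB: "N z = L z + k" if "z \<in> B" for z using that k by (simp add: N_def)
  note L' = prim_add[OF L, of k]
  have "prim H (A \<union> B) N"
  proof (rule primI)
    fix z assume "z \<in> A \<union> B"
    then consider "z \<in> A" | "z \<in> B" by blast
    then show "\<exists>V U f. open V \<and> z \<in> V \<and> pot U f \<and> H ` (V \<inter> (A \<union> B)) \<subseteq> U \<and>
        (\<forall>z'\<in>V \<inter> (A \<union> B). N z' = f (H z'))"
    proof cases
      case 1
      obtain V U f where V: "open V" "z \<in> V" "pot U f" "H ` (V \<inter> A) \<subseteq> U"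
        "\<And>z'. z' \<in> V \<inter> A \<Longrightarrow> K z' = f (H z')" using primE[OF K 1] by blast
      show ?thesis
        by (rule exI[of _ "V \<inter> A"], rule exI[of _ U], rule exI[of _ f]) (use V 1 AB NA in auto)
    next
      case 2
      obtain V U f where V: "open V" "z \<in> V" "pot U f" "H ` (V \<inter> B) \<subseteq> U"
        "\<And>z'. z' \<in> V \<inter> B \<Longrightarrow> L z' + k = f (H z')" using primE[OF L' 2] by blast
      show ?thesis
        by (rule exI[of _ "V \<inter> B"], rule exI[of _ U], rule exI[of _ f]) (use V 2 AB NB in auto)
    qed
  qed
  then show ?thesis by (rule exI[of "prim H (A \<union> B)"])
qed

lemma prim_local:
  fixes H :: "'z::topological_space \<Rightarrow> 'm"
  assumes H: "continuous_map euclidean X H"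
  obtains V f where "open V" "z \<in> V" "prim H V f"
proof -
  have "H z \<in> topspace X" using H by (auto simp: continuous_map_def)
  then obtain U f where U: "pot U f" "H z \<in> U" using pot_ex by blast
  have "openin euclidean {x \<in> topspace euclidean. H x \<in> U}"
    using openin_continuous_map_preimage[OF H pot_open[OF U(1)]] .
  then have o: "open {x. H x \<in> U}" by simp
  have "prim H {x. H x \<in> U} (\<lambda>z. f (H z))"
  proof (rule primI)
    fix z assume "z \<in> {x. H x \<in> U}"
    then show "\<exists>V U' f'. open V \<and> z \<in> V \<and> pot U' f' \<and> H ` (V \<inter> {x. H x \<in> U}) \<subseteq> U' \<and>
        (\<forall>z'\<in>V \<inter> {x. H x \<in> U}. f (H z') = f' (H z'))"
      by (intro exI[of _ "{x. H x \<in> U}"] exI[of _ U] exI[of _ f]) (use o U in auto)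
  qed
  then show ?thesis using that o U(2) by blast
qed

text \<open>Compactness of the square in the form of bisection, first along a row and then over
  rows. Pieces meet in rectangles, which are connected, so \<open>prim_glue\<close> applies.\<close>

lemma prim_square:
  fixes H :: "real \<times> real \<Rightarrow> 'm"
  assumes H: "continuous_map euclidean X H"
  shows "\<exists>K. prim H ({0..1} \<times> {0..1}) K"
proof -
  \<comment> \<open>The margin \<open>e\<close> makes the rectangles open and lets two that share an
    edge overlap in a convex neighbourhood of this edge.\<close>
  define R where "R a b s t e = {a - e<..<b + e} \<times> {s - e<..<t + e}" for a b s t e :: real
  have Ro: "open (R a b s t e)" for a b s t e unfolding R_def by (intro open_Times) auto
  have Rsub: "R a b s t e \<subseteq> R a b s t e'" if "e \<le> e'" for a b s t e e'
    using that by (auto simp: R_def)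
  have row: "\<exists>e>0. \<exists>K. prim H (R 0 1 s s e) K" for s
  proof -
    have "(0::real) \<le> 1" by simp
    then show ?thesis
    proof (induction rule: Bolzano[where P="\<lambda>a b. \<exists>e>0. \<exists>K. prim H (R a b s s e) K"])
      case (trans a b c)
      obtain e1 K1 where 1: "e1 > 0" "prim H (R a b s s e1) K1" using trans(1) by blast
      obtain e2 K2 where 2: "e2 > 0" "prim H (R b c s s e2) K2" using trans(2) by blast
      define e where "e = min e1 e2"
      have e: "e > 0" "e \<le> e1" "e \<le> e2" using 1 2 by (auto simp: e_def)
      have i: "R a b s s e \<inter> R b c s s e = R b b s s e" using trans(3,4) by (auto simp: R_def)
      have u: "R a b s s e \<union> R b c s s e = R a c s s e" using trans(3,4) e(1) by (auto simp: R_def)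
      have "topological_space_class.connected (R b b s s e)"
        unfolding R_def by (intro convex_connected convex_Times convex_real_interval)
      then have "\<exists>N. prim H (R a b s s e \<union> R b c s s e) N"
        by (intro prim_glue[OF H Ro Ro _ prim_subset[OF 1(2) Rsub[OF e(2)]] prim_subset[OF 2(2) Rsub[OF e(3)]]])
          (simp add: i)
      then show ?case unfolding u using e(1) by blast
    next
      case (local x)
      obtain V f where V: "open V" "(x, s) \<in> V" "prim H V f" using prim_local[OF H] by blast
      obtain r where r: "r > 0" "ball (x, s) r \<subseteq> V" using V by (meson open_contains_ball)
      have sub: "R a b s s (r / 4) \<subseteq> V" if "a \<le> x" "x \<le> b" "b - a < r / 4" for a b
      proof
        fix z assume "z \<in> R a b s s (r / 4)"
        then obtain y t where z: "z = (y, t)" "a - r / 4 < y" "y < b + r / 4" "s - r / 4 < t" "t < s + r / 4"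
          by (auto simp: R_def)
        have "dist (x, s) z \<le> \<bar>x - y\<bar> + \<bar>s - t\<bar>"
          using sqrt_sum_squares_le_sum_abs[of "x - y" "s - t"] by (simp add: z(1) dist_Pair_Pair dist_real_def)
        also have "\<dots> < r" using z that by (auto simp: abs_real_def)
        finally show "z \<in> V" using r(2) by auto
      qed
      show ?case
        by (intro exI[of _ "r / 4"] conjI allI impI)
          (use r(1) sub prim_subset[OF V(3)] in \<open>auto intro!: exI[of _ "r / 4"] exI[of _ f]\<close>)
    qed
  qed
  \<comment> \<open>The second bisection stacks strips of full width; \<open>row\<close> provides
    them locally.\<close>
  have "\<exists>e>0. \<exists>K. prim H (R 0 1 0 1 e) K"
  proof -
    have "(0::real) \<le> 1" by simp
    then show ?thesis
    proof (induction rule: Bolzano[where P="\<lambda>a b. \<exists>e>0. \<exists>K. prim H (R 0 1 a b e) K"])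
      case (trans a b c)
      obtain e1 K1 where 1: "e1 > 0" "prim H (R 0 1 a b e1) K1" using trans(1) by blast
      obtain e2 K2 where 2: "e2 > 0" "prim H (R 0 1 b c e2) K2" using trans(2) by blast
      define e where "e = min e1 e2"
      have e: "e > 0" "e \<le> e1" "e \<le> e2" using 1 2 by (auto simp: e_def)
      have i: "R 0 1 a b e \<inter> R 0 1 b c e = R 0 1 b b e" using trans(3,4) by (auto simp: R_def)
      have u: "R 0 1 a b e \<union> R 0 1 b c e = R 0 1 a c e" using trans(3,4) e(1) by (auto simp: R_def)
      have "topological_space_class.connected (R 0 1 b b e)"
        unfolding R_def by (intro convex_connected convex_Times convex_real_interval)
      then have "\<exists>N. prim H (R 0 1 a b e \<union> R 0 1 b c e) N"
        by (intro prim_glue[OF H Ro Ro _ prim_subset[OF 1(2) Rsub[OF e(2)]] prim_subset[OF 2(2) Rsub[OF e(3)]]])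
          (simp add: i)
      then show ?case unfolding u using e(1) by blast
    next
      case (local s)
      obtain e K where e: "e > 0" "prim H (R 0 1 s s e) K" using row by blast
      have sub: "R 0 1 a b (e / 2) \<subseteq> R 0 1 s s e" if "a \<le> s" "s \<le> b" "b - a < e / 2" for a b
        using that e(1) by (auto simp: R_def)
      show ?case
        by (intro exI[of _ "e / 2"] conjI allI impI)
          (use e(1) sub prim_subset[OF e(2)] in \<open>auto intro!: exI[of _ "e / 2"] exI[of _ K]\<close>)
    qed
  qed
  then obtain e K where e: "e > 0" "prim H (R 0 1 0 1 e) K" by blast
  have "{0..1} \<times> {0..1} \<subseteq> R 0 1 0 1 e" using e(1) by (auto simp: R_def)
  then show ?thesis using prim_subset[OF e(2)] by blast
qed

text \<open>Extends paths and homotopies given on the unit interval to maps on the whole line or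
  plane, where open rectangles around the square make sense.\<close>

definition clamp01 :: "real \<Rightarrow> real" where "clamp01 t = max 0 (min 1 t)"

lemma clamp01: "clamp01 t \<in> {0..1}" "t \<in> {0..1} \<Longrightarrow> clamp01 t = t"
  by (auto simp: clamp01_def)

lemma continuous_clamp01: "continuous_on S clamp01"
  unfolding clamp01_def by (intro continuous_intros)

lemma pathin_clamp:
  assumes "pathin X g" "continuous_on UNIV h"
  shows "continuous_map euclidean X (\<lambda>t. g (clamp01 (h t)))"
proof -
  have "continuous_on UNIV (\<lambda>t. clamp01 (h t))"
    using continuous_on_compose2[OF continuous_clamp01 assms(2)] by auto
  then have "continuous_map euclidean (top_of_set {0..1}) (\<lambda>t. clamp01 (h t))"
    using clamp01(1) by (simp add: continuous_map_in_subtopology Pi_iff)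
  from continuous_map_compose[OF this] assms(1) show ?thesis by (auto simp: pathin_def o_def)
qed

text \<open>A path is a square that is constant in its second variable.\<close>

lemma prim_path:
  assumes "pathin X g"
  shows "\<exists>K. prim g {0..1} K"
proof -
  have "continuous_map euclidean X (\<lambda>z::real \<times> real. g (clamp01 (fst z)))"
    by (rule pathin_clamp[OF assms]) (intro continuous_intros)
  from prim_square[OF this] obtain K where
    K: "prim (\<lambda>z::real \<times> real. g (clamp01 (fst z))) ({0..1} \<times> {0..1}) K" by blast
  have "prim g {0..1} (\<lambda>t. K (t, 0))"
    by (rule prim_compose[OF K]) (auto intro!: continuous_intros simp: clamp01(2))
  then show ?thesis by blast
qed

lemma prim_path_unique:
  assumes "pathin X g" "prim g {0..1} K" "prim g {0..1} L"
  shows "K 1 - K 0 = L 1 - L 0"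
proof -
  have "topological_space_class.connected {0..(1::real)}" by (rule convex_connected[OF convex_real_interval(5)])
  from prim_unique[OF this assms(1)[unfolded pathin_def] assms(2,3), of 0 1] show ?thesis by simp
qed

lemma prim_const_path:
  fixes g :: "real \<Rightarrow> 'm"
  assumes "\<And>t. t \<in> {0..1} \<Longrightarrow> g t = p" "p \<in> topspace X" "prim g {0..1} K"
  shows "K 1 = K 0"
proof -
  have p: "prim (\<lambda>_. p) {0..1} (\<lambda>t. K t)"
    by (rule prim_compose[OF assms(3) continuous_on_id]) (simp_all add: assms(1))
  obtain U f where U: "pot U f" "p \<in> U" using pot_ex[OF assms(2)] by blast
  have "prim (\<lambda>_. p) {0..1} (\<lambda>_::real. f p)"
    by (rule primI) (intro exI[of _ UNIV] exI[of _ U] exI[of _ f], use U in auto)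
  moreover have "pathin X (\<lambda>_. p)" using assms(2) by simp
  ultimately show ?thesis using prim_path_unique[OF _ p] by fastforce
qed

text \<open>Continue along a contraction of the loop. Three sides of the square are constant paths
  and have increment zero, hence so has the fourth, the loop; by \<open>prim_path_unique\<close> its
  increment is that of \<open>K\<close>.\<close>

lemma prim_loop:
  assumes sc: "simply_connected_space X" and g: "pathin X g" "g 0 = g 1" and K: "prim g {0..1} K"
  shows "K 1 = K 0"
proof -
  have "homotopic_with (\<lambda>q. q 0 = g 0 \<and> q 1 = g 0) (top_of_set {0..1}) X g (\<lambda>_. g 0)"
    using sc g unfolding simply_connected_space_def by blast
  then obtain h :: "real \<times> real \<Rightarrow> 'm" where h': "continuous_map (prod_topology (top_of_set {0..1}) (top_of_set {0..1})) X h"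
    "\<forall>x. h (0, x) = g x" "\<forall>x. h (1, x) = g 0" "\<forall>t\<in>{0..1}. h (t, 0) = g 0 \<and> h (t, 1) = g 0"
    unfolding homotopic_with_def by (elim exE conjE) (rule that)
  have h: "continuous_map (prod_topology (top_of_set {0..1}) (top_of_set {0..1})) X h"
    "h (0, x) = g x" "h (1, x) = g 0" "t \<in> {0..1} \<Longrightarrow> h (t, 0) = g 0 \<and> h (t, 1) = g 0" for x t
    using h' by blast+
  have cl: "continuous_map euclidean (top_of_set {0..1}) (\<lambda>z. clamp01 (k z))" if "continuous_on UNIV k"
    for k :: "real \<times> real \<Rightarrow> real"
  proof -
    have "continuous_on UNIV (\<lambda>t. clamp01 (k t))"
      using continuous_on_compose2[OF continuous_clamp01 that] by auto
    then show ?thesis using clamp01(1) by (simp add: continuous_map_in_subtopology Pi_iff)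
  qed
  have "continuous_map euclidean (prod_topology (top_of_set {0..1}) (top_of_set {0..1}))
      (\<lambda>z::real \<times> real. (clamp01 (fst z), clamp01 (snd z)))"
    by (intro continuous_map_pairedI cl continuous_on_fst continuous_on_snd continuous_on_id)
  from continuous_map_compose[OF this h(1)]
  have "continuous_map euclidean X (\<lambda>z. h (clamp01 (fst z), clamp01 (snd z)))" by (simp add: o_def)
  from prim_square[OF this] obtain L where
    L: "prim (\<lambda>z. h (clamp01 (fst z), clamp01 (snd z))) ({0..1} \<times> {0..1}) L" by blast
  have g0: "g 0 \<in> topspace X" using g(1) by (rule path_start_in_topspace)
  have "prim (\<lambda>_. g 0) {0..1} (\<lambda>t. L (t, 0))"
    by (rule prim_compose[OF L]) (auto intro!: continuous_intros simp: clamp01(2) h(4))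
  then have 1: "L (1, 0) = L (0, 0)" using prim_const_path[OF refl g0] by blast
  have "prim (\<lambda>_. g 0) {0..1} (\<lambda>t. L (t, 1))"
    by (rule prim_compose[OF L]) (auto intro!: continuous_intros simp: clamp01(2) h(4))
  then have 2: "L (1, 1) = L (0, 1)" using prim_const_path[OF refl g0] by blast
  have "prim (\<lambda>_. g 0) {0..1} (\<lambda>t. L (1, t))"
    by (rule prim_compose[OF L]) (auto intro!: continuous_intros simp: clamp01(2) h(3))
  then have 3: "L (1, 1) = L (1, 0)" using prim_const_path[OF refl g0] by blast
  have "prim g {0..1} (\<lambda>t. L (0, t))"
    by (rule prim_compose[OF L]) (auto intro!: continuous_intros simp: clamp01(2) h(2))
  from prim_path_unique[OF g(1) K this] show ?thesis using 1 2 3 by simp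
qed

text \<open>\<open>F\<close> is the increment along a chosen path from a base point. For a neighbour
  \<open>q\<close> of \<open>p\<close>, the loop that goes to \<open>p\<close>, over to
  \<open>q\<close> inside \<open>U\<close>, and back has increment zero, so \<open>F\<close> and the
  local function differ on \<open>U\<close> by a constant.\<close>

theorem global_primitive:
  assumes sc: "simply_connected_space X"
  shows "\<exists>F. \<forall>p\<in>topspace X. \<exists>U f. pot U f \<and> p \<in> U \<and> (\<forall>q\<in>U. F q = f q)"
proof (cases "topspace X = {}")
  case False
  then obtain p0 where p0: "p0 \<in> topspace X" by blast
  have "\<forall>p. \<exists>g. p \<in> topspace X \<longrightarrow> pathin X g \<and> g 0 = p0 \<and> g 1 = p"
    using sc p0 unfolding simply_connected_space_def path_connected_space_def by blast
  from choice[OF this] obtain g where g: "\<And>p. p \<in> topspace X \<Longrightarrow> pathin X (g p) \<and> g p 0 = p0 \<and> g p 1 = p"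
    by blast
  have "\<forall>p. \<exists>K. p \<in> topspace X \<longrightarrow> prim (g p) {0..1} K" using g prim_path by blast
  from choice[OF this] obtain K where K: "\<And>p. p \<in> topspace X \<Longrightarrow> prim (g p) {0..1} (K p)" by blast
  define F where "F p = K p 1 - K p 0" for p
  have "\<exists>U f. pot U f \<and> p \<in> U \<and> (\<forall>q\<in>U. F q = f q)" if p: "p \<in> topspace X" for p
  proof -
    obtain U f where U: "pot U f" "p \<in> U" "path_connectedin X U" using pot_ex[OF p] by blast
    have "F q = f q + (F p - f p)" if q: "q \<in> U" for q
    proof -
      have qX: "q \<in> topspace X" using q openin_subset[OF pot_open[OF U(1)]] by blast
      have "\<exists>s. pathin X s \<and> s \<in> {0..1} \<rightarrow> U \<and> s 0 = p \<and> s 1 = q"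
        using U(2,3) q unfolding path_connectedin by blast
      then obtain s where s: "pathin X s" "s \<in> {0..1} \<rightarrow> U" "s 0 = p" "s 1 = q" by blast
      \<comment> \<open>The path to \<open>p\<close>, the short path \<open>s\<close>, and the
        reversed path to \<open>q\<close>, each on one third of the interval.\<close>
      define l where "l t = (if t \<le> 1/3 then g p (clamp01 (3 * t)) else
        if t \<le> 2/3 then s (clamp01 (3 * t - 1)) else g q (clamp01 (3 - 3 * t)))" for t
      have ccl: "clamp01 0 = 0" "clamp01 1 = 1" by (simp_all add: clamp01_def)
      have "continuous_map euclidean X l"
        unfolding l_def
      proof (rule continuous_map_cases_le)
        show "continuous_map (subtopology euclidean {x \<in> topspace euclidean. x \<le> 1/3}) X
            (\<lambda>t. g p (clamp01 (3 * t)))"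
          by (intro continuous_map_from_subtopology pathin_clamp continuous_intros) (use g p in blast)
        show "continuous_map (subtopology euclidean {x \<in> topspace euclidean. 1/3 \<le> x}) X
            (\<lambda>t. if t \<le> 2/3 then s (clamp01 (3 * t - 1)) else g q (clamp01 (3 - 3 * t)))"
        proof (rule continuous_map_from_subtopology, rule continuous_map_cases_le)
          show "continuous_map (subtopology euclidean {x \<in> topspace euclidean. x \<le> 2/3}) X
              (\<lambda>t. s (clamp01 (3 * t - 1)))"
            by (intro continuous_map_from_subtopology pathin_clamp continuous_intros s(1))
          show "continuous_map (subtopology euclidean {x \<in> topspace euclidean. 2/3 \<le> x}) X
              (\<lambda>t. g q (clamp01 (3 - 3 * t)))"
            by (intro continuous_map_from_subtopology pathin_clamp continuous_intros) (use g qX in blast)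
          fix t :: real assume t: "t = 2/3"
          show "s (clamp01 (3 * t - 1)) = g q (clamp01 (3 - 3 * t))"
            unfolding t using g[OF qX] s by (simp add: ccl)
        qed (auto simp: continuous_map_id[unfolded id_def])
        fix t :: real assume t: "t = 1/3"
        show "g p (clamp01 (3 * t)) = (if t \<le> 2/3 then s (clamp01 (3 * t - 1)) else g q (clamp01 (3 - 3 * t)))"
          unfolding t using g[OF p] s by (simp add: ccl)
      qed (auto simp: continuous_map_id[unfolded id_def])
      then have lp: "pathin X l" unfolding pathin_def by (rule continuous_map_from_subtopology)
      obtain N where N: "prim l {0..1} N" using prim_path[OF lp] by blast
      have "l 0 = p0" "l 1 = p0" using g[OF p] g[OF qX] by (simp_all add: l_def ccl)
      then have N01: "N 1 = N 0" using prim_loop[OF sc lp _ N] by simp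
      have "prim (g p) {0..1} (\<lambda>t. N (t / 3))"
        by (rule prim_compose[OF N]) (auto intro!: continuous_intros simp: l_def clamp01(2))
      from prim_path_unique[OF _ this K[OF p]] have 1: "N (1/3) - N 0 = F p"
        using g[OF p] by (simp add: F_def)
      have "prim s {0..1} (\<lambda>t. N ((t + 1) / 3))"
      proof (rule prim_compose[OF N])
        fix t :: real assume t: "t \<in> {0..1}"
        show "s t = l ((t + 1) / 3)"
        proof (cases "t = 0")
          case True
          then show ?thesis using s(3) g[OF p] by (simp add: l_def ccl)
        next
          case False
          then have "\<not> (t + 1) / 3 \<le> 1/3" "(t + 1) / 3 \<le> 2/3" using t by (auto simp: field_simps)
          then have "l ((t + 1) / 3) = s (clamp01 (3 * ((t + 1) / 3) - 1))"
            by (simp only: l_def if_False if_True)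
          also have "3 * ((t + 1) / 3) - 1 = t" by (simp add: field_simps)
          finally show ?thesis by (simp only: clamp01(2)[OF t])
        qed
      qed (auto intro!: continuous_intros)
      moreover have "prim s {0..1} (\<lambda>t. f (s t))"
        by (rule primI) (intro exI[of _ UNIV] exI[of _ U] exI[of _ f], use U s(2) in auto)
      ultimately have "N ((1 + 1) / 3) - N ((0 + 1) / 3) = f (s 1) - f (s 0)"
        by (rule prim_path_unique[OF s(1)])
      then have 2: "N (2/3) - N (1/3) = f q - f p" using s by simp
      have "prim (g q) {0..1} (\<lambda>t. N (1 - t / 3))"
      proof (rule prim_compose[OF N])
        fix t :: real assume t: "t \<in> {0..1}"
        show "g q t = l (1 - t / 3)"
        proof (cases "t = 1")
          case True
          then show ?thesis using s(4) g[OF qX] by (simp add: l_def ccl)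
        next
          case False
          then have "\<not> 1 - t / 3 \<le> 1/3" "\<not> 1 - t / 3 \<le> 2/3" using t by (auto simp: field_simps)
          then have "l (1 - t / 3) = g q (clamp01 (3 - 3 * (1 - t / 3)))"
            by (simp only: l_def if_False if_True)
          also have "3 - 3 * (1 - t / 3) = t" by (simp add: field_simps)
          finally show ?thesis by (simp only: clamp01(2)[OF t])
        qed
      qed (auto intro!: continuous_intros)
      from prim_path_unique[OF _ this K[OF qX]] have 3: "N (2/3) - N 1 = F q"
        using g[OF qX] by (simp add: F_def)
      show ?thesis using 1 2 3 N01 by simp
    qed
    then show ?thesis using pot_add[OF U(1), of "F p - f p"] U(2) by blast
  qed
  then show ?thesis by blast
qed auto

end

section \<open>Smooth functions on manifolds\<close>

lemma partial_deriv_cong: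
  assumes W: "eopen d W" "x \<in> W" "i < d" and fg: "\<And>y. y \<in> W \<Longrightarrow> f y = g y"
  shows "partial_deriv i f x = partial_deriv i g x"
  unfolding partial_deriv_def
proof (rule deriv_cong_ev)
  show "eventually (\<lambda>t. f (x(i := t)) = g (x(i := t))) (nhds (x i))"
    using eventually_upd[OF W] by eventually_elim (rule fg)
qed simp

text \<open>Functions stay on the manifold and coordinates appear only inside this definition, so
  that frames, products and derivatives can be written at points.\<close>

definition smooth_in :: "'m mfd \<Rightarrow> 'm chart \<Rightarrow> 'm set \<Rightarrow> ('m \<Rightarrow> real) \<Rightarrow> bool" where
  "smooth_in M c U f \<longleftrightarrow> smooth_fun_on (mdim M) (snd c ` U) (\<lambda>x. f (chart_inv c x))"

locale smooth_mfd =
  fixes M :: "'m mfd"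
  assumes smooth_manifold: "smooth_manifold M"
begin

abbreviation dm :: nat where "dm \<equiv> mdim M"

lemma chart:
  assumes "c \<in> matlas M"
  shows chart_open: "openin (mtop M) (fst c)"
    and chart_image: "eopen dm (snd c ` fst c)"
    and chart_homeo: "homeomorphic_map (subtopology (mtop M) (fst c))
      (subtopology (Euclidean_space dm) (snd c ` fst c)) (snd c)"
  using smooth_manifold assms openin_Euclidean_space_iff unfolding smooth_manifold_def
  by (auto simp: case_prod_beta)

lemma chart_ex: "p \<in> topspace (mtop M) \<Longrightarrow> \<exists>c\<in>matlas M. p \<in> fst c"
  using smooth_manifold unfolding smooth_manifold_def by auto

lemma chart_topspace: "c \<in> matlas M \<Longrightarrow> p \<in> fst c \<Longrightarrow> p \<in> topspace (mtop M)"
  using openin_subset[OF chart_open] by blast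

lemma chart_topspace_sub: "c \<in> matlas M \<Longrightarrow> topspace (subtopology (mtop M) (fst c)) = fst c"
  using openin_subset[OF chart_open, of c] by (simp add: Int_absorb1)

lemma chart_inj: "c \<in> matlas M \<Longrightarrow> inj_on (snd c) (fst c)"
  using homeomorphic_imp_injective_map[OF chart_homeo] chart_topspace_sub by metis

lemma chart_inv_left: "c \<in> matlas M \<Longrightarrow> p \<in> fst c \<Longrightarrow> chart_inv c (snd c p) = p"
  unfolding chart_inv_def by (rule inv_into_f_f[OF chart_inj])

lemma chart_coord: "c \<in> matlas M \<Longrightarrow> p \<in> fst c \<Longrightarrow> snd c p \<in> coord_space dm"
  using eopen_sub[OF chart_image] by blast

lemma chart_image_open:
  assumes c: "c \<in> matlas M" and U: "openin (mtop M) U" "U \<subseteq> fst c"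
  shows "eopen dm (snd c ` U)"
proof -
  have "openin (subtopology (mtop M) (fst c)) U"
    using U openin_open_subtopology[OF chart_open[OF c]] by blast
  then have "openin (subtopology (Euclidean_space dm) (snd c ` fst c)) (snd c ` U)"
    using homeomorphic_imp_open_map[OF chart_homeo[OF c]] by (simp add: open_map_def)
  moreover have "openin (Euclidean_space dm) (snd c ` fst c)"
    using chart_image[OF c] openin_Euclidean_space_iff by blast
  ultimately show ?thesis
    using openin_open_subtopology openin_Euclidean_space_iff by blast
qed

lemma chart_preimage_open:
  assumes c: "c \<in> matlas M" and V: "eopen dm V"
  shows "openin (mtop M) {p \<in> fst c. snd c p \<in> V}"
proof -
  have "openin (subtopology (Euclidean_space dm) (snd c ` fst c)) (snd c ` fst c \<inter> V)"
    using V openin_Euclidean_space_iff openin_subtopology_Int2 by blast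
  from openin_continuous_map_preimage[OF homeomorphic_imp_continuous_map[OF chart_homeo[OF c]] this]
  have "openin (subtopology (mtop M) (fst c)) {p \<in> fst c. snd c p \<in> snd c ` fst c \<inter> V}"
    by (simp only: chart_topspace_sub[OF c])
  moreover have "{p \<in> fst c. snd c p \<in> snd c ` fst c \<inter> V} = {p \<in> fst c. snd c p \<in> V}" by auto
  ultimately show ?thesis
    using openin_open_subtopology[OF chart_open[OF c]] by simp
qed

lemma chart_inv_continuous:
  assumes c: "c \<in> matlas M"
  shows "continuous_map (top_of_set (snd c ` fst c)) (mtop M) (chart_inv c)"
proof -
  obtain g where g: "homeomorphic_maps (subtopology (mtop M) (fst c))
      (subtopology (Euclidean_space dm) (snd c ` fst c)) (snd c) g"
    using chart_homeo[OF c] homeomorphic_map_maps by blast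
  have sub: "subtopology (Euclidean_space dm) (snd c ` fst c) = top_of_set (snd c ` fst c)"
    unfolding Euclidean_space_eq subtopology_subtopology
    using eopen_sub[OF chart_image[OF c]] by (simp add: Int_absorb1)
  have "continuous_map (top_of_set (snd c ` fst c)) (mtop M) g"
    using g unfolding homeomorphic_maps_def sub by (simp add: continuous_map_in_subtopology)
  then show ?thesis
  proof (rule continuous_map_eq)
    fix x assume "x \<in> topspace (top_of_set (snd c ` fst c))"
    then obtain p where p: "p \<in> fst c" "x = snd c p" by auto
    then have "g x = p" using g chart_topspace_sub[OF c] unfolding homeomorphic_maps_def by simp
    then show "g x = chart_inv c x" using p chart_inv_left[OF c] by simp
  qed
qed

lemma smooth_in_cong:
  assumes c: "c \<in> matlas M" and U: "openin (mtop M) U" "U \<subseteq> fst c"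
    and fg: "\<And>p. p \<in> U \<Longrightarrow> f p = g p" and f: "smooth_in M c U f"
  shows "smooth_in M c U g"
proof -
  have "f (chart_inv c x) = g (chart_inv c x)" if "x \<in> snd c ` U" for x
    using that fg chart_inv_left[OF c] U(2) by auto
  from smooth_fun_on_cong[OF chart_image_open[OF c U] this] show ?thesis
    using f unfolding smooth_in_def by simp
qed

lemma smooth_in_subset: "smooth_in M c U f \<Longrightarrow> V \<subseteq> U \<Longrightarrow> smooth_in M c V f"
  unfolding smooth_in_def by (rule smooth_fun_on_subset) auto

lemma chart_deriv_cong:
  assumes c: "c \<in> matlas M" and U: "openin (mtop M) U" "U \<subseteq> fst c" "p \<in> U" "i < dm"
    and fg: "\<And>p. p \<in> U \<Longrightarrow> f p = g p"
  shows "chart_deriv c i f p = chart_deriv c i g p"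
  unfolding chart_deriv_def
proof (rule partial_deriv_cong[OF chart_image_open[OF c U(1,2)] _ U(4)])
  fix y assume "y \<in> snd c ` U"
  then show "f (chart_inv c y) = g (chart_inv c y)" using fg chart_inv_left[OF c] U(2) by auto
qed (use U in auto)

lemma chart_deriv_inv:
  assumes "c \<in> matlas M" "x \<in> snd c ` fst c"
  shows "chart_deriv c i f (chart_inv c x) = partial_deriv i (\<lambda>x. f (chart_inv c x)) x"
  using assms chart_inv_left[OF assms(1)] by (auto simp: chart_deriv_def)

text \<open>Connects analysis with the algebraic locale. \<open>D_comm\<close> is the symmetry of
  second derivatives, and \<open>D_cong\<close> holds because \<open>U\<close> is open.\<close>

lemma derivations:
  assumes c: "c \<in> matlas M" and U: "openin (mtop M) U" "U \<subseteq> fst c"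
  shows "derivation_algebra dm U {f. smooth_in M c U f} (chart_deriv c)"
proof -
  note W = chart_image_open[OF c U]
  have xW: "snd c p \<in> snd c ` U" if "p \<in> U" for p using that by blast
  show ?thesis
  proof
    show "(\<lambda>_. k) \<in> {f. smooth_in M c U f}" for k
      using smooth_fun_on_intros(1)[OF W] by (simp add: smooth_in_def)
    show "(\<lambda>p. f p + g p) \<in> {f. smooth_in M c U f}"
      if "f \<in> {f. smooth_in M c U f}" "g \<in> {f. smooth_in M c U f}" for f g
      using that smooth_fun_on_intros(3)[OF W] by (simp add: smooth_in_def)
    show "(\<lambda>p. f p * g p) \<in> {f. smooth_in M c U f}"
      if "f \<in> {f. smooth_in M c U f}" "g \<in> {f. smooth_in M c U f}" for f g
      using that smooth_fun_on_intros(4)[OF W] by (simp add: smooth_in_def)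
    show "chart_deriv c i f \<in> {f. smooth_in M c U f}" if "i < dm" "f \<in> {f. smooth_in M c U f}" for i f
    proof -
      have "smooth_fun_on dm (snd c ` U) (partial_deriv i (\<lambda>x. f (chart_inv c x)))"
        using that smooth_fun_on_partial_deriv by (simp add: smooth_in_def)
      moreover have "partial_deriv i (\<lambda>x. f (chart_inv c x)) x = chart_deriv c i f (chart_inv c x)"
        if "x \<in> snd c ` U" for x using chart_deriv_inv[OF c] that U(2) by auto
      ultimately show ?thesis
        unfolding smooth_in_def mem_Collect_eq
        using smooth_fun_on_cong[OF W, of "partial_deriv i (\<lambda>x. f (chart_inv c x))"
          "\<lambda>x. chart_deriv c i f (chart_inv c x)"] by simp
    qed
    show "chart_deriv c i (\<lambda>_. k) p = 0" for i p k
      by (simp add: chart_deriv_def partial_deriv_def)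
    fix i p assume i: "i < dm" and p: "p \<in> U"
    have D: "((\<lambda>t. f (chart_inv c ((snd c p)(i := t)))) has_real_derivative chart_deriv c i f p) (at (snd c p i))"
      if "f \<in> {f. smooth_in M c U f}" for f
      using partials_onD[OF smooth_fun_on_partials i xW[OF p]] that
      unfolding smooth_in_def chart_deriv_def by auto
    have eq: "(snd c p)(i := snd c p i) = snd c p" by simp
    fix f g
    show "chart_deriv c i (\<lambda>q. f q + g q) p = chart_deriv c i f p + chart_deriv c i g p"
      if "f \<in> {f. smooth_in M c U f}" "g \<in> {f. smooth_in M c U f}"
      using DERIV_imp_deriv[OF DERIV_add[OF D[OF that(1)] D[OF that(2)]]]
      by (simp add: chart_deriv_def[of c i "\<lambda>q. f q + g q"] partial_deriv_def)
    show "chart_deriv c i (\<lambda>q. f q * g q) p = chart_deriv c i f p * g p + f p * chart_deriv c i g p"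
      if "f \<in> {f. smooth_in M c U f}" "g \<in> {f. smooth_in M c U f}"
      using DERIV_imp_deriv[OF DERIV_mult[OF D[OF that(1)] D[OF that(2)]]] p U(2)
      by (auto simp: chart_deriv_def[of c i "\<lambda>q. f q * g q"] partial_deriv_def chart_inv_left[OF c])
    show "chart_deriv c i f p = chart_deriv c i g p" if "\<And>q. q \<in> U \<Longrightarrow> f q = g q"
      by (rule chart_deriv_cong[OF c U p i that])
    fix j assume j: "j < dm"
    show "chart_deriv c i (chart_deriv c j f) p = chart_deriv c j (chart_deriv c i f) p"
      if "f \<in> {f. smooth_in M c U f}"
    proof -
      let ?F = "\<lambda>x. f (chart_inv c x)"
      have F: "Ck_on 2 dm (snd c ` U) ?F" using that by (simp add: smooth_in_def smooth_fun_on_def)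
      have s: "chart_deriv c i (chart_deriv c j f) p = partial_deriv i (partial_deriv j ?F) (snd c p)"
        if "i < dm" for i j
        unfolding chart_deriv_def[of c i]
      proof (rule partial_deriv_cong[OF W xW[OF p] that])
        show "chart_deriv c j f (chart_inv c y) = partial_deriv j ?F y" if "y \<in> snd c ` U" for y
          using chart_deriv_inv[OF c] that U(2) by auto
      qed
      show ?thesis unfolding s[OF i] s[OF j] by (rule partial_deriv_commute[OF W xW[OF p] F i j])
    qed
  qed
qed

text \<open>With \<open>F\<close> the identity this is the change of charts, with a left translation
  it serves invariance.\<close>

lemma chain_rule:
  assumes c: "c \<in> matlas M" "c' \<in> matlas M"
    and U: "openin (mtop M) U" "U \<subseteq> fst c" and V: "openin (mtop M) V" "V \<subseteq> fst c'"
    and F: "\<And>p. p \<in> U \<Longrightarrow> F p \<in> V" "\<And>j. j < dm \<Longrightarrow> smooth_in M c U (\<lambda>q. snd c' (F q) j)"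
    and f: "smooth_in M c' V f"
  shows "smooth_in M c U (\<lambda>q. f (F q))"
    and "p \<in> U \<Longrightarrow> i < dm \<Longrightarrow>
      chart_deriv c i (\<lambda>q. f (F q)) p = (\<Sum>j<dm. jacobian F c c' p i j * chart_deriv c' j f (F p))"
proof -
  note W = chart_image_open[OF c(1) U] and W' = chart_image_open[OF c(2) V]
  let ?\<phi> = "\<lambda>x. snd c' (F (chart_inv c x))"
  let ?F = "\<lambda>x. f (chart_inv c' x)"
  have mem: "?\<phi> x \<in> snd c' ` V" if xU: "x \<in> snd c ` U" for x
  proof -
    obtain q where q: "q \<in> U" "x = snd c q" using xU by blast
    have "chart_inv c x = q" using q chart_inv_left[OF c(1)] U(2) by blast
    then show ?thesis using F(1)[OF q(1)] by simp
  qed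
  have eq: "?F (?\<phi> x) = f (F (chart_inv c x))" if xU: "x \<in> snd c ` U" for x
  proof -
    obtain q where q: "q \<in> U" "x = snd c q" using xU by blast
    have "chart_inv c x = q" using q chart_inv_left[OF c(1)] U(2) by blast
    moreover have "F q \<in> fst c'" using F(1)[OF q(1)] V(2) by blast
    ultimately show ?thesis by (simp add: chart_inv_left[OF c(2)])
  qed
  have \<phi>: "smooth_fun_on dm (snd c ` U) (\<lambda>x. ?\<phi> x j)" if "j < dm" for j
    using F(2)[OF that] by (simp add: smooth_in_def)
  have f': "smooth_fun_on dm (snd c' ` V) ?F" using f by (simp add: smooth_in_def)
  have "smooth_fun_on dm (snd c ` U) (\<lambda>x. ?F (?\<phi> x))"
    by (rule smooth_fun_on_compose[OF W' W mem f' \<phi>])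
  then show "smooth_in M c U (\<lambda>q. f (F q))"
    unfolding smooth_in_def using smooth_fun_on_cong[OF W eq] by simp
  assume p: "p \<in> U" and i: "i < dm"
  have "chart_deriv c i (\<lambda>q. f (F q)) p = partial_deriv i (\<lambda>x. ?F (?\<phi> x)) (snd c p)"
    unfolding chart_deriv_def using p by (intro partial_deriv_cong[OF W _ i] eq[symmetric]) auto
  also have "\<dots> = (\<Sum>j<dm. partial_deriv j ?F (?\<phi> (snd c p)) * partial_deriv i (\<lambda>x. ?\<phi> x j) (snd c p))"
    using p by (intro partial_deriv_compose[OF W' W mem f' \<phi> i]) auto
  also have "\<dots> = (\<Sum>j<dm. jacobian F c c' p i j * chart_deriv c' j f (F p))"
    using p U(2) by (simp add: jacobian_def chart_deriv_def chart_inv_left[OF c(1) subsetD[OF U(2) p]] mult.commute)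
  finally show "chart_deriv c i (\<lambda>q. f (F q)) p = (\<Sum>j<dm. jacobian F c c' p i j * chart_deriv c' j f (F p))" .
qed

lemma transition_smooth:
  assumes c: "c \<in> matlas M" "c' \<in> matlas M" and j: "j < dm"
  shows "smooth_in M c (fst c \<inter> fst c') (\<lambda>q. snd c' q j)"
  using smooth_manifold assms unfolding smooth_manifold_def smooth_in_def by blast

lemma chart_deriv_coord:
  assumes c: "c \<in> matlas M" and p: "p \<in> fst c" and i: "i < dm"
  shows "chart_deriv c i (\<lambda>q. snd c q j) p = (if i = j then 1 else 0)"
proof -
  have "chart_deriv c i (\<lambda>q. snd c q j) p = partial_deriv i (\<lambda>x. x j) (snd c p)"
    unfolding chart_deriv_def
    by (rule partial_deriv_cong[OF chart_image[OF c] _ i]) (use p chart_inv_left[OF c] in auto)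
  also have "\<dots> = (if i = j then 1 else 0)"
    unfolding partial_deriv_def by (rule DERIV_imp_deriv) (auto intro!: derivative_eq_intros)
  finally show ?thesis .
qed

lemma smooth_inI_partials:
  assumes c: "c \<in> matlas M" and U: "openin (mtop M) U" "U \<subseteq> fst c"
    and f: "\<And>p i. p \<in> U \<Longrightarrow> i < dm \<Longrightarrow>
      ((\<lambda>t. f (chart_inv c ((snd c p)(i := t)))) has_real_derivative h i p) (at (snd c p i))"
    and h: "\<And>i. i < dm \<Longrightarrow> smooth_in M c U (h i)"
  shows "smooth_in M c U f"
  unfolding smooth_in_def
proof (rule smooth_fun_onI_partials[OF chart_image_open[OF c U]])
  show "partials_on dm (snd c ` U) (\<lambda>x. f (chart_inv c x)) (\<lambda>i x. h i (chart_inv c x))"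
    unfolding partials_on_def
  proof (intro allI impI ballI)
    fix i x assume i: "i < dm" and "x \<in> snd c ` U"
    then obtain p where p: "p \<in> U" "x = snd c p" by blast
    show "((\<lambda>t. f (chart_inv c (x(i := t)))) has_real_derivative h i (chart_inv c x)) (at (x i))"
      using f[OF p(1) i] chart_inv_left[OF c] p U(2) by auto
  qed
qed (use h in \<open>simp add: smooth_in_def\<close>)

end

section \<open>The Poincare lemma on boxes\<close>

text \<open>The primitive is the integral of the form along the segment from the centre
  \<open>x0\<close>. Differentiating under the integral and using closedness turns the integrand
  into a derivative in the segment parameter.\<close>

lemma poincare_box:
  assumes x0: "x0 \<in> coord_space d" and e: "e > 0"
    and h: "\<And>i. i < d \<Longrightarrow> smooth_fun_on d (ebox d x0 e) (h i)"
    and cl: "\<And>i j x. i < d \<Longrightarrow> j < d \<Longrightarrow> x \<in> ebox d x0 e \<Longrightarrow>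
      partial_deriv i (h j) x = partial_deriv j (h i) x"
  shows "\<exists>f. partials_on d (ebox d x0 e) f h"
proof -
  let ?W = "ebox d x0 e"
  note W = eopen_ebox[of d x0 e]
  define g where "g s y = (\<lambda>l. x0 l + s * (y l - x0 l))" for s :: real and y :: "nat \<Rightarrow> real"
  have gW: "g s y \<in> ?W" if "y \<in> ?W" "0 \<le> s" "s \<le> 1" for s y
    unfolding ebox_def
  proof (intro CollectI conjI allI impI)
    show "g s y \<in> coord_space d" using that x0 by (auto simp: g_def ebox_def coord_space_def)
    fix l assume "l < d"
    then have yl: "\<bar>y l - x0 l\<bar> < e" using that by (auto simp: ebox_def)
    have "\<bar>g s y l - x0 l\<bar> \<le> 1 * \<bar>y l - x0 l\<bar>"
      unfolding g_def by (simp only: add_diff_cancel_left' abs_mult) (use that in \<open>intro mult_right_mono; simp\<close>)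
    also have "\<dots> < e" using yl by simp
    finally show "\<bar>g s y l - x0 l\<bar> < e" .
  qed
  define F where "F y = integral (cbox 0 1) (\<lambda>s. \<Sum>i<d. (y i - x0 i) * h i (g s y))" for y
  have "partials_on d ?W F h"
    unfolding partials_on_def
  proof (intro allI impI ballI)
    fix j x assume j: "j < d" and x: "x \<in> ?W"
    have xc: "x \<in> coord_space d" using x by (simp add: ebox_def)
    \<comment> \<open>The admissible values of coordinate \<open>j\<close>. Differentiation under
      the integral takes place on this open convex set.\<close>
    define T where "T = ball (x0 j) e"
    have xT: "x j \<in> T" using x j by (auto simp: T_def ebox_def dist_real_def abs_minus_commute)
    have upd: "x(j := r) \<in> ?W" if "r \<in> T" for r
      using x that j by (auto simp: T_def ebox_def dist_real_def abs_minus_commute coord_space_def)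
    let ?fx = "\<lambda>r s. h j (g s (x(j := r))) +
      (\<Sum>i<d. ((x(j := r)) i - x0 i) * (partial_deriv j (h i) (g s (x(j := r))) * s))"
    have hp: "partials_on d ?W (h i) (\<lambda>l. partial_deriv l (h i))" if "i < d" for i
      by (rule smooth_fun_on_partials[OF h[OF that]])
    have hc: "continuous_on ?W (partial_deriv l (h i))" if "i < d" "l < d" for i l
      by (rule smooth_fun_on_continuous[OF smooth_fun_on_partial_deriv[OF h[OF that(1)] that(2)]])
    have dh: "((\<lambda>r. h i (g s (x(j := r)))) has_real_derivative partial_deriv j (h i) (g s (x(j := r))) * s) (at r)"
      if i: "i < d" and s: "0 \<le> s" "s \<le> 1" and r: "r \<in> T" for i s r
    proof -
      have "((\<lambda>r. h i (g s (x(j := r)))) has_real_derivative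
          (\<Sum>l<d. partial_deriv l (h i) (g s (x(j := r))) * (if l = j then s else 0))) (at r)"
      proof (rule partials_on_curve[OF W hp[OF i] hc[OF i]])
        show "((\<lambda>t. g s (x(j := t)) l) has_real_derivative (if l = j then s else 0)) (at r)" for l
          unfolding g_def by (auto intro!: derivative_eq_intros)
        have "eventually (\<lambda>t. t \<in> T) (nhds r)"
          using r by (intro eventually_nhds_in_open) (auto simp: T_def)
        then show "eventually (\<lambda>t. g s (x(j := t)) \<in> ?W) (nhds r)"
          by eventually_elim (use gW upd s in blast)
      qed
      also have "(\<Sum>l<d. partial_deriv l (h i) (g s (x(j := r))) * (if l = j then s else 0)) =
          partial_deriv j (h i) (g s (x(j := r))) * s"
        using j by (simp add: if_distrib cong: if_cong)
      finally show ?thesis .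
    qed
    have dF: "((\<lambda>r. \<Sum>i<d. ((x(j := r)) i - x0 i) * h i (g s (x(j := r)))) has_real_derivative ?fx r s) (at r)"
      if s: "0 \<le> s" "s \<le> 1" and r: "r \<in> T" for s r
    proof -
      have "((\<lambda>r. \<Sum>i<d. ((x(j := r)) i - x0 i) * h i (g s (x(j := r)))) has_real_derivative
         (\<Sum>i<d. (if i = j then 1 else 0) * h i (g s (x(j := r))) +
           (partial_deriv j (h i) (g s (x(j := r))) * s) * ((x(j := r)) i - x0 i))) (at r)"
      proof (rule DERIV_sum, rule DERIV_mult)
        fix i assume "i \<in> {..<d}"
        then show "((\<lambda>r. h i (g s (x(j := r)))) has_real_derivative
            partial_deriv j (h i) (g s (x(j := r))) * s) (at r)" by (intro dh s r) simp
        show "((\<lambda>r. (x(j := r)) i - x0 i) has_real_derivative (if i = j then 1 else 0)) (at r)"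
          by (auto intro!: derivative_eq_intros)
      qed
      also have "(\<Sum>i<d. (if i = j then 1 else 0) * h i (g s (x(j := r))) +
           (partial_deriv j (h i) (g s (x(j := r))) * s) * ((x(j := r)) i - x0 i)) = ?fx r s"
      proof -
        have "(\<Sum>i<d. (if i = j then 1 else 0) * h i (g s (x(j := r)))) =
            (\<Sum>i<d. if i = j then h i (g s (x(j := r))) else 0)" by (intro sum.cong) auto
        also have "\<dots> = h j (g s (x(j := r)))" using j by simp
        finally show ?thesis by (simp add: sum.distrib mult.commute del: fun_upd_apply)
      qed
      finally show ?thesis .
    qed
    have gc: "continuous_on (T \<times> cbox 0 1) (\<lambda>(r, s). g s (x(j := r)))"
    proof (rule continuous_on_coordinatewise_then_product)
      fix l
      have eq: "(\<lambda>z. (case z of (r, s) \<Rightarrow> g s (x(j := r))) l) =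
          (\<lambda>z. x0 l + snd z * ((if l = j then fst z else x l) - x0 l))"
        by (auto simp: g_def fun_eq_iff)
      show "continuous_on (T \<times> cbox 0 1) (\<lambda>z. (case z of (r, s) \<Rightarrow> g s (x(j := r))) l)"
        unfolding eq by (cases "l = j") (auto intro!: continuous_intros)
    qed
    have gim: "(\<lambda>(r, s). g s (x(j := r))) ` (T \<times> cbox 0 1) \<subseteq> ?W"
      using gW upd by (auto simp: cbox_interval)
    have comp: "continuous_on (T \<times> cbox 0 1) (\<lambda>(r, s). k (g s (x(j := r))))"
      if "continuous_on ?W k" for k :: "(nat \<Rightarrow> real) \<Rightarrow> real"
      using continuous_on_compose2[OF that gc gim] by (simp add: case_prod_beta)
    have fxc: "continuous_on (T \<times> cbox 0 1) (\<lambda>(r, s). ?fx r s)"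
    proof -
      have u: "continuous_on (T \<times> cbox 0 1) (\<lambda>z. (x(j := fst z)) i - x0 i)" for i
        by (cases "i = j") (auto intro!: continuous_intros)
      have a: "continuous_on (T \<times> cbox 0 1) (\<lambda>z. h j (g (snd z) (x(j := fst z))))"
        using comp[OF smooth_fun_on_continuous[OF h[OF j]]] by (simp only: case_prod_unfold)
      have b: "continuous_on (T \<times> cbox 0 1) (\<lambda>z. partial_deriv j (h i) (g (snd z) (x(j := fst z))))"
        if "i < d" for i
        using comp[OF hc[OF that j]] by (simp only: case_prod_unfold)
      show ?thesis
        unfolding case_prod_unfold
        by (intro continuous_on_add a continuous_on_sum continuous_on_mult u b continuous_on_snd
            continuous_on_id) simp
    
    qed
    have Fc: "continuous_on (cbox 0 1) (\<lambda>s. \<Sum>i<d. ((x(j := r)) i - x0 i) * h i (g s (x(j := r))))"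
      if r: "r \<in> T" for r
    proof (intro continuous_on_sum continuous_on_mult continuous_on_const)
      fix i assume "i \<in> {..<d}"
      then have i: "i < d" by simp
      have "continuous_on (cbox 0 1) (\<lambda>s. (r, s))" by (intro continuous_intros)
      from continuous_on_compose2[OF comp[OF smooth_fun_on_continuous[OF h[OF i]]] this]
      show "continuous_on (cbox 0 1) (\<lambda>s. h i (g s (x(j := r))))" using r by auto
    qed
    have "((\<lambda>r. integral (cbox 0 1) (\<lambda>s. \<Sum>i<d. ((x(j := r)) i - x0 i) * h i (g s (x(j := r)))))
        has_field_derivative integral (cbox 0 1) (?fx (x j))) (at (x j) within T)"
    proof (rule leibniz_rule_field_derivative[of T 0 1 _ ?fx])
      fix r s :: real assume "r \<in> T" "s \<in> cbox 0 1"
      then have "0 \<le> s" "s \<le> 1" "r \<in> T" by (auto simp: cbox_interval)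
      from dF[OF this] show "((\<lambda>r. \<Sum>i<d. ((x(j := r)) i - x0 i) * h i (g s (x(j := r))))
          has_field_derivative ?fx r s) (at r within T)" by (rule has_field_derivative_at_within)
    next
      fix r assume "r \<in> T"
      from integrable_continuous[OF Fc[OF this]]
      show "(\<lambda>s. \<Sum>i<d. ((x(j := r)) i - x0 i) * h i (g s (x(j := r)))) integrable_on cbox 0 1" .
    qed (use fxc xT in \<open>simp_all add: T_def del: fun_upd_apply\<close>)
    moreover have "at (x j) within T = at (x j)"
      by (rule at_within_open[OF xT]) (simp add: T_def)
    ultimately have D: "((\<lambda>r. F (x(j := r))) has_real_derivative integral (cbox 0 1) (?fx (x j))) (at (x j))"
      unfolding F_def by (simp only:)
    \<comment> \<open>By closedness \<open>?fx (x j)\<close> is the derivative of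
      \<open>s * h j (g s x)\<close> in \<open>s\<close>, so the integral is the boundary value at
      \<open>s = 1\<close>.\<close>
    have "(?fx (x j) has_integral (1 * h j (g 1 x) - 0 * h j (g 0 x))) {0..1}"
    proof (rule fundamental_theorem_of_calculus)
      fix s :: real assume s: "s \<in> {0..1}"
      have gx: "eventually (\<lambda>s. g s x \<in> ?W) (nhds s)"
      proof -
        have "eventually (\<lambda>s. \<forall>l\<in>{..<d}. \<bar>s * (x l - x0 l)\<bar> < e) (nhds s)"
        proof (rule eventually_ball_finite, simp, rule ballI)
          fix l assume "l \<in> {..<d}"
          then have "\<bar>s * (x l - x0 l)\<bar> < e" using gW[OF x, of s] s by (auto simp: g_def ebox_def)
          moreover have "((\<lambda>s. \<bar>s * (x l - x0 l)\<bar>) \<longlongrightarrow> \<bar>s * (x l - x0 l)\<bar>) (nhds s)"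
            by (intro tendsto_intros) (rule filterlim_ident)
          ultimately show "eventually (\<lambda>s. \<bar>s * (x l - x0 l)\<bar> < e) (nhds s)"
            by (auto dest: order_tendstoD(2))
        qed
        then show ?thesis
          by eventually_elim (use xc x0 in \<open>auto simp: ebox_def g_def coord_space_def\<close>)
      qed
      have "((\<lambda>s. h j (g s x)) has_real_derivative (\<Sum>l<d. partial_deriv l (h j) (g s x) * (x l - x0 l))) (at s)"
        by (rule partials_on_curve[OF W hp[OF j] hc[OF j] _ gx])
          (auto simp: g_def intro!: derivative_eq_intros)
      from DERIV_mult[OF DERIV_ident this]
      have "((\<lambda>s. s * h j (g s x)) has_real_derivative
         1 * h j (g s x) + (\<Sum>l<d. partial_deriv l (h j) (g s x) * (x l - x0 l)) * s) (at s)" .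
      also have "1 * h j (g s x) + (\<Sum>l<d. partial_deriv l (h j) (g s x) * (x l - x0 l)) * s = ?fx (x j) s"
        using gW[OF x] s by (simp add: cl[OF j] sum_distrib_left sum_distrib_right mult_ac)
      finally show "((\<lambda>s. s * h j (g s x)) has_vector_derivative ?fx (x j) s) (at s within {0..1})"
        by (simp add: has_real_derivative_iff_has_vector_derivative[symmetric] has_field_derivative_at_within)
    qed simp
    then have "integral (cbox 0 1) (?fx (x j)) = 1 * h j (g 1 x) - 0 * h j (g 0 x)"
      unfolding cbox_interval by (rule integral_unique)
    also have "\<dots> = h j x" by (simp add: g_def)
    finally show "((\<lambda>t. F (x(j := t))) has_real_derivative h j x) (at (x j))" using D by simp
  qed
  then show ?thesis by (rule exI[of "\<lambda>f. partials_on d ?W f h"])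
qed

section \<open>Closed one-forms on simply connected manifolds\<close>

lemma path_connectedin_ebox:
  shows "path_connectedin euclidean (ebox d x0 e)"
  unfolding path_connectedin
proof (intro conjI ballI)
  fix x y assume x: "x \<in> ebox d x0 e" and y: "y \<in> ebox d x0 e"
  let ?g = "\<lambda>t i. (1 - t) * x i + t * (y i :: real)"
  have "continuous_on {0..1} ?g"
    by (rule continuous_on_coordinatewise_then_product) (intro continuous_intros)
  then have "pathin euclidean ?g" by (simp add: pathin_def)
  moreover have "?g t \<in> ebox d x0 e" if t: "t \<in> {0..1}" for t
    unfolding ebox_def
  proof (intro CollectI conjI allI impI)
    show "?g t \<in> coord_space d" using x y by (simp add: ebox_def coord_space_def)
    fix i assume i: "i < d"
    have xy: "\<bar>x i - x0 i\<bar> < e" "\<bar>y i - x0 i\<bar> < e" using x y i by (auto simp: ebox_def)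
    have "x i - x0 i \<in> ball 0 e" "y i - x0 i \<in> ball 0 e" using xy by auto
    from convexD[OF convex_ball this, of "1 - t" t] t
    have "(1 - t) * (x i - x0 i) + t * (y i - x0 i) \<in> ball 0 e" by simp
    moreover have "(1 - t) * (x i - x0 i) + t * (y i - x0 i) = ?g t i - x0 i"
      by (simp add: algebra_simps)
    ultimately have "?g t i - x0 i \<in> ball 0 e" by (simp only:)
    then show "\<bar>?g t i - x0 i\<bar> < e" by (simp add: dist_real_def)
  qed
  ultimately show "\<exists>g. pathin euclidean g \<and> g \<in> {0..1} \<rightarrow> ebox d x0 e \<and> g 0 = x \<and> g 1 = y"
    by (intro exI[of _ ?g]) auto
qed simp

context smooth_mfd
begin

lemma smooth_in_DERIV:
  assumes c: "c \<in> matlas M" and U: "openin (mtop M) U" "U \<subseteq> fst c"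
    and f: "smooth_in M c U f" and p: "p \<in> U" "i < dm"
  shows "((\<lambda>t. f (chart_inv c ((snd c p)(i := t)))) has_real_derivative chart_deriv c i f p) (at (snd c p i))"
proof -
  have "snd c p \<in> snd c ` U" using p by blast
  from partials_onD[OF smooth_fun_on_partials p(2) this] f show ?thesis
    unfolding smooth_in_def chart_deriv_def by auto
qed

lemma eventually_chart:
  assumes c: "c \<in> matlas M" and U: "openin (mtop M) U" and p: "p \<in> U" "p \<in> fst c" "i < dm"
  shows "eventually (\<lambda>t. chart_inv c ((snd c p)(i := t)) \<in> U) (nhds (snd c p i))"
proof -
  have o: "openin (mtop M) (U \<inter> fst c)" using U chart_open[OF c] by blast
  have "snd c p \<in> snd c ` (U \<inter> fst c)" using p by blast
  from eventually_upd[OF chart_image_open[OF c o] this p(3)] show ?thesis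
  proof (rule eventually_mono)
    fix t assume "(snd c p)(i := t) \<in> snd c ` (U \<inter> fst c)"
    then obtain q where "q \<in> U" "q \<in> fst c" "(snd c p)(i := t) = snd c q" by blast
    then show "chart_inv c ((snd c p)(i := t)) \<in> U" using chart_inv_left[OF c] by simp
  qed simp
qed

text \<open>Prescribes derivatives in every chart at once, so that primitives built in different
  charts can be compared wherever they meet.\<close>

definition potential :: "('m chart \<Rightarrow> nat \<Rightarrow> 'm \<Rightarrow> real) \<Rightarrow> 'm set \<Rightarrow> ('m \<Rightarrow> real) \<Rightarrow> bool" where
  "potential \<eta> U f \<longleftrightarrow> openin (mtop M) U \<and> (\<forall>c\<in>matlas M. \<forall>p\<in>U \<inter> fst c. \<forall>i<dm.
    ((\<lambda>t. f (chart_inv c ((snd c p)(i := t)))) has_real_derivative \<eta> c i p) (at (snd c p i)))"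

lemma potentialD:
  "potential \<eta> U f \<Longrightarrow> c \<in> matlas M \<Longrightarrow> p \<in> U \<Longrightarrow> p \<in> fst c \<Longrightarrow> i < dm \<Longrightarrow>
    ((\<lambda>t. f (chart_inv c ((snd c p)(i := t)))) has_real_derivative \<eta> c i p) (at (snd c p i))"
  by (simp add: potential_def)

text \<open>In a coordinate box the difference has vanishing partial derivatives and is constant by
  the mean value theorem.\<close>

lemma potential_diff:
  assumes f: "potential \<eta> U f" and g: "potential \<eta> V g" and p: "p \<in> U" "p \<in> V"
  shows "\<exists>W. openin (mtop M) W \<and> p \<in> W \<and> (\<exists>k. \<forall>q\<in>W. f q = g q + k)"
proof -
  have UV: "openin (mtop M) U" "openin (mtop M) V" using f g by (auto simp: potential_def)
  have "p \<in> topspace (mtop M)" using p(1) openin_subset[OF UV(1)] by blast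
  then obtain c where c: "c \<in> matlas M" "p \<in> fst c" using chart_ex by blast
  have O: "openin (mtop M) (U \<inter> V \<inter> fst c)" using UV chart_open[OF c(1)] by blast
  have pO: "snd c p \<in> snd c ` (U \<inter> V \<inter> fst c)" using p c by blast
  obtain e where e: "e > 0" "ebox dm (snd c p) e \<subseteq> snd c ` (U \<inter> V \<inter> fst c)"
    using eopenD[OF chart_image_open[OF c(1) O] pO] by blast
  let ?h = "\<lambda>x. f (chart_inv c x) - g (chart_inv c x)"
  have "partials_on dm (ebox dm (snd c p) e) ?h (\<lambda>_ _. 0)"
    unfolding partials_on_def
  proof (intro allI impI ballI)
    fix i x assume i: "i < dm" and "x \<in> ebox dm (snd c p) e"
    then obtain q where q: "q \<in> U" "q \<in> V" "q \<in> fst c" "x = snd c q" using e(2) by blast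
    show "((\<lambda>t. ?h (x(i := t))) has_real_derivative 0) (at (x i))"
      using DERIV_diff[OF potentialD[OF f c(1) q(1,3) i] potentialD[OF g c(1) q(2,3) i]]
      unfolding q(4) by simp
  qed
  note mvt = partials_on_mvt[OF this chart_coord[OF c]]
  show ?thesis
  proof (rule exI[of _ "{q \<in> fst c. snd c q \<in> ebox dm (snd c p) e}"], intro conjI)
    show "openin (mtop M) {q \<in> fst c. snd c q \<in> ebox dm (snd c p) e}"
      by (rule chart_preimage_open[OF c(1) eopen_ebox])
    show "p \<in> {q \<in> fst c. snd c q \<in> ebox dm (snd c p) e}"
      using c e(1) chart_coord[OF c] by (simp add: ebox_center)
    have "f q = g q + (f p - g p)" if q: "q \<in> fst c" "snd c q \<in> ebox dm (snd c p) e" for q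
    proof -
      have "?h (snd c q) - ?h (snd c p) = 0" using mvt[OF q(2)] by auto
      then show ?thesis using chart_inv_left[OF c(1)] q(1) c(2) by simp
    qed
    then show "\<exists>k. \<forall>q\<in>{q \<in> fst c. snd c q \<in> ebox dm (snd c p) e}. f q = g q + k" by blast
  qed
qed

text \<open>Poincare's lemma gives primitives on chart boxes, the transformation law
  \<open>tr\<close> makes them primitives in all other charts, and \<open>global_primitive\<close>
  joins them. Derivatives are local, so the joined function inherits them.\<close>

theorem closed_exact:
  fixes \<eta> :: "'m chart \<Rightarrow> nat \<Rightarrow> 'm \<Rightarrow> real"
  assumes sc: "simply_connected_space (mtop M)"
    and sm: "\<And>c i. c \<in> matlas M \<Longrightarrow> i < dm \<Longrightarrow> smooth_in M c (fst c) (\<eta> c i)"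
    and cl: "\<And>c i j p. c \<in> matlas M \<Longrightarrow> i < dm \<Longrightarrow> j < dm \<Longrightarrow> p \<in> fst c \<Longrightarrow>
      chart_deriv c i (\<eta> c j) p = chart_deriv c j (\<eta> c i) p"
    and tr: "\<And>c c' i p. c \<in> matlas M \<Longrightarrow> c' \<in> matlas M \<Longrightarrow> i < dm \<Longrightarrow> p \<in> fst c \<Longrightarrow> p \<in> fst c' \<Longrightarrow>
      \<eta> c i p = (\<Sum>j<dm. jacobian (\<lambda>q. q) c c' p i j * \<eta> c' j p)"
  shows "\<exists>f. \<forall>c\<in>matlas M. smooth_in M c (fst c) f \<and>
    (\<forall>p\<in>fst c. \<forall>i<dm. chart_deriv c i f p = \<eta> c i p)"
proof -
  have ex: "\<exists>U f. potential \<eta> U f \<and> p \<in> U \<and> path_connectedin (mtop M) U" if p: "p \<in> topspace (mtop M)" for p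
  proof -
    obtain c where c: "c \<in> matlas M" "p \<in> fst c" using chart_ex[OF p] by blast
    have "snd c p \<in> snd c ` fst c" using c by blast
    then obtain e where e: "e > 0" "ebox dm (snd c p) e \<subseteq> snd c ` fst c"
      using eopenD[OF chart_image[OF c(1)]] by blast
    let ?B = "ebox dm (snd c p) e"
    let ?U = "{q \<in> fst c. snd c q \<in> ?B}"
    have U: "openin (mtop M) ?U" "?U \<subseteq> fst c"
      using chart_preimage_open[OF c(1) eopen_ebox] by auto
    have sB: "smooth_fun_on dm ?B (\<lambda>x. \<eta> c i (chart_inv c x))" if "i < dm" for i
      using smooth_fun_on_subset[OF _ e(2)] sm[OF c(1) that] by (simp add: smooth_in_def)
    have "\<exists>f. partials_on dm ?B f (\<lambda>i x. \<eta> c i (chart_inv c x))"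
    proof (rule poincare_box[OF chart_coord[OF c] e(1) sB])
      fix i j x assume ij: "i < dm" "j < dm" and "x \<in> ?B"
      then have x: "x \<in> snd c ` fst c" using e(2) by blast
      then have q: "chart_inv c x \<in> fst c" using chart_inv_left[OF c(1)] by auto
      show "partial_deriv i (\<lambda>x. \<eta> c j (chart_inv c x)) x = partial_deriv j (\<lambda>x. \<eta> c i (chart_inv c x)) x"
        using cl[OF c(1) ij q] chart_deriv_inv[OF c(1) x] by simp
    qed
    then obtain \<phi> where \<phi>: "partials_on dm ?B \<phi> (\<lambda>i x. \<eta> c i (chart_inv c x))" by blast
    let ?f = "\<lambda>q. \<phi> (snd c q)"
    have \<phi>': "partials_on dm ?B (\<lambda>x. ?f (chart_inv c x)) (\<lambda>i x. \<eta> c i (chart_inv c x))"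
    proof (rule partials_on_cong[OF eopen_ebox \<phi>])
      fix x assume "x \<in> ?B"
      then have "x \<in> snd c ` fst c" using e(2) by blast
      then show "\<phi> x = ?f (chart_inv c x)" using chart_inv_left[OF c(1)] by auto
    qed simp
    have fd: "((\<lambda>t. ?f (chart_inv c ((snd c q)(i := t)))) has_real_derivative \<eta> c i q) (at (snd c q i))"
      if "q \<in> ?U" "i < dm" for q i
      using partials_onD[OF \<phi>' that(2), of "snd c q"] that(1) chart_inv_left[OF c(1)] by simp
    have fs: "smooth_in M c ?U ?f"
      by (rule smooth_inI_partials[OF c(1) U fd]) (use smooth_in_subset[OF sm[OF c(1)] U(2)] in auto)
    have fc: "chart_deriv c i ?f q = \<eta> c i q" if "q \<in> ?U" "i < dm" for q i
      unfolding chart_deriv_def partial_deriv_def by (rule DERIV_imp_deriv[OF fd[OF that]])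
    have "potential \<eta> ?U ?f"
      unfolding potential_def
    proof (intro conjI ballI allI impI)
      fix c' q i assume c': "c' \<in> matlas M" and q: "q \<in> ?U \<inter> fst c'" and i: "i < dm"
      have O: "openin (mtop M) (?U \<inter> fst c')" "?U \<inter> fst c' \<subseteq> fst c'"
        using U(1) chart_open[OF c'] by blast+
      have t: "smooth_in M c' (?U \<inter> fst c') (\<lambda>q. snd c q j)" if "j < dm" for j
        by (rule smooth_in_subset[OF transition_smooth[OF c' c(1) that]]) auto
      have "chart_deriv c' i ?f q = (\<Sum>j<dm. jacobian (\<lambda>q. q) c' c q i j * chart_deriv c j ?f q)"
        by (rule chain_rule(2)[where F = "\<lambda>q. q", OF c' c(1) O U _ t fs q i]) blast
      also have "\<dots> = (\<Sum>j<dm. jacobian (\<lambda>q. q) c' c q i j * \<eta> c j q)"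
        using q by (intro sum.cong refl) (simp add: fc)
      also have "\<dots> = \<eta> c' i q" using tr[OF c' c(1) i, of q] q by simp
      finally have d: "chart_deriv c' i ?f q = \<eta> c' i q" .
      have s: "smooth_in M c' (?U \<inter> fst c') ?f"
        by (rule chain_rule(1)[where F = "\<lambda>q. q", OF c' c(1) O U _ t fs]) blast
      show "((\<lambda>t. ?f (chart_inv c' ((snd c' q)(i := t)))) has_real_derivative \<eta> c' i q) (at (snd c' q i))"
        using smooth_in_DERIV[OF c' O s q i] unfolding d .
    qed (rule U(1))
    moreover have "p \<in> ?U" using c e(1) chart_coord[OF c] by (simp add: ebox_center)
    moreover have "path_connectedin (mtop M) ?U"
    proof -
      have "path_connectedin (top_of_set (snd c ` fst c)) ?B"
        using path_connectedin_ebox e(2) by (simp add: path_connectedin_subtopology)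
      from path_connectedin_continuous_map_image[OF chart_inv_continuous[OF c(1)] this]
      have "path_connectedin (mtop M) (chart_inv c ` ?B)" .
      moreover have "chart_inv c ` ?B = ?U"
      proof
        show "chart_inv c ` ?B \<subseteq> ?U"
        proof
          fix q assume "q \<in> chart_inv c ` ?B"
          then obtain x where x: "x \<in> ?B" "q = chart_inv c x" by blast
          then obtain q' where "q' \<in> fst c" "x = snd c q'" using e(2) by blast
          then show "q \<in> ?U" using x chart_inv_left[OF c(1)] by simp
        qed
        show "?U \<subseteq> chart_inv c ` ?B"
        proof
          fix q assume q: "q \<in> ?U"
          then have "q = chart_inv c (snd c q)" using chart_inv_left[OF c(1)] by simp
          then show "q \<in> chart_inv c ` ?B" using q by blast
        qed
      qed
      ultimately show ?thesis by simp
    qed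
    ultimately show ?thesis by blast
  qed
  interpret local_primitives "mtop M" "potential \<eta>"
  proof
    show "openin (mtop M) U" if "potential \<eta> U f" for U f using that by (simp add: potential_def)
    show "potential \<eta> U (\<lambda>q. f q + k)" if "potential \<eta> U f" for U f k
      using that DERIV_add[OF _ DERIV_const] unfolding potential_def by fastforce
    show "\<exists>W. openin (mtop M) W \<and> p \<in> W \<and> (\<exists>k. \<forall>q\<in>W. f q = g q + k)"
      if "potential \<eta> U f" "potential \<eta> V g" "p \<in> U" "p \<in> V" for U f V g p
      by (rule potential_diff[OF that])
    show "\<exists>U f. potential \<eta> U f \<and> p \<in> U \<and> path_connectedin (mtop M) U" if "p \<in> topspace (mtop M)" for p
      by (rule ex[OF that])
  qed
  obtain F where F: "\<And>p. p \<in> topspace (mtop M) \<Longrightarrow> \<exists>U f. potential \<eta> U f \<and> p \<in> U \<and> (\<forall>q\<in>U. F q = f q)"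
    using global_primitive[OF sc] by (elim exE) (rule that, erule (1) bspec)
  have FD: "((\<lambda>t. F (chart_inv c ((snd c p)(i := t)))) has_real_derivative \<eta> c i p) (at (snd c p i))"
    if c: "c \<in> matlas M" and p: "p \<in> fst c" and i: "i < dm" for c p i
  proof -
    obtain U f where U: "potential \<eta> U f" "p \<in> U" "\<And>q. q \<in> U \<Longrightarrow> F q = f q"
      using F[OF chart_topspace[OF c p]] by blast
    have "eventually (\<lambda>t. F (chart_inv c ((snd c p)(i := t))) = f (chart_inv c ((snd c p)(i := t)))) (nhds (snd c p i))"
      using eventually_chart[OF c pot_open[OF U(1)] U(2) p i] by eventually_elim (rule U(3))
    from DERIV_cong_ev[OF refl this refl] show ?thesis using potentialD[OF U(1) c U(2) p i] by blast
  qed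
  have "smooth_in M c (fst c) F \<and> (\<forall>p\<in>fst c. \<forall>i<dm. chart_deriv c i F p = \<eta> c i p)" if c: "c \<in> matlas M" for c
  proof (intro conjI ballI allI impI)
    show "smooth_in M c (fst c) F"
      by (rule smooth_inI_partials[OF c chart_open[OF c] order_refl FD[OF c]]) (assumption | rule sm[OF c])+
    show "chart_deriv c i F p = \<eta> c i p" if "p \<in> fst c" "i < dm" for p i
      unfolding chart_deriv_def partial_deriv_def by (rule DERIV_imp_deriv[OF FD[OF c that]])
  qed
  then show ?thesis by blast
qed

end

section \<open>Left-invariant vector fields\<close>

definition comb :: "nat \<Rightarrow> (nat \<Rightarrow> real) \<Rightarrow> (nat \<Rightarrow> real) \<Rightarrow> nat \<Rightarrow> real" where
  "comb d x y = (\<lambda>i. if i < d then x i else y (i - d))"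

lemma comb_inj:
  assumes "comb d x y = comb d x' y'" "x \<in> coord_space d" "x' \<in> coord_space d"
  shows "x = x' \<and> y = y'"
proof -
  have "x i = x' i" for i
    using fun_cong[OF assms(1), of i] assms(2,3) by (cases "i < d") (auto simp: comb_def coord_space_def)
  moreover have "y i = y' i" for i
    using fun_cong[OF assms(1), of "d + i"] by (simp add: comb_def)
  ultimately show ?thesis by (simp add: fun_eq_iff)
qed

lemma smooth_comb:
  assumes W: "eopen e W"
  shows "smooth_fun_on e W (\<lambda>y. comb d x y j)" "smooth_fun_on e W (\<lambda>x. comb d x y j)"
  unfolding comb_def using smooth_fun_on_intros(1,2)[OF W] by (cases "j < d"; simp)+

locale lie_grp = smooth_mfd M for M :: "'m mfd" +
  fixes G :: "'m monoid"
  assumes lie_group: "lie_group M G"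
begin

lemma G_group: "Group.group G" and G_carrier: "carrier G = topspace (mtop M)"
  and G_smooth: "smooth_map (product_mfd M M) M (\<lambda>(x, y). x \<otimes>\<^bsub>G\<^esub> y)"
  using lie_group by (auto simp: lie_group_def)

lemma chart_carrier: "c \<in> matlas M \<Longrightarrow> p \<in> fst c \<Longrightarrow> p \<in> carrier G"
  using chart_topspace G_carrier by simp

lemma G_cont: "continuous_map (prod_topology (mtop M) (mtop M)) (mtop M) (\<lambda>(x, y). x \<otimes>\<^bsub>G\<^esub> y)"
  using G_smooth by (simp add: smooth_map_def product_mfd_def)

lemma left_open:
  assumes "a \<in> carrier G" "openin (mtop M) U" "openin (mtop M) V"
  shows "openin (mtop M) {q \<in> U. a \<otimes>\<^bsub>G\<^esub> q \<in> V}"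
proof -
  have "continuous_map (mtop M) (prod_topology (mtop M) (mtop M)) (\<lambda>q. (a, q))"
    using assms(1) G_carrier by (intro continuous_map_pairedI) auto
  from continuous_map_compose[OF this G_cont]
  have "continuous_map (mtop M) (mtop M) (\<lambda>q. a \<otimes>\<^bsub>G\<^esub> q)" by (simp add: o_def)
  from openin_Int[OF assms(2) openin_continuous_map_preimage[OF this assms(3)]]
  show ?thesis using openin_subset[OF assms(2)] by (auto elim: back_subst[of "openin (mtop M)"])
qed

lemma right_open:
  assumes "a \<in> carrier G" "openin (mtop M) U" "openin (mtop M) V"
  shows "openin (mtop M) {p \<in> U. p \<otimes>\<^bsub>G\<^esub> a \<in> V}"
proof -
  have "continuous_map (mtop M) (prod_topology (mtop M) (mtop M)) (\<lambda>q. (q, a))"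
    using assms(1) G_carrier by (intro continuous_map_pairedI) auto
  from continuous_map_compose[OF this G_cont]
  have "continuous_map (mtop M) (mtop M) (\<lambda>q. q \<otimes>\<^bsub>G\<^esub> a)" by (simp add: o_def)
  from openin_Int[OF assms(2) openin_continuous_map_preimage[OF this assms(3)]]
  show ?thesis using openin_subset[OF assms(2)] by (auto elim: back_subst[of "openin (mtop M)"])
qed

section \<open>Group multiplication in charts\<close>

definition mdom :: "'m chart \<Rightarrow> 'm chart \<Rightarrow> 'm chart \<Rightarrow> ('m \<times> 'm) set" where
  "mdom c1 c2 c3 = {(p, q). p \<in> fst c1 \<and> q \<in> fst c2 \<and> p \<otimes>\<^bsub>G\<^esub> q \<in> fst c3}"

text \<open>Written through \<open>chart_inv\<close> of the product chart, so that it is literally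
  the function whose smoothness \<open>smooth_map\<close> asserts.\<close>

definition mfun :: "'m chart \<Rightarrow> 'm chart \<Rightarrow> 'm chart \<Rightarrow> nat \<Rightarrow> (nat \<Rightarrow> real) \<Rightarrow> real" where
  "mfun c1 c2 c3 j z = snd c3 ((\<lambda>(x, y). x \<otimes>\<^bsub>G\<^esub> y) (chart_inv (product_chart dm c1 c2) z)) j"

definition mimg :: "'m chart \<Rightarrow> 'm chart \<Rightarrow> 'm chart \<Rightarrow> (nat \<Rightarrow> real) set" where
  "mimg c1 c2 c3 = (\<lambda>(p, q). comb dm (snd c1 p) (snd c2 q)) ` mdom c1 c2 c3"

lemma mfun_comb:
  assumes c: "c1 \<in> matlas M" "c2 \<in> matlas M" and pq: "p \<in> fst c1" "q \<in> fst c2"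
  shows "mfun c1 c2 c3 j (comb dm (snd c1 p) (snd c2 q)) = snd c3 (p \<otimes>\<^bsub>G\<^esub> q) j"
proof -
  have pc: "product_chart dm c1 c2 = (fst c1 \<times> fst c2, \<lambda>(p, q). comb dm (snd c1 p) (snd c2 q))"
    by (simp add: product_chart_def comb_def fun_eq_iff)
  have inj: "inj_on (\<lambda>(p, q). comb dm (snd c1 p) (snd c2 q)) (fst c1 \<times> fst c2)"
  proof (rule inj_onI, clarify)
    fix p q p' q' assume a: "p \<in> fst c1" "q \<in> fst c2" "p' \<in> fst c1" "q' \<in> fst c2"
      "comb dm (snd c1 p) (snd c2 q) = comb dm (snd c1 p') (snd c2 q')"
    from comb_inj[OF a(5) chart_coord[OF c(1) a(1)] chart_coord[OF c(1) a(3)]]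
    show "p = p' \<and> q = q'"
      using inj_onD[OF chart_inj[OF c(1)]] inj_onD[OF chart_inj[OF c(2)]] a by blast
  qed
  have "chart_inv (product_chart dm c1 c2) (comb dm (snd c1 p) (snd c2 q)) = (p, q)"
    unfolding chart_inv_def pc using inv_into_f_f[OF inj, of "(p, q)"] pq by simp
  then show ?thesis by (simp add: mfun_def)
qed

lemma mimg_open:
  assumes c: "c1 \<in> matlas M" "c2 \<in> matlas M" "c3 \<in> matlas M"
  shows "eopen (dm + dm) (mimg c1 c2 c3)"
  unfolding eopen_def
proof (intro conjI subsetI ballI)
  fix z assume "z \<in> mimg c1 c2 c3"
  then obtain p q where pq: "p \<in> fst c1" "q \<in> fst c2" "p \<otimes>\<^bsub>G\<^esub> q \<in> fst c3"
    and z: "z = comb dm (snd c1 p) (snd c2 q)" by (auto simp: mimg_def mdom_def)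
  show "z \<in> coord_space (dm + dm)"
    using chart_coord[OF c(2) pq(2)] unfolding z by (auto simp: comb_def coord_space_def)
  have o1: "openin (prod_topology (mtop M) (mtop M))
      {x \<in> topspace (prod_topology (mtop M) (mtop M)). (\<lambda>(x, y). x \<otimes>\<^bsub>G\<^esub> y) x \<in> fst c3}"
    by (rule openin_continuous_map_preimage[OF G_cont chart_open[OF c(3)]])
  have o2: "(p, q) \<in> {x \<in> topspace (prod_topology (mtop M) (mtop M)). (\<lambda>(x, y). x \<otimes>\<^bsub>G\<^esub> y) x \<in> fst c3}"
    using pq chart_topspace c by simp
  from mp[OF spec[OF spec[OF iffD1[OF openin_prod_topology_alt o1]]] o2]
  obtain A B where AB: "openin (mtop M) A" "openin (mtop M) B" "p \<in> A" "q \<in> B"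
    "A \<times> B \<subseteq> {x \<in> topspace (prod_topology (mtop M) (mtop M)). (\<lambda>(x, y). x \<otimes>\<^bsub>G\<^esub> y) x \<in> fst c3}"
    by (elim exE conjE) (rule that)
  have A': "openin (mtop M) (A \<inter> fst c1)" "A \<inter> fst c1 \<subseteq> fst c1" using AB(1) chart_open[OF c(1)] by blast+
  have B': "openin (mtop M) (B \<inter> fst c2)" "B \<inter> fst c2 \<subseteq> fst c2" using AB(2) chart_open[OF c(2)] by blast+
  have "snd c1 p \<in> snd c1 ` (A \<inter> fst c1)" "snd c2 q \<in> snd c2 ` (B \<inter> fst c2)" using pq AB(3,4) by blast+
  then obtain e1 e2 where e: "e1 > 0" "ebox dm (snd c1 p) e1 \<subseteq> snd c1 ` (A \<inter> fst c1)"
    "e2 > 0" "ebox dm (snd c2 q) e2 \<subseteq> snd c2 ` (B \<inter> fst c2)"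
    using eopenD[OF chart_image_open[OF c(1) A']] eopenD[OF chart_image_open[OF c(2) B']] by meson
  show "\<exists>e>0. ebox (dm + dm) z e \<subseteq> mimg c1 c2 c3"
  proof (intro exI[of _ "min e1 e2"] conjI subsetI)
    show "min e1 e2 > 0" using e by simp
    fix w assume w: "w \<in> ebox (dm + dm) z (min e1 e2)"
    let ?x = "\<lambda>i. if i < dm then w i else 0" and ?y = "\<lambda>i. w (dm + i)"
    have wz: "\<bar>w i - z i\<bar> < min e1 e2" if "i < dm + dm" for i using w that by (simp add: ebox_def)
    have "?x \<in> ebox dm (snd c1 p) e1"
    proof -
      have "\<bar>w i - snd c1 p i\<bar> < e1" if "i < dm" for i
        using wz[of i] that unfolding z by (simp add: comb_def)
      then show ?thesis by (simp add: ebox_def coord_space_def)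
    qed
    then obtain p' where p': "p' \<in> A" "p' \<in> fst c1" "?x = snd c1 p'" using e(2) by blast
    have "?y \<in> ebox dm (snd c2 q) e2"
    proof -
      have "\<bar>w (dm + i) - snd c2 q i\<bar> < e2" if "i < dm" for i
        using wz[of "dm + i"] that unfolding z by (simp add: comb_def)
      then show ?thesis using w by (simp add: ebox_def coord_space_def)
    qed
    then obtain q' where q': "q' \<in> B" "q' \<in> fst c2" "?y = snd c2 q'" using e(4) by blast
    have "w = comb dm ?x ?y" by (auto simp: comb_def)
    then have "w = (\<lambda>(p, q). comb dm (snd c1 p) (snd c2 q)) (p', q')" using p' q' by simp
    moreover have "(p', q') \<in> mdom c1 c2 c3" using p' q' AB(5) by (auto simp: mdom_def)
    ultimately show "w \<in> mimg c1 c2 c3" unfolding mimg_def by (rule image_eqI)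
  qed
qed

lemma mfun_smooth:
  assumes c: "c1 \<in> matlas M" "c2 \<in> matlas M" "c3 \<in> matlas M" and j: "j < dm"
  shows "smooth_fun_on (dm + dm) (mimg c1 c2 c3) (mfun c1 c2 c3 j)"
proof -
  have pc: "product_chart dm c1 c2 = (fst c1 \<times> fst c2, \<lambda>(p, q). comb dm (snd c1 p) (snd c2 q))"
    by (simp add: product_chart_def comb_def fun_eq_iff)
  have m: "product_chart dm c1 c2 \<in> matlas (product_mfd M M)"
    unfolding product_mfd_def mfd.select_convs using c(1,2) by blast
  have "\<forall>c\<in>matlas (product_mfd M M). \<forall>c'\<in>matlas M. \<forall>j<mdim M.
       smooth_fun_on (mdim (product_mfd M M)) (snd c ` {p \<in> fst c. (\<lambda>(x, y). x \<otimes>\<^bsub>G\<^esub> y) p \<in> fst c'})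
         (\<lambda>x. snd c' ((\<lambda>(x, y). x \<otimes>\<^bsub>G\<^esub> y) (chart_inv c x)) j)"
    using G_smooth unfolding smooth_map_def by (rule conjunct2)
  from this[rule_format, OF m c(3) j]
  have 1: "smooth_fun_on (dm + dm) (snd (product_chart dm c1 c2) `
      {p \<in> fst (product_chart dm c1 c2). (\<lambda>(x, y). x \<otimes>\<^bsub>G\<^esub> y) p \<in> fst c3}) (mfun c1 c2 c3 j)"
    by (simp add: product_mfd_def mfun_def[abs_def])
  have 2: "{p \<in> fst (product_chart dm c1 c2). (\<lambda>(x, y). x \<otimes>\<^bsub>G\<^esub> y) p \<in> fst c3} = mdom c1 c2 c3"
    by (auto simp: pc mdom_def)
  have 3: "snd (product_chart dm c1 c2) ` mdom c1 c2 c3 = mimg c1 c2 c3"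
    by (simp add: pc mimg_def)
  show ?thesis using 1 unfolding 2 3 .
qed

text \<open>Left translation is multiplication with its first argument frozen. Its Jacobian is
  therefore a block of partial derivatives of \<open>mfun\<close>, which exhibits the dependence on
  \<open>p\<close> as well.\<close>

lemma left_smooth:
  assumes c: "c1 \<in> matlas M" "c2 \<in> matlas M" "c3 \<in> matlas M" and j: "j < dm" and p: "p \<in> fst c1"
  shows "smooth_in M c2 {q \<in> fst c2. p \<otimes>\<^bsub>G\<^esub> q \<in> fst c3} (\<lambda>q. snd c3 (p \<otimes>\<^bsub>G\<^esub> q) j)"
    and "q \<in> fst c2 \<Longrightarrow> p \<otimes>\<^bsub>G\<^esub> q \<in> fst c3 \<Longrightarrow> i < dm \<Longrightarrow> jacobian (\<lambda>q. p \<otimes>\<^bsub>G\<^esub> q) c2 c3 q i j =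
      partial_deriv (dm + i) (mfun c1 c2 c3 j) (comb dm (snd c1 p) (snd c2 q))"
proof -
  let ?U = "{q \<in> fst c2. p \<otimes>\<^bsub>G\<^esub> q \<in> fst c3}"
  have U: "openin (mtop M) ?U" "?U \<subseteq> fst c2"
    using left_open[OF chart_carrier[OF c(1) p] chart_open[OF c(2)] chart_open[OF c(3)]] by auto
  note W = chart_image_open[OF c(2) U]
  have mem: "comb dm (snd c1 p) y \<in> mimg c1 c2 c3" if y: "y \<in> snd c2 ` ?U" for y
  proof -
    obtain q where q: "q \<in> ?U" "y = snd c2 q" using y by blast
    then have "(p, q) \<in> mdom c1 c2 c3" using p by (simp add: mdom_def)
    then show ?thesis unfolding mimg_def q(2) by force
  qed
  have eq: "mfun c1 c2 c3 j (comb dm (snd c1 p) y) = snd c3 (p \<otimes>\<^bsub>G\<^esub> chart_inv c2 y) j"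
    if y: "y \<in> snd c2 ` ?U" for y
  proof -
    obtain q where q: "q \<in> fst c2" "y = snd c2 q" using y by blast
    then show ?thesis using mfun_comb[OF c(1,2) p q(1)] chart_inv_left[OF c(2)] by simp
  qed
  note sc = smooth_comb(1)[OF W, of dm "snd c1 p"]
  have "smooth_fun_on dm (snd c2 ` ?U) (\<lambda>y. mfun c1 c2 c3 j (comb dm (snd c1 p) y))"
    by (rule smooth_fun_on_compose[OF mimg_open[OF c] W mem mfun_smooth[OF c j] sc])
  then show "smooth_in M c2 ?U (\<lambda>q. snd c3 (p \<otimes>\<^bsub>G\<^esub> q) j)"
    unfolding smooth_in_def using smooth_fun_on_cong[OF W eq] by simp
  assume q: "q \<in> fst c2" "p \<otimes>\<^bsub>G\<^esub> q \<in> fst c3" and i: "i < dm"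
  then have qU: "snd c2 q \<in> snd c2 ` ?U" by blast
  have "jacobian (\<lambda>q. p \<otimes>\<^bsub>G\<^esub> q) c2 c3 q i j = partial_deriv i (\<lambda>y. mfun c1 c2 c3 j (comb dm (snd c1 p) y)) (snd c2 q)"
    unfolding jacobian_def chart_deriv_def by (rule partial_deriv_cong[OF W qU i eq[symmetric]])
  also have "\<dots> = (\<Sum>l<dm + dm. partial_deriv l (mfun c1 c2 c3 j) (comb dm (snd c1 p) (snd c2 q)) *
      partial_deriv i (\<lambda>y. comb dm (snd c1 p) y l) (snd c2 q))"
    by (rule partial_deriv_compose[OF mimg_open[OF c] W mem mfun_smooth[OF c j] sc i qU])
  also have "\<dots> = (\<Sum>l<dm + dm. if l = dm + i then partial_deriv l (mfun c1 c2 c3 j) (comb dm (snd c1 p) (snd c2 q)) else 0)"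
  proof (intro sum.cong refl)
    fix l
    have "((\<lambda>t. comb dm (snd c1 p) ((snd c2 q)(i := t)) l) has_real_derivative (if l = dm + i then 1 else 0)) (at (snd c2 q i))"
    proof -
      have "(\<lambda>t. comb dm (snd c1 p) ((snd c2 q)(i := t)) l) =
          (if l = dm + i then (\<lambda>t. t) else (\<lambda>_. comb dm (snd c1 p) (snd c2 q) l))"
        by (auto simp: comb_def fun_eq_iff)
      then show ?thesis by (auto intro!: derivative_eq_intros)
    qed
    from DERIV_imp_deriv[OF this]
    show "partial_deriv l (mfun c1 c2 c3 j) (comb dm (snd c1 p) (snd c2 q)) * partial_deriv i (\<lambda>y. comb dm (snd c1 p) y l) (snd c2 q) =
      (if l = dm + i then partial_deriv l (mfun c1 c2 c3 j) (comb dm (snd c1 p) (snd c2 q)) else 0)"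
      unfolding partial_deriv_def[of i] by simp
  qed
  also have "\<dots> = partial_deriv (dm + i) (mfun c1 c2 c3 j) (comb dm (snd c1 p) (snd c2 q))"
    using i by simp
  finally show "jacobian (\<lambda>q. p \<otimes>\<^bsub>G\<^esub> q) c2 c3 q i j =
      partial_deriv (dm + i) (mfun c1 c2 c3 j) (comb dm (snd c1 p) (snd c2 q))" .
qed

text \<open>Smoothness in the translating element; this is what makes left-invariant extensions of
  tangent vectors smooth.\<close>

lemma left_jacobian_smooth:
  assumes c: "c1 \<in> matlas M" "c2 \<in> matlas M" "c3 \<in> matlas M" and ij: "i < dm" "j < dm" and q: "q \<in> fst c2"
  shows "smooth_in M c1 {p \<in> fst c1. p \<otimes>\<^bsub>G\<^esub> q \<in> fst c3} (\<lambda>p. jacobian (\<lambda>q. p \<otimes>\<^bsub>G\<^esub> q) c2 c3 q i j)"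
proof -
  let ?U = "{p \<in> fst c1. p \<otimes>\<^bsub>G\<^esub> q \<in> fst c3}"
  have U: "openin (mtop M) ?U" "?U \<subseteq> fst c1"
    using right_open[OF chart_carrier[OF c(2) q] chart_open[OF c(1)] chart_open[OF c(3)]] by auto
  note W = chart_image_open[OF c(1) U]
  have mem: "comb dm x (snd c2 q) \<in> mimg c1 c2 c3" if x: "x \<in> snd c1 ` ?U" for x
  proof -
    obtain p where p: "p \<in> ?U" "x = snd c1 p" using x by blast
    then have "(p, q) \<in> mdom c1 c2 c3" using q by (simp add: mdom_def)
    then show ?thesis unfolding mimg_def p(2) by force
  qed
  have eq: "partial_deriv (dm + i) (mfun c1 c2 c3 j) (comb dm x (snd c2 q)) =
      jacobian (\<lambda>q. chart_inv c1 x \<otimes>\<^bsub>G\<^esub> q) c2 c3 q i j" if x: "x \<in> snd c1 ` ?U" for x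
  proof -
    obtain p where p: "p \<in> fst c1" "p \<otimes>\<^bsub>G\<^esub> q \<in> fst c3" "x = snd c1 p" using x by blast
    then show ?thesis using left_smooth(2)[OF c ij(2) p(1) q p(2) ij(1)] chart_inv_left[OF c(1)] by simp
  qed
  have l: "dm + i < dm + dm" using ij by simp
  have "smooth_fun_on dm (snd c1 ` ?U) (\<lambda>x. partial_deriv (dm + i) (mfun c1 c2 c3 j) (comb dm x (snd c2 q)))"
    by (rule smooth_fun_on_compose[OF mimg_open[OF c] W mem
      smooth_fun_on_partial_deriv[OF mfun_smooth[OF c ij(2)] l] smooth_comb(2)[OF W]])
  then show ?thesis
    unfolding smooth_in_def using smooth_fun_on_cong[OF W eq] by simp
qed

end

context lie_grp
begin

abbreviation gmul :: "'m \<Rightarrow> 'm \<Rightarrow> 'm" where "gmul a p \<equiv> a \<otimes>\<^bsub>G\<^esub> p"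

section \<open>Translations and the space of left-invariant fields\<close>

lemma one_carrier: "\<one>\<^bsub>G\<^esub> \<in> carrier G"
  using G_group by (simp add: group.is_monoid)

lemma gmul_carrier: "a \<in> carrier G \<Longrightarrow> p \<in> carrier G \<Longrightarrow> gmul a p \<in> carrier G"
  using G_group by (simp add: group.is_monoid monoid.m_closed)

lemma gmul_assoc: "a \<in> carrier G \<Longrightarrow> p \<in> carrier G \<Longrightarrow> q \<in> carrier G \<Longrightarrow>
  gmul (gmul a p) q = gmul a (gmul p q)"
  using G_group by (simp add: group.is_monoid monoid.m_assoc)

lemma gmul_one: "a \<in> carrier G \<Longrightarrow> gmul \<one>\<^bsub>G\<^esub> a = a" "a \<in> carrier G \<Longrightarrow> gmul a \<one>\<^bsub>G\<^esub> = a"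
  using G_group by (simp_all add: group.is_monoid monoid.l_one monoid.r_one)

lemma gmul_transitive:
  assumes "p \<in> carrier G" "q \<in> carrier G"
  shows "\<exists>a\<in>carrier G. gmul a p = q"
proof -
  let ?i = "inv\<^bsub>G\<^esub> p"
  have i: "?i \<in> carrier G" using G_group assms by (simp add: group.inv_closed)
  have "gmul (gmul q ?i) p = gmul q (gmul ?i p)" by (rule gmul_assoc[OF assms(2) i assms(1)])
  also have "\<dots> = q" using G_group assms by (simp add: group.l_inv gmul_one)
  finally show ?thesis using gmul_carrier[OF assms(2) i] by blast
qed

lemma chart_ex_carrier: "p \<in> carrier G \<Longrightarrow> \<exists>c\<in>matlas M. p \<in> fst c"
  using chart_ex G_carrier by simp

lemma left_dom:
  assumes "a \<in> carrier G" "c \<in> matlas M" "c' \<in> matlas M"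
  shows "openin (mtop M) {q \<in> fst c. gmul a q \<in> fst c'}" "{q \<in> fst c. gmul a q \<in> fst c'} \<subseteq> fst c"
  using left_open[OF assms(1) chart_open[OF assms(2)] chart_open[OF assms(3)]] by auto

lemma left_mult_smooth:
  assumes a: "a \<in> carrier G" and c: "c \<in> matlas M" "c' \<in> matlas M" and j: "j < dm"
  shows "smooth_in M c {q \<in> fst c. gmul a q \<in> fst c'} (\<lambda>q. snd c' (gmul a q) j)"
proof -
  obtain c1 where "c1 \<in> matlas M" "a \<in> fst c1" using chart_ex_carrier[OF a] by blast
  from left_smooth(1)[OF this(1) c j this(2)] show ?thesis .
qed

lemma left_chain:
  assumes a: "a \<in> carrier G" and c: "c \<in> matlas M" "c' \<in> matlas M"
    and p: "p \<in> fst c" "gmul a p \<in> fst c'" and i: "i < dm"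
    and V: "openin (mtop M) V" "V \<subseteq> fst c'" "gmul a p \<in> V" and f: "smooth_in M c' V f"
  shows "chart_deriv c i (\<lambda>q. f (gmul a q)) p =
    (\<Sum>k<dm. jacobian (gmul a) c c' p i k * chart_deriv c' k f (gmul a p))"
proof -
  let ?U = "{q \<in> fst c. gmul a q \<in> V}"
  have U: "openin (mtop M) ?U" "?U \<subseteq> fst c"
    using left_open[OF a chart_open[OF c(1)] V(1)] by auto
  have s: "smooth_in M c ?U (\<lambda>q. snd c' (gmul a q) j)" if "j < dm" for j
    by (rule smooth_in_subset[OF left_mult_smooth[OF a c that]]) (use V(2) in auto)
  show ?thesis
    by (rule chain_rule(2)[where F = "gmul a", OF c U V(1,2) _ s f _ i]) (use p V(3) in auto)
qed

lemma jacobian_one: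
  assumes c: "c \<in> matlas M" and p: "p \<in> fst c" "i < dm"
  shows "jacobian (gmul \<one>\<^bsub>G\<^esub>) c c' p i j = jacobian (\<lambda>q. q) c c' p i j"
  unfolding jacobian_def
proof (rule chart_deriv_cong[OF c chart_open[OF c] order_refl p])
  fix q assume "q \<in> fst c"
  then have "gmul \<one>\<^bsub>G\<^esub> q = q" using gmul_one chart_carrier[OF c] by blast
  then show "snd c' (gmul \<one>\<^bsub>G\<^esub> q) j = snd c' q j" by simp
qed

definition LA :: "'m vfield set" where
  "LA = {X. vector_field M X \<and> left_invariant_field M G X}"

lemma LA_vanish: "X \<in> LA \<Longrightarrow> \<not> (c \<in> matlas M \<and> p \<in> fst c \<and> i < dm) \<Longrightarrow> X c p i = 0"
  unfolding LA_def vector_field_def by blast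

lemma LA_smooth:
  assumes "X \<in> LA" "c \<in> matlas M" "i < dm"
  shows "smooth_in M c (fst c) (\<lambda>q. X c q i)"
  using assms unfolding LA_def vector_field_def smooth_in_def by blast

lemma LA_left:
  assumes "X \<in> LA" "a \<in> carrier G" "c \<in> matlas M" "c' \<in> matlas M" "p \<in> fst c" "gmul a p \<in> fst c'" "j < dm"
  shows "X c' (gmul a p) j = (\<Sum>i<dm. jacobian (gmul a) c c' p i j * X c p i)"
  using assms unfolding LA_def left_invariant_field_def by blast

text \<open>Invariance under the identity element is the transformation law under changes of charts.\<close>

lemma LA_I:
  assumes van: "\<And>c p i. \<not> (c \<in> matlas M \<and> p \<in> fst c \<and> i < dm) \<Longrightarrow> X c p i = 0"
    and sm: "\<And>c i. c \<in> matlas M \<Longrightarrow> i < dm \<Longrightarrow> smooth_in M c (fst c) (\<lambda>q. X c q i)"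
    and left: "\<And>a c c' p j. a \<in> carrier G \<Longrightarrow> c \<in> matlas M \<Longrightarrow> c' \<in> matlas M \<Longrightarrow> p \<in> fst c \<Longrightarrow>
      gmul a p \<in> fst c' \<Longrightarrow> j < dm \<Longrightarrow> X c' (gmul a p) j = (\<Sum>i<dm. jacobian (gmul a) c c' p i j * X c p i)"
  shows "X \<in> LA"
  unfolding LA_def
proof (intro CollectI conjI)
  show "left_invariant_field M G X" unfolding left_invariant_field_def using left by blast
  have "X c' p j = (\<Sum>i<dm. jacobian (\<lambda>q. q) c c' p i j * X c p i)"
    if c: "c \<in> matlas M" "c' \<in> matlas M" and p: "p \<in> fst c \<inter> fst c'" and j: "j < dm" for c c' p j
  proof -
    have pc: "p \<in> fst c" "p \<in> fst c'" using p by auto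
    have e: "gmul \<one>\<^bsub>G\<^esub> p = p" by (rule gmul_one(1)[OF chart_carrier[OF c(1) pc(1)]])
    have "X c' p j = (\<Sum>i<dm. jacobian (gmul \<one>\<^bsub>G\<^esub>) c c' p i j * X c p i)"
      using left[OF one_carrier c pc(1) _ j] pc(2) by (simp add: e)
    then show ?thesis using jacobian_one[OF c(1) pc(1)] by simp
  qed
  then show "vector_field M X"
    unfolding vector_field_def using van sm unfolding smooth_in_def by blast
qed

text \<open>Left translations act transitively, so the value at one point determines the
  field.\<close>

lemma LA_zero:
  assumes X: "X \<in> LA" and c: "c \<in> matlas M" and p: "p \<in> fst c" and z: "\<And>i. i < dm \<Longrightarrow> X c p i = 0"
  shows "X = (\<lambda>_ _ _. 0)"
proof (intro ext)
  fix c' q j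
  show "X c' q j = 0"
  proof (cases "c' \<in> matlas M \<and> q \<in> fst c' \<and> j < dm")
    case True
    then obtain a where a: "a \<in> carrier G" "gmul a p = q"
      using gmul_transitive[OF chart_carrier[OF c p] chart_carrier[of c' q]] by blast
    then show ?thesis using LA_left[OF X a(1) c, of c' p j] True p z by simp
  qed (rule LA_vanish[OF X])
qed

lemma LA_sum:
  assumes "\<And>b. b \<in> B \<Longrightarrow> E b \<in> LA"
  shows "(\<lambda>c p i. \<Sum>b\<in>B. x b * E b c p i) \<in> LA"
proof (rule LA_I)
  show "(\<Sum>b\<in>B. x b * E b c p i) = 0" if "\<not> (c \<in> matlas M \<and> p \<in> fst c \<and> i < dm)" for c p i
    by (rule sum.neutral) (use LA_vanish[OF assms that] in auto)
  show "smooth_in M c (fst c) (\<lambda>q. \<Sum>b\<in>B. x b * E b c q i)" if c: "c \<in> matlas M" "i < dm" for c i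
  proof -
    interpret derivation_algebra dm "fst c" "{f. smooth_in M c (fst c) f}" "chart_deriv c"
      by (rule derivations[OF c(1) chart_open[OF c(1)] order_refl])
    have "(\<lambda>q. \<Sum>b\<in>B. x b * E b c q i) \<in> {f. smooth_in M c (fst c) f}"
      by (intro S_sum S_cmult) (use LA_smooth[OF assms c] in auto)
    then show ?thesis by simp
  qed
  show "(\<Sum>b\<in>B. x b * E b c' (gmul a p) j) = (\<Sum>i<dm. jacobian (gmul a) c c' p i j * (\<Sum>b\<in>B. x b * E b c p i))"
    if h: "a \<in> carrier G" "c \<in> matlas M" "c' \<in> matlas M" "p \<in> fst c" "gmul a p \<in> fst c'" "j < dm" for a c c' p j
  proof -
    have "(\<Sum>b\<in>B. x b * E b c' (gmul a p) j) = (\<Sum>b\<in>B. \<Sum>i<dm. jacobian (gmul a) c c' p i j * (x b * E b c p i))"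
      by (intro sum.cong refl) (simp add: LA_left[OF assms h] sum_distrib_left mult_ac)
    also have "\<dots> = (\<Sum>i<dm. \<Sum>b\<in>B. jacobian (gmul a) c c' p i j * (x b * E b c p i))" by (rule sum.swap)
    finally show ?thesis by (simp add: sum_distrib_left)
  qed
qed

text \<open>The left-invariant extension of the tangent vector at the identity with coordinates
  \<open>v\<close> in the chart \<open>c0\<close>.\<close>

definition lfield :: "'m chart \<Rightarrow> (nat \<Rightarrow> real) \<Rightarrow> 'm vfield" where
  "lfield c0 v c p j = (if c \<in> matlas M \<and> p \<in> fst c \<and> j < dm
    then \<Sum>i<dm. v i * jacobian (gmul p) c0 c \<one>\<^bsub>G\<^esub> i j else 0)"

text \<open>Invariance is the chain rule for the composition of two left translations; smoothness
  comes from \<open>left_jacobian_smooth\<close>.\<close>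

lemma lfield_LA:
  assumes c0: "c0 \<in> matlas M" "\<one>\<^bsub>G\<^esub> \<in> fst c0"
  shows "lfield c0 v \<in> LA"
proof (rule LA_I)
  show "lfield c0 v c p i = 0" if "\<not> (c \<in> matlas M \<and> p \<in> fst c \<and> i < dm)" for c p i
    using that by (auto simp: lfield_def)
  show "smooth_in M c (fst c) (\<lambda>q. lfield c0 v c q j)" if c: "c \<in> matlas M" and j: "j < dm" for c j
  proof -
    interpret derivation_algebra dm "fst c" "{f. smooth_in M c (fst c) f}" "chart_deriv c"
      by (rule derivations[OF c(1) chart_open[OF c(1)] order_refl])
    have "{p \<in> fst c. gmul p \<one>\<^bsub>G\<^esub> \<in> fst c} = fst c"
      using gmul_one(2) chart_carrier[OF c] by auto
    then have "smooth_in M c (fst c) (\<lambda>p. jacobian (gmul p) c0 c \<one>\<^bsub>G\<^esub> i j)" if "i < dm" for i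
      using left_jacobian_smooth[OF c c0(1) c that j c0(2)] by simp
    then have "(\<lambda>p. \<Sum>i<dm. v i * jacobian (gmul p) c0 c \<one>\<^bsub>G\<^esub> i j) \<in> {f. smooth_in M c (fst c) f}"
      by (intro S_sum S_cmult) auto
    then show ?thesis
      using smooth_in_cong[OF c chart_open[OF c] order_refl, of "\<lambda>p. \<Sum>i<dm. v i * jacobian (gmul p) c0 c \<one>\<^bsub>G\<^esub> i j"]
      by (auto simp: lfield_def c j)
  qed
  fix a c c' p j
  assume a: "a \<in> carrier G" and c: "c \<in> matlas M" "c' \<in> matlas M" and p: "p \<in> fst c" "gmul a p \<in> fst c'"
    and j: "j < dm"
  note pG = chart_carrier[OF c(1) p(1)]
  have J: "jacobian (gmul (gmul a p)) c0 c' \<one>\<^bsub>G\<^esub> i j =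
      (\<Sum>k<dm. jacobian (gmul p) c0 c \<one>\<^bsub>G\<^esub> i k * jacobian (gmul a) c c' p k j)" if i: "i < dm" for i
  proof -
    let ?V = "{r \<in> fst c. gmul a r \<in> fst c'}"
    have p1: "gmul p \<one>\<^bsub>G\<^esub> = p" by (rule gmul_one(2)[OF pG])
    have "jacobian (gmul (gmul a p)) c0 c' \<one>\<^bsub>G\<^esub> i j = chart_deriv c0 i (\<lambda>q. snd c' (gmul a (gmul p q)) j) \<one>\<^bsub>G\<^esub>"
      unfolding jacobian_def
      by (rule chart_deriv_cong[OF c0(1) chart_open[OF c0(1)] order_refl c0(2) i])
        (simp add: gmul_assoc[OF a pG chart_carrier[OF c0(1)]])
    also have "\<dots> = (\<Sum>k<dm. jacobian (gmul p) c0 c \<one>\<^bsub>G\<^esub> i k * chart_deriv c k (\<lambda>r. snd c' (gmul a r) j) (gmul p \<one>\<^bsub>G\<^esub>))"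
      by (rule left_chain[where f = "\<lambda>r. snd c' (gmul a r) j", OF pG c0(1) c(1) c0(2) _ i left_dom[OF a c] _
            left_mult_smooth[OF a c j]]) (simp_all add: p1 p)
    finally show ?thesis by (simp add: p1 jacobian_def)
  qed
  have "lfield c0 v c' (gmul a p) j = (\<Sum>i<dm. \<Sum>k<dm. v i * (jacobian (gmul p) c0 c \<one>\<^bsub>G\<^esub> i k * jacobian (gmul a) c c' p k j))"
    using c p j by (simp add: lfield_def J sum_distrib_left)
  also have "\<dots> = (\<Sum>k<dm. \<Sum>i<dm. v i * (jacobian (gmul p) c0 c \<one>\<^bsub>G\<^esub> i k * jacobian (gmul a) c c' p k j))"
    by (rule sum.swap)
  also have "\<dots> = (\<Sum>k<dm. jacobian (gmul a) c c' p k j * lfield c0 v c p k)"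
    using c p by (simp add: lfield_def sum_distrib_left mult_ac)
  finally show "lfield c0 v c' (gmul a p) j = (\<Sum>k<dm. jacobian (gmul a) c c' p k j * lfield c0 v c p k)" .
qed

lemma lfield_one:
  assumes c0: "c0 \<in> matlas M" "\<one>\<^bsub>G\<^esub> \<in> fst c0" and j: "j < dm"
  shows "lfield c0 v c0 \<one>\<^bsub>G\<^esub> j = v j"
proof -
  have "jacobian (gmul \<one>\<^bsub>G\<^esub>) c0 c0 \<one>\<^bsub>G\<^esub> i j = (if i = j then 1 else 0)" if "i < dm" for i
    by (rule trans[OF jacobian_one[OF c0 that]]) (unfold jacobian_def, rule chart_deriv_coord[OF c0 that])
  then have "lfield c0 v c0 \<one>\<^bsub>G\<^esub> j = (\<Sum>i<dm. v i * (if i = j then 1 else 0))"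
    unfolding lfield_def using c0 j by simp
  also have "\<dots> = (\<Sum>i<dm. if i = j then v i else 0)" by (intro sum.cong) auto
  finally show ?thesis using j by simp
qed

text \<open>The second derivatives of left translation cancel by symmetry.\<close>

lemma lie_bracket_LA:
  assumes X: "X \<in> LA" and Y: "Y \<in> LA"
  shows "lie_bracket M X Y \<in> LA"
proof (rule LA_I)
  show "lie_bracket M X Y c p i = 0" if "\<not> (c \<in> matlas M \<and> p \<in> fst c \<and> i < dm)" for c p i
    using that by (auto simp: lie_bracket_def)
  show "smooth_in M c (fst c) (\<lambda>q. lie_bracket M X Y c q j)" if c: "c \<in> matlas M" and j: "j < dm" for c j
  proof -
    interpret derivation_algebra dm "fst c" "{f. smooth_in M c (fst c) f}" "chart_deriv c"
      by (rule derivations[OF c(1) chart_open[OF c(1)] order_refl])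
    have XS: "(\<lambda>q. X c q i) \<in> {f. smooth_in M c (fst c) f}" "(\<lambda>q. Y c q i) \<in> {f. smooth_in M c (fst c) f}"
      if "i < dm" for i using LA_smooth[OF X c that] LA_smooth[OF Y c that] by auto
    have s: "(\<lambda>q. \<Sum>i<dm. X c q i * chart_deriv c i (\<lambda>q. Y c q j) q + (-1) * (Y c q i * chart_deriv c i (\<lambda>q. X c q j) q))
        \<in> {f. smooth_in M c (fst c) f}"
      using j by (intro S_sum S_add S_cmult S_mult XS S_D) auto
    show ?thesis
      by (rule smooth_in_cong[OF c chart_open[OF c] order_refl _ CollectD[OF s]])
        (simp add: lie_bracket_def c j)
  qed
  fix a c c' p j
  assume a: "a \<in> carrier G" and c: "c \<in> matlas M" "c' \<in> matlas M" and p: "p \<in> fst c" "gmul a p \<in> fst c'"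
    and j: "j < dm"
  let ?U = "{q \<in> fst c. gmul a q \<in> fst c'}"
  note U = left_dom[OF a c]
  interpret derivation_algebra dm ?U "{f. smooth_in M c ?U f}" "chart_deriv c"
    by (rule derivations[OF c(1) U])
  have pU: "p \<in> ?U" using p by simp
  let ?F = "\<lambda>q. snd c' (gmul a q) j" and ?J = "\<lambda>i k. jacobian (gmul a) c c' p i k"
  have FS: "?F \<in> {f. smooth_in M c ?U f}" using left_mult_smooth[OF a c j] by simp
  \<comment> \<open>Differentiates the invariance of \<open>W\<close> in the direction
    \<open>Z\<close>. The first double sum contains second derivatives of the translation and is
    symmetric in \<open>Z\<close> and \<open>W\<close>.\<close>
  have lk: "(\<Sum>k<dm. Z c' (gmul a p) k * chart_deriv c' k (\<lambda>q. W c' q j) (gmul a p)) =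
      (\<Sum>i<dm. \<Sum>l<dm. Z c p i * (W c p l * chart_deriv c i (chart_deriv c l ?F) p)) +
      (\<Sum>l<dm. ?J l j * (\<Sum>i<dm. Z c p i * chart_deriv c i (\<lambda>q. W c q l) p))"
    if Z: "Z \<in> LA" and W: "W \<in> LA" for Z W
  proof -
    have WS: "(\<lambda>q. W c q l) \<in> {f. smooth_in M c ?U f}" if "l < dm" for l
      using smooth_in_subset[OF LA_smooth[OF W c(1) that] U(2)] by simp
    have "(\<Sum>k<dm. Z c' (gmul a p) k * chart_deriv c' k (\<lambda>q. W c' q j) (gmul a p)) =
        (\<Sum>k<dm. \<Sum>i<dm. Z c p i * (?J i k * chart_deriv c' k (\<lambda>q. W c' q j) (gmul a p)))"
      by (intro sum.cong refl) (simp add: LA_left[OF Z a c p] sum_distrib_left sum_distrib_right mult_ac)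
    also have "\<dots> = (\<Sum>i<dm. Z c p i * (\<Sum>k<dm. ?J i k * chart_deriv c' k (\<lambda>q. W c' q j) (gmul a p)))"
      by (subst sum.swap) (simp add: sum_distrib_left)
    also have "\<dots> = (\<Sum>i<dm. Z c p i * chart_deriv c i (\<lambda>q. \<Sum>l<dm. chart_deriv c l ?F q * W c q l) p)"
    proof (intro sum.cong refl)
      fix i assume "i \<in> {..<dm}"
      then have i: "i < dm" by simp
      have "(\<Sum>k<dm. ?J i k * chart_deriv c' k (\<lambda>q. W c' q j) (gmul a p)) = chart_deriv c i (\<lambda>q. W c' (gmul a q) j) p"
        by (rule left_chain[where f = "\<lambda>q. W c' q j", OF a c p i chart_open[OF c(2)] order_refl p(2)
              LA_smooth[OF W c(2) j], symmetric])
      also have "\<dots> = chart_deriv c i (\<lambda>q. \<Sum>l<dm. chart_deriv c l ?F q * W c q l) p"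
        by (rule D_cong[OF i _ pU]) (simp add: LA_left[OF W a c _ _ j] jacobian_def)
      finally show "Z c p i * (\<Sum>k<dm. ?J i k * chart_deriv c' k (\<lambda>q. W c' q j) (gmul a p)) =
          Z c p i * chart_deriv c i (\<lambda>q. \<Sum>l<dm. chart_deriv c l ?F q * W c q l) p" by simp
    qed
    also have "\<dots> = (\<Sum>i<dm. Z c p i * (\<Sum>l<dm. chart_deriv c i (chart_deriv c l ?F) p * W c p l +
        chart_deriv c l ?F p * chart_deriv c i (\<lambda>q. W c q l) p))"
    proof (intro sum.cong refl)
      fix i assume "i \<in> {..<dm}"
      then have i: "i < dm" by simp
      have "chart_deriv c i (\<lambda>q. \<Sum>l<dm. chart_deriv c l ?F q * W c q l) p =
         (\<Sum>l<dm. chart_deriv c i (chart_deriv c l ?F) p * W c p l +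
        chart_deriv c l ?F p * chart_deriv c i (\<lambda>q. W c q l) p)"
        by (rule D_sum_mult[OF i pU]) (use S_D[OF _ FS] WS in auto)
      then show "Z c p i * chart_deriv c i (\<lambda>q. \<Sum>l<dm. chart_deriv c l ?F q * W c q l) p =
         Z c p i * (\<Sum>l<dm. chart_deriv c i (chart_deriv c l ?F) p * W c p l +
        chart_deriv c l ?F p * chart_deriv c i (\<lambda>q. W c q l) p)" by simp
    qed
    also have "\<dots> = (\<Sum>i<dm. \<Sum>l<dm. Z c p i * (W c p l * chart_deriv c i (chart_deriv c l ?F) p)) +
       (\<Sum>i<dm. \<Sum>l<dm. ?J l j * (Z c p i * chart_deriv c i (\<lambda>q. W c q l) p))"
      by (simp add: jacobian_def sum.distrib distrib_left sum_distrib_left mult_ac)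
    also have "(\<Sum>i<dm. \<Sum>l<dm. ?J l j * (Z c p i * chart_deriv c i (\<lambda>q. W c q l) p)) =
       (\<Sum>l<dm. ?J l j * (\<Sum>i<dm. Z c p i * chart_deriv c i (\<lambda>q. W c q l) p))"
      by (subst sum.swap) (simp add: sum_distrib_left)
    finally show ?thesis .
  qed
  have sym: "(\<Sum>i<dm. \<Sum>l<dm. X c p i * (Y c p l * chart_deriv c i (chart_deriv c l ?F) p)) =
      (\<Sum>i<dm. \<Sum>l<dm. Y c p i * (X c p l * chart_deriv c i (chart_deriv c l ?F) p))"
    by (subst sum.swap) (intro sum.cong refl, simp add: D_comm[OF _ _ FS pU] mult_ac)
  have "lie_bracket M X Y c' (gmul a p) j =
     (\<Sum>k<dm. X c' (gmul a p) k * chart_deriv c' k (\<lambda>q. Y c' q j) (gmul a p)) -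
     (\<Sum>k<dm. Y c' (gmul a p) k * chart_deriv c' k (\<lambda>q. X c' q j) (gmul a p))"
    using c p j by (simp add: lie_bracket_def sum_subtractf)
  also have "\<dots> = (\<Sum>l<dm. ?J l j * (\<Sum>i<dm. X c p i * chart_deriv c i (\<lambda>q. Y c q l) p)) -
      (\<Sum>l<dm. ?J l j * (\<Sum>i<dm. Y c p i * chart_deriv c i (\<lambda>q. X c q l) p))"
    unfolding lk[OF X Y] lk[OF Y X] sym by simp
  also have "\<dots> = (\<Sum>l<dm. ?J l j * lie_bracket M X Y c p l)"
    using c p by (simp add: lie_bracket_def sum_subtractf right_diff_distrib)
  finally show "lie_bracket M X Y c' (gmul a p) j = (\<Sum>l<dm. ?J l j * lie_bracket M X Y c p l)" .
qed

end

section \<open>Left-invariant orthonormal frames\<close>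

text \<open>\<open>E\<close> is a basis of the left-invariant fields with structure constants
  \<open>C\<close>. The number of its members is derived, not assumed, and orthonormality is imposed
  later by the choice of metric.\<close>

locale left_frame = lie_grp M G for M :: "'m mfd" and G +
  fixes B :: "'b set" and E :: "'b \<Rightarrow> 'm vfield" and C :: "'b \<Rightarrow> 'b \<Rightarrow> 'b \<Rightarrow> real"
  assumes finB: "finite B"
    and E_LA: "b \<in> B \<Longrightarrow> E b \<in> LA"
    and E_span: "X \<in> LA \<Longrightarrow> \<exists>x. X = (\<lambda>c p i. \<Sum>b\<in>B. x b * E b c p i)"
    and E_indep: "(\<lambda>c p i. \<Sum>b\<in>B. x b * E b c p i) = (\<lambda>_ _ _. 0) \<Longrightarrow> b \<in> B \<Longrightarrow> x b = 0"
    and E_bracket: "a \<in> B \<Longrightarrow> b \<in> B \<Longrightarrow>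
      lie_bracket M (E a) (E b) = (\<lambda>c p i. \<Sum>e\<in>B. C a b e * E e c p i)"
    and C_skew': "a \<in> B \<Longrightarrow> b \<in> B \<Longrightarrow> e \<in> B \<Longrightarrow> C b a e = - C a b e"
begin

section \<open>Dimension count and dual coframe\<close>

definition enum :: "nat \<Rightarrow> 'b" where
  "enum = (SOME h. bij_betw h {..<card B} B)"

lemma enum: "bij_betw enum {..<card B} B"
proof -
  have "\<exists>h. bij_betw h {..<card B} B"
    using ex_bij_betw_nat_finite[OF finB] by (simp add: atLeast0LessThan)
  then show ?thesis unfolding enum_def by (rule someI_ex)
qed

lemma sum_enum: "(\<Sum>k<card B. f (enum k)) = (\<Sum>b\<in>B. f b)"
  by (rule sum.reindex_bij_betw[OF enum])

lemma E_independent: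
  assumes c: "c \<in> matlas M" and p: "p \<in> fst c"
    and z: "\<And>i. i < dm \<Longrightarrow> (\<Sum>b\<in>B. x b * E b c p i) = 0" and b: "b \<in> B"
  shows "x b = 0"
  by (rule E_indep[OF LA_zero[OF LA_sum[OF E_LA] c p z] b])

lemma enum_inv:
  assumes "b \<in> B"
  shows "\<exists>k<card B. enum k = b"
proof -
  have "b \<in> enum ` {..<card B}" using enum assms by (simp add: bij_betw_def)
  then show ?thesis by auto
qed

lemma enum_B: "k < card B \<Longrightarrow> enum k \<in> B"
  using enum by (auto simp: bij_betw_def)

text \<open>Evaluate at the identity. With more than \<open>dm\<close> members a dependency at this
  point would be one of fields; with fewer, the left-invariant extensions of the coordinate vectors
  would be dependent there.\<close>

lemma card_B: "card B = dm"
proof -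
  obtain c0 where c0: "c0 \<in> matlas M" "\<one>\<^bsub>G\<^esub> \<in> fst c0" using chart_ex_carrier[OF one_carrier] by blast
  have "\<not> dm < card B"
  proof
    assume "dm < card B"
    from dependent_vectors[OF this, of "\<lambda>k j. E (enum k) c0 \<one>\<^bsub>G\<^esub> j"]
    obtain v where v: "\<exists>k<card B. v k \<noteq> 0" "\<forall>j<dm. (\<Sum>k<card B. v k * E (enum k) c0 \<one>\<^bsub>G\<^esub> j) = 0"
      by blast
    let ?x = "\<lambda>b. v (inv_into {..<card B} enum b)"
    have inv: "inv_into {..<card B} enum (enum k) = k" if "k < card B" for k
      using enum that by (simp add: bij_betw_def)
    have "(\<Sum>b\<in>B. ?x b * E b c0 \<one>\<^bsub>G\<^esub> j) = 0" if "j < dm" for j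
      using v(2) that by (simp add: sum_enum[symmetric] inv)
    then have "?x b = 0" if "b \<in> B" for b using E_independent[OF c0 _ that, of ?x] by blast
    then have "v k = 0" if "k < card B" for k using enum_B[OF that] inv[OF that] by fastforce
    then show False using v(1) by blast
  qed
  moreover have "\<not> card B < dm"
  proof
    assume lt: "card B < dm"
    let ?L = "\<lambda>i. lfield c0 (\<lambda>j. if i = j then 1 else 0)"
    have "\<forall>i. \<exists>x. ?L i = (\<lambda>c p j. \<Sum>b\<in>B. x b * E b c p j)"
      using E_span[OF lfield_LA[OF c0]] by blast
    from choice[OF this] obtain x where x: "\<forall>i. ?L i = (\<lambda>c p j. \<Sum>b\<in>B. x i b * E b c p j)" by blast
    from dependent_vectors[OF lt, of "\<lambda>i k. x i (enum k)"]
    obtain v where v: "\<exists>i<dm. v i \<noteq> 0" "\<forall>k<card B. (\<Sum>i<dm. v i * x i (enum k)) = 0" by blast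
    have "v j = 0" if j: "j < dm" for j
    proof -
      have "(\<Sum>b\<in>B. x i b * E b c0 \<one>\<^bsub>G\<^esub> j) = (if i = j then 1 else 0)" for i
        using lfield_one[OF c0 j, of "\<lambda>j. if i = j then 1 else 0"] x by metis
      then have "(\<Sum>i<dm. v i * (\<Sum>b\<in>B. x i b * E b c0 \<one>\<^bsub>G\<^esub> j)) = (\<Sum>i<dm. if i = j then v i else 0)"
        by (intro sum.cong) auto
      also have "\<dots> = v j" using j by simp
      also have "(\<Sum>i<dm. v i * (\<Sum>b\<in>B. x i b * E b c0 \<one>\<^bsub>G\<^esub> j)) =
          (\<Sum>i<dm. \<Sum>b\<in>B. v i * x i b * E b c0 \<one>\<^bsub>G\<^esub> j)"
        by (simp add: sum_distrib_left mult.assoc)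
      also have "\<dots> = (\<Sum>b\<in>B. \<Sum>i<dm. v i * x i b * E b c0 \<one>\<^bsub>G\<^esub> j)" by (rule sum.swap)
      also have "\<dots> = (\<Sum>b\<in>B. (\<Sum>i<dm. v i * x i b) * E b c0 \<one>\<^bsub>G\<^esub> j)"
        by (simp add: sum_distrib_right)
      also have "\<dots> = (\<Sum>k<card B. (\<Sum>i<dm. v i * x i (enum k)) * E (enum k) c0 \<one>\<^bsub>G\<^esub> j)"
        by (rule sum_enum[symmetric])
      also have "\<dots> = 0" using v(2) by simp
      finally show ?thesis by simp
    qed
    then show False using v(1) by blast
  qed
  ultimately show ?thesis by linarith
qed

text \<open>The dual coframe: frame vectors are the columns of a matrix, and the rows of its inverse
  are the dual covectors.\<close>

definition th :: "'m chart \<Rightarrow> 'b \<Rightarrow> nat \<Rightarrow> 'm \<Rightarrow> real" where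
  "th c b i p = minv dm (\<lambda>i k. E (enum k) c p i) (inv_into {..<dm} enum b) i"

lemma th_enum: "k < dm \<Longrightarrow> th c (enum k) i p = minv dm (\<lambda>i k. E (enum k) c p i) k i"
  using enum by (simp add: th_def bij_betw_def card_B)

lemma E_mdet:
  assumes c: "c \<in> matlas M" and p: "p \<in> fst c"
  shows "mdet dm (\<lambda>i k. E (enum k) c p i) \<noteq> 0"
proof (rule mdet_nonzero, intro allI impI)
  fix v k assume v: "\<And>i. i < dm \<Longrightarrow> (\<Sum>k<dm. E (enum k) c p i * v k) = 0" and k: "k < dm"
  let ?x = "\<lambda>b. v (inv_into {..<dm} enum b)"
  have inv: "inv_into {..<dm} enum (enum k) = k" if "k < dm" for k
    using enum that by (simp add: bij_betw_def card_B)
  have "(\<Sum>b\<in>B. ?x b * E b c p i) = 0" if i: "i < dm" for i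
    using v[OF i] by (simp add: sum_enum[symmetric] inv card_B mult.commute)
  from E_independent[OF c p this enum_B, of k] show "v k = 0" using k inv[OF k] by (simp add: card_B)
qed

lemma th_smooth:
  assumes c: "c \<in> matlas M" and b: "b \<in> B" and i: "i < dm"
  shows "smooth_in M c (fst c) (th c b i)"
proof -
  obtain k where k: "k < dm" "enum k = b" using enum_inv[OF b] card_B by auto
  have "smooth_fun_on dm (snd c ` fst c) (\<lambda>x. minv dm (\<lambda>i k. E (enum k) c (chart_inv c x) i) k i)"
  proof (rule smooth_minv[OF chart_image[OF c] _ _ k(1) i])
    show "smooth_fun_on dm (snd c ` fst c) (\<lambda>x. E (enum j) c (chart_inv c x) i)" if "i < dm" "j < dm" for i j
      using LA_smooth[OF E_LA[OF enum_B] c that(1)] that(2) by (simp add: card_B smooth_in_def)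
    show "mdet dm (\<lambda>i k. E (enum k) c (chart_inv c x) i) \<noteq> 0" if "x \<in> snd c ` fst c" for x
      using that E_mdet[OF c] chart_inv_left[OF c] by auto
  qed
  then show ?thesis unfolding smooth_in_def k(2)[symmetric] th_enum[OF k(1)] .
qed

lemma frame:
  assumes c: "c \<in> matlas M"
  shows "frame dm (fst c) {f. smooth_in M c (fst c) f} (chart_deriv c) B (th c) (\<lambda>b i p. E b c p i) C"
proof -
  interpret derivation_algebra dm "fst c" "{f. smooth_in M c (fst c) f}" "chart_deriv c"
    by (rule derivations[OF c chart_open[OF c] order_refl])
  show ?thesis
  proof
    show "finite B" by (rule finB)
    show "th c a i \<in> {f. smooth_in M c (fst c) f}" if "a \<in> B" "i < dm" for a i
      using th_smooth[OF c that] by simp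
    show "(\<lambda>p. E a c p i) \<in> {f. smooth_in M c (fst c) f}" if "a \<in> B" "i < dm" for a i
      using LA_smooth[OF E_LA[OF that(1)] c that(2)] by simp
    show "C b a e = - C a b e" if "a \<in> B" "b \<in> B" "e \<in> B" for a b e by (rule C_skew'[OF that])
  next
    fix p a b assume p: "p \<in> fst c" and a: "a \<in> B" and b: "b \<in> B"
    obtain k l where kl: "k < dm" "enum k = a" "l < dm" "enum l = b"
      using enum_inv[OF a] enum_inv[OF b] card_B by auto
    have "(\<Sum>i<dm. E a c p i * th c b i p) = (\<Sum>i<dm. minv dm (\<lambda>i k. E (enum k) c p i) l i * E (enum k) c p i)"
      unfolding kl(2,4)[symmetric] th_enum[OF kl(3)] by (simp add: mult.commute)
    also have "\<dots> = (if l = k then 1 else 0)" by (rule minv_left[OF E_mdet[OF c p] kl(3,1)])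
    also have "\<dots> = (if a = b then 1 else 0)"
      using enum kl by (auto simp: bij_betw_def inj_on_def card_B)
    finally show "(\<Sum>i<dm. E a c p i * th c b i p) = (if a = b then 1 else 0)" .
    fix j assume j: "j < dm"
    show "(\<Sum>i<dm. E a c p i * chart_deriv c i (\<lambda>p. E b c p j) p - E b c p i * chart_deriv c i (\<lambda>p. E a c p j) p) =
        (\<Sum>e\<in>B. C a b e * E e c p j)"
      using fun_cong[OF fun_cong[OF fun_cong[OF E_bracket[OF a b], of c], of p], of j] c p j
      by (simp add: lie_bracket_def)
  next
    fix p i j assume p: "p \<in> fst c" and ij: "i < dm" "j < dm"
    have "(\<Sum>a\<in>B. E a c p i * th c a j p) = (\<Sum>k<dm. E (enum k) c p i * minv dm (\<lambda>i k. E (enum k) c p i) k j)"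
      unfolding sum_enum[symmetric] card_B by (intro sum.cong refl) (simp add: th_enum)
    also have "\<dots> = (if i = j then 1 else 0)" by (rule minv_right[OF E_mdet[OF c p] ij])
    finally show "(\<Sum>a\<in>B. E a c p i * th c a j p) = (if i = j then 1 else 0)" .
  qed
qed

text \<open>The pulled-back coframe has the same pairing with the invariant frame as
  \<open>th\<close> itself, and covectors are determined by these pairings.\<close>

lemma th_left:
  assumes a: "a \<in> carrier G" and c: "c \<in> matlas M" "c' \<in> matlas M"
    and p: "p \<in> fst c" "gmul a p \<in> fst c'" and b: "b \<in> B" and i: "i < dm"
  shows "th c b i p = (\<Sum>j<dm. jacobian (gmul a) c c' p i j * th c' b j (gmul a p))"
proof -
  interpret F: frame dm "fst c" "{f. smooth_in M c (fst c) f}" "chart_deriv c" B "th c" "\<lambda>b i p. E b c p i" C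
    by (rule frame[OF c(1)])
  interpret F': frame dm "fst c'" "{f. smooth_in M c' (fst c') f}" "chart_deriv c'" B "th c'" "\<lambda>b i p. E b c' p i" C
    by (rule frame[OF c(2)])
  let ?w = "\<lambda>i. \<Sum>j<dm. jacobian (gmul a) c c' p i j * th c' b j (gmul a p)"
  have "(\<Sum>i<dm. E e c p i * ?w i) = (if e = b then 1 else 0)" if e: "e \<in> B" for e
  proof -
    have "(\<Sum>i<dm. E e c p i * ?w i) = (\<Sum>i<dm. \<Sum>j<dm. th c' b j (gmul a p) * (jacobian (gmul a) c c' p i j * E e c p i))"
      by (simp add: sum_distrib_left mult_ac)
    also have "\<dots> = (\<Sum>j<dm. \<Sum>i<dm. th c' b j (gmul a p) * (jacobian (gmul a) c c' p i j * E e c p i))"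
      by (rule sum.swap)
    also have "\<dots> = (\<Sum>j<dm. E e c' (gmul a p) j * th c' b j (gmul a p))"
      by (intro sum.cong refl) (simp add: LA_left[OF E_LA[OF e] a c p] sum_distrib_left sum_distrib_right mult_ac)
    also have "\<dots> = (if e = b then 1 else 0)" by (rule F'.dual1[OF p(2) e b])
    finally show ?thesis .
  qed
  then have "?w i = (\<Sum>e\<in>B. th c e i p * (if e = b then 1 else 0))"
    using F.expand_th[OF p(1) i, of ?w] by simp
  also have "\<dots> = (\<Sum>e\<in>B. if e = b then th c e i p else 0)" by (intro sum.cong) auto
  also have "\<dots> = th c b i p" using b finB by simp
  finally show ?thesis by simp
qed

lemma th_transition:
  assumes c: "c \<in> matlas M" "c' \<in> matlas M" and p: "p \<in> fst c" "p \<in> fst c'" and b: "b \<in> B" and i: "i < dm"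
  shows "th c b i p = (\<Sum>j<dm. jacobian (\<lambda>q. q) c c' p i j * th c' b j p)"
proof -
  have e: "gmul \<one>\<^bsub>G\<^esub> p = p" by (rule gmul_one(1)[OF chart_carrier[OF c(1) p(1)]])
  have "th c b i p = (\<Sum>j<dm. jacobian (gmul \<one>\<^bsub>G\<^esub>) c c' p i j * th c' b j (gmul \<one>\<^bsub>G\<^esub> p))"
    by (rule th_left[OF one_carrier c p(1) _ b i]) (simp add: e p)
  then show ?thesis by (simp add: e jacobian_one[OF c(1) p(1) i])
qed

text \<open>The metric for which the frame \<open>E\<close> is orthonormal.\<close>

definition metric :: "'m tensor2" where
  "metric c p i j = (\<Sum>b\<in>B. th c b i p * th c b j p)"

text \<open>Serves both changes of charts and left translations, with \<open>J\<close> the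
  respective Jacobian.\<close>

lemma metric_pullback:
  assumes "\<And>b i. b \<in> B \<Longrightarrow> i < dm \<Longrightarrow> th c b i p = (\<Sum>k<dm. J i k * th c' b k p')" "i < dm" "j < dm"
  shows "metric c p i j = (\<Sum>k<dm. \<Sum>l<dm. J i k * J j l * metric c' p' k l)"
proof -
  have "metric c p i j = (\<Sum>b\<in>B. \<Sum>k<dm. \<Sum>l<dm. J i k * J j l * (th c' b k p' * th c' b l p'))"
    by (simp add: metric_def assms sum_product mult_ac)
  also have "\<dots> = (\<Sum>k<dm. \<Sum>b\<in>B. \<Sum>l<dm. J i k * J j l * (th c' b k p' * th c' b l p'))"
    by (rule sum.swap)
  also have "\<dots> = (\<Sum>k<dm. \<Sum>l<dm. \<Sum>b\<in>B. J i k * J j l * (th c' b k p' * th c' b l p'))"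
    by (intro sum.cong refl sum.swap)
  finally show ?thesis by (simp add: metric_def sum_distrib_left)
qed

lemma riemannian_metric: "riemannian_metric M metric"
  unfolding riemannian_metric_def
proof (intro conjI ballI allI impI)
  fix c i j assume c: "c \<in> matlas M" and ij: "i < dm" "j < dm"
  interpret F: frame dm "fst c" "{f. smooth_in M c (fst c) f}" "chart_deriv c" B "th c" "\<lambda>b i p. E b c p i" C
    by (rule frame[OF c])
  have "(\<lambda>p. metric c p i j) \<in> {f. smooth_in M c (fst c) f}"
    unfolding metric_def using ij by (intro F.S_sum F.S_mult F.th_S)
  then show "smooth_fun_on dm (snd c ` fst c) (\<lambda>x. metric c (chart_inv c x) i j)"
    by (simp add: smooth_in_def)
next
  fix c c' p i j assume "c \<in> matlas M" "c' \<in> matlas M" "p \<in> fst c \<inter> fst c'" and ij: "i < dm" "j < dm"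
  then show "metric c p i j = (\<Sum>k<dm. \<Sum>l<dm. jacobian (\<lambda>q. q) c c' p i k * jacobian (\<lambda>q. q) c c' p j l * metric c' p k l)"
    by (intro metric_pullback[OF _ ij] th_transition) auto
next
  fix c p i j show "metric c p i j = metric c p j i" by (simp add: metric_def mult.commute)
next
  fix c p and v :: "nat \<Rightarrow> real" assume c: "c \<in> matlas M" and p: "p \<in> fst c" and v: "\<exists>i<dm. v i \<noteq> 0"
  interpret F: frame dm "fst c" "{f. smooth_in M c (fst c) f}" "chart_deriv c" B "th c" "\<lambda>b i p. E b c p i" C
    by (rule frame[OF c])
  have "(\<Sum>i<dm. \<Sum>j<dm. metric c p i j * v i * v j) =
      (\<Sum>i<dm. \<Sum>j<dm. \<Sum>b\<in>B. (th c b i p * v i) * (th c b j p * v j))"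
    by (simp add: metric_def sum_distrib_right sum_distrib_left mult_ac)
  also have "\<dots> = (\<Sum>i<dm. \<Sum>b\<in>B. \<Sum>j<dm. (th c b i p * v i) * (th c b j p * v j))"
    by (intro sum.cong refl sum.swap)
  also have "\<dots> = (\<Sum>b\<in>B. \<Sum>i<dm. \<Sum>j<dm. (th c b i p * v i) * (th c b j p * v j))"
    by (rule sum.swap)
  also have "\<dots> = (\<Sum>b\<in>B. (\<Sum>i<dm. th c b i p * v i)\<^sup>2)"
    by (simp add: power2_eq_square sum_product)
  also have "\<dots> > 0"
  proof -
    have "\<exists>b\<in>B. (\<Sum>i<dm. th c b i p * v i) \<noteq> 0"
    proof (rule ccontr)
      assume "\<not> (\<exists>b\<in>B. (\<Sum>i<dm. th c b i p * v i) \<noteq> 0)"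
      then have "v j = 0" if "j < dm" for j using F.expand_E[OF p that, of v] by simp
      then show False using v by blast
    qed
    then obtain b where "b \<in> B" "(\<Sum>i<dm. th c b i p * v i) \<noteq> 0" by blast
    then show ?thesis by (intro sum_pos2[OF finB]) auto
  qed
  finally show "(\<Sum>i<dm. \<Sum>j<dm. metric c p i j * v i * v j) > 0" .
qed

lemma left_invariant_metric: "left_invariant_metric M G metric"
  unfolding left_invariant_metric_def
proof (intro conjI ballI allI impI)
  fix a c c' p i j assume "a \<in> carrier G" "c \<in> matlas M" "c' \<in> matlas M" "p \<in> fst c" "gmul a p \<in> fst c'"
    and ij: "i < dm" "j < dm"
  then show "metric c p i j = (\<Sum>k<dm. \<Sum>l<dm. jacobian (gmul a) c c' p i k * jacobian (gmul a) c c' p j l *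
      metric c' (gmul a p) k l)"
    by (intro metric_pullback[OF _ ij] th_left)
qed (rule riemannian_metric)

definition ricci_coeff :: "'b \<Rightarrow> 'b \<Rightarrow> real" where
  "ricci_coeff b m = (\<Sum>a\<in>B. \<Sum>n\<in>B. C a n b * C a n m / 4 - C b a n * C m a n / 2 - C b a n * C m n a / 2)"

text \<open>Identifies the coordinate definitions of inverse metric, Christoffel symbols and
  curvature with their frame counterparts on the chart domain, after which
  \<open>ricci_frame\<close> and \<open>ricc_eq\<close> apply.\<close>

lemma ricci_metric:
  assumes c: "c \<in> matlas M" and p: "p \<in> fst c" and jk: "j < dm" "k < dm"
    and uni: "\<And>n. n \<in> B \<Longrightarrow> (\<Sum>a\<in>B. C a n a) = 0"
  shows "ricci M metric c p j k = (\<Sum>b\<in>B. \<Sum>m\<in>B. ricci_coeff b m * th c b j p * th c m k p)"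
proof -
  interpret F: frame dm "fst c" "{f. smooth_in M c (fst c) f}" "chart_deriv c" B "th c" "\<lambda>b i p. E b c p i" C
    by (rule frame[OF c])
  have gg: "(\<lambda>q. metric c q i j) = F.gg i j" for i j by (simp add: metric_def F.gg_def fun_eq_iff)
  have gg': "metric c q i j = F.gg i j q" for i j q by (simp add: metric_def F.gg_def)
  have inv: "metric_inverse M metric c q k l = F.hh k l q" if q: "q \<in> fst c" and kl: "k < dm" "l < dm" for q k l
  proof -
    let ?P = "\<lambda>h. (\<forall>i k. i < dm \<and> k < dm \<longrightarrow> (\<Sum>j<dm. metric c q i j * h j k) = (if i = k then 1 else 0)) \<and>
      (\<forall>i k. \<not> (i < dm \<and> k < dm) \<longrightarrow> h i k = 0)"
    let ?h = "\<lambda>i k. if i < dm \<and> k < dm then F.hh i k q else 0"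
    \<comment> \<open>Uniqueness holds because \<open>hh\<close> is, by symmetry, also a left
      inverse of the metric.\<close>
    have "(THE h. ?P h) = ?h"
    proof (rule the_equality)
      show "?P ?h" by (auto simp: gg' F.gg_hh[OF q])
      fix h assume h: "?P h"
      show "h = ?h"
      proof (intro ext)
        fix l k
        show "h l k = ?h l k"
        proof (cases "l < dm \<and> k < dm")
          case True
          then have lk: "l < dm" "k < dm" by auto
          have hg: "(\<Sum>i<dm. F.hh l i q * F.gg i j q) = (if j = l then 1 else 0)" if "j < dm" for j
            using F.gg_hh[OF q that lk(1)] by (simp add: F.gg_sym[of _ j] F.hh_sym[of l] mult.commute)
          have "(\<Sum>i<dm. F.hh l i q * (\<Sum>j<dm. F.gg i j q * h j k)) = (\<Sum>i<dm. \<Sum>j<dm. F.hh l i q * F.gg i j q * h j k)"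
            by (simp add: sum_distrib_left mult.assoc)
          also have "\<dots> = (\<Sum>j<dm. \<Sum>i<dm. F.hh l i q * F.gg i j q * h j k)" by (rule sum.swap)
          also have "\<dots> = (\<Sum>j<dm. (if j = l then 1 else 0) * h j k)"
            by (simp add: sum_distrib_right[symmetric] hg)
          also have "\<dots> = (\<Sum>j<dm. if j = l then h j k else 0)" by (intro sum.cong) auto
          also have "\<dots> = h l k" using lk by simp
          also have "(\<Sum>i<dm. F.hh l i q * (\<Sum>j<dm. F.gg i j q * h j k)) = (\<Sum>i<dm. F.hh l i q * (if i = k then 1 else 0))"
            using h lk by (intro sum.cong refl) (simp add: gg')
          also have "\<dots> = (\<Sum>i<dm. if i = k then F.hh l i q else 0)" by (intro sum.cong) auto
          also have "\<dots> = F.hh l k q" using lk by simp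
          finally show ?thesis using lk by simp
        next
          case False
          then show ?thesis using h by auto
        qed
      qed
    qed
    then show ?thesis unfolding metric_inverse_def using kl by simp
  qed
  have chr: "christoffel M metric c k i j q = F.Gam k i j q" if q: "q \<in> fst c" and kij: "k < dm" "i < dm" "j < dm" for k i j q
    unfolding christoffel_def gg F.christoffel_eq[OF q kij, symmetric]
    by (intro sum.cong refl) (simp add: inv[OF q kij(1)])
  have dchr: "chart_deriv c l (christoffel M metric c k i j) p = chart_deriv c l (F.Gam k i j) p"
    if "l < dm" "k < dm" "i < dm" "j < dm" for l k i j
    by (rule F.D_cong[OF that(1) _ p]) (rule chr[OF _ that(2-4)])
  have "ricci M metric c p j k = (\<Sum>i<dm. F.Rm i k i j p)"
    unfolding ricci_def
  proof (intro sum.cong refl)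
    fix i assume "i \<in> {..<dm}"
    then show "curvature M metric c i k i j p = F.Rm i k i j p"
      unfolding curvature_def F.Rm_def using jk by (simp add: dchr chr[OF p])
  qed
  also have "\<dots> = (\<Sum>b\<in>B. \<Sum>m\<in>B. F.ricc b m * th c b j p * th c m k p)"
    by (rule F.ricci_frame[OF p jk])
  also have "\<dots> = (\<Sum>b\<in>B. \<Sum>m\<in>B. ricci_coeff b m * th c b j p * th c m k p)"
    by (intro sum.cong refl) (simp add: F.ricc_eq uni ricci_coeff_def)
  finally show ?thesis .
qed

text \<open>The soliton field is found one component at a time, by increasing rank: each component is a
  primitive of a one-form in the components of smaller rank, which is closed by the Jacobi identity
  and the derivation property.\<close>

lemma derivation_field:
  fixes rank :: "'b \<Rightarrow> nat"
  assumes sc: "simply_connected_space (mtop M)"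
    and rank: "\<And>a b e. a \<in> B \<Longrightarrow> b \<in> B \<Longrightarrow> e \<in> B \<Longrightarrow> C a b e \<noteq> 0 \<Longrightarrow> rank b < rank e"
    and jac: "\<And>a b e k. a \<in> B \<Longrightarrow> b \<in> B \<Longrightarrow> e \<in> B \<Longrightarrow> k \<in> B \<Longrightarrow>
      (\<Sum>l\<in>B. C b l e * C a k l - C a l e * C b k l + C a b l * C l k e) = 0"
    and der: "\<And>a b e. a \<in> B \<Longrightarrow> b \<in> B \<Longrightarrow> e \<in> B \<Longrightarrow> C a b e \<noteq> 0 \<Longrightarrow> dd a + dd b = dd e"
  shows "\<exists>f. \<forall>a\<in>B. \<forall>c\<in>matlas M. smooth_in M c (fst c) (f a) \<and> (\<forall>p\<in>fst c. \<forall>i<dm.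
    chart_deriv c i (f a) p = dd a * th c a i p - (\<Sum>b\<in>B. \<Sum>e\<in>B. C b e a * th c b i p * f e p))"
proof -
  define sol where "sol f a \<longleftrightarrow> (\<forall>c\<in>matlas M. \<forall>p\<in>fst c. \<forall>i<dm.
    chart_deriv c i (f a) p = dd a * th c a i p - (\<Sum>b\<in>B. \<Sum>e\<in>B. C b e a * th c b i p * f e p))"
    for f :: "'b \<Rightarrow> 'm \<Rightarrow> real" and a
  define smo where "smo f \<longleftrightarrow> (\<forall>c\<in>matlas M. smooth_in M c (fst c) f)" for f
  have "\<exists>f. (\<forall>a\<in>B. smo (f a)) \<and> (\<forall>a\<in>B. rank a < n \<longrightarrow> sol f a)" for n
  proof (induction n)
    case 0
    \<comment> \<open>The functions of not yet treated rank are dummies, smooth but not solutions;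
      zero will do at the start.\<close>
    have "smo (\<lambda>_. 0)"
      unfolding smo_def smooth_in_def using smooth_fun_on_intros(1)[OF chart_image] by blast
    then show ?case by (intro exI[of _ "\<lambda>_ _. 0"]) simp
  next
    case (Suc n)
    then obtain f where f: "\<forall>a\<in>B. smo (f a)" "\<forall>a\<in>B. rank a < n \<longrightarrow> sol f a" by blast
    have fS: "f a \<in> {f. smooth_in M c (fst c) f}" if "a \<in> B" "c \<in> matlas M" for a c
      using f(1) that unfolding smo_def by blast
    have step: "\<exists>F. \<forall>c\<in>matlas M. smooth_in M c (fst c) F \<and> (\<forall>p\<in>fst c. \<forall>i<dm. chart_deriv c i F p =
        dd a * th c a i p - (\<Sum>b\<in>B. \<Sum>e\<in>B. C b e a * th c b i p * f e p))" if a: "a \<in> B" "rank a = n" for a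
    proof -
      \<comment> \<open>The frame components of the one-form whose primitive is to become component
        \<open>a\<close>.\<close>
      define h where "h b p = (if b = a then dd a else 0) - (\<Sum>e\<in>B. C b e a * f e p)" for b p
      define \<eta> where "\<eta> c i p = (\<Sum>b\<in>B. h b p * th c b i p)" for c i p
      have hS: "h b \<in> {f. smooth_in M c (fst c) f}" if "b \<in> B" "c \<in> matlas M" for b c
      proof -
        interpret F: frame dm "fst c" "{f. smooth_in M c (fst c) f}" "chart_deriv c" B "th c" "\<lambda>b i p. E b c p i" C
          by (rule frame[OF that(2)])
        have "(\<lambda>p. (if b = a then dd a else 0) + (-1) * (\<Sum>e\<in>B. C b e a * f e p)) \<in> {f. smooth_in M c (fst c) f}"
          by (intro F.S_add F.S_const F.S_cmult F.S_sum fS that)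
        then show ?thesis by (simp add: h_def[abs_def])
      qed
      have "\<exists>F. \<forall>c\<in>matlas M. smooth_in M c (fst c) F \<and> (\<forall>p\<in>fst c. \<forall>i<dm. chart_deriv c i F p = \<eta> c i p)"
      proof (rule closed_exact[OF sc])
        fix c i assume c: "c \<in> matlas M" and i: "i < dm"
        interpret F: frame dm "fst c" "{f. smooth_in M c (fst c) f}" "chart_deriv c" B "th c" "\<lambda>b i p. E b c p i" C
          by (rule frame[OF c])
        have "\<eta> c i \<in> {f. smooth_in M c (fst c) f}"
          unfolding \<eta>_def[abs_def] using i by (intro F.S_sum F.S_mult hS c F.th_S)
        then show "smooth_in M c (fst c) (\<eta> c i)" by simp
        fix j p assume j: "j < dm" and p: "p \<in> fst c"
        \<comment> \<open>\<open>k e b\<close> is the component along \<open>th b\<close> of the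
          differential prescribed for \<open>f e\<close>, and \<open>w b' b\<close> below is that of
          the differential of \<open>h b\<close>.\<close>
        define k where "k e b = (if e = b then dd e else 0) - (\<Sum>l\<in>B. C b l e * f l p)" for e b
        define w where "w b' b = - (\<Sum>e\<in>B. C b e a * k e b')" for b' b
        show "chart_deriv c i (\<eta> c j) p = chart_deriv c j (\<eta> c i) p"
          unfolding \<eta>_def[abs_def]
        proof (rule F.closed_form[where w = w and h = h, OF hS[OF _ c] i j p])
          fix b i assume b: "b \<in> B" and i: "i < dm"
          \<comment> \<open>The factor \<open>C b e a\<close> restricts the claim to
            \<open>e\<close> of smaller rank, where the equation for \<open>f e\<close> is already
            available.\<close>
          have fe: "C b e a * chart_deriv c i (f e) p = C b e a * (\<Sum>b'\<in>B. k e b' * th c b' i p)" if e: "e \<in> B" for e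
          proof (cases "C b e a = 0")
            case False
            then have "rank e < n" using rank[OF b e a(1)] a(2) by simp
            then have "chart_deriv c i (f e) p = dd e * th c e i p - (\<Sum>b'\<in>B. \<Sum>l\<in>B. C b' l e * th c b' i p * f l p)"
              using f(2) e c p i unfolding sol_def by blast
            also have "dd e * th c e i p = (\<Sum>b'\<in>B. if e = b' then dd e * th c b' i p else 0)"
              using e finB by simp
            also have "\<dots> - (\<Sum>b'\<in>B. \<Sum>l\<in>B. C b' l e * th c b' i p * f l p) = (\<Sum>b'\<in>B. k e b' * th c b' i p)"
              unfolding k_def sum_subtractf[symmetric]
              by (intro sum.cong refl) (simp add: left_diff_distrib right_diff_distrib sum_distrib_right sum_distrib_left mult_ac)
            finally show ?thesis by simp
          qed simp
          have "chart_deriv c i (h b) p = chart_deriv c i (\<lambda>p. (if b = a then dd a else 0) + (-1) * (\<Sum>e\<in>B. C b e a * f e p)) p"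
            by (simp add: h_def[abs_def])
          also have "\<dots> = chart_deriv c i (\<lambda>_. if b = a then dd a else 0) p + chart_deriv c i (\<lambda>p. (-1) * (\<Sum>e\<in>B. C b e a * f e p)) p"
            by (rule F.D_add[OF i _ _ p]) (intro F.S_const F.S_cmult F.S_sum fS c)+
          also have "chart_deriv c i (\<lambda>_. if b = a then dd a else 0) p = 0" by (rule F.D_const[OF i p])
          also have "chart_deriv c i (\<lambda>p. (-1) * (\<Sum>e\<in>B. C b e a * f e p)) p = (-1) * chart_deriv c i (\<lambda>p. \<Sum>e\<in>B. C b e a * f e p) p"
            by (rule F.D_cmult[OF i _ p]) (intro F.S_cmult F.S_sum fS c)
          also have "chart_deriv c i (\<lambda>p. \<Sum>e\<in>B. C b e a * f e p) p = (\<Sum>e\<in>B. chart_deriv c i (\<lambda>p. C b e a * f e p) p)"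
            by (rule F.D_sum[OF i p]) (intro F.S_cmult fS c)
          also have "\<dots> = (\<Sum>e\<in>B. C b e a * chart_deriv c i (f e) p)"
            by (intro sum.cong refl F.D_cmult[OF i _ p] fS c)
          also have "\<dots> = (\<Sum>e\<in>B. \<Sum>b'\<in>B. C b e a * k e b' * th c b' i p)"
            by (intro sum.cong refl) (simp add: fe sum_distrib_left mult.assoc)
          also have "\<dots> = (\<Sum>b'\<in>B. \<Sum>e\<in>B. C b e a * k e b' * th c b' i p)" by (rule sum.swap)
          finally show "chart_deriv c i (h b) p = (\<Sum>b'\<in>B. w b' b * th c b' i p)"
            by (simp add: w_def sum_distrib_right sum_negf)
        next
          fix b' b assume b': "b' \<in> B" and b: "b \<in> B"
          have w: "w b' b = - (C b b' a * dd b') + (\<Sum>l\<in>B. \<Sum>e\<in>B. C b e a * C b' l e * f l p)"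
            if "b' \<in> B" for b' b
          proof -
            have "w b' b = (\<Sum>e\<in>B. (if e = b' then - (C b e a * dd e) else 0) + (\<Sum>l\<in>B. C b e a * C b' l e * f l p))"
              unfolding w_def k_def sum_negf[symmetric]
              by (intro sum.cong refl) (simp add: right_diff_distrib sum_distrib_left mult.assoc)
            also have "\<dots> = - (C b b' a * dd b') + (\<Sum>e\<in>B. \<Sum>l\<in>B. C b e a * C b' l e * f l p)"
              using that finB by (simp add: sum.distrib)
            also have "(\<Sum>e\<in>B. \<Sum>l\<in>B. C b e a * C b' l e * f l p) = (\<Sum>l\<in>B. \<Sum>e\<in>B. C b e a * C b' l e * f l p)"
              by (rule sum.swap)
            finally show ?thesis .
          qed
          have r: "(\<Sum>e\<in>B. C b' b e * h e p) = C b' b a * dd a - (\<Sum>l\<in>B. \<Sum>e\<in>B. C b' b e * C e l a * f l p)"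
          proof -
            have "(\<Sum>e\<in>B. C b' b e * h e p) = (\<Sum>e\<in>B. (if e = a then C b' b e * dd a else 0) - (\<Sum>l\<in>B. C b' b e * C e l a * f l p))"
              unfolding h_def by (intro sum.cong refl) (simp add: right_diff_distrib sum_distrib_left mult.assoc)
            also have "\<dots> = C b' b a * dd a - (\<Sum>e\<in>B. \<Sum>l\<in>B. C b' b e * C e l a * f l p)"
              using a(1) finB by (simp add: sum_subtractf)
            also have "(\<Sum>e\<in>B. \<Sum>l\<in>B. C b' b e * C e l a * f l p) = (\<Sum>l\<in>B. \<Sum>e\<in>B. C b' b e * C e l a * f l p)"
              by (rule sum.swap)
            finally show ?thesis .
          qed
          \<comment> \<open>The terms that contain \<open>f\<close> vanish by the Jacobi identity.
            The constant terms are left to the derivation property, in \<open>D\<close>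
            below.\<close>
          have "(\<Sum>l\<in>B. \<Sum>e\<in>B. C b e a * C b' l e * f l p) - (\<Sum>l\<in>B. \<Sum>e\<in>B. C b' e a * C b l e * f l p) +
              (\<Sum>l\<in>B. \<Sum>e\<in>B. C b' b e * C e l a * f l p) =
              (\<Sum>l\<in>B. (\<Sum>e\<in>B. C b e a * C b' l e - C b' e a * C b l e + C b' b e * C e l a) * f l p)"
            by (simp add: sum.distrib sum_subtractf sum_distrib_right distrib_right left_diff_distrib)
          also have "\<dots> = 0" using jac[OF b' b a(1)] by simp
          finally have J: "(\<Sum>l\<in>B. \<Sum>e\<in>B. C b e a * C b' l e * f l p) - (\<Sum>l\<in>B. \<Sum>e\<in>B. C b' e a * C b l e * f l p) =
              - (\<Sum>l\<in>B. \<Sum>e\<in>B. C b' b e * C e l a * f l p)" by simp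
          have D: "C b' b a * dd b' + C b' b a * dd b = C b' b a * dd a"
          proof (cases "C b' b a = 0")
            case False
            from der[OF b' b a(1) this] show ?thesis by (simp add: distrib_left[symmetric])
          qed simp
          show "w b' b - w b b' = (\<Sum>e\<in>B. C b' b e * h e p)"
            unfolding w[OF b'] w[OF b] r C_skew'[OF b' b a(1)] using J D by simp
        qed (use c in auto)
      next
        fix c c' i p assume c: "c \<in> matlas M" "c' \<in> matlas M" and i: "i < dm" and p: "p \<in> fst c" "p \<in> fst c'"
        have "\<eta> c i p = (\<Sum>b\<in>B. \<Sum>j<dm. jacobian (\<lambda>q. q) c c' p i j * (h b p * th c' b j p))"
          unfolding \<eta>_def using th_transition[OF c p _ i]
          by (intro sum.cong refl) (simp add: sum_distrib_left mult_ac)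
        also have "\<dots> = (\<Sum>j<dm. \<Sum>b\<in>B. jacobian (\<lambda>q. q) c c' p i j * (h b p * th c' b j p))" by (rule sum.swap)
        finally show "\<eta> c i p = (\<Sum>j<dm. jacobian (\<lambda>q. q) c c' p i j * \<eta> c' j p)"
          by (simp add: \<eta>_def sum_distrib_left)
      qed
      moreover have "\<eta> c i p = dd a * th c a i p - (\<Sum>b\<in>B. \<Sum>e\<in>B. C b e a * th c b i p * f e p)" for c i p
      proof -
        have "\<eta> c i p = (\<Sum>b\<in>B. (if b = a then dd a * th c b i p else 0) - (\<Sum>e\<in>B. C b e a * th c b i p * f e p))"
          unfolding \<eta>_def h_def by (intro sum.cong refl) (simp add: left_diff_distrib right_diff_distrib sum_distrib_left sum_distrib_right mult_ac)
        then show ?thesis using a(1) finB by (simp add: sum_subtractf)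
      qed
      ultimately show ?thesis by simp
    qed
    have "\<forall>a. \<exists>F. a \<in> B \<longrightarrow> rank a = n \<longrightarrow> (\<forall>c\<in>matlas M. smooth_in M c (fst c) F \<and> (\<forall>p\<in>fst c. \<forall>i<dm. chart_deriv c i F p =
        dd a * th c a i p - (\<Sum>b\<in>B. \<Sum>e\<in>B. C b e a * th c b i p * f e p)))"
      using step by blast
    from choice[OF this] obtain F where F: "\<forall>a. a \<in> B \<longrightarrow> rank a = n \<longrightarrow> (\<forall>c\<in>matlas M. smooth_in M c (fst c) (F a) \<and>
      (\<forall>p\<in>fst c. \<forall>i<dm. chart_deriv c i (F a) p = dd a * th c a i p - (\<Sum>b\<in>B. \<Sum>e\<in>B. C b e a * th c b i p * f e p)))"
      by blast
    define f' where "f' a = (if rank a = n then F a else f a)" for a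
    \<comment> \<open>Equations up to rank \<open>n\<close> involve only components of strictly
      smaller rank, which the new functions do not alter.\<close>
    have same: "(\<Sum>b\<in>B. \<Sum>e\<in>B. C b e a * th c b i p * f' e p) = (\<Sum>b\<in>B. \<Sum>e\<in>B. C b e a * th c b i p * f e p)"
      if a: "a \<in> B" "rank a < Suc n" for a c i p
    proof (intro sum.cong refl)
      fix b e assume be: "b \<in> B" "e \<in> B"
      show "C b e a * th c b i p * f' e p = C b e a * th c b i p * f e p"
      proof (cases "C b e a = 0")
        case False
        then have "rank e < n" using rank[OF be a(1)] a(2) by simp
        then show ?thesis by (simp add: f'_def)
      qed simp
    qed
    show ?case
    proof (intro exI[of _ f'] conjI ballI impI)
      fix a assume a: "a \<in> B"
      show "smo (f' a)" using f(1) F a by (auto simp: f'_def smo_def)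
      assume r: "rank a < Suc n"
      show "sol f' a"
      proof (cases "rank a = n")
        case True
        then show ?thesis using F a unfolding sol_def same[OF a r] by (auto simp: f'_def)
      next
        case False
        then have "sol f a" using f(2) a r by auto
        then show ?thesis using False unfolding sol_def same[OF a r] by (auto simp: f'_def)
      qed
    qed
  qed
  from this[of "Suc (Max (insert 0 (rank ` B)))"] obtain f where
    f: "\<forall>a\<in>B. smo (f a)" "\<forall>a\<in>B. rank a < Suc (Max (insert 0 (rank ` B))) \<longrightarrow> sol f a" by blast
  have "rank a < Suc (Max (insert 0 (rank ` B)))" if "a \<in> B" for a
    using finB that by (simp add: less_Suc_eq_le)
  then show ?thesis using f unfolding smo_def sol_def by (intro exI[of _ f]) blast
qed

text \<open>The Ricci tensor has the value \<open>\<kappa> + 2 * dd b\<close> on \<open>E b\<close>,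
  and the field whose bracket with each frame vector is prescribed by \<open>dd\<close> has a Lie
  derivative of the metric equal to \<open>2 * dd b\<close> there.\<close>

theorem soliton:
  fixes rank :: "'b \<Rightarrow> nat"
  assumes sc: "simply_connected_space (mtop M)"
    and rank: "\<And>a b e. a \<in> B \<Longrightarrow> b \<in> B \<Longrightarrow> e \<in> B \<Longrightarrow> C a b e \<noteq> 0 \<Longrightarrow> rank b < rank e"
    and jac: "\<And>a b e k. a \<in> B \<Longrightarrow> b \<in> B \<Longrightarrow> e \<in> B \<Longrightarrow> k \<in> B \<Longrightarrow>
      (\<Sum>l\<in>B. C b l e * C a k l - C a l e * C b k l + C a b l * C l k e) = 0"
    and der: "\<And>a b e. a \<in> B \<Longrightarrow> b \<in> B \<Longrightarrow> e \<in> B \<Longrightarrow> C a b e \<noteq> 0 \<Longrightarrow> dd a + dd b = dd e"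
    and uni: "\<And>n. n \<in> B \<Longrightarrow> (\<Sum>a\<in>B. C a n a) = 0"
    and ric: "\<And>b m. b \<in> B \<Longrightarrow> m \<in> B \<Longrightarrow> ricci_coeff b m = (if b = m then \<kappa> + 2 * dd b else 0)"
  shows "ricci_soliton M metric"
proof -
  have "\<exists>f. \<forall>a\<in>B. \<forall>c\<in>matlas M. smooth_in M c (fst c) (f a) \<and> (\<forall>p\<in>fst c. \<forall>i<dm.
    chart_deriv c i (f a) p = dd a * th c a i p - (\<Sum>b\<in>B. \<Sum>e\<in>B. C b e a * th c b i p * f e p))"
    by (rule derivation_field[OF sc, of rank dd]) (fact rank jac der)+
  then obtain f where
    f: "\<forall>a\<in>B. \<forall>c\<in>matlas M. smooth_in M c (fst c) (f a) \<and> (\<forall>p\<in>fst c. \<forall>i<dm.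
    chart_deriv c i (f a) p = dd a * th c a i p - (\<Sum>b\<in>B. \<Sum>e\<in>B. C b e a * th c b i p * f e p))" by blast
  define X where "X c p k = (\<Sum>b\<in>B. f b p * E b c p k)" for c p k
  have "vector_field M X"
    unfolding vector_field_def
  proof (intro conjI allI impI ballI)
    fix c p i assume "\<not> (c \<in> matlas M \<and> p \<in> fst c \<and> i < dm)"
    then show "X c p i = 0" unfolding X_def using LA_vanish[OF E_LA] by (intro sum.neutral) simp
  next
    fix c i assume c: "c \<in> matlas M" and i: "i < dm"
    interpret F: frame dm "fst c" "{f. smooth_in M c (fst c) f}" "chart_deriv c" B "th c" "\<lambda>b i p. E b c p i" C
      by (rule frame[OF c])
    have "(\<lambda>p. X c p i) \<in> {f. smooth_in M c (fst c) f}"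
      unfolding X_def using f c i by (intro F.S_sum F.S_mult F.E_S) auto
    then show "smooth_fun_on dm (snd c ` fst c) (\<lambda>x. X c (chart_inv c x) i)"
      by (simp add: smooth_in_def)
  next
    fix c c' p j assume c: "c \<in> matlas M" "c' \<in> matlas M" and p: "p \<in> fst c \<inter> fst c'" and j: "j < dm"
    have "E b c' p j = (\<Sum>i<dm. jacobian (\<lambda>q. q) c c' p i j * E b c p i)" if "b \<in> B" for b
      using E_LA[OF that] c p j unfolding LA_def vector_field_def by blast
    then have "X c' p j = (\<Sum>b\<in>B. \<Sum>i<dm. jacobian (\<lambda>q. q) c c' p i j * (f b p * E b c p i))"
      unfolding X_def by (intro sum.cong refl) (simp add: sum_distrib_left mult_ac)
    also have "\<dots> = (\<Sum>i<dm. \<Sum>b\<in>B. jacobian (\<lambda>q. q) c c' p i j * (f b p * E b c p i))" by (rule sum.swap)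
    finally show "X c' p j = (\<Sum>i<dm. jacobian (\<lambda>q. q) c c' p i j * X c p i)"
      by (simp add: X_def sum_distrib_left)
  qed
  moreover have "ricci M metric c p i j = \<kappa> * metric c p i j + lie_derivative M X metric c p i j"
    if c: "c \<in> matlas M" and p: "p \<in> fst c" and ij: "i < dm" "j < dm" for c p i j
  proof -
    interpret F: frame dm "fst c" "{f. smooth_in M c (fst c) f}" "chart_deriv c" B "th c" "\<lambda>b i p. E b c p i" C
      by (rule frame[OF c])
    have gg: "(\<lambda>q. metric c q i j) = F.gg i j" for i j by (simp add: metric_def F.gg_def fun_eq_iff)
    have gg': "metric c q i j = F.gg i j q" for i j q by (simp add: metric_def F.gg_def)
    have "lie_derivative M X metric c p i j =
      (\<Sum>k<dm. (\<lambda>q. X c q k) p * chart_deriv c k (F.gg i j) p + F.gg k j p * chart_deriv c i (\<lambda>q. X c q k) p +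
        F.gg i k p * chart_deriv c j (\<lambda>q. X c q k) p)"
      by (simp add: lie_derivative_def gg gg')
    also have "\<dots> = (\<Sum>a\<in>B. 2 * dd a * th c a i p * th c a j p)"
    proof (rule F.lie_derivative_frame[where X = "\<lambda>k q. X c q k" and f = f])
      show "f a \<in> {f. smooth_in M c (fst c) f}" if "a \<in> B" for a using f c that by blast
      show "(\<lambda>q. X c q k) = (\<lambda>p. \<Sum>a\<in>B. f a p * E a c p k)" for k by (simp add: X_def)
      show "chart_deriv c i (f a) p = dd a * th c a i p - (\<Sum>b\<in>B. \<Sum>e\<in>B. C b e a * th c b i p * f e p)"
        if "a \<in> B" "i < dm" for a i using f c p that by blast
    qed (fact p ij)+
    finally have L: "lie_derivative M X metric c p i j = (\<Sum>a\<in>B. 2 * dd a * th c a i p * th c a j p)" .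
    have "ricci M metric c p i j = (\<Sum>b\<in>B. \<Sum>m\<in>B. ricci_coeff b m * th c b i p * th c m j p)"
      by (rule ricci_metric[OF c p ij]) (fact uni)
    also have "\<dots> = (\<Sum>b\<in>B. \<Sum>m\<in>B. if b = m then (\<kappa> + 2 * dd b) * th c b i p * th c m j p else 0)"
      by (intro sum.cong refl) (simp add: ric)
    also have "\<dots> = (\<Sum>b\<in>B. (\<kappa> + 2 * dd b) * th c b i p * th c b j p)" using finB by simp
    finally show ?thesis
      unfolding L metric_def by (simp add: distrib_right sum.distrib sum_distrib_left mult.assoc)
  qed
  ultimately show ?thesis
    unfolding ricci_soliton_def using riemannian_metric by blast
qed

end

section \<open>The structure constants of a weighted TAOS algebra\<close>

locale weighted_taos =
  fixes P :: "'p set" and r :: "'p \<Rightarrow> 'p \<Rightarrow> bool" and x :: "'p \<Rightarrow> real"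
  assumes finP: "finite P" and taos: "taos P r" and x_pos: "x b > 0"
    and x_sum: "(a, b) \<in> taos_basis P r \<Longrightarrow> (b, c) \<in> taos_basis P r \<Longrightarrow>
      (\<Sum>l | (a, l) \<in> taos_basis P r \<and> (l, c) \<in> taos_basis P r. x l) =
      (\<Sum>l | (a, l) \<in> taos_basis P r \<and> (l, b) \<in> taos_basis P r. x l) +
      (\<Sum>l | (b, l) \<in> taos_basis P r \<and> (l, c) \<in> taos_basis P r. x l) +
      (1 - (real (card {d. (d, b) \<in> taos_basis P r}) + real (card {d. (b, d) \<in> taos_basis P r})) * x b)"
begin

abbreviation Bs :: "('p \<times> 'p) set" where "Bs \<equiv> taos_basis P r"

text \<open>The structure constants refer to the basis \<open>f(a,b) = sqrt (x b) e(a,b)\<close> of the algebra, and \<open>ev\<close>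
  consists of the eigenvalues of half the derivation.\<close>

definition pc :: "'p \<times> 'p \<Rightarrow> 'p \<times> 'p \<Rightarrow> 'p \<times> 'p \<Rightarrow> real" where
  "pc a b e = (if snd a = fst b \<and> e = (fst a, snd b) then sqrt (x (snd a)) else 0)"

definition sc :: "'p \<times> 'p \<Rightarrow> 'p \<times> 'p \<Rightarrow> 'p \<times> 'p \<Rightarrow> real" where
  "sc a b e = pc a b e - pc b a e"

text \<open>The rank of the triangular system: a bracket spans a strictly larger interval than
  either factor, which also expresses nilpotency.\<close>

definition height :: "'p \<times> 'p \<Rightarrow> nat" where
  "height a = card {l. (fst a, l) \<in> Bs \<and> (l, snd a) \<in> Bs}"

text \<open>Half of (Ricci eigenvalue + 1/2). The sum counts brackets that produce \<open>a\<close>,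
  the two products count brackets of \<open>a\<close> with pairs starting at its end and with pairs
  ending at its start.\<close>

definition ev :: "'p \<times> 'p \<Rightarrow> real" where
  "ev a = (1 + (\<Sum>l | (fst a, l) \<in> Bs \<and> (l, snd a) \<in> Bs. x l)
    - real (card {d. (snd a, d) \<in> Bs}) * x (snd a) - real (card {d. (d, fst a) \<in> Bs}) * x (fst a)) / 4"

section \<open>Grading, Jacobi identity and unimodularity of the structure constants\<close>

lemma finBs: "finite Bs" by (rule finite_taos_basis[OF finP])

lemma Bs_trans: "(a, b) \<in> Bs \<Longrightarrow> (b, c) \<in> Bs \<Longrightarrow> (a, c) \<in> Bs"
  by (rule taos_basis_trans[OF taos])

lemma Bs_irrefl: "(a, a) \<notin> Bs" by (simp add: taos_basis_iff)

lemma Bs_asym: "(a, b) \<in> Bs \<Longrightarrow> (b, a) \<notin> Bs"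
  using Bs_trans[of a b a] Bs_irrefl by blast

lemma pcE:
  assumes "pc a b e \<noteq> 0"
  obtains s v t where "a = (s, v)" "b = (v, t)" "e = (s, t)"
  using assms that[of "fst a" "snd a" "snd b"]
  by (cases a; cases b; cases e) (auto simp: pc_def split: if_splits)

lemma sc_skew: "sc b a e = - sc a b e" by (simp add: sc_def)

lemma scE:
  assumes "sc a b e \<noteq> 0"
  obtains s v t where "a = (s, v) \<and> b = (v, t) \<or> b = (s, v) \<and> a = (v, t)" "e = (s, t)"
proof (cases "pc a b e = 0")
  case True
  then have "pc b a e \<noteq> 0" using assms by (simp add: sc_def)
  then show ?thesis using that by (elim pcE) blast
next
  case False
  then show ?thesis using that by (elim pcE) blast
qed

lemma height_less:
  assumes "(s, v) \<in> Bs" "(v, t) \<in> Bs"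
  shows "height (v, t) < height (s, t)" "height (s, v) < height (s, t)"
proof -
  have fin: "finite {l. (s, l) \<in> Bs \<and> (l, t) \<in> Bs}"
    by (rule finite_subset[OF _ finP]) (auto simp: taos_basis_iff)
  have "{l. (v, l) \<in> Bs \<and> (l, t) \<in> Bs} \<subset> {l. (s, l) \<in> Bs \<and> (l, t) \<in> Bs}"
    using assms Bs_irrefl[of v] Bs_trans[OF assms(1)] by blast
  from psubset_card_mono[OF fin this] show "height (v, t) < height (s, t)" by (simp add: height_def)
  have "{l. (s, l) \<in> Bs \<and> (l, v) \<in> Bs} \<subset> {l. (s, l) \<in> Bs \<and> (l, t) \<in> Bs}"
    using assms Bs_irrefl[of v] Bs_trans[OF _ assms(2)] by blast
  from psubset_card_mono[OF fin this] show "height (s, v) < height (s, t)" by (simp add: height_def)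
qed

lemma sc_height:
  assumes "a \<in> Bs" "b \<in> Bs" "sc a b e \<noteq> 0"
  shows "height b < height e"
  using assms(3)
proof (rule scE)
  fix s v t assume "a = (s, v) \<and> b = (v, t) \<or> b = (s, v) \<and> a = (v, t)" "e = (s, t)"
  then show ?thesis using height_less[of s v t] assms(1,2) by auto
qed

lemma ev_add:
  assumes "a \<in> Bs" "b \<in> Bs" "sc a b e \<noteq> 0"
  shows "ev a + ev b = ev e"
  using assms(3)
proof (rule scE)
  fix s v t assume h: "a = (s, v) \<and> b = (v, t) \<or> b = (s, v) \<and> a = (v, t)" "e = (s, t)"
  then have "(s, v) \<in> Bs" "(v, t) \<in> Bs" using assms(1,2) by auto
  from x_sum[OF this] have "ev (s, v) + ev (v, t) = ev (s, t)"
    unfolding ev_def fst_conv snd_conv by (simp add: field_simps)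
  then show ?thesis using h by auto
qed

text \<open>The coefficient at \<open>e\<close> of a triple product; associativity appears as the
  agreement of \<open>pc_left\<close> and \<open>pc_right\<close> with it.\<close>

definition tc :: "'p \<times> 'p \<Rightarrow> 'p \<times> 'p \<Rightarrow> 'p \<times> 'p \<Rightarrow> 'p \<times> 'p \<Rightarrow> real" where
  "tc a b k e = (if snd a = fst b \<and> snd b = fst k \<and> e = (fst a, snd k)
    then sqrt (x (snd a)) * sqrt (x (snd b)) else 0)"

lemma Bs_comp: "a \<in> Bs \<Longrightarrow> b \<in> Bs \<Longrightarrow> snd a = fst b \<Longrightarrow> (fst a, snd b) \<in> Bs"
  by (cases a; cases b) (auto intro: Bs_trans)

lemma pc_left:
  assumes "a \<in> Bs" "b \<in> Bs"
  shows "(\<Sum>l\<in>Bs. pc a b l * pc l k e) = tc a b k e"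
proof -
  have "(\<Sum>l\<in>Bs. pc a b l * pc l k e) =
      (\<Sum>l\<in>Bs. if l = (fst a, snd b) then pc a b l * pc l k e else 0)"
    by (intro sum.cong) (auto simp: pc_def)
  also have "\<dots> = tc a b k e"
    using Bs_comp[OF assms] finBs by (auto simp: pc_def tc_def)
  finally show ?thesis .
qed

lemma pc_right:
  assumes "b \<in> Bs" "k \<in> Bs"
  shows "(\<Sum>l\<in>Bs. pc b k l * pc a l e) = tc a b k e"
proof -
  have "(\<Sum>l\<in>Bs. pc b k l * pc a l e) =
      (\<Sum>l\<in>Bs. if l = (fst b, snd k) then pc b k l * pc a l e else 0)"
    by (intro sum.cong) (auto simp: pc_def)
  also have "\<dots> = tc a b k e"
    using Bs_comp[OF assms] finBs by (auto simp: pc_def tc_def)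
  finally show ?thesis .
qed

text \<open>The commutator of an associative product: the twelve triple products cancel in
  pairs.\<close>

lemma sc_jacobi:
  assumes "a \<in> Bs" "b \<in> Bs" "k \<in> Bs"
  shows "(\<Sum>l\<in>Bs. sc b l e * sc a k l - sc a l e * sc b k l + sc a b l * sc l k e) = 0"
proof -
  have "(\<Sum>l\<in>Bs. sc b l e * sc a k l - sc a l e * sc b k l + sc a b l * sc l k e) =
     (\<Sum>l\<in>Bs. pc a k l * pc b l e - pc k a l * pc b l e - pc a k l * pc l b e + pc k a l * pc l b e
      - (pc b k l * pc a l e - pc k b l * pc a l e - pc b k l * pc l a e + pc k b l * pc l a e)
      + (pc a b l * pc l k e - pc a b l * pc k l e - pc b a l * pc l k e + pc b a l * pc k l e))"
    by (intro sum.cong refl) (simp add: sc_def algebra_simps)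
  also have "\<dots> = 0"
    by (simp add: sum.distrib sum_subtractf pc_left[OF assms(1,2)] pc_left[OF assms(2,1)]
      pc_left[OF assms(1,3)] pc_left[OF assms(3,1)] pc_left[OF assms(2,3)] pc_left[OF assms(3,2)]
      pc_right[OF assms(1,2)] pc_right[OF assms(2,1)] pc_right[OF assms(1,3)]
      pc_right[OF assms(3,1)] pc_right[OF assms(2,3)] pc_right[OF assms(3,2)])
  finally show ?thesis .
qed

text \<open>Each diagonal entry vanishes, because a bracket strictly raises the height.\<close>

lemma sc_unimodular:
  assumes "n \<in> Bs"
  shows "(\<Sum>a\<in>Bs. sc a n a) = 0"
proof (rule sum.neutral, intro ballI)
  fix a assume a: "a \<in> Bs"
  show "sc a n a = 0"
  proof (rule ccontr)
    assume "sc a n a \<noteq> 0"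
    then have "sc n a a \<noteq> 0" by (simp add: sc_skew[of n a])
    from sc_height[OF assms a this] show False by simp
  qed
qed

section \<open>The Ricci coefficients\<close>

lemma x_abs: "\<bar>x b\<bar> = x b"
  using x_pos[of b] by simp

text \<open>A product equal to a multiple of f(s,t) corresponds to a splitting point l between s and
  t, and contributes the square x l of its structure constant.\<close>

lemma sum_pc_target:
  assumes b: "b \<in> Bs"
  shows "(\<Sum>a\<in>Bs. \<Sum>n\<in>Bs. pc a n b * pc a n m) =
    (if b = m then \<Sum>l | (fst b, l) \<in> Bs \<and> (l, snd b) \<in> Bs. x l else 0)"
proof (cases "b = m")
  case True
  have fin: "finite {l. (fst b, l) \<in> Bs \<and> (l, snd b) \<in> Bs}"
    by (rule finite_subset[OF _ finP]) (auto simp: taos_basis_iff)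
  have "(\<Sum>a\<in>Bs. \<Sum>n\<in>Bs. pc a n b * pc a n b) =
      (\<Sum>a\<in>Bs. \<Sum>n\<in>Bs. if n = (snd a, snd b) then (if fst a = fst b then x (snd a) else 0) else 0)"
    by (intro sum.cong refl) (auto simp: pc_def x_abs prod_eq_iff)
  also have "\<dots> = (\<Sum>a\<in>Bs. if fst a = fst b \<and> (snd a, snd b) \<in> Bs then x (snd a) else 0)"
    by (intro sum.cong refl) (use finBs in \<open>auto simp: sum.delta\<close>)
  also have "\<dots> = (\<Sum>a\<in>{a \<in> Bs. fst a = fst b \<and> (snd a, snd b) \<in> Bs}. x (snd a))"
    by (rule sum.inter_filter[OF finBs, symmetric])
  also have "{a \<in> Bs. fst a = fst b \<and> (snd a, snd b) \<in> Bs} = Pair (fst b) ` {l. (fst b, l) \<in> Bs \<and> (l, snd b) \<in> Bs}"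
    by force
  also have "(\<Sum>a\<in>Pair (fst b) ` {l. (fst b, l) \<in> Bs \<and> (l, snd b) \<in> Bs}. x (snd a)) =
      (\<Sum>l | (fst b, l) \<in> Bs \<and> (l, snd b) \<in> Bs. x l)"
    by (subst sum.reindex) (auto simp: inj_on_def)
  finally show ?thesis using True by simp
next
  case False
  then show ?thesis by (auto simp: pc_def intro!: sum.neutral)
qed

text \<open>Right factors for \<open>b\<close> are the pairs starting at its end, all with the same
  constant. Different \<open>b\<close> and \<open>m\<close> never give the same product with the
  same right factor.\<close>

lemma sum_pc_left:
  assumes b: "b \<in> Bs"
  shows "(\<Sum>a\<in>Bs. \<Sum>n\<in>Bs. pc b a n * pc m a n) = (if b = m then real (card {d. (snd b, d) \<in> Bs}) * x (snd b) else 0)"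
proof (cases "b = m")
  case True
  have "(\<Sum>a\<in>Bs. \<Sum>n\<in>Bs. pc b a n * pc b a n) =
      (\<Sum>a\<in>Bs. \<Sum>n\<in>Bs. if n = (fst b, snd a) then (if fst a = snd b then x (snd b) else 0) else 0)"
    by (intro sum.cong refl) (auto simp: pc_def x_abs)
  also have "\<dots> = (\<Sum>a\<in>Bs. if fst a = snd b then x (snd b) else 0)"
    by (intro sum.cong refl) (use finBs Bs_comp[OF b] in \<open>auto simp: sum.delta\<close>)
  also have "\<dots> = (\<Sum>a\<in>{a \<in> Bs. fst a = snd b}. x (snd b))"
    by (rule sum.inter_filter[OF finBs, symmetric])
  also have "{a \<in> Bs. fst a = snd b} = Pair (snd b) ` {d. (snd b, d) \<in> Bs}"
    by force
  also have "(\<Sum>a\<in>Pair (snd b) ` {d. (snd b, d) \<in> Bs}. x (snd b)) = real (card {d. (snd b, d) \<in> Bs}) * x (snd b)"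
    by (subst sum.reindex) (auto simp: inj_on_def)
  finally show ?thesis using True by simp
next
  case False
  have "pc b a n * pc m a n = 0" for a n
    using False by (auto simp: pc_def prod_eq_iff)
  then show ?thesis unfolding if_not_P[OF False] by (simp only: sum.neutral_const)
qed

lemma sum_pc_right:
  assumes b: "b \<in> Bs"
  shows "(\<Sum>a\<in>Bs. \<Sum>n\<in>Bs. pc a b n * pc a m n) = (if b = m then real (card {d. (d, fst b) \<in> Bs}) * x (fst b) else 0)"
proof (cases "b = m")
  case True
  have "(\<Sum>a\<in>Bs. \<Sum>n\<in>Bs. pc a b n * pc a b n) =
      (\<Sum>a\<in>Bs. \<Sum>n\<in>Bs. if n = (fst a, snd b) then (if snd a = fst b then x (fst b) else 0) else 0)"
    by (intro sum.cong refl) (auto simp: pc_def x_abs)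
  also have "\<dots> = (\<Sum>a\<in>Bs. if snd a = fst b then x (fst b) else 0)"
    by (intro sum.cong refl) (use finBs Bs_comp[OF _ b] in \<open>auto simp: sum.delta\<close>)
  also have "\<dots> = (\<Sum>a\<in>{a \<in> Bs. snd a = fst b}. x (fst b))"
    by (rule sum.inter_filter[OF finBs, symmetric])
  also have "{a \<in> Bs. snd a = fst b} = (\<lambda>d. (d, fst b)) ` {d. (d, fst b) \<in> Bs}"
    by force
  also have "(\<Sum>a\<in>(\<lambda>d. (d, fst b)) ` {d. (d, fst b) \<in> Bs}. x (fst b)) = real (card {d. (d, fst b) \<in> Bs}) * x (fst b)"
    by (subst sum.reindex) (auto simp: inj_on_def)
  finally show ?thesis using True by simp
next
  case False
  have "pc a b n * pc a m n = 0" for a n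
    using False by (auto simp: pc_def prod_eq_iff)
  then show ?thesis unfolding if_not_P[OF False] by (simp only: sum.neutral_const)
qed

text \<open>The Killing term vanishes by nilpotency and the mixed products by the order axioms. The
  remaining sums of squares are diagonal and give the terms of \<open>ev\<close>, whose summand 1 is
  compensated by the constant -1/2.\<close>

lemma sc_ricci:
  assumes b: "b \<in> Bs" and m: "m \<in> Bs"
  shows "(\<Sum>a\<in>Bs. \<Sum>n\<in>Bs. sc a n b * sc a n m / 4 - sc b a n * sc m a n / 2 - sc b a n * sc m n a / 2) =
    (if b = m then - (1 / 2) + 2 * ev b else 0)"
proof -
  have t: "sc a n b * sc a n m / 4 - sc b a n * sc m a n / 2 - sc b a n * sc m n a / 2 =
      (pc a n b * pc a n m / 4 + pc n a b * pc n a m / 4) - (pc b a n * pc m a n / 2 + pc a b n * pc a m n / 2)"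
    if a: "a \<in> Bs" and n: "n \<in> Bs" for a n
  proof -
    \<comment> \<open>The two factors would require the heights of \<open>a\<close> and
      \<open>n\<close> to increase in both directions.\<close>
    have 1: "sc b a n * sc m n a = 0"
    proof (rule ccontr)
      assume "sc b a n * sc m n a \<noteq> 0"
      then have "sc b a n \<noteq> 0" "sc m n a \<noteq> 0" by auto
      then show False using sc_height[OF b a] sc_height[OF m n] by fastforce
    qed
    \<comment> \<open>Composable in both orders would contradict antisymmetry; the products in
      \<open>3\<close> would force a pair with equal ends.\<close>
    have 2: "pc a n b * pc n a m = 0" "pc n a b * pc a n m = 0"
      using a n by (cases a; cases n; auto simp: pc_def dest: Bs_asym)+
    have 3: "pc b a n * pc a m n = 0" "pc a b n * pc m a n = 0"
      using b by (cases b; auto simp: pc_def Bs_irrefl)+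
    have "sc a n b * sc a n m = pc a n b * pc a n m - pc a n b * pc n a m - pc n a b * pc a n m + pc n a b * pc n a m"
      by (simp add: sc_def algebra_simps)
    moreover have "sc b a n * sc m a n = pc b a n * pc m a n - pc b a n * pc a m n - pc a b n * pc m a n + pc a b n * pc a m n"
      by (simp add: sc_def algebra_simps)
    ultimately show ?thesis using 1 2 3 by (simp add: add_divide_distrib)
  qed
  have sw: "(\<Sum>a\<in>Bs. \<Sum>n\<in>Bs. pc n a b * pc n a m) = (\<Sum>a\<in>Bs. \<Sum>n\<in>Bs. pc a n b * pc a n m)"
    by (rule sum.swap)
  have "(\<Sum>a\<in>Bs. \<Sum>n\<in>Bs. sc a n b * sc a n m / 4 - sc b a n * sc m a n / 2 - sc b a n * sc m n a / 2) =
     (\<Sum>a\<in>Bs. \<Sum>n\<in>Bs. (pc a n b * pc a n m / 4 + pc n a b * pc n a m / 4) - (pc b a n * pc m a n / 2 + pc a b n * pc a m n / 2))"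
    by (intro sum.cong refl) (rule t)
  also have "\<dots> = ((\<Sum>a\<in>Bs. \<Sum>n\<in>Bs. pc a n b * pc a n m) / 4 + (\<Sum>a\<in>Bs. \<Sum>n\<in>Bs. pc n a b * pc n a m) / 4) -
     ((\<Sum>a\<in>Bs. \<Sum>n\<in>Bs. pc b a n * pc m a n) / 2 + (\<Sum>a\<in>Bs. \<Sum>n\<in>Bs. pc a b n * pc a m n) / 2)"
    by (simp only: sum.distrib sum_subtractf sum_divide_distrib)
  also have "\<dots> = (if b = m then - (1 / 2) + 2 * ev b else 0)"
    unfolding sw sum_pc_target[OF b] sum_pc_left[OF b] sum_pc_right[OF b]
    by (simp add: ev_def field_simps)
  finally show ?thesis .
qed

section \<open>From the abstract Lie algebra to a frame on the group\<close>

lemma taos_lie_carrier: "acarrier (taos_lie_algebra P r) = {u. {b. u b \<noteq> 0} \<subseteq> Bs}"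
  using finBs by (auto simp: taos_lie_algebra_def commutator_algebra_def taos_algebra_def basis_algebra_def
      intro: finite_subset)

lemma taos_lie_add: "aadd (taos_lie_algebra P r) u v = (\<lambda>b. u b + v b)"
  and taos_lie_scale: "ascale (taos_lie_algebra P r) k u = (\<lambda>b. k * u b)"
  by (simp_all add: taos_lie_algebra_def commutator_algebra_def taos_algebra_def basis_algebra_def)

definition unit :: "'p \<times> 'p \<Rightarrow> 'p \<times> 'p \<Rightarrow> real" where
  "unit a = (\<lambda>b. if b = a then sqrt (x (snd a)) else 0)"

text \<open>For composable pairs, sqrt (x v) e(s,v) times sqrt (x t) e(v,t) is sqrt (x v) f(s,t).
  The factor of the target cancels, so only the middle point enters \<open>pc\<close>.\<close>

lemma taos_mult_unit:
  assumes "a \<in> Bs" "b \<in> Bs"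
  shows "amult (taos_algebra P r) (unit a) (unit b) e = pc a b e * sqrt (x (snd e))"
proof -
  let ?S = "{(p, q) \<in> Bs \<times> Bs. (case p of (s, t) \<Rightarrow> \<lambda>(u, v). if t = u then Some (s, v) else None) q = Some e}"
  have fin: "finite ?S" by (rule finite_subset[of _ "Bs \<times> Bs"]) (use finBs in auto)
  have "amult (taos_algebra P r) (unit a) (unit b) e = (\<Sum>(p, q)\<in>?S. unit a p * unit b q)"
    by (simp add: taos_algebra_def basis_algebra_def)
  also have "\<dots> = (\<Sum>z\<in>?S. if z = (a, b) then sqrt (x (snd a)) * sqrt (x (snd b)) else 0)"
    by (intro sum.cong) (auto simp: unit_def split: if_splits)
  also have "\<dots> = (if (a, b) \<in> ?S then sqrt (x (snd a)) * sqrt (x (snd b)) else 0)"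
    by (rule sum.delta[OF fin])
  also have "\<dots> = pc a b e * sqrt (x (snd e))"
    using assms by (cases a; cases b; cases e) (auto simp: pc_def)
  finally show ?thesis .
qed

lemma taos_bracket_unit:
  assumes "a \<in> Bs" "b \<in> Bs"
  shows "amult (taos_lie_algebra P r) (unit a) (unit b) = (\<lambda>e. sc a b e * sqrt (x (snd e)))"
proof
  fix e
  have "amult (taos_lie_algebra P r) (unit a) (unit b) e =
    amult (taos_algebra P r) (unit a) (unit b) e + (-1) * amult (taos_algebra P r) (unit b) (unit a) e"
    by (simp add: taos_lie_algebra_def commutator_algebra_def taos_algebra_def basis_algebra_def)
  then show "amult (taos_lie_algebra P r) (unit a) (unit b) e = sc a b e * sqrt (x (snd e))"
    unfolding taos_mult_unit[OF assms] taos_mult_unit[OF assms(2,1)] by (simp add: sc_def left_diff_distrib)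
qed

lemma sc_in_Bs:
  assumes "a \<in> Bs" "b \<in> Bs" "sc a b e \<noteq> 0"
  shows "e \<in> Bs"
  using assms(3)
proof (rule scE)
  fix s v t assume "a = (s, v) \<and> b = (v, t) \<or> b = (s, v) \<and> a = (v, t)" "e = (s, t)"
  then show ?thesis using assms(1,2) Bs_trans[of s v t] by auto
qed

text \<open>Pull the rescaled basis back through the isomorphism; span, independence and brackets
  are transported by its injectivity.\<close>

lemma exists_frame:
  assumes lie: "lie_group M G"
    and iso: "real_alg_isomorphic (lie_algebra_of M G) (taos_lie_algebra P r)"
  shows "\<exists>E. left_frame M G Bs E sc"
proof -
  interpret lie_grp M G by unfold_locales (use lie in \<open>auto simp: lie_group_def\<close>)
  let ?L = "lie_algebra_of M G" and ?T = "taos_lie_algebra P r"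
  have L: "acarrier ?L = LA" "aadd ?L X Y = (\<lambda>c p i. X c p i + Y c p i)"
    "ascale ?L k X = (\<lambda>c p i. k * X c p i)" "amult ?L X Y = lie_bracket M X Y" for X Y k
    by (simp_all add: lie_algebra_of_def LA_def)
  obtain f where f: "bij_betw f LA {u. {b. u b \<noteq> 0} \<subseteq> Bs}"
    and add: "\<forall>X\<in>LA. \<forall>Y\<in>LA. f (\<lambda>c p i. X c p i + Y c p i) = (\<lambda>b. f X b + f Y b)"
    and scale: "\<forall>k. \<forall>X\<in>LA. f (\<lambda>c p i. k * X c p i) = (\<lambda>b. k * f X b)"
    and mult: "\<forall>X\<in>LA. \<forall>Y\<in>LA. f (lie_bracket M X Y) = amult ?T (f X) (f Y)"
    using iso unfolding real_alg_isomorphic_def L taos_lie_carrier taos_lie_add taos_lie_scale by blast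
  have inj: "inj_on f LA" and onto: "f ` LA = {u. {b. u b \<noteq> 0} \<subseteq> Bs}" using f by (auto simp: bij_betw_def)
  have "\<exists>X. X \<in> LA \<and> f X = unit a" if "a \<in> Bs" for a
  proof -
    have "unit a \<in> f ` LA" unfolding onto using that by (auto simp: unit_def)
    then obtain X where "unit a = f X" "X \<in> LA" by (rule imageE)
    then show ?thesis by (intro exI[of _ X]) simp
  qed
  then have "\<forall>a. \<exists>X. a \<in> Bs \<longrightarrow> X \<in> LA \<and> f X = unit a" by blast
  from choice[OF this] obtain E where E: "\<forall>a. a \<in> Bs \<longrightarrow> E a \<in> LA \<and> f (E a) = unit a" by blast
  have E_LA: "E a \<in> LA" and fE: "f (E a) = unit a" if "a \<in> Bs" for a
    using mp[OF spec[OF E] that] by blast+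
  have zero: "(\<lambda>_ _ _. 0) \<in> LA" using LA_sum[of "{}"] by simp
  have f0: "f (\<lambda>_ _ _. 0) = (\<lambda>_. 0)"
    using scale[rule_format, OF zero, of 0] by simp
  \<comment> \<open>The isomorphism is additive only on left-invariant fields, so the combination is
    built up one summand at a time with membership in \<open>LA\<close> at hand.\<close>
  have f_sum: "f (\<lambda>c p i. \<Sum>b\<in>S. k b * E b c p i) = (\<lambda>e. \<Sum>b\<in>S. k b * unit b e)" if "S \<subseteq> Bs" for S k
    using finite_subset[OF that finBs] that
  proof (induction S rule: finite_induct)
    case empty
    show ?case using f0 by simp
  next
    case (insert a S)
    have a: "a \<in> Bs" and S: "S \<subseteq> Bs" using insert by auto
    have s1: "(\<lambda>c p i. \<Sum>b\<in>{a}. k b * E b c p i) \<in> LA" by (rule LA_sum) (use E_LA[OF a] in simp)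
    have s2: "(\<lambda>c p i. \<Sum>b\<in>S. k b * E b c p i) \<in> LA" by (rule LA_sum) (use E_LA S in blast)
    have "f (\<lambda>c p i. k a * E a c p i + (\<Sum>b\<in>S. k b * E b c p i)) =
        (\<lambda>e. f (\<lambda>c p i. k a * E a c p i) e + f (\<lambda>c p i. \<Sum>b\<in>S. k b * E b c p i) e)"
      using add[rule_format, OF s1 s2] by simp
    then show ?case
      using insert.hyps by (simp add: insert.IH[OF S] scale[rule_format, OF E_LA[OF a]] fE[OF a])
  qed
  have f_frame: "f (\<lambda>c p i. \<Sum>b\<in>Bs. k b * E b c p i) = (\<lambda>e. if e \<in> Bs then k e * sqrt (x (snd e)) else 0)" for k
  proof
    fix e
    have "(\<Sum>b\<in>Bs. k b * unit b e) = (\<Sum>b\<in>Bs. if b = e then k e * sqrt (x (snd e)) else 0)"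
      by (intro sum.cong) (auto simp: unit_def)
    then show "f (\<lambda>c p i. \<Sum>b\<in>Bs. k b * E b c p i) e = (if e \<in> Bs then k e * sqrt (x (snd e)) else 0)"
      unfolding f_sum[OF order_refl] using finBs by simp
  qed
  have frame_LA: "(\<lambda>c p i. \<Sum>b\<in>Bs. k b * E b c p i) \<in> LA" for k by (rule LA_sum[OF E_LA])
  have "left_frame M G Bs E sc"
  proof
    show "finite Bs" by (rule finBs)
    show "E b \<in> LA" if "b \<in> Bs" for b by (rule E_LA[OF that])
    show "\<exists>k. X = (\<lambda>c p i. \<Sum>b\<in>Bs. k b * E b c p i)" if X: "X \<in> LA" for X
    \<comment> \<open>Coordinates refer to the unscaled basis, hence the division by sqrt (x (snd
      b)), which is nonzero as weights are positive.\<close>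
    proof (rule exI[of _ "\<lambda>b. f X b / sqrt (x (snd b))"], rule inj_onD[OF inj _ X frame_LA])
      have "{b. f X b \<noteq> 0} \<subseteq> Bs" using onto X by blast
      then have "f X e = (if e \<in> Bs then f X e / sqrt (x (snd e)) * sqrt (x (snd e)) else 0)" for e
        using x_pos[of "snd e"] by auto
      then show "f X = f (\<lambda>c p i. \<Sum>b\<in>Bs. f X b / sqrt (x (snd b)) * E b c p i)"
        unfolding f_frame by (rule ext)
    qed
    show "k b = 0" if z: "(\<lambda>c p i. \<Sum>b\<in>Bs. k b * E b c p i) = (\<lambda>_ _ _. 0)" and b: "b \<in> Bs" for k b
    proof -
      have "k b * sqrt (x (snd b)) = 0"
        using fun_cong[OF f_frame[of k, unfolded z f0], of b] b by simp
      then show ?thesis using x_pos[of "snd b"] by simp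
    qed
    show "lie_bracket M (E a) (E b) = (\<lambda>c p i. \<Sum>e\<in>Bs. sc a b e * E e c p i)" if ab: "a \<in> Bs" "b \<in> Bs" for a b
    proof (rule inj_onD[OF inj _ lie_bracket_LA[OF E_LA[OF ab(1)] E_LA[OF ab(2)]] frame_LA])
      have "f (lie_bracket M (E a) (E b)) = (\<lambda>e. sc a b e * sqrt (x (snd e)))"
        using mult[rule_format, OF E_LA[OF ab(1)] E_LA[OF ab(2)]] by (simp add: fE ab taos_bracket_unit)
      also have "\<dots> = (\<lambda>e. if e \<in> Bs then sc a b e * sqrt (x (snd e)) else 0)"
        using sc_in_Bs[OF ab] by (auto simp: fun_eq_iff)
      finally show "f (lie_bracket M (E a) (E b)) = f (\<lambda>c p i. \<Sum>e\<in>Bs. sc a b e * E e c p i)"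
        unfolding f_frame .
    qed
    show "sc b a e = - sc a b e" for a b e by (rule sc_skew)
  qed
  then show ?thesis by blast
qed

end

theorem theorem1p3:
  fixes P :: "'p set" and r :: "'p \<Rightarrow> 'p \<Rightarrow> bool"
    and C :: "('p, 'p \<times> 'p) pre_digraph set"
    and M :: "'m mfd" and G :: "'m monoid"
  assumes "finite P" and "taos P r"
    and "algebraically_connected_components (hasse_quiver P r) C"
    and "\<And>E. E \<in> C \<Longrightarrow> \<exists>A s. array_taos A s \<and> E = hasse_quiver A s"
    and "\<And>E F. E \<in> C \<Longrightarrow> F \<in> C \<Longrightarrow> E \<noteq> F \<Longrightarrow>
      \<not> (\<exists>u v p q. pre_digraph.awalk E u p v \<and> pre_digraph.awalk F u q v \<and>
            length p \<ge> 2 \<and> length q \<ge> 2)"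
    and "lie_group M G" and "simply_connected_space (mtop M)"
    and "real_alg_isomorphic (lie_algebra_of M G) (taos_lie_algebra P r)"
  shows "\<exists>g. left_invariant_metric M G g \<and> ricci_soliton M g"
proof -
  have arr: "\<forall>E\<in>C. \<exists>A s. array_taos A s \<and> E = hasse_quiver A s"
    by (rule ballI) (rule assms(4))
  have sep: "\<forall>E\<in>C. \<forall>F\<in>C. E \<noteq> F \<longrightarrow> \<not> (\<exists>u v p q. pre_digraph.awalk E u p v \<and> pre_digraph.awalk F u q v \<and>
      length p \<ge> 2 \<and> length q \<ge> 2)"
    by (intro ballI impI) (rule assms(5))
  obtain x where "weighted_taos P r x"
  proof (rule taos_weights[OF assms(1-3) arr sep])
    fix x :: "'p \<Rightarrow> real"
    assume "\<And>b. x b > 0" and "\<And>a b c. (a, b) \<in> taos_basis P r \<Longrightarrow> (b, c) \<in> taos_basis P r \<Longrightarrow>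
      (\<Sum>l | (a, l) \<in> taos_basis P r \<and> (l, c) \<in> taos_basis P r. x l) =
      (\<Sum>l | (a, l) \<in> taos_basis P r \<and> (l, b) \<in> taos_basis P r. x l) +
      (\<Sum>l | (b, l) \<in> taos_basis P r \<and> (l, c) \<in> taos_basis P r. x l) +
      (1 - (real (card {d. (d, b) \<in> taos_basis P r}) + real (card {d. (b, d) \<in> taos_basis P r})) * x b)"
    with assms(1,2) have "weighted_taos P r x" by (rule weighted_taos.intro)
    then show ?thesis by (rule that)
  qed
  then interpret weighted_taos P r x .
  obtain E where "left_frame M G (taos_basis P r) E sc"
    using exists_frame[OF assms(6,8)] by blast
  then interpret F: left_frame M G "taos_basis P r" E sc .
  have "ricci_soliton M F.metric"
  \<comment> \<open>The rank is \<open>height\<close>, the bracket eigenvalues are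
    \<open>ev\<close>, and -1/2 is the soliton constant.\<close>
  proof (rule F.soliton[OF assms(7), of height ev "- (1 / 2)"])
    show "F.ricci_coeff b m = (if b = m then - (1 / 2) + 2 * ev b else 0)" if "b \<in> Bs" "m \<in> Bs" for b m
      unfolding F.ricci_coeff_def by (rule sc_ricci[OF that])
  qed (simp_all add: sc_height ev_add sc_jacobi sc_unimodular)
  then show ?thesis using F.left_invariant_metric by blast
qed

end
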